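(* Let $\ell\in\mathbb N$, $\ell\ge 1$, and let $\theta_n=(d_n/n,D_n)\in\Theta^{\mathrm{CW}}_n$ $(n\in\mathbb N)$ be a sequence of parameters such that $$R(D_n):=\frac{\|D_n\|}{\sqrt{\operatorname{tr}(D_n^2)}}=o\big(n^{1/(3\ell)}\big)\quad\text{as } n\to\infty,$$ where $\|\cdot\|$ is the spectral norm and $\operatorname{tr}$ is the normalized trace. Then the law of the free deterministic equivalent Z-score $\mathcal Z^\Box_\ell(\theta_n\mid\theta_n)$ converges weakly to the standard normal distribution $\mathrm{Normal}(0,1)$ as $n\to\infty$.
   Context: Parameters: for $n\in\mathbb N$, $\Theta^{\mathrm{CW}}_n$ is the set of pairs $(d/n,D)$ with $d\in\mathbb N$, $d\ge n$, and $D\in M_d(\mathbb R)$ self-adjoint (symmetric) positive definite; $\Theta^{\mathrm{CW}}=\bigcup_n\Theta^{\mathrm{CW}}_n$. The integers $d$ and $n$ are determined by $\theta=(d/n,D)$ ($d$ is the size of $D$). Write $\lambda=d/n$. Compound Wishart matrix: $W_\theta=Z^TDZ$, where $Z$ is a $d\times n$ random matrix with independent centered Gaussian entries of variance $1/n$ (standard deviation $1/\sqrt n$). Traces: $\operatorname{Tr}$ is the unnormalized trace, $\operatorname{tr}$ the normalized trace, $m_k(D)=\operatorname{tr}(D^k)$. $\mathbb E$ and $\mathbb V$ denote expectation and variance. Amplification: for $\mathfrak a\in\mathbb N$, $\theta^{\mathfrak a}=(\lambda,D\otimes I_{\mathfrak a})\in\Theta^{\mathrm{CW}}_{\mathfrak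 a n}$. Premaps: let $[m]=\{1,\dots,m\}$ and $\pm[m]=[m]\cup(-[m])$. A premap is a permutation $\pi$ of $\pm[m]$ with $\pi(k)=-\pi^{-1}(-k)$ for all $k$ and such that no cycle contains both $k$ and $-k$. $\mathrm{PM}_m$ is the set of premaps of $\pm[m]$. A cycle of a premap is particular if its element of smallest absolute value is positive; $\pi/2$ denotes the permutation (of the set of elements appearing in particular cycles) formed by the particular cycles of $\pi$. $\#\sigma$ is the number of cycles of $\sigma$ (fixed points included). For a permutation $\sigma$ with cycles $c_1,\dots,c_p$, $\operatorname{tr}_\sigma[D]=\prod_{j=1}^p m_{|c_j|}(D)$, where $|c_j|$ is the length of $c_j$. For a permutation $\gamma$ of $[m]$, the permutation $\gamma_+$ of $\pm[m]$ equals $\gamma$ on $[m]$ and the identity on $-[m]$; $\gamma_-$ is the identity on $[m]$ and $\gamma_-(-k)=-\gamma(k)$ for $k\in[m]$. For $\pi\in\mathrm{PM}_m$, $$\chi(\gamma,\pi)=\#\big((\gamma_+\gamma_-^{-1})/2\big)+\#(\pi/2)+\#\big((\gamma_-^{-1}\pi\gamma_+)/2\big)-m .$$ FDE mean and variance: with $\gamma=(1,2,\dots,\ell)$, $$\mu^\Box_\ell(\theta)=n\alpha_\ell+\beta_\ell,\quad \alpha_\ell=\sum_{\pi\in\mathrm{PM}_\ell,\ \chi(\gamma,\pi)=2}\lambda^{\#(\pi/2)}\operatorname{tr}_{\pi/2}[D],\quad \beta_\ell=\sum_{\pi\in\mathrm{PM}_\ell,\ \chi(\gamma,\pi)=1}\lambda^{\#(\pi/2)}\operatorname{tr}_{\pi/2}[D],$$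 $$\mathrm{Var}^\Box_\ell(\theta)=\lim_{\mathfrak a\to\infty}\mathbb V[\operatorname{Tr}(W_{\theta^{\mathfrak a}}^\ell)]$$ (the limit exists). FDE Z-score: for parameters $\theta_0,\theta$, $$\mathcal Z^\Box_\ell(\theta_0\mid\theta)=\frac{\operatorname{Tr}(W_{\theta_0}^\ell)-\mu^\Box_\ell(\theta)}{\sqrt{\mathrm{Var}^\Box_\ell(\theta)}} .$$ *)

theory Defs
  imports
    "HOL-Probability.Probability"
    "HOL-Library.Landau_Symbols"
    "HOL-Combinatorics.Orbits"
    "HOL-Combinatorics.Cycles"
    "Jordan_Normal_Form.Matrix"
begin

section \<open>Matrices\<close>

definition mat_Tr :: "real mat \<Rightarrow> real" where
  "mat_Tr A = (\<Sum>i<dim_row A. A $$ (i, i))"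

definition mat_tr :: "real mat \<Rightarrow> real" where
  "mat_tr A = mat_Tr A / real (dim_row A)"

definition moment :: "nat \<Rightarrow> real mat \<Rightarrow> real" where
  "moment k D = mat_tr (D ^\<^sub>m k)"

definition pos_def_mat :: "real mat \<Rightarrow> bool" where
  "pos_def_mat D \<longleftrightarrow>
     (\<forall>v \<in> carrier_vec (dim_row D). v \<noteq> 0\<^sub>v (dim_row D) \<longrightarrow> scalar_prod v (D *\<^sub>v v) > 0)"

definition euclid_norm :: "real vec \<Rightarrow> real" where
  "euclid_norm v = sqrt (scalar_prod v v)"

definition spectral_norm :: "real mat \<Rightarrow> real" where
  "spectral_norm A = (SUP v \<in> {v \<in> carrier_vec (dim_col A). euclid_norm v \<le> 1}. euclid_norm (A *\<^sub>v v))"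

definition kronecker :: "real mat \<Rightarrow> real mat \<Rightarrow> real mat" where
  "kronecker A B = Matrix.mat (dim_row A * dim_row B) (dim_col A * dim_col B)
     (\<lambda>(i, j). A $$ (i div dim_row B, j div dim_col B) * B $$ (i mod dim_row B, j mod dim_col B))"

section \<open>Compound Wishart matrices\<close>

type_synonym cw_param = "real \<times> real mat"

text \<open>Sizes are at least 1, so that \<open>d\<close> and \<open>n\<close> can be read off from \<open>(d/n, D)\<close>.\<close>

definition Theta :: "nat \<Rightarrow> cw_param set" where
  "Theta n = {(real d / real n, D) | d D. 1 \<le> n \<and> n \<le> d \<and> D \<in> carrier_mat d d
                 \<and> transpose_mat D = D \<and> pos_def_mat D}"

definition par_lambda :: "cw_param \<Rightarrow> real" where
  "par_lambda \<theta> = fst \<theta>"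

definition par_D :: "cw_param \<Rightarrow> real mat" where
  "par_D \<theta> = snd \<theta>"

definition par_d :: "cw_param \<Rightarrow> nat" where
  "par_d \<theta> = dim_row (par_D \<theta>)"

definition par_n :: "cw_param \<Rightarrow> nat" where
  "par_n \<theta> = (THE n. \<theta> \<in> Theta n)"

lemma par_n_eq:
  assumes "\<theta> \<in> Theta n"
  shows "par_n \<theta> = n"
  unfolding par_n_def
proof (rule the_equality)
  fix m assume m: "\<theta> \<in> Theta m"
  obtain d D where 1: "\<theta> = (real d / real n, D)" "1 \<le> n" "n \<le> d" "D \<in> carrier_mat d d"
    using assms unfolding Theta_def by blast
  obtain d' D' where 2: "\<theta> = (real d' / real m, D')" "1 \<le> m" "D' \<in> carrier_mat d' d'"
    using m unfolding Theta_def by blast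
  from 1 2 have "d' = d" by auto
  with 1 2 show "m = n" by (auto simp: field_simps)
qed (fact assms)

definition amplify :: "nat \<Rightarrow> cw_param \<Rightarrow> cw_param" where
  "amplify a \<theta> = (par_lambda \<theta>, kronecker (par_D \<theta>) (1\<^sub>m a))"

text \<open>The law of the family of entries of \<open>Z\<close>; a sample point \<open>\<omega>\<close> assigns a value to each
  index pair \<open>(i, j)\<close>. The parameter of \<open>normal_density\<close> is the standard deviation.\<close>

definition cw_space :: "cw_param \<Rightarrow> (nat \<times> nat \<Rightarrow> real) measure" where
  "cw_space \<theta> = PiM ({..<par_d \<theta>} \<times> {..<par_n \<theta>})
     (\<lambda>_. density lborel (\<lambda>x. ennreal (normal_density 0 (1 / sqrt (real (par_n \<theta>))) x)))"

definition Z_mat :: "cw_param \<Rightarrow> (nat \<times> nat \<Rightarrow> real) \<Rightarrow> real mat" where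
  "Z_mat \<theta> \<omega> = Matrix.mat (par_d \<theta>) (par_n \<theta>) \<omega>"

definition wishart :: "cw_param \<Rightarrow> (nat \<times> nat \<Rightarrow> real) \<Rightarrow> real mat" where
  "wishart \<theta> \<omega> = transpose_mat (Z_mat \<theta> \<omega>) * par_D \<theta> * Z_mat \<theta> \<omega>"

section \<open>Premaps\<close>

definition pm_set :: "nat \<Rightarrow> int set" where
  "pm_set m = {1..int m} \<union> uminus ` {1..int m}"

definition cycles_on :: "int set \<Rightarrow> (int \<Rightarrow> int) \<Rightarrow> int set set" where
  "cycles_on S \<sigma> = orbit \<sigma> ` S"

definition num_cycles :: "int set \<Rightarrow> (int \<Rightarrow> int) \<Rightarrow> nat" where
  "num_cycles S \<sigma> = card (cycles_on S \<sigma>)"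

definition tr_perm :: "int set \<Rightarrow> (int \<Rightarrow> int) \<Rightarrow> real mat \<Rightarrow> real" where
  "tr_perm S \<sigma> D = (\<Prod>c \<in> cycles_on S \<sigma>. moment (card c) D)"

definition premaps :: "nat \<Rightarrow> (int \<Rightarrow> int) set" where
  "premaps m = {\<pi>. \<pi> permutes pm_set m
      \<and> (\<forall>k \<in> pm_set m. \<pi> k = - Hilbert_Choice.inv \<pi> (- k))
      \<and> (\<forall>c \<in> cycles_on (pm_set m) \<pi>. \<not> (\<exists>k. k \<in> c \<and> - k \<in> c))}"

definition particular :: "int set \<Rightarrow> bool" where
  "particular c \<longleftrightarrow> (\<exists>k \<in> c. k > 0 \<and> (\<forall>j \<in> c. \<bar>k\<bar> \<le> \<bar>j\<bar>))"

text \<open>The permutation \<open>\<pi>/2\<close> is \<open>half m \<pi>\<close>, considered as a permutation of \<open>half_set m \<pi>\<close>;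
  as a function on all integers it is extended by the identity.\<close>

definition half_set :: "nat \<Rightarrow> (int \<Rightarrow> int) \<Rightarrow> int set" where
  "half_set m \<pi> = \<Union> {c \<in> cycles_on (pm_set m) \<pi>. particular c}"

definition half :: "nat \<Rightarrow> (int \<Rightarrow> int) \<Rightarrow> int \<Rightarrow> int" where
  "half m \<pi> = perm_restrict \<pi> (half_set m \<pi>)"

definition num_half :: "nat \<Rightarrow> (int \<Rightarrow> int) \<Rightarrow> nat" where
  "num_half m \<pi> = num_cycles (half_set m \<pi>) (half m \<pi>)"

definition tr_half :: "nat \<Rightarrow> (int \<Rightarrow> int) \<Rightarrow> real mat \<Rightarrow> real" where
  "tr_half m \<pi> D = tr_perm (half_set m \<pi>) (half m \<pi>) D"

definition perm_plus :: "(int \<Rightarrow> int) \<Rightarrow> int \<Rightarrow> int" where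
  "perm_plus \<gamma> k = (if k > 0 then \<gamma> k else k)"

definition perm_minus :: "(int \<Rightarrow> int) \<Rightarrow> int \<Rightarrow> int" where
  "perm_minus \<gamma> k = (if k < 0 then - \<gamma> (- k) else k)"

definition euler_char :: "nat \<Rightarrow> (int \<Rightarrow> int) \<Rightarrow> (int \<Rightarrow> int) \<Rightarrow> int" where
  "euler_char m \<gamma> \<pi> =
     int (num_half m (perm_plus \<gamma> \<circ> Hilbert_Choice.inv (perm_minus \<gamma>)))
     + int (num_half m \<pi>)
     + int (num_half m (Hilbert_Choice.inv (perm_minus \<gamma>) \<circ> \<pi> \<circ> perm_plus \<gamma>))
     - int m"

section \<open>The free deterministic equivalent Z-score\<close>

definition long_cycle :: "nat \<Rightarrow> int \<Rightarrow> int" where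
  "long_cycle l = cycle_of_list [1..int l]"

definition fde_coeff :: "int \<Rightarrow> nat \<Rightarrow> cw_param \<Rightarrow> real" where
  "fde_coeff x l \<theta> = (\<Sum>\<pi> \<in> {\<pi> \<in> premaps l. euler_char l (long_cycle l) \<pi> = x}.
     par_lambda \<theta> ^ num_half l \<pi> * tr_half l \<pi> (par_D \<theta>))"

definition fde_mean :: "nat \<Rightarrow> cw_param \<Rightarrow> real" where
  "fde_mean l \<theta> = real (par_n \<theta>) * fde_coeff 2 l \<theta> + fde_coeff 1 l \<theta>"

definition trace_power :: "nat \<Rightarrow> cw_param \<Rightarrow> (nat \<times> nat \<Rightarrow> real) \<Rightarrow> real" where
  "trace_power l \<theta> \<omega> = mat_Tr (wishart \<theta> \<omega> ^\<^sub>m l)"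

definition fde_var :: "nat \<Rightarrow> cw_param \<Rightarrow> real" where
  "fde_var l \<theta> = lim (\<lambda>a. prob_space.variance (cw_space (amplify a \<theta>)) (trace_power l (amplify a \<theta>)))"

text \<open>The Z-score of \<open>\<theta>\<^sub>0\<close> with respect to \<open>\<theta>\<close> is a random variable on \<open>cw_space \<theta>\<^sub>0\<close>.\<close>

definition fde_Z_score :: "nat \<Rightarrow> cw_param \<Rightarrow> cw_param \<Rightarrow> (nat \<times> nat \<Rightarrow> real) \<Rightarrow> real" where
  "fde_Z_score l \<theta>\<^sub>0 \<theta> \<omega> = (trace_power l \<theta>\<^sub>0 \<omega> - fde_mean l \<theta>) / sqrt (fde_var l \<theta>)"

definition R_ratio :: "real mat \<Rightarrow> real" where
  "R_ratio D = spectral_norm D / sqrt (mat_tr (D ^\<^sub>m 2))"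

end

theory Submission
  imports Defs "HOL-Real_Asymp.Real_Asymp"
begin

text \<open>
  Why the theorem holds. Put \<open>S = \<parallel>D\<parallel>\<close>, \<open>Q a = D^a / S^a\<close> and \<open>p a = Tr (D^a) / (n S^a)\<close>, and for a
  word \<open>w = [a\<^sub>1, \<dots>, a\<^sub>m]\<close> let \<open>T w = Tr (Z\<^sup>T Q a\<^sub>1 Z \<cdots> Z\<^sup>T Q a\<^sub>m Z)\<close>; then \<open>Tr (W^l) = S^l T u\<close> with
  \<open>u = [1, \<dots>, 1]\<close>. Gaussian integration by parts in one factor \<open>Z\<close> expresses \<open>E (T (a # as) G)\<close> through
  traces of words with one letter fewer (\<open>loop_equation\<close>): two letters are contracted, and
  \<open>Q a Q b = Q (a + b)\<close> makes the product a letter again. Everything about fluctuations follows from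
  these equations by induction on the length of the words.

  Sizes. With \<open>K = max 1 (p 1)\<close> and \<open>q = sqrt (p 2)\<close>, the expectation of \<open>T w\<close> is of order
  \<open>n K^|w|\<close>, and each centred trace contributes a factor \<open>q K^(|w| - 1)\<close> to joint moments, with
  constants that depend on the lengths only (\<open>moment_bounds\<close>).

  Fluctuations. Without their \<open>1/n\<close> terms, the loop equations become recursions that define the limits
  \<open>tau\<close> of \<open>E (T w) / n\<close> and \<open>limit_cov\<close> of the covariances. If the gradient of \<open>G\<close> is \<open>h\<close> times the
  gradient of \<open>T u\<close>, then \<open>Cov (T w, G)\<close> is \<open>limit_cov p w u * E h\<close> up to \<open>O(1/n)\<close> (\<open>ctr_covariance\<close>).
  For \<open>G = T u\<close> this is a variance estimate. Amplification multiplies \<open>n\<close> by \<open>\<aa>\<close> and does not change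
  \<open>p\<close>, hence \<open>fde_var\<close> equals \<open>S^(2l) v\<close> with \<open>v = limit_cov p u u\<close> (\<open>fde_var_eq\<close>). For \<open>G = f (s Y)\<close>, where
  \<open>Y\<close> is the centred trace divided by \<open>sqrt v\<close>, it is an approximate Stein identity
  \<open>E (Y f (s Y)) \<approx> s E (f' (s Y))\<close> (\<open>stein_estimate\<close>). With \<open>f = sin\<close> and \<open>f = cos\<close> it says that the
  characteristic function of \<open>Y\<close> nearly satisfies \<open>c' t = - t c t\<close>, the equation that characterises
  \<open>exp (- t\<^sup>2 / 2)\<close>.

  Mean. Wick's formula writes \<open>E (Tr (W^l))\<close> as a sum over pairings of the \<open>2l\<close> Gaussian factors. Pairings
  of \<open>\<plusminus>[l]\<close> are the same as premaps, and counting indices gives the exact genus expansion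
  \<open>\<Sum>\<pi>. n^(\<chi> - 1) \<lambda>^#(\<pi>/2) tr\<^sub>\<pi>[D]\<close> (\<open>genus_expansion\<close>). The terms with \<open>\<chi> = 2\<close> and \<open>\<chi> = 1\<close> are the
  mean of the free deterministic equivalent, \<open>\<chi> > 2\<close> does not occur, and the rest is \<open>O(1/n)\<close>
  (\<open>fde_mean_error\<close>).

  Conclusion. All errors have to be compared with \<open>sqrt v\<close>. Discarding terms of the recursion in two ways gives
  \<open>v \<ge> p 2 * max ((p 1)\<^sup>2) (p 2) ^ (l - 1)\<close> (\<open>limit_var_lower_bound\<close>), and \<open>p 2 = \<lambda> / R(D)\<^sup>2 \<ge> 1 / R(D)\<^sup>2\<close>.
  Therefore the characteristic function of the Z-score differs from that of the standard normal law by
  at most a constant times \<open>max 1 R(D) ^ (3l) / n\<close> (\<open>char_Z_score_estimate\<close>), which tends to zero by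
  hypothesis. Levy's continuity theorem finishes the proof.
\<close>

section \<open>Gaussian integration by parts\<close>

definition gauss :: "real \<Rightarrow> real measure" where
  "gauss s = density lborel (\<lambda>x. ennreal (normal_density 0 s x))"

lemma sets_gauss [measurable_cong, simp]: "sets (gauss s) = sets borel"
  by (simp add: gauss_def)

lemma space_gauss [simp]: "space (gauss s) = UNIV"
  by (simp add: gauss_def)

lemma prob_space_gauss: "s > 0 \<Longrightarrow> prob_space (gauss s)"
  unfolding gauss_def by (rule prob_space_normal_density)

lemma integrable_gauss_iff:
  assumes "f \<in> borel_measurable borel"
  shows "integrable (gauss s) f \<longleftrightarrow> integrable lborel (\<lambda>x. normal_density 0 s x * f x)"
  using assms unfolding gauss_def
  by (subst integrable_density) (auto simp: normal_density_nonneg)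

lemma integral_gauss:
  fixes f :: "real \<Rightarrow> real"
  assumes "f \<in> borel_measurable borel"
  shows "integral\<^sup>L (gauss s) f = (\<integral>x. normal_density 0 s x * f x \<partial>lborel)"
  using assms unfolding gauss_def
  by (subst integral_density) (auto simp: normal_density_nonneg)

lemma integrable_gauss_power: "s > 0 \<Longrightarrow> integrable (gauss s) (\<lambda>x. x ^ k)"
  using integrable_normal_moment[of s 0 k] by (subst integrable_gauss_iff) auto

lemma integrable_gauss_poly_bound:
  fixes g :: "real \<Rightarrow> real"
  assumes s: "s > 0" and g: "g \<in> borel_measurable borel" and b: "\<And>x. \<bar>g x\<bar> \<le> C * (A + x\<^sup>2) ^ k"
  shows "integrable (gauss s) g"
proof (rule Bochner_Integration.integrable_bound)
  have "integrable (gauss s) (\<lambda>x. C * (\<Sum>j\<le>k. of_nat (k choose j) * A ^ j * x ^ (2 * (k - j))))"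
    by (intro integrable_mult_right Bochner_Integration.integrable_sum integrable_gauss_power s)
  then show "integrable (gauss s) (\<lambda>x. C * (A + x\<^sup>2) ^ k)"
    by (simp add: binomial_ring power_mult mult.assoc)
  show "g \<in> borel_measurable (gauss s)" using g by (simp add: measurable_def)
  show "AE x in gauss s. norm (g x) \<le> norm (C * (A + x\<^sup>2) ^ k)"
    using b by (intro always_eventually allI) (metis abs_ge_self order_trans real_norm_def)
qed

text \<open>The bound is polynomial in \<open>x\<^sup>2\<close>, so that the two ends of the real line can be treated at
  once: both filters make \<open>x\<^sup>2\<close> tend to infinity.\<close>

lemma poly_times_normal_density_tendsto_0:
  assumes s: "s > 0" and F: "filterlim (\<lambda>x::real. x\<^sup>2) at_top F"
  shows "((\<lambda>x. (A + x\<^sup>2) ^ k * normal_density 0 s x) \<longlongrightarrow> 0) F"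
proof -
  define u where "u x = (A + x\<^sup>2) / (2 * s\<^sup>2)" for x :: real
  have "filterlim u at_top F"
    unfolding u_def divide_inverse using s
    by (intro filterlim_at_top_mult_tendsto_pos[where c="inverse (2 * s\<^sup>2)"]
        filterlim_tendsto_add_at_top[OF tendsto_const F]) auto
  from filterlim_compose[OF tendsto_power_div_exp_0[of k] this]
  have 1: "((\<lambda>x. (2 * s\<^sup>2) ^ k * exp (A / (2 * s\<^sup>2)) / sqrt (2 * pi * s\<^sup>2) * (u x ^ k / exp (u x))) \<longlongrightarrow> 0) F"
    by (intro tendsto_mult_right_zero) simp
  have "(2 * s\<^sup>2) ^ k * exp (A / (2 * s\<^sup>2)) / sqrt (2 * pi * s\<^sup>2) * (u x ^ k / exp (u x))
      = (A + x\<^sup>2) ^ k * normal_density 0 s x" for x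
  proof -
    have a: "(2 * s\<^sup>2) ^ k * u x ^ k = (A + x\<^sup>2) ^ k"
      using s by (simp add: u_def power_divide)
    have "exp (A / (2 * s\<^sup>2)) / exp (u x) = exp (- x\<^sup>2 / (2 * s\<^sup>2))"
      by (simp add: u_def exp_diff[symmetric] diff_divide_distrib[symmetric])
    then have b: "exp (A / (2 * s\<^sup>2)) = exp (- x\<^sup>2 / (2 * s\<^sup>2)) * exp (u x)"
      by (simp add: field_simps)
    show ?thesis unfolding normal_density_def a[symmetric] b by simp
  qed
  with 1 show ?thesis by simp
qed

lemma normal_density_has_derivative:
  assumes "s > 0"
  shows "(normal_density 0 s has_real_derivative - (x / s\<^sup>2) * normal_density 0 s x) (at x)"
proof -
  have "((\<lambda>x. 1 / sqrt (2 * pi * s\<^sup>2) * exp (- (x - 0)\<^sup>2 / (2 * s\<^sup>2))) has_real_derivative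
      1 / sqrt (2 * pi * s\<^sup>2) * (exp (- (x - 0)\<^sup>2 / (2 * s\<^sup>2)) * (- (2 * x) / (2 * s\<^sup>2)))) (at x)"
    using assms by (intro DERIV_cmult DERIV_fun_exp) (auto intro!: derivative_eq_intros simp: power2_eq_square)
  moreover have "1 / sqrt (2 * pi * s\<^sup>2) * (exp (- (x - 0)\<^sup>2 / (2 * s\<^sup>2)) * (- (2 * x) / (2 * s\<^sup>2)))
      = - (x / s\<^sup>2) * normal_density 0 s x"
    by (simp add: normal_density_def mult_ac)
  ultimately show ?thesis unfolding normal_density_def[abs_def] by simp
qed

text \<open>The density \<open>\<phi>\<close> satisfies \<open>\<phi>' x = - (x / s\<^sup>2) \<phi> x\<close>, so \<open>g' \<phi> - (x / s\<^sup>2) g \<phi>\<close> is the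
  derivative of \<open>g \<phi>\<close>, and the latter vanishes at both ends because \<open>g\<close> grows polynomially.
  The constants \<open>A\<close> and \<open>A'\<close> in the growth conditions make room for the other coordinates,
  which are fixed when the statement is applied in several variables.\<close>

lemma gauss_integration_by_parts:
  fixes g g' :: "real \<Rightarrow> real"
  assumes s: "s > 0"
    and der: "\<And>x. (g has_real_derivative g' x) (at x)"
    and cont: "continuous_on UNIV g'"
    and b: "\<And>x. \<bar>g x\<bar> \<le> C * (A + x\<^sup>2) ^ k" "\<And>x. \<bar>g' x\<bar> \<le> C' * (A' + x\<^sup>2) ^ k'"
  shows "(\<integral>x. x * g x \<partial>gauss s) = s\<^sup>2 * (\<integral>x. g' x \<partial>gauss s)"
proof -
  let ?p = "normal_density 0 s"
  have cg: "continuous_on UNIV g"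
    using der by (intro continuous_at_imp_continuous_on ballI) (auto intro: DERIV_isCont)
  have mg: "g \<in> borel_measurable borel" "g' \<in> borel_measurable borel"
    using cg cont by (auto intro: borel_measurable_continuous_onI)
  have ig': "integrable (gauss s) g'"
    by (rule integrable_gauss_poly_bound[OF s mg(2) b(2)])
  have A1: "\<bar>x * g x\<bar> \<le> \<bar>C\<bar> * ((1 + \<bar>A\<bar>) + x\<^sup>2) ^ (k+1)" for x
  proof -
    have "\<bar>g x\<bar> \<le> \<bar>C\<bar> * ((1 + \<bar>A\<bar>) + x\<^sup>2) ^ k"
    proof -
      have "C * (A + x\<^sup>2) ^ k \<le> \<bar>C\<bar> * (\<bar>A + x\<^sup>2\<bar>) ^ k"
        by (metis abs_ge_self abs_mult power_abs)
      also have "\<dots> \<le> \<bar>C\<bar> * ((1 + \<bar>A\<bar>) + x\<^sup>2) ^ k"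
        using abs_triangle_ineq[of A "x\<^sup>2"] by (intro mult_left_mono power_mono) auto
      finally show ?thesis using b(1)[of x] by simp
    qed
    moreover have "\<bar>x\<bar> \<le> (1 + \<bar>A\<bar>) + x\<^sup>2"
    proof -
      have "0 \<le> (\<bar>x\<bar> - 1)\<^sup>2" by simp
      then have "2 * \<bar>x\<bar> \<le> 1 + x\<^sup>2" by (simp add: power2_eq_square algebra_simps)
      then show ?thesis using zero_le_power2[of x] abs_ge_zero[of A] abs_ge_zero[of x] by linarith
    qed
    ultimately have "\<bar>x\<bar> * \<bar>g x\<bar> \<le> ((1 + \<bar>A\<bar>) + x\<^sup>2) * (\<bar>C\<bar> * ((1 + \<bar>A\<bar>) + x\<^sup>2) ^ k)"
      by (intro mult_mono) auto
    then show ?thesis by (simp add: abs_mult mult_ac)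
  qed
  have ixg: "integrable (gauss s) (\<lambda>x. x * g x)"
    by (rule integrable_gauss_poly_bound[OF s _ A1]) (use mg in measurable)
  let ?f = "\<lambda>x. ?p x * g' x - (1 / s\<^sup>2) * (?p x * (x * g x))"
  have if1: "integrable lborel (\<lambda>x. ?p x * g' x)" "integrable lborel (\<lambda>x. ?p x * (x * g x))"
    using ig' ixg mg by (simp_all add: integrable_gauss_iff)
  have if2: "integrable lborel ?f" using if1 by simp
  have lim: "((\<lambda>x. g x * ?p x) \<longlongrightarrow> 0) F" if F: "filterlim (\<lambda>x::real. x\<^sup>2) at_top F" for F
  proof (rule Lim_null_comparison)
    show "((\<lambda>x. C * ((A + x\<^sup>2) ^ k * ?p x)) \<longlongrightarrow> 0) F"
      by (intro tendsto_mult_right_zero poly_times_normal_density_tendsto_0 s F)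
    show "\<forall>\<^sub>F x in F. norm (g x * ?p x) \<le> C * ((A + x\<^sup>2) ^ k * ?p x)"
      using b(1) by (intro always_eventually allI)
        (auto simp: abs_mult mult.assoc[symmetric] intro!: mult_right_mono)
  qed
  have "(LBINT x=-\<infinity>..\<infinity>. ?f x) = 0 - 0"
  proof (rule interval_integral_FTC_integrable[where F="\<lambda>x. g x * ?p x"])
    fix x
    have "((\<lambda>x. g x * ?p x) has_real_derivative ?f x) (at x)"
      using DERIV_mult[OF der normal_density_has_derivative[OF s], of x] by (simp add: mult_ac)
    then show "((\<lambda>x. g x * ?p x) has_vector_derivative ?f x) (at x)"
      by (simp add: has_real_derivative_iff_has_vector_derivative)
    have cp: "isCont ?p x"
      using normal_density_has_derivative[OF s] by (rule DERIV_isCont)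
    have "isCont g' x" "isCont g x" using cont cg
      by (auto simp: continuous_on_eq_continuous_at)
    then show "isCont ?f x" using cp by (intro continuous_intros) auto
    show "set_integrable lborel (einterval (-\<infinity>) \<infinity>) ?f"
      using if2 by (simp add: set_integrable_def)
    have "filterlim (\<lambda>x::real. x\<^sup>2) at_top at_top"
      by (rule filterlim_pow_at_top) (auto simp: filterlim_ident)
    then show "(((\<lambda>x. g x * ?p x) \<circ> real_of_ereal) \<longlongrightarrow> 0) (at_left \<infinity>)"
      using lim by (simp add: ereal_tendsto_simps)
    have "filterlim (\<lambda>x::real. x\<^sup>2) at_top at_bot"
      by (rule filterlim_pow_at_bot_even) (auto simp: filterlim_ident)
    then show "(((\<lambda>x. g x * ?p x) \<circ> real_of_ereal) \<longlongrightarrow> 0) (at_right (-\<infinity>))"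
      using lim by (simp add: ereal_tendsto_simps)
  qed auto
  then have "(\<integral>x. ?f x \<partial>lborel) = 0"
    by (simp add: interval_lebesgue_integral_def set_lebesgue_integral_def)
  then have "(\<integral>x. ?p x * g' x \<partial>lborel) = (1 / s\<^sup>2) * (\<integral>x. ?p x * (x * g x) \<partial>lborel)"
    using if1 by simp
  then show ?thesis using s mg by (simp add: integral_gauss)
qed

text \<open>The class of functions to which integration by parts in a single coordinate applies: it is
  closed under sums, products and composition with bounded continuous functions, contains the
  coordinates, and its members are integrable. Continuity along coordinate lines is what the
  one-dimensional formula asks of a derivative.\<close>

definition tempered :: "'i set \<Rightarrow> (('i \<Rightarrow> real) \<Rightarrow> real) \<Rightarrow> bool" where
  "tempered I F \<longleftrightarrow> F \<in> borel_measurable (PiM I (\<lambda>_. borel))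
     \<and> (\<forall>z. \<forall>e\<in>I. continuous_on UNIV (\<lambda>x. F (z(e := x))))
     \<and> (\<exists>C k. \<forall>z. \<bar>F z\<bar> \<le> C * (1 + (\<Sum>i\<in>I. (z i)\<^sup>2)) ^ k)"

lemma temperedI:
  assumes "F \<in> borel_measurable (PiM I (\<lambda>_. borel))"
    "\<And>z e. e \<in> I \<Longrightarrow> continuous_on UNIV (\<lambda>x. F (z(e := x)))"
    "\<And>z. \<bar>F z\<bar> \<le> C * (1 + (\<Sum>i\<in>I. (z i)\<^sup>2)) ^ k"
  shows "tempered I F"
  using assms unfolding tempered_def by blast

lemma tempered_measurable: "tempered I F \<Longrightarrow> F \<in> borel_measurable (PiM I (\<lambda>_. borel))"
  by (simp add: tempered_def)

lemma tempered_continuous: "tempered I F \<Longrightarrow> e \<in> I \<Longrightarrow> continuous_on UNIV (\<lambda>x. F (z(e := x)))"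
  by (simp add: tempered_def)

lemma tempered_bound:
  assumes "tempered I F"
  obtains C k where "C \<ge> 0" "\<And>z. \<bar>F z\<bar> \<le> C * (1 + (\<Sum>i\<in>I. (z i)\<^sup>2)) ^ k"
proof -
  obtain C k where C: "\<And>z. \<bar>F z\<bar> \<le> C * (1 + (\<Sum>i\<in>I. (z i)\<^sup>2)) ^ k"
    using assms unfolding tempered_def by blast
  have "C * (1 + (\<Sum>i\<in>I. (z i)\<^sup>2)) ^ k \<le> \<bar>C\<bar> * (1 + (\<Sum>i\<in>I. (z i)\<^sup>2)) ^ k" for z
    by (intro mult_right_mono zero_le_power add_nonneg_nonneg sum_nonneg zero_le_power2) auto
  then show ?thesis using C by (intro that[of "\<bar>C\<bar>" k]) (auto intro: order_trans)
qed

lemma tempered_const [intro]: "tempered I (\<lambda>_. c)"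
  by (rule temperedI[where C="\<bar>c\<bar>" and k=0]) auto

lemma tempered_coord [intro]:
  assumes "finite I" "e \<in> I"
  shows "tempered I (\<lambda>z. z e)"
proof (rule temperedI[where C=1 and k=1])
  show "(\<lambda>z. z e) \<in> borel_measurable (PiM I (\<lambda>_. borel))" using assms by measurable
  show "continuous_on UNIV (\<lambda>x. (z(i := x)) e)" for z i by (cases "i = e") auto
  fix z :: "'a \<Rightarrow> real"
  have "0 \<le> (\<bar>z e\<bar> - 1)\<^sup>2" by simp
  then have "2 * \<bar>z e\<bar> \<le> 1 + (z e)\<^sup>2" by (simp add: power2_eq_square algebra_simps)
  moreover have "(z e)\<^sup>2 \<le> (\<Sum>i\<in>I. (z i)\<^sup>2)" using assms by (intro member_le_sum) auto
  ultimately show "\<bar>z e\<bar> \<le> 1 * (1 + (\<Sum>i\<in>I. (z i)\<^sup>2)) ^ 1"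
    using abs_ge_zero[of "z e"] by simp
qed

lemma tempered_add [intro]:
  assumes "tempered I F" "tempered I G"
  shows "tempered I (\<lambda>z. F z + G z)"
proof -
  obtain C k where C: "C \<ge> 0" "\<And>z. \<bar>F z\<bar> \<le> C * (1 + (\<Sum>i\<in>I. (z i)\<^sup>2)) ^ k"
    using tempered_bound[OF assms(1)] by blast
  obtain C' k' where C': "C' \<ge> 0" "\<And>z. \<bar>G z\<bar> \<le> C' * (1 + (\<Sum>i\<in>I. (z i)\<^sup>2)) ^ k'"
    using tempered_bound[OF assms(2)] by blast
  show ?thesis
  proof (rule temperedI[where C="C+C'" and k="k+k'"])
    show "(\<lambda>z. F z + G z) \<in> borel_measurable (PiM I (\<lambda>_. borel))"
      using assms[THEN tempered_measurable] by measurable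
    show "continuous_on UNIV (\<lambda>x. F (z(e := x)) + G (z(e := x)))" if "e \<in> I" for z e
      using assms that by (intro continuous_intros tempered_continuous)
    fix z :: "'a \<Rightarrow> real"
    let ?S = "1 + (\<Sum>i\<in>I. (z i)\<^sup>2)"
    have S: "?S \<ge> 1" by (simp add: sum_nonneg)
    have "\<bar>F z + G z\<bar> \<le> C * ?S ^ k + C' * ?S ^ k'"
      using C(2)[of z] C'(2)[of z] by linarith
    also have "\<dots> \<le> C * ?S ^ (k + k') + C' * ?S ^ (k + k')"
      using S C C' by (intro add_mono mult_left_mono power_increasing) auto
    finally show "\<bar>F z + G z\<bar> \<le> (C + C') * ?S ^ (k + k')" by (simp add: algebra_simps)
  qed
qed

lemma tempered_mult [intro]:
  assumes "tempered I F" "tempered I G"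
  shows "tempered I (\<lambda>z. F z * G z)"
proof -
  obtain C k where C: "C \<ge> 0" "\<And>z. \<bar>F z\<bar> \<le> C * (1 + (\<Sum>i\<in>I. (z i)\<^sup>2)) ^ k"
    using tempered_bound[OF assms(1)] by blast
  obtain C' k' where C': "C' \<ge> 0" "\<And>z. \<bar>G z\<bar> \<le> C' * (1 + (\<Sum>i\<in>I. (z i)\<^sup>2)) ^ k'"
    using tempered_bound[OF assms(2)] by blast
  show ?thesis
  proof (rule temperedI[where C="C*C'" and k="k+k'"])
    show "(\<lambda>z. F z * G z) \<in> borel_measurable (PiM I (\<lambda>_. borel))"
      using assms[THEN tempered_measurable] by measurable
    show "continuous_on UNIV (\<lambda>x. F (z(e := x)) * G (z(e := x)))" if "e \<in> I" for z e
      using assms that by (intro continuous_intros tempered_continuous)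
    fix z :: "'a \<Rightarrow> real"
    have "\<bar>F z\<bar> * \<bar>G z\<bar> \<le> (C * (1 + (\<Sum>i\<in>I. (z i)\<^sup>2)) ^ k) * (C' * (1 + (\<Sum>i\<in>I. (z i)\<^sup>2)) ^ k')"
      using C(2)[of z] C'(2)[of z] by (intro mult_mono) (auto intro: order_trans[OF abs_ge_zero])
    then show "\<bar>F z * G z\<bar> \<le> C * C' * (1 + (\<Sum>i\<in>I. (z i)\<^sup>2)) ^ (k + k')"
      by (simp add: abs_mult power_add mult_ac)
  qed
qed

lemma tempered_sum [intro]: "(\<And>a. a \<in> A \<Longrightarrow> tempered I (F a)) \<Longrightarrow> tempered I (\<lambda>z. \<Sum>a\<in>A. F a z)"
  by (induction A rule: infinite_finite_induct) auto

lemma tempered_prod [intro]: "(\<And>a. a \<in> A \<Longrightarrow> tempered I (F a)) \<Longrightarrow> tempered I (\<lambda>z. \<Prod>a\<in>A. F a z)"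
  by (induction A rule: infinite_finite_induct) auto

lemma tempered_bounded_comp:
  assumes F: "tempered I F" and f: "continuous_on UNIV f" and b: "\<And>x. \<bar>f x\<bar> \<le> (B::real)"
  shows "tempered I (\<lambda>z. f (F z))"
proof (rule temperedI[where C=B and k=0])
  have "f \<in> borel_measurable borel" using f by (rule borel_measurable_continuous_onI)
  then show "(\<lambda>z. f (F z)) \<in> borel_measurable (PiM I (\<lambda>_. borel))"
    using tempered_measurable[OF F] by measurable
  show "continuous_on UNIV (\<lambda>x. f (F (z(e := x))))" if "e \<in> I" for z e
    by (rule continuous_on_compose2[OF f tempered_continuous[OF F that]]) auto
qed (use b in auto)

definition gauss_prod :: "'i set \<Rightarrow> real \<Rightarrow> ('i \<Rightarrow> real) measure" where
  "gauss_prod I s = PiM I (\<lambda>_. gauss s)"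

lemma sets_gauss_prod [measurable_cong]: "sets (gauss_prod I s) = sets (PiM I (\<lambda>_. borel))"
  unfolding gauss_prod_def by (rule sets_PiM_cong) auto

lemma prob_space_gauss_prod: "s > 0 \<Longrightarrow> prob_space (gauss_prod I s)"
  unfolding gauss_prod_def by (intro prob_space_PiM prob_space_gauss)

lemma measurable_gauss_prod: "tempered I F \<Longrightarrow> F \<in> borel_measurable (gauss_prod I s)"
  using tempered_measurable[of I F] measurable_cong_sets[OF sets_gauss_prod refl] by blast

text \<open>A power of \<open>1 + \<Sum>(z i)\<^sup>2\<close> is dominated by that of the largest summand, up to a constant,
  hence by a sum of even powers of single coordinates, whose integrability is a statement
  about one variable.\<close>

lemma integrable_tempered:
  assumes fin: "finite I" and s: "s > 0" and F: "tempered I F"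
  shows "integrable (gauss_prod I s) F"
proof -
  interpret prob_space "gauss_prod I s" by (rule prob_space_gauss_prod[OF s])
  obtain C k where C: "C \<ge> 0" "\<And>z. \<bar>F z\<bar> \<le> C * (1 + (\<Sum>i\<in>I. (z i)\<^sup>2)) ^ k"
    using tempered_bound[OF F] by blast
  have coord: "integrable (gauss_prod I s) (\<lambda>z. (z i) ^ m)" if i: "i \<in> I" for i m
  proof -
    have d: "distr (gauss_prod I s) (gauss s) (\<lambda>z. z i) = gauss s"
      unfolding gauss_prod_def using i by (intro distr_PiM_component prob_space_gauss s)
    have m: "(\<lambda>z. z i) \<in> measurable (gauss_prod I s) (gauss s)"
      unfolding gauss_prod_def using i by measurable
    have "integrable (distr (gauss_prod I s) (gauss s) (\<lambda>z. z i)) (\<lambda>x. x ^ m)"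
      unfolding d by (rule integrable_gauss_power[OF s])
    then show ?thesis using m by (subst (asm) integrable_distr_eq) auto
  qed
  let ?N = "real (card I + 1)"
  have pb: "(1 + (\<Sum>i\<in>I. (z i)\<^sup>2)) ^ k \<le> ?N ^ k * (1 + (\<Sum>i\<in>I. (z i) ^ (2 * k)))" for z
  proof -
    \<comment> \<open>the largest summand; the element 1 makes the maximum exist for empty index sets\<close>
    define m where "m = Max (insert 1 ((\<lambda>i. (z i)\<^sup>2) ` I))"
    have m1: "m \<ge> 1" unfolding m_def using fin by simp
    have mi: "(z i)\<^sup>2 \<le> m" if "i \<in> I" for i unfolding m_def using fin that by simp
    have "m \<in> insert 1 ((\<lambda>i. (z i)\<^sup>2) ` I)" unfolding m_def using fin by (intro Max_in) auto
    then have "m ^ k = 1 \<or> (\<exists>i\<in>I. m ^ k = (z i) ^ (2 * k))" by (auto simp: power_mult)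
    then have mk: "m ^ k \<le> 1 + (\<Sum>i\<in>I. (z i) ^ (2 * k))"
    proof
      assume "m ^ k = 1" then show ?thesis by (simp add: sum_nonneg)
    next
      assume "\<exists>i\<in>I. m ^ k = (z i) ^ (2 * k)"
      then obtain i where i: "i \<in> I" "m ^ k = (z i) ^ (2 * k)" by blast
      have "(z i) ^ (2 * k) \<le> (\<Sum>i\<in>I. (z i) ^ (2 * k))"
        using i fin by (intro member_le_sum) auto
      then show ?thesis using i by simp
    qed
    have "(\<Sum>i\<in>I. (z i)\<^sup>2) \<le> real (card I) * m"
      using mi by (rule sum_bounded_above)
    then have "1 + (\<Sum>i\<in>I. (z i)\<^sup>2) \<le> ?N * m" using m1 by (simp add: algebra_simps)
    then have "(1 + (\<Sum>i\<in>I. (z i)\<^sup>2)) ^ k \<le> (?N * m) ^ k"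
      by (intro power_mono) (auto intro!: add_nonneg_nonneg sum_nonneg)
    also have "\<dots> = ?N ^ k * m ^ k" by (simp add: power_mult_distrib)
    also have "\<dots> \<le> ?N ^ k * (1 + (\<Sum>i\<in>I. (z i) ^ (2 * k)))"
      by (intro mult_left_mono mk) auto
    finally show ?thesis .
  qed
  show ?thesis
  proof (rule Bochner_Integration.integrable_bound)
    show "integrable (gauss_prod I s) (\<lambda>z. C * (?N ^ k * (1 + (\<Sum>i\<in>I. (z i) ^ (2 * k)))))"
      by (intro integrable_mult_right Bochner_Integration.integrable_add Bochner_Integration.integrable_sum coord) auto
    show "F \<in> borel_measurable (gauss_prod I s)" by (rule measurable_gauss_prod[OF F])
    have "\<bar>F z\<bar> \<le> C * (?N ^ k * (1 + (\<Sum>i\<in>I. (z i) ^ (2 * k))))" for z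
      using C(2)[of z] mult_left_mono[OF pb[of z] C(1)] by linarith
    then show "AE z in gauss_prod I s. norm (F z) \<le> norm (C * (?N ^ k * (1 + (\<Sum>i\<in>I. (z i) ^ (2 * k)))))"
      by (intro always_eventually allI) (metis abs_ge_self order_trans real_norm_def)
  qed
qed

text \<open>The gradient is recorded as a family of functions \<open>F' e\<close>, one for each coordinate \<open>e\<close>. All
  functions are required to be tempered, so that no separate integrability checks are needed
  when gradients are combined.\<close>

definition has_grad :: "'i set \<Rightarrow> (('i \<Rightarrow> real) \<Rightarrow> real) \<Rightarrow> ('i \<Rightarrow> ('i \<Rightarrow> real) \<Rightarrow> real) \<Rightarrow> bool" where
  "has_grad I F F' \<longleftrightarrow> tempered I F \<and> (\<forall>e\<in>I. tempered I (F' e))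
     \<and> (\<forall>z. \<forall>e\<in>I. ((\<lambda>x. F (z(e := x))) has_real_derivative F' e z) (at (z e)))"

text \<open>By Fubini the coordinate \<open>e\<close> can be integrated first, with all others fixed.\<close>

lemma gauss_prod_integration_by_parts:
  assumes fin: "finite I" and s: "s > 0" and F: "has_grad I F F'" and e: "e \<in> I"
  shows "(\<integral>z. z e * F z \<partial>gauss_prod I s) = s\<^sup>2 * (\<integral>z. F' e z \<partial>gauss_prod I s)"
proof -
  define J where "J = I - {e}"
  have I: "I = insert e J" "e \<notin> J" "finite J" using e fin by (auto simp: J_def)
  interpret product_sigma_finite "\<lambda>_. gauss s"
    by standard (metis prob_space_gauss[OF s] prob_space_imp_sigma_finite sigma_finite_measure_def)
  have t: "tempered I F" "tempered I (F' e)" using F e by (auto simp: has_grad_def)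
  have tx: "tempered I (\<lambda>z. z e * F z)" using t(1) fin e by auto
  have ins: "(\<integral>z. G z \<partial>gauss_prod I s) = (\<integral>z. (\<integral>x. G (z(e := x)) \<partial>gauss s) \<partial>PiM J (\<lambda>_. gauss s))"
    if G: "tempered I G" for G
    using integrable_tempered[OF fin s G] product_integral_insert[OF I(3,2), of G]
    unfolding gauss_prod_def I(1) by blast
  have bd: "\<exists>C A k. \<forall>x. \<bar>G (z(e := x))\<bar> \<le> C * (A + x\<^sup>2) ^ k" if G: "tempered I G" for G and z :: "'a \<Rightarrow> real"
  proof -
    obtain C k where C: "\<And>z. \<bar>G z\<bar> \<le> C * (1 + (\<Sum>i\<in>I. (z i)\<^sup>2)) ^ k"
      using tempered_bound[OF G] by blast
    have "(\<Sum>i\<in>I. ((z(e := x)) i)\<^sup>2) = x\<^sup>2 + (\<Sum>i\<in>J. (z i)\<^sup>2)" for x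
    proof -
      have "(\<Sum>i\<in>J. ((z(e := x)) i)\<^sup>2) = (\<Sum>i\<in>J. (z i)\<^sup>2)"
        using I by (intro sum.cong) auto
      then show ?thesis using I by simp
    qed
    then show ?thesis using C[of "z(e := _)"] by (intro exI[of _ C] exI[of _ "1 + (\<Sum>i\<in>J. (z i)\<^sup>2)"] exI[of _ k] allI)
      (simp add: add_ac)
  qed
  have inner: "(\<integral>x. x * F (z(e := x)) \<partial>gauss s) = s\<^sup>2 * (\<integral>x. F' e (z(e := x)) \<partial>gauss s)" for z
  proof -
    obtain C A k where 1: "\<And>x. \<bar>F (z(e := x))\<bar> \<le> C * (A + x\<^sup>2) ^ k" using bd[OF t(1)] by blast
    obtain C' A' k' where 2: "\<And>x. \<bar>F' e (z(e := x))\<bar> \<le> C' * (A' + x\<^sup>2) ^ k'" using bd[OF t(2)] by blast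
    have d: "((\<lambda>x. F (z(e := x))) has_real_derivative F' e (z(e := x))) (at x)" for x
    proof -
      have "((\<lambda>y. F ((z(e := x))(e := y))) has_real_derivative F' e (z(e := x))) (at ((z(e := x)) e))"
        using F e unfolding has_grad_def by blast
      then show ?thesis by simp
    qed
    show ?thesis
      by (rule gauss_integration_by_parts[OF s d tempered_continuous[OF t(2) e] 1 2])
  qed
  show ?thesis
    by (simp add: ins[OF tx] ins[OF t(2)] inner)
qed

lemma has_gradD:
  assumes "has_grad I F F'"
  shows "tempered I F" "e \<in> I \<Longrightarrow> tempered I (F' e)"
    "e \<in> I \<Longrightarrow> ((\<lambda>x. F (z(e := x))) has_real_derivative F' e z) (at (z e))"
  using assms by (auto simp: has_grad_def)

lemma has_gradI:
  assumes "tempered I F" "\<And>e. e \<in> I \<Longrightarrow> tempered I (F' e)"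
    "\<And>z e. e \<in> I \<Longrightarrow> ((\<lambda>x. F (z(e := x))) has_real_derivative F' e z) (at (z e))"
  shows "has_grad I F F'"
  using assms by (auto simp: has_grad_def)

lemma has_grad_const: "has_grad I (\<lambda>_. c) (\<lambda>_ _. 0)"
  by (intro has_gradI) auto

lemma has_grad_coord:
  assumes "finite I" "i \<in> I"
  shows "has_grad I (\<lambda>z. z i) (\<lambda>e _. if e = i then 1 else 0)"
proof (intro has_gradI)
  fix z :: "'a \<Rightarrow> real" and e
  show "((\<lambda>x. (z(e := x)) i) has_real_derivative (if e = i then 1 else 0)) (at (z e))"
    by (cases "e = i") auto
qed (use assms in auto)

lemma has_grad_add:
  assumes "has_grad I F F'" "has_grad I G G'"
  shows "has_grad I (\<lambda>z. F z + G z) (\<lambda>e z. F' e z + G' e z)"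
  using has_gradD[OF assms(1)] has_gradD[OF assms(2)]
  by (intro has_gradI) (auto intro!: derivative_eq_intros)

lemma has_grad_mult:
  assumes "has_grad I F F'" "has_grad I G G'"
  shows "has_grad I (\<lambda>z. F z * G z) (\<lambda>e z. F' e z * G z + F z * G' e z)"
proof (intro has_gradI)
  fix z and e assume e: "e \<in> I"
  show "((\<lambda>x. F (z(e := x)) * G (z(e := x))) has_real_derivative F' e z * G z + F z * G' e z) (at (z e))"
    using DERIV_mult[OF has_gradD(3)[OF assms(1) e, of z] has_gradD(3)[OF assms(2) e, of z]]
    by (simp add: mult_ac)
  show "tempered I (\<lambda>z. F' e z * G z + F z * G' e z)"
    using has_gradD(1,2)[OF assms(1)] has_gradD(1,2)[OF assms(2)] e
    by (intro tempered_add tempered_mult) auto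
qed (use has_gradD[OF assms(1)] has_gradD[OF assms(2)] in auto)

lemma has_grad_sum:
  assumes "\<And>a. a \<in> A \<Longrightarrow> has_grad I (F a) (F' a)"
  shows "has_grad I (\<lambda>z. \<Sum>a\<in>A. F a z) (\<lambda>e z. \<Sum>a\<in>A. F' a e z)"
  using assms
  by (induction A rule: infinite_finite_induct) (auto intro: has_grad_const has_grad_add)

lemma has_grad_cong:
  assumes "has_grad I F F'" "\<And>e z. e \<in> I \<Longrightarrow> F' e z = F'' e z"
  shows "has_grad I F F''"
proof -
  have "F' e = F'' e" if "e \<in> I" for e using assms(2)[OF that] by auto
  then show ?thesis using assms(1) unfolding has_grad_def by auto
qed

lemma has_grad_comp:
  assumes F: "has_grad I F F'" and f: "\<And>x. (f has_real_derivative f' x) (at x)"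
    and t: "tempered I (\<lambda>z. f (F z))" "tempered I (\<lambda>z. f' (F z))"
  shows "has_grad I (\<lambda>z. f (F z)) (\<lambda>e z. f' (F z) * F' e z)"
proof (intro has_gradI)
  fix z and e assume e: "e \<in> I"
  show "((\<lambda>x. f (F (z(e := x)))) has_real_derivative f' (F z) * F' e z) (at (z e))"
    by (rule DERIV_chain2[OF _ has_gradD(3)[OF F e]]) (simp add: f)
qed (use has_gradD[OF F] t in auto)

section \<open>Traces of words and loop equations\<close>

text \<open>The words that arise when the first letter \<open>a\<close> of \<open>a # as\<close> is contracted with the letter
  \<open>u ! s\<close> of another word: the two closed words become one. The matrices are real, so a word
  may be read in both directions, and there are two ways of joining.\<close>

definition merge1 :: "nat \<Rightarrow> nat list \<Rightarrow> nat list \<Rightarrow> nat \<Rightarrow> nat list" where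
  "merge1 a as u s = rev as @ (a + u ! s) # (drop (Suc s) u @ take s u)"

definition merge2 :: "nat \<Rightarrow> nat list \<Rightarrow> nat list \<Rightarrow> nat \<Rightarrow> nat list" where
  "merge2 a as u s = rev as @ (a + u ! s) # rev (drop (Suc s) u @ take s u)"

text \<open>Contraction of \<open>a\<close> with a letter of its own word \<open>as\<close>. In one of the two orientations the
  word stays connected and its part before the contracted letter is reversed; in the other
  orientation the word splits into this loop and the rest \<open>drop (Suc s) as\<close>.\<close>

definition flip :: "nat \<Rightarrow> nat list \<Rightarrow> nat \<Rightarrow> nat list" where
  "flip a as s = rev (take s as) @ (a + as ! s) # drop (Suc s) as"

definition loop :: "nat \<Rightarrow> nat list \<Rightarrow> nat \<Rightarrow> nat list" where
  "loop a as s = (a + as ! s) # rev (take s as)"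

text \<open>Only symmetry and the semigroup law \<open>Q a * Q b = Q (a + b)\<close> enter the loop equations; the
  instance of interest is \<open>Q a = D^a / S^a\<close>. Matrices are functions on pairs of indices here,
  because their entries are differentiated as functions of the sample point \<open>z\<close>.\<close>

locale wishart_words =
  fixes d n :: nat and Q :: "nat \<Rightarrow> nat \<Rightarrow> nat \<Rightarrow> real"
  assumes Q_sym: "i < d \<Longrightarrow> j < d \<Longrightarrow> Q a i j = Q a j i"
    and Q_mult: "i < d \<Longrightarrow> j < d \<Longrightarrow> (\<Sum>k<d. Q a i k * Q b k j) = Q (a + b) i j"
    and n_pos: "n > 0"
begin

abbreviation Ix :: "(nat \<times> nat) set" where "Ix \<equiv> {..<d} \<times> {..<n}"

definition E :: "((nat \<times> nat \<Rightarrow> real) \<Rightarrow> real) \<Rightarrow> real" where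
  "E F = (\<integral>z. F z \<partial>gauss_prod Ix (1 / sqrt (real n)))"

lemma sd_pos: "1 / sqrt (real n) > 0" using n_pos by simp

lemma integrable_E: "tempered Ix F \<Longrightarrow> integrable (gauss_prod Ix (1 / sqrt (real n))) F"
  by (rule integrable_tempered[OF _ sd_pos]) auto

lemma E_add: "tempered Ix F \<Longrightarrow> tempered Ix G \<Longrightarrow> E (\<lambda>z. F z + G z) = E F + E G"
  unfolding E_def by (intro Bochner_Integration.integral_add integrable_E)

lemma E_diff: "tempered Ix F \<Longrightarrow> tempered Ix G \<Longrightarrow> E (\<lambda>z. F z - G z) = E F - E G"
  unfolding E_def by (intro Bochner_Integration.integral_diff integrable_E)

lemma E_cmult: "E (\<lambda>z. c * F z) = c * E F"
  unfolding E_def by simp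

lemma E_sum: "(\<And>a. a \<in> A \<Longrightarrow> tempered Ix (F a)) \<Longrightarrow> E (\<lambda>z. \<Sum>a\<in>A. F a z) = (\<Sum>a\<in>A. E (F a))"
  unfolding E_def by (intro Bochner_Integration.integral_sum integrable_E)

lemma E_sum2:
  assumes "\<And>i j. i < d \<Longrightarrow> j < n \<Longrightarrow> tempered Ix (F i j)"
  shows "E (\<lambda>z. \<Sum>i<d. \<Sum>j<n. F i j z) = (\<Sum>i<d. \<Sum>j<n. E (F i j))"
proof -
  have "E (\<lambda>z. \<Sum>i<d. \<Sum>j<n. F i j z) = (\<Sum>i<d. E (\<lambda>z. \<Sum>j<n. F i j z))"
    using assms by (intro E_sum tempered_sum) auto
  also have "\<dots> = (\<Sum>i<d. \<Sum>j<n. E (F i j))"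
    using assms by (intro sum.cong refl E_sum) auto
  finally show ?thesis .
qed

lemma E_const: "E (\<lambda>z. c) = c"
proof -
  interpret prob_space "gauss_prod Ix (1 / sqrt (real n))" by (rule prob_space_gauss_prod[OF sd_pos])
  show ?thesis unfolding E_def by (simp add: prob_space)
qed

text \<open>The matrix \<open>Q a Z\<close>; \<open>P\<close> and \<open>V\<close> below are \<open>Z\<^sup>T Q a\<^sub>1 Z \<cdots> Z\<^sup>T Q a\<^sub>m Z\<close> and \<open>Q a Z P\<close>.\<close>

definition U :: "(nat \<times> nat \<Rightarrow> real) \<Rightarrow> nat \<Rightarrow> nat \<Rightarrow> nat \<Rightarrow> real" where
  "U z a i y = (\<Sum>k<d. Q a i k * z (k, y))"

primrec P :: "(nat \<times> nat \<Rightarrow> real) \<Rightarrow> nat list \<Rightarrow> nat \<Rightarrow> nat \<Rightarrow> real" where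
  "P z [] x y = (if x = y then 1 else 0)"
| "P z (a # as) x y = (\<Sum>i<d. z (i, x) * (\<Sum>k<n. U z a i k * P z as k y))"

definition V :: "(nat \<times> nat \<Rightarrow> real) \<Rightarrow> nat \<Rightarrow> nat list \<Rightarrow> nat \<Rightarrow> nat \<Rightarrow> real" where
  "V z a as i y = (\<Sum>k<n. U z a i k * P z as k y)"

definition T :: "(nat \<times> nat \<Rightarrow> real) \<Rightarrow> nat list \<Rightarrow> real" where
  "T z w = (\<Sum>x<n. P z w x x)"

definition trQ :: "nat \<Rightarrow> real" where "trQ a = (\<Sum>i<d. Q a i i)"

lemma P_Cons: "P z (a # as) x y = (\<Sum>i<d. z (i, x) * V z a as i y)"
  by (simp add: V_def)

declare P.simps(2) [simp del]

lemma T_Nil: "T z [] = real n" by (simp add: T_def)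

lemma V_Nil: "y < n \<Longrightarrow> V z a [] i y = U z a i y"
  by (simp add: V_def if_distrib[of "\<lambda>x. _ * x"] sum.delta cong: if_cong)

lemma P_append: "x < n \<Longrightarrow> P z (us @ vs) x y = (\<Sum>k<n. P z us x k * P z vs k y)"
proof (induction us arbitrary: x)
  case Nil
  then show ?case by (simp add: if_distrib[of "\<lambda>x. x * _"] sum.delta cong: if_cong)
next
  case (Cons a us)
  have "P z ((a # us) @ vs) x y = (\<Sum>i<d. z (i, x) * (\<Sum>k<n. U z a i k * (\<Sum>l<n. P z us k l * P z vs l y)))"
    using Cons.IH by (simp add: P.simps(2))
  also have "\<dots> = (\<Sum>i<d. \<Sum>k<n. \<Sum>l<n. z (i, x) * U z a i k * P z us k l * P z vs l y)"
    by (simp add: sum_distrib_left mult_ac)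
  also have "\<dots> = (\<Sum>i<d. \<Sum>l<n. \<Sum>k<n. z (i, x) * U z a i k * P z us k l * P z vs l y)"
    by (intro sum.cong refl sum.swap)
  also have "\<dots> = (\<Sum>l<n. \<Sum>i<d. \<Sum>k<n. z (i, x) * U z a i k * P z us k l * P z vs l y)"
    by (rule sum.swap)
  also have "\<dots> = (\<Sum>l<n. P z (a # us) x l * P z vs l y)"
    by (simp add: P.simps(2) sum_distrib_left sum_distrib_right mult_ac)
  finally show ?case .
qed

lemma V_append: "V z a (us @ vs) i y = (\<Sum>k<n. V z a us i k * P z vs k y)"
proof -
  have "V z a (us @ vs) i y = (\<Sum>k<n. \<Sum>l<n. U z a i k * (P z us k l * P z vs l y))"
    by (simp add: V_def P_append sum_distrib_left)
  also have "\<dots> = (\<Sum>l<n. \<Sum>k<n. U z a i k * (P z us k l * P z vs l y))"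
    by (rule sum.swap)
  also have "\<dots> = (\<Sum>l<n. V z a us i l * P z vs l y)"
    by (simp add: V_def sum_distrib_right sum_distrib_left mult_ac)
  finally show ?thesis .
qed

lemma P_single: "y < n \<Longrightarrow> P z [a] x y = (\<Sum>i<d. z (i, x) * U z a i y)"
  by (simp add: P_Cons V_Nil)

lemma P_single_sym: "x < n \<Longrightarrow> y < n \<Longrightarrow> P z [a] x y = P z [a] y x"
proof -
  assume "x < n" "y < n"
  then have "P z [a] x y = (\<Sum>i<d. \<Sum>k<d. z (i, x) * (Q a i k * z (k, y)))"
    by (simp add: P_single U_def sum_distrib_left)
  also have "\<dots> = (\<Sum>k<d. \<Sum>i<d. z (i, x) * (Q a i k * z (k, y)))" by (rule sum.swap)
  also have "\<dots> = (\<Sum>k<d. \<Sum>i<d. z (k, y) * (Q a k i * z (i, x)))"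
    by (intro sum.cong refl) (auto simp: Q_sym[of _ _ a] mult_ac)
  also have "\<dots> = P z [a] y x"
    using \<open>x < n\<close> by (simp add: P_single U_def sum_distrib_left)
  finally show ?thesis .
qed

lemma P_Cons_single: "x < n \<Longrightarrow> P z (a # as) x y = (\<Sum>k<n. P z [a] x k * P z as k y)"
  using P_append[of x z "[a]" as y] by simp

lemma P_rev: "x < n \<Longrightarrow> y < n \<Longrightarrow> P z (rev us) x y = P z us y x"
proof (induction us arbitrary: x y)
  case (Cons a us)
  have "P z (rev (a # us)) x y = (\<Sum>k<n. P z (rev us) x k * P z [a] k y)"
    using Cons.prems by (simp add: P_append)
  also have "\<dots> = (\<Sum>k<n. P z [a] y k * P z us k x)"
    using Cons by (intro sum.cong) (auto simp: P_single_sym[of y] mult_ac)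
  also have "\<dots> = P z (a # us) y x" using Cons.prems by (simp add: P_Cons_single[of y _ a us])
  finally show ?case .
qed auto

lemma U_U:
  assumes "x < n" "y < n"
  shows "(\<Sum>i<d. U z a i x * U z b i y) = P z [a + b] x y"
proof -
  have "(\<Sum>i<d. U z a i x * U z b i y) = (\<Sum>i<d. \<Sum>k<d. \<Sum>l<d. z (k, x) * (Q a k i * Q b i l) * z (l, y))"
    by (simp add: U_def sum_product Q_sym[of _ _ a] mult_ac cong: sum.cong)
      (intro sum.cong refl, auto simp: Q_sym[of _ _ a])
  also have "\<dots> = (\<Sum>k<d. \<Sum>i<d. \<Sum>l<d. z (k, x) * (Q a k i * Q b i l) * z (l, y))"
    by (rule sum.swap)
  also have "\<dots> = (\<Sum>k<d. \<Sum>l<d. \<Sum>i<d. z (k, x) * (Q a k i * Q b i l) * z (l, y))"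
    by (intro sum.cong refl sum.swap)
  also have "\<dots> = (\<Sum>k<d. \<Sum>l<d. z (k, x) * Q (a + b) k l * z (l, y))"
    by (intro sum.cong refl) (simp add: Q_mult[symmetric] sum_distrib_left sum_distrib_right)
  also have "\<dots> = P z [a + b] x y"
    using assms by (simp add: P_single U_def sum_distrib_left mult_ac)
  finally show ?thesis .
qed

text \<open>The rule for contracting two letters: transposing the first factor reverses its word, and
  the adjacent \<open>Q a\<close> and \<open>Q b\<close> combine to one letter.\<close>

lemma V_V: "(\<Sum>i<d. \<Sum>y<n. V z a us i y * V z b vs i y) = T z (rev us @ (a + b) # vs)"
proof -
  have "(\<Sum>i<d. \<Sum>y<n. V z a us i y * V z b vs i y)
      = (\<Sum>y<n. \<Sum>i<d. \<Sum>k<n. \<Sum>l<n. P z us k y * (U z a i k * U z b i l) * P z vs l y)"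
    by (subst sum.swap) (simp add: V_def sum_product mult_ac)
  also have "\<dots> = (\<Sum>y<n. \<Sum>k<n. \<Sum>l<n. \<Sum>i<d. P z us k y * (U z a i k * U z b i l) * P z vs l y)"
    by (subst sum.swap, rule sum.cong[OF refl], rule sum.cong[OF refl]) (rule sum.swap)
  also have "\<dots> = (\<Sum>y<n. \<Sum>k<n. \<Sum>l<n. P z us k y * P z [a + b] k l * P z vs l y)"
    by (intro sum.cong refl) (simp add: U_U[symmetric] sum_distrib_left sum_distrib_right)
  also have "\<dots> = (\<Sum>y<n. P z (rev us @ [a + b] @ vs) y y)"
    by (intro sum.cong refl)
      (simp add: P_append P_rev P_Cons_single[of _ z "a + b" vs] sum_distrib_left mult_ac)
  finally show ?thesis by (simp add: T_def)
qed

lemma has_grad_U: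
  assumes "i < d" "k < n"
  shows "has_grad Ix (\<lambda>z. U z a i k) (\<lambda>e z. if snd e = k then Q a i (fst e) else 0)"
proof -
  have "has_grad Ix (\<lambda>z. U z a i k) (\<lambda>e z. \<Sum>l<d. 0 * z (l, k) + Q a i l * (if e = (l, k) then 1 else 0))"
    unfolding U_def using assms by (intro has_grad_sum has_grad_mult has_grad_const has_grad_coord) auto
  then show ?thesis
  proof (rule has_grad_cong)
    fix e :: "nat \<times> nat" and z :: "nat \<times> nat \<Rightarrow> real" assume e: "e \<in> Ix"
    have "(\<Sum>l<d. Q a i l * (if e = (l, k) then 1 else 0)) = (\<Sum>l<d. if fst e = l then (if snd e = k then Q a i l else 0) else 0)"
      by (intro sum.cong) (auto simp: prod_eq_iff)
    then show "(\<Sum>l<d. 0 * z (l, k) + Q a i l * (if e = (l, k) then 1 else 0)) = (if snd e = k then Q a i (fst e) else 0)"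
      using e by (auto simp: sum.delta)
  qed
qed

text \<open>The product rule: the factor differentiated at position \<open>s\<close> is either the one on the right
  or the one on the left (transposed) of the letter \<open>w ! s\<close>.\<close>

definition gradP :: "nat list \<Rightarrow> nat \<Rightarrow> nat \<Rightarrow> nat \<times> nat \<Rightarrow> (nat \<times> nat \<Rightarrow> real) \<Rightarrow> real" where
  "gradP w x y e z = (\<Sum>s<length w. P z (take s w) x (snd e) * V z (w ! s) (drop (Suc s) w) (fst e) y
     + V z (w ! s) (rev (take s w)) (fst e) x * P z (drop (Suc s) w) (snd e) y)"

lemma V_snoc: "V z b (us @ [a]) i x = (\<Sum>k<n. V z b us i k * P z [a] k x)"
  by (rule V_append)

lemma has_grad_P:
  assumes "x < n" "y < n"
  shows "has_grad Ix (\<lambda>z. P z w x y) (gradP w x y)"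
  using assms
proof (induction w arbitrary: x)
  case Nil
  show ?case using has_grad_const[of Ix "if x = y then 1 else 0"]
    by (simp add: gradP_def[abs_def])
next
  case (Cons a w)
  have "has_grad Ix (\<lambda>z. P z (a # w) x y) (\<lambda>e z. \<Sum>i<d. (if e = (i, x) then 1 else 0) * (\<Sum>k<n. U z a i k * P z w k y)
     + z (i, x) * (\<Sum>k<n. (if snd e = k then Q a i (fst e) else 0) * P z w k y + U z a i k * gradP w k y e z))"
    unfolding P.simps(2) using Cons.prems
    by (intro has_grad_sum has_grad_mult has_grad_coord has_grad_U Cons.IH) auto
  then show ?case
  proof (rule has_grad_cong)
    fix e :: "nat \<times> nat" and z :: "nat \<times> nat \<Rightarrow> real" assume "e \<in> Ix"
    then have e: "fst e < d" "snd e < n" by auto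
    have 1: "(\<Sum>i<d. (if e = (i, x) then 1 else 0) * (\<Sum>k<n. U z a i k * P z w k y))
      = P z [] x (snd e) * V z a w (fst e) y"
    proof -
      have "(\<Sum>i<d. (if e = (i, x) then 1 else 0) * (\<Sum>k<n. U z a i k * P z w k y))
        = (\<Sum>i<d. if fst e = i then (if snd e = x then V z a w i y else 0) else 0)"
        by (intro sum.cong) (auto simp: prod_eq_iff V_def)
      then show ?thesis using e by simp
    qed
    have "(\<Sum>k<n. (if snd e = k then Q a i (fst e) else 0) * P z w k y) = Q a i (fst e) * P z w (snd e) y" for i
      using e by (simp add: if_distrib[of "\<lambda>x. x * _"] sum.delta cong: if_cong)
    then have "(\<Sum>i<d. z (i, x) * (\<Sum>k<n. (if snd e = k then Q a i (fst e) else 0) * P z w k y))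
      = (\<Sum>i<d. z (i, x) * Q a i (fst e)) * P z w (snd e) y"
      by (simp add: sum_distrib_right sum_distrib_left mult_ac)
    also have "(\<Sum>i<d. z (i, x) * Q a i (fst e)) = U z a (fst e) x"
      unfolding U_def using e by (intro sum.cong) (auto simp: Q_sym[of _ _ a] mult_ac)
    finally have 2: "(\<Sum>i<d. z (i, x) * (\<Sum>k<n. (if snd e = k then Q a i (fst e) else 0) * P z w k y))
      = V z a (rev []) (fst e) x * P z w (snd e) y" using Cons.prems by (simp add: V_Nil)
    have 3: "(\<Sum>i<d. z (i, x) * (\<Sum>k<n. U z a i k * gradP w k y e z))
       = (\<Sum>s<length w. P z (a # take s w) x (snd e) * V z (w ! s) (drop (Suc s) w) (fst e) y
          + V z (w ! s) (rev (a # take s w)) (fst e) x * P z (drop (Suc s) w) (snd e) y)"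
    proof -
      have "(\<Sum>i<d. z (i, x) * (\<Sum>k<n. U z a i k * gradP w k y e z)) = (\<Sum>i<d. \<Sum>k<n. z (i, x) * U z a i k * gradP w k y e z)"
        by (simp add: sum_distrib_left mult_ac)
      also have "\<dots> = (\<Sum>k<n. \<Sum>i<d. z (i, x) * U z a i k * gradP w k y e z)" by (rule sum.swap)
      also have "\<dots> = (\<Sum>k<n. P z [a] x k * gradP w k y e z)"
        by (simp add: P_single sum_distrib_right)
      also have "\<dots> = (\<Sum>k<n. \<Sum>s<length w. P z [a] x k * (P z (take s w) k (snd e) * V z (w ! s) (drop (Suc s) w) (fst e) y
          + V z (w ! s) (rev (take s w)) (fst e) k * P z (drop (Suc s) w) (snd e) y))"
        by (simp add: gradP_def sum_distrib_left)
      also have "\<dots> = (\<Sum>s<length w. \<Sum>k<n. P z [a] x k * (P z (take s w) k (snd e) * V z (w ! s) (drop (Suc s) w) (fst e) y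
          + V z (w ! s) (rev (take s w)) (fst e) k * P z (drop (Suc s) w) (snd e) y))"
        by (rule sum.swap)
      also have "\<dots> = (\<Sum>s<length w. (\<Sum>k<n. P z [a] x k * P z (take s w) k (snd e)) * V z (w ! s) (drop (Suc s) w) (fst e) y
          + (\<Sum>k<n. V z (w ! s) (rev (take s w)) (fst e) k * P z [a] k x) * P z (drop (Suc s) w) (snd e) y)"
        using Cons.prems
        by (intro sum.cong refl) (simp add: sum_distrib_left sum_distrib_right sum.distrib algebra_simps P_single_sym[of x])
      also have "\<dots> = (\<Sum>s<length w. P z (a # take s w) x (snd e) * V z (w ! s) (drop (Suc s) w) (fst e) y
          + V z (w ! s) (rev (a # take s w)) (fst e) x * P z (drop (Suc s) w) (snd e) y)"
        using Cons.prems by (intro sum.cong refl) (simp add: P_Cons_single[of x _ a "take _ w"] V_snoc)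
      finally show ?thesis .
    qed
    show "(\<Sum>i<d. (if e = (i, x) then 1 else 0) * (\<Sum>k<n. U z a i k * P z w k y)
     + z (i, x) * (\<Sum>k<n. (if snd e = k then Q a i (fst e) else 0) * P z w k y + U z a i k * gradP w k y e z))
     = gradP (a # w) x y e z"
      using 1 2 3 unfolding gradP_def
      by (simp add: sum.distrib distrib_left sum.lessThan_Suc_shift del: sum.lessThan_Suc P.simps)
  qed
qed

lemma tempered_P: "x < n \<Longrightarrow> y < n \<Longrightarrow> tempered Ix (\<lambda>z. P z w x y)"
  using has_grad_P by (rule has_gradD)

lemma tempered_T [intro]: "tempered Ix (\<lambda>z. T z w)"
  unfolding T_def by (intro tempered_sum tempered_P) auto

lemma has_grad_V:
  assumes "i < d" "y < n"
  shows "has_grad Ix (\<lambda>z. V z a w i y) (\<lambda>e z. \<Sum>k<n. (if snd e = k then Q a i (fst e) else 0) * P z w k y + U z a i k * gradP w k y e z)"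
  unfolding V_def using assms
  by (intro has_grad_sum has_grad_mult has_grad_U has_grad_P) auto

lemma tempered_V [intro]: "i < d \<Longrightarrow> k < n \<Longrightarrow> tempered Ix (\<lambda>z. V z a w i k)"
  using has_grad_V by (rule has_gradD)

definition gradT :: "nat list \<Rightarrow> nat \<times> nat \<Rightarrow> (nat \<times> nat \<Rightarrow> real) \<Rightarrow> real" where
  "gradT w e z = (\<Sum>s<length w. V z (w ! s) (drop (Suc s) w @ take s w) (fst e) (snd e)
     + V z (w ! s) (rev (drop (Suc s) w @ take s w)) (fst e) (snd e))"

lemma has_grad_T: "has_grad Ix (\<lambda>z. T z w) (gradT w)"
proof -
  have "has_grad Ix (\<lambda>z. T z w) (\<lambda>e z. \<Sum>x<n. gradP w x x e z)"
    unfolding T_def by (intro has_grad_sum has_grad_P) auto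
  then show ?thesis
  proof (rule has_grad_cong)
    fix e :: "nat \<times> nat" and z :: "nat \<times> nat \<Rightarrow> real" assume "e \<in> Ix"
    then have e: "snd e < n" by auto
    have "(\<Sum>x<n. gradP w x x e z) = (\<Sum>s<length w. \<Sum>x<n. P z (take s w) x (snd e) * V z (w ! s) (drop (Suc s) w) (fst e) x
     + V z (w ! s) (rev (take s w)) (fst e) x * P z (drop (Suc s) w) (snd e) x)"
      unfolding gradP_def by (rule sum.swap)
    also have "\<dots> = gradT w e z"
      unfolding gradT_def using e
      by (intro sum.cong refl) (simp add: sum.distrib V_append P_rev mult_ac)
    finally show "(\<Sum>x<n. gradP w x x e z) = gradT w e z" .
  qed
qed

text \<open>Contraction of \<open>a\<close> with the letters of a second word \<open>u\<close>.\<close>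

lemma V_gradT:
  "(\<Sum>i<d. \<Sum>j<n. V z a as i j * gradT u (i, j) z) = (\<Sum>s<length u. T z (merge1 a as u s) + T z (merge2 a as u s))"
proof -
  have "(\<Sum>i<d. \<Sum>j<n. V z a as i j * gradT u (i, j) z)
     = (\<Sum>i<d. \<Sum>s<length u. \<Sum>j<n. V z a as i j * (V z (u ! s) (drop (Suc s) u @ take s u) i j
     + V z (u ! s) (rev (drop (Suc s) u @ take s u)) i j))"
    unfolding gradT_def by (simp add: sum_distrib_left sum.swap[of _ "{..<length u}" "{..<n}"])
  also have "\<dots> = (\<Sum>s<length u. \<Sum>i<d. \<Sum>j<n. V z a as i j * (V z (u ! s) (drop (Suc s) u @ take s u) i j
     + V z (u ! s) (rev (drop (Suc s) u @ take s u)) i j))"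
    by (rule sum.swap)
  also have "\<dots> = (\<Sum>s<length u. T z (merge1 a as u s) + T z (merge2 a as u s))"
    unfolding merge1_def merge2_def V_V[symmetric]
    by (intro sum.cong refl) (simp add: distrib_left sum.distrib)
  finally show ?thesis .
qed

text \<open>Contraction of \<open>a\<close> with the factor next to it gives \<open>trQ a\<close>; contraction with a later letter
  gives \<open>flip\<close> or \<open>loop\<close>, according to the orientation.\<close>

lemma divergence_V:
  "(\<Sum>i<d. \<Sum>j<n. \<Sum>k<n. (if j = k then Q a i i else 0) * P z as k j + U z a i k * gradP as k j (i, j) z)
   = trQ a * T z as + (\<Sum>s<length as. T z (flip a as s) + T z (loop a as s) * T z (drop (Suc s) as))"
proof -
  have 1: "(\<Sum>i<d. \<Sum>j<n. \<Sum>k<n. (if j = k then Q a i i else 0) * P z as k j) = trQ a * T z as"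
  proof -
    have "(\<Sum>k<n. (if j = k then Q a i i else 0) * P z as k j) = Q a i i * P z as j j" if "j < n" for i j
      using that by (simp add: if_distrib[of "\<lambda>x. x * _"] sum.delta cong: if_cong)
    then show ?thesis by (simp add: trQ_def T_def sum_product)
  qed
  have "(\<Sum>i<d. \<Sum>j<n. \<Sum>k<n. U z a i k * gradP as k j (i, j) z)
     = (\<Sum>i<d. \<Sum>j<n. \<Sum>s<length as. \<Sum>k<n. U z a i k * (P z (take s as) k j * V z (as ! s) (drop (Suc s) as) i j
     + V z (as ! s) (rev (take s as)) i k * P z (drop (Suc s) as) j j))"
    unfolding gradP_def by (simp add: sum_distrib_left sum.swap[of _ "{..<length as}" "{..<n}"])
  also have "\<dots> = (\<Sum>i<d. \<Sum>s<length as. \<Sum>j<n. \<Sum>k<n. U z a i k * (P z (take s as) k j * V z (as ! s) (drop (Suc s) as) i j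
     + V z (as ! s) (rev (take s as)) i k * P z (drop (Suc s) as) j j))"
    by (intro sum.cong refl sum.swap)
  also have "\<dots> = (\<Sum>s<length as. \<Sum>i<d. \<Sum>j<n. \<Sum>k<n. U z a i k * (P z (take s as) k j * V z (as ! s) (drop (Suc s) as) i j
     + V z (as ! s) (rev (take s as)) i k * P z (drop (Suc s) as) j j))"
    by (rule sum.swap)
  also have "\<dots> = (\<Sum>s<length as. T z (flip a as s) + T z (loop a as s) * T z (drop (Suc s) as))"
  proof (rule sum.cong[OF refl])
    fix s
    have A: "(\<Sum>i<d. \<Sum>j<n. \<Sum>k<n. U z a i k * (P z (take s as) k j * V z (as ! s) (drop (Suc s) as) i j))
       = T z (flip a as s)"
      unfolding flip_def V_V[symmetric] by (simp add: V_def[of z a "take s as"] sum_distrib_right sum_distrib_left mult_ac)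
    have "T z (loop a as s) = (\<Sum>i<d. \<Sum>k<n. U z a i k * V z (as ! s) (rev (take s as)) i k)"
      using V_V[of z a "[]" "as ! s" "rev (take s as)"] by (simp add: loop_def V_Nil)
    then have "T z (loop a as s) * T z (drop (Suc s) as)
      = (\<Sum>i<d. (\<Sum>k<n. U z a i k * V z (as ! s) (rev (take s as)) i k) * (\<Sum>j<n. P z (drop (Suc s) as) j j))"
      by (simp add: T_def[of z "drop (Suc s) as"] sum_distrib_right)
    also have "\<dots> = (\<Sum>i<d. \<Sum>j<n. \<Sum>k<n. U z a i k * (V z (as ! s) (rev (take s as)) i k * P z (drop (Suc s) as) j j))"
      by (subst sum.swap) (simp add: sum_product sum_distrib_left sum_distrib_right mult_ac)
    finally have B: "T z (loop a as s) * T z (drop (Suc s) as)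
       = (\<Sum>i<d. \<Sum>j<n. \<Sum>k<n. U z a i k * (V z (as ! s) (rev (take s as)) i k * P z (drop (Suc s) as) j j))" .
    show "(\<Sum>i<d. \<Sum>j<n. \<Sum>k<n. U z a i k * (P z (take s as) k j * V z (as ! s) (drop (Suc s) as) i j
     + V z (as ! s) (rev (take s as)) i k * P z (drop (Suc s) as) j j))
      = T z (flip a as s) + T z (loop a as s) * T z (drop (Suc s) as)"
      unfolding A[symmetric] B by (simp add: distrib_left sum.distrib)
  qed
  finally have 2: "(\<Sum>i<d. \<Sum>j<n. \<Sum>k<n. U z a i k * gradP as k j (i, j) z)
    = (\<Sum>s<length as. T z (flip a as s) + T z (loop a as s) * T z (drop (Suc s) as))" .
  show ?thesis using 1 2 by (simp add: sum.distrib)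
qed

lemma T_Cons: "T z (a # as) = (\<Sum>i<d. \<Sum>j<n. z (i, j) * V z a as i j)"
  unfolding T_def P_Cons by (rule sum.swap)

text \<open>Write \<open>T (a # as)\<close> as \<open>\<Sum>i j. z (i, j) * V a as i j\<close> and integrate by parts in every
  coordinate. The derivative falls on \<open>V\<close> (\<open>divergence_V\<close>) or on \<open>G\<close>.\<close>

theorem loop_equation:
  assumes G: "has_grad Ix G G'"
  shows "real n * E (\<lambda>z. T z (a # as) * G z) = trQ a * E (\<lambda>z. T z as * G z)
    + (\<Sum>s<length as. E (\<lambda>z. T z (flip a as s) * G z) + E (\<lambda>z. T z (loop a as s) * T z (drop (Suc s) as) * G z))
    + E (\<lambda>z. \<Sum>i<d. \<Sum>j<n. V z a as i j * G' (i, j) z)"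
proof -
  note tG = has_gradD(1)[OF G]
  let ?V' = "\<lambda>i j e z. \<Sum>k<n. (if snd e = k then Q a i (fst e) else 0) * P z as k j + U z a i k * gradP as k j e z"
  have tV': "tempered Ix (?V' i j (i, j))" if "i < d" "j < n" for i j
    using has_gradD(2)[OF has_grad_V[OF that, of a as], of "(i, j)"] that by simp
  have tGV: "tempered Ix (\<lambda>z. V z a as i j * G' (i, j) z)" if "i < d" "j < n" for i j
    using that has_gradD(2)[OF G] by auto
  have ibp: "real n * E (\<lambda>z. z (i, j) * (V z a as i j * G z))
      = E (\<lambda>z. ?V' i j (i, j) z * G z) + E (\<lambda>z. V z a as i j * G' (i, j) z)" if "i < d" "j < n" for i j
  proof -
    have g: "has_grad Ix (\<lambda>z. V z a as i j * G z) (\<lambda>e z. ?V' i j e z * G z + V z a as i j * G' e z)"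
      by (rule has_grad_mult[OF has_grad_V[OF that] G])
    have "real n * E (\<lambda>z. z (i, j) * (V z a as i j * G z)) = E (\<lambda>z. ?V' i j (i, j) z * G z + V z a as i j * G' (i, j) z)"
      unfolding E_def using that n_pos
      by (subst gauss_prod_integration_by_parts[OF _ sd_pos g, of "(i, j)"]) (auto simp: power_divide)
    also have "\<dots> = E (\<lambda>z. ?V' i j (i, j) z * G z) + E (\<lambda>z. V z a as i j * G' (i, j) z)"
      by (intro E_add tempered_mult[OF tV'[OF that] tG] tGV[OF that])
    finally show ?thesis .
  qed
  have "real n * E (\<lambda>z. T z (a # as) * G z) = real n * E (\<lambda>z. \<Sum>i<d. \<Sum>j<n. z (i, j) * (V z a as i j * G z))"
    by (simp add: T_Cons sum_distrib_right sum_distrib_left mult_ac)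
  also have "\<dots> = (\<Sum>i<d. \<Sum>j<n. real n * E (\<lambda>z. z (i, j) * (V z a as i j * G z)))"
    unfolding sum_distrib_left[symmetric] using tG
    by (subst E_sum2) (auto intro!: tempered_mult tempered_coord tempered_V)
  also have "\<dots> = (\<Sum>i<d. \<Sum>j<n. E (\<lambda>z. ?V' i j (i, j) z * G z)) + (\<Sum>i<d. \<Sum>j<n. E (\<lambda>z. V z a as i j * G' (i, j) z))"
    by (simp add: ibp sum.distrib)
  also have "(\<Sum>i<d. \<Sum>j<n. E (\<lambda>z. V z a as i j * G' (i, j) z)) = E (\<lambda>z. \<Sum>i<d. \<Sum>j<n. V z a as i j * G' (i, j) z)"
    by (rule E_sum2[symmetric]) (rule tGV)
  also have "(\<Sum>i<d. \<Sum>j<n. E (\<lambda>z. ?V' i j (i, j) z * G z)) = E (\<lambda>z. (\<Sum>i<d. \<Sum>j<n. ?V' i j (i, j) z) * G z)"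
  proof -
    have t2: "tempered Ix (\<lambda>z. ?V' i j (i, j) z * G z)" if "i < d" "j < n" for i j
      using tV'[OF that] tG by (rule tempered_mult)
    have "E (\<lambda>z. (\<Sum>i<d. \<Sum>j<n. ?V' i j (i, j) z) * G z) = E (\<lambda>z. \<Sum>i<d. \<Sum>j<n. ?V' i j (i, j) z * G z)"
      unfolding sum_distrib_right[of _ _ "G _"] ..
    also have "\<dots> = (\<Sum>i<d. \<Sum>j<n. E (\<lambda>z. ?V' i j (i, j) z * G z))"
      by (rule E_sum2) (rule t2)
    finally show ?thesis by simp
  qed
  also have "(\<lambda>z. (\<Sum>i<d. \<Sum>j<n. ?V' i j (i, j) z) * G z) = (\<lambda>z. trQ a * (T z as * G z)
     + (\<Sum>s<length as. T z (flip a as s) * G z + T z (loop a as s) * T z (drop (Suc s) as) * G z))"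
    by (simp only: fst_conv snd_conv divergence_V) (simp add: algebra_simps sum_distrib_left)
  also have "E \<dots> = trQ a * E (\<lambda>z. T z as * G z)
     + (\<Sum>s<length as. E (\<lambda>z. T z (flip a as s) * G z) + E (\<lambda>z. T z (loop a as s) * T z (drop (Suc s) as) * G z))"
  proof -
    have t: "tempered Ix (\<lambda>z. T z w * G z)" "tempered Ix (\<lambda>z. T z w * T z w' * G z)" for w w'
      by (intro tempered_mult tempered_T tG)+
    have "E (\<lambda>z. trQ a * (T z as * G z)
        + (\<Sum>s<length as. T z (flip a as s) * G z + T z (loop a as s) * T z (drop (Suc s) as) * G z))
      = E (\<lambda>z. trQ a * (T z as * G z))
        + E (\<lambda>z. \<Sum>s<length as. T z (flip a as s) * G z + T z (loop a as s) * T z (drop (Suc s) as) * G z)"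
      using t by (intro E_add tempered_sum tempered_add tempered_mult[OF tempered_const])
    also have "E (\<lambda>z. \<Sum>s<length as. T z (flip a as s) * G z + T z (loop a as s) * T z (drop (Suc s) as) * G z)
      = (\<Sum>s<length as. E (\<lambda>z. T z (flip a as s) * G z + T z (loop a as s) * T z (drop (Suc s) as) * G z))"
      using t by (intro E_sum tempered_add)
    also have "\<dots> = (\<Sum>s<length as. E (\<lambda>z. T z (flip a as s) * G z) + E (\<lambda>z. T z (loop a as s) * T z (drop (Suc s) as) * G z))"
      using t by (intro sum.cong refl E_add)
    finally show ?thesis by (simp only: E_cmult)
  qed
  finally show ?thesis .
qed

end

section \<open>Moment bounds and limits for traces of words\<close>

lemma length_flip [simp]: "s < length as \<Longrightarrow> length (flip a as s) = length as"
  by (simp add: flip_def)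

lemma length_loop [simp]: "s < length as \<Longrightarrow> length (loop a as s) = Suc s"
  by (simp add: loop_def)

lemma length_merge [simp]:
  "s < length u \<Longrightarrow> length (merge1 a as u s) = length as + length u"
  "s < length u \<Longrightarrow> length (merge2 a as u s) = length as + length u"
  by (auto simp: merge1_def merge2_def)

text \<open>Letters \<open>0\<close> stand for a factor \<open>Z\<^sup>T Z\<close> whose size is not controlled by \<open>K\<close>. They do not
  arise: contraction adds letters, and adding two positive letters produces a letter that is
  at least \<open>2\<close>. This is the source of the gain \<open>q\<^sup>2\<close> of every contraction.\<close>

definition pos_word :: "nat list \<Rightarrow> bool" where "pos_word w \<longleftrightarrow> (\<forall>a\<in>set w. a \<ge> 1)"

definition has_square :: "nat list \<Rightarrow> bool" where "has_square w \<longleftrightarrow> (\<exists>a\<in>set w. a \<ge> 2)"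

lemma pos_word_simps [simp]:
  "pos_word []" "pos_word (a # as) \<longleftrightarrow> a \<ge> 1 \<and> pos_word as"
  "pos_word (as @ bs) \<longleftrightarrow> pos_word as \<and> pos_word bs" "pos_word (rev as) \<longleftrightarrow> pos_word as"
  by (auto simp: pos_word_def)

lemma pos_word_take_drop [simp]: "pos_word as \<Longrightarrow> pos_word (take s as)" "pos_word as \<Longrightarrow> pos_word (drop s as)"
  by (auto simp: pos_word_def dest: in_set_takeD in_set_dropD)

lemma pos_word_nth: "pos_word as \<Longrightarrow> s < length as \<Longrightarrow> as ! s \<ge> 1"
  by (auto simp: pos_word_def)

lemma pos_word_contract:
  assumes "pos_word as" "a \<ge> 1"
  shows "pos_word (flip a as s)" "pos_word (loop a as s)"
    "pos_word u \<Longrightarrow> pos_word (merge1 a as u s)" "pos_word u \<Longrightarrow> pos_word (merge2 a as u s)"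
  using assms by (auto simp: flip_def loop_def merge1_def merge2_def)

lemma has_square_contract:
  assumes "pos_word as" "a \<ge> 1" "s < length as"
  shows "has_square (flip a as s)" "has_square (loop a as s)"
proof -
  have "a + as ! s \<ge> 2" using assms pos_word_nth[of as s] by simp
  then show "has_square (flip a as s)" "has_square (loop a as s)"
    unfolding has_square_def flip_def loop_def by auto
qed

lemma has_square_merge:
  assumes "pos_word u" "a \<ge> 1" "s < length u"
  shows "has_square (merge1 a as u s)" "has_square (merge2 a as u s)"
proof -
  have "a + u ! s \<ge> 2" using assms pos_word_nth[of u s] by simp
  then show "has_square (merge1 a as u s)" "has_square (merge2 a as u s)"
    unfolding has_square_def merge1_def merge2_def by auto
qed

text \<open>The loop equations for \<open>E (T w) / n\<close> with all terms of order \<open>1/n\<close> removed: \<open>flip\<close>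
  disappears and the expectation of the product over the two parts factorises.\<close>

function tau :: "(nat \<Rightarrow> real) \<Rightarrow> nat list \<Rightarrow> real" where
  "tau p [] = 1"
| "tau p (a # as) = p a * tau p as + (\<Sum>s<length as. tau p (loop a as s) * tau p (drop (Suc s) as))"
  by pat_completeness auto
termination by (relation "Wellfounded.measure (\<lambda>(p, w). length w)") auto

text \<open>Formally the derivative of the recursion for \<open>tau\<close>: by the Leibniz rule the covariance with
  \<open>T u\<close> falls on one of the two parts, and contractions with the letters of \<open>u\<close> appear as a
  source.\<close>

function limit_cov :: "(nat \<Rightarrow> real) \<Rightarrow> nat list \<Rightarrow> nat list \<Rightarrow> real" where
  "limit_cov p [] u = 0"
| "limit_cov p (a # as) u = p a * limit_cov p as u
     + (\<Sum>s<length as. tau p (loop a as s) * limit_cov p (drop (Suc s) as) u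
          + tau p (drop (Suc s) as) * limit_cov p (loop a as s) u)
     + (\<Sum>s<length u. tau p (merge1 a as u s) + tau p (merge2 a as u s))"
  by pat_completeness auto
termination by (relation "Wellfounded.measure (\<lambda>(p, w, u). length w)") auto

text \<open>Chosen to dominate \<open>C \<mapsto> C + 9 N C\<^sup>2\<close>, which is how the constants in the moment bounds grow
  when the total length of the words increases by one.\<close>

fun moment_const :: "nat \<Rightarrow> real" where
  "moment_const 0 = 1" | "moment_const (Suc N) = 20 * real (Suc N) * (moment_const N)\<^sup>2"

lemma moment_const_ge_1: "moment_const N \<ge> 1"
proof (induction N)
  case (Suc N)
  have "1 * 1 \<le> (20 * real (Suc N)) * (moment_const N)\<^sup>2"
    using Suc by (intro mult_mono) auto
  then show ?case by simp
qed simp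

lemma moment_const_Suc: "moment_const N + real N * 9 * (moment_const N)\<^sup>2 \<le> moment_const (Suc N)"
proof -
  have "moment_const N \<le> (moment_const N)\<^sup>2" using moment_const_ge_1[of N] by (simp add: self_le_power)
  moreover have "moment_const (Suc N) = 20 * (moment_const N)\<^sup>2 + 20 * (real N * (moment_const N)\<^sup>2)" by (simp add: algebra_simps)
  moreover have "0 \<le> real N * (moment_const N)\<^sup>2" "0 \<le> (moment_const N)\<^sup>2" by simp_all
  ultimately show "moment_const N + real N * 9 * (moment_const N)\<^sup>2 \<le> moment_const (Suc N)" by linarith
qed

lemma abs_sum_lessThan_le:
  fixes f :: "nat \<Rightarrow> real"
  assumes "\<And>s. s < k \<Longrightarrow> \<bar>f s\<bar> \<le> B"
  shows "\<bar>\<Sum>s<k. f s\<bar> \<le> real k * B"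
proof -
  have "\<bar>\<Sum>s<k. f s\<bar> \<le> (\<Sum>s<k. \<bar>f s\<bar>)" by (rule sum_abs)
  also have "\<dots> \<le> (\<Sum>s<k. B)" using assms by (intro sum_mono) auto
  finally show ?thesis by simp
qed

lemma abs_sum4_le:
  fixes a b c d A B :: real
  shows "\<bar>a\<bar> \<le> A \<Longrightarrow> \<bar>b\<bar> \<le> A \<Longrightarrow> \<bar>c\<bar> \<le> B \<Longrightarrow> \<bar>d\<bar> \<le> B \<Longrightarrow> \<bar>a + b + c + d\<bar> \<le> 2 * A + 2 * B"
  by linarith

lemma abs_sum6_le:
  fixes a b c d e f A B C :: real
  shows "\<bar>a\<bar> \<le> A \<Longrightarrow> \<bar>b\<bar> \<le> B \<Longrightarrow> \<bar>c\<bar> \<le> B \<Longrightarrow> \<bar>d\<bar> \<le> C \<Longrightarrow> \<bar>e\<bar> \<le> C \<Longrightarrow> \<bar>f\<bar> \<le> A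
    \<Longrightarrow> \<bar>a + b + c + d + e + f\<bar> \<le> 2 * A + 2 * B + 2 * C"
  by linarith

lemma abs_sum3_le:
  fixes a b c A B C :: real
  shows "\<bar>a\<bar> \<le> A \<Longrightarrow> \<bar>b\<bar> \<le> B \<Longrightarrow> \<bar>c\<bar> \<le> C \<Longrightarrow> \<bar>a + b + c\<bar> \<le> A + B + C"
  by linarith

lemma abs_mult_le:
  fixes a b A B :: real
  shows "\<bar>a\<bar> \<le> A \<Longrightarrow> \<bar>b\<bar> \<le> B \<Longrightarrow> \<bar>a * b\<bar> \<le> A * B"
  unfolding abs_mult by (rule mult_mono) auto

declare moment_const.simps(2) [simp del]

text \<open>Constants for the distance of \<open>E (T w) / n\<close> from \<open>tau\<close>, and below for that of the
  covariances from \<open>limit_cov\<close>; the recursions collect the errors of the terms of the loop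
  equations.\<close>

fun limit_const :: "nat \<Rightarrow> real" where
  "limit_const 0 = 1" | "limit_const (Suc N) = limit_const N + real (Suc N) * (2 * moment_const (Suc N) + 2 * moment_const (Suc N) * limit_const N)"

fun cov_const :: "nat \<Rightarrow> nat \<Rightarrow> real" where
  "cov_const L 0 = 0"
| "cov_const L (Suc N) = cov_const L N + real N * (2 + 2 * limit_const (N + L) + 2 * moment_const (N + L) * cov_const L N) + 2 * real L * (limit_const (N + L) + 1)"

text \<open>\<open>K\<close> bounds the traces of the single letters, and \<open>q\<^sup>2\<close> bounds those of the letters that are
  at least \<open>2\<close>. The condition \<open>1/n \<le> q\<close> allows a factor \<open>1/n\<close> to be exchanged for the weight
  \<open>q\<close> of a centred trace when two centred traces merge into one.\<close>

locale wishart_bounds = wishart_words +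
  fixes p :: "nat \<Rightarrow> real" and K q :: real
  assumes p_eq: "p a = trQ a / real n"
    and p1: "\<bar>p 1\<bar> \<le> K" and p2: "a \<ge> 2 \<Longrightarrow> \<bar>p a\<bar> \<le> q\<^sup>2"
    and qK: "q\<^sup>2 \<le> K" and K1: "1 \<le> K" and q_n: "1 / real n \<le> q"
begin

lemma n1: "1 / real n \<le> 1" "1 / real n > 0" using n_pos by auto

lemma q_pos: "q > 0" using n1 q_n by linarith

lemma q_le_K: "q \<le> K"
proof -
  have "q\<^sup>2 \<le> K\<^sup>2" using qK K1 self_le_power[of K 2] by simp
  then show ?thesis using K1 by (intro power2_le_imp_le[of q K]) auto
qed

lemma p_le_K: "a \<ge> 1 \<Longrightarrow> \<bar>p a\<bar> \<le> K"
  using p1 p2[of a] qK by (cases "a = 1") auto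

lemma K_pow_mono: "i \<le> j \<Longrightarrow> K ^ i \<le> K ^ j" using K1 by (rule power_increasing[rotated])

text \<open>The mean \<open>n * t w\<close> of \<open>T w\<close> grows with \<open>n\<close>, whereas the fluctuation \<open>ctr w\<close> stays of order
  \<open>q\<close>; the two are estimated separately.\<close>

definition t :: "nat list \<Rightarrow> real" where "t w = E (\<lambda>z. T z w) / real n"

definition ctr :: "nat list \<Rightarrow> (nat \<times> nat \<Rightarrow> real) \<Rightarrow> real" where "ctr w z = T z w - real n * t w"

lemma t_Nil: "t [] = 1" using n_pos by (simp add: t_def T_Nil E_const)

lemma ctr_Nil: "ctr [] z = 0" by (simp add: ctr_def t_Nil T_Nil)

lemma T_eq: "T z w = real n * t w + ctr w z" by (simp add: ctr_def)

lemma tempered_ctr [intro]: "tempered Ix (ctr w)"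
  unfolding ctr_def[abs_def] diff_conv_add_uminus by (intro tempered_add tempered_T tempered_const)

lemma E_ctr: "E (ctr w) = 0"
  unfolding ctr_def[abs_def] using n_pos
  by (subst E_diff) (auto simp: E_const t_def intro: tempered_const)

lemma has_grad_ctr: "has_grad Ix (ctr w) (gradT w)"
proof -
  have "has_grad Ix (\<lambda>z. T z w + (- real n * t w)) (\<lambda>e z. gradT w e z + 0)"
    by (intro has_grad_add has_grad_T has_grad_const)
  then show ?thesis by (simp add: ctr_def[abs_def])
qed

lemma E_T: "tempered Ix G \<Longrightarrow> E (\<lambda>z. T z w * G z) = real n * t w * E G + E (\<lambda>z. ctr w z * G z)"
proof -
  assume G: "tempered Ix G"
  have "E (\<lambda>z. T z w * G z) = E (\<lambda>z. (real n * t w) * G z + ctr w z * G z)"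
    by (simp add: T_eq distrib_right)
  also have "\<dots> = real n * t w * E G + E (\<lambda>z. ctr w z * G z)"
    using G by (subst E_add) (auto simp: E_cmult intro!: tempered_mult)
  finally show ?thesis .
qed

lemma E_T_T:
  assumes G: "tempered Ix G"
  shows "E (\<lambda>z. T z v * T z w * G z) = (real n)\<^sup>2 * t v * t w * E G
     + real n * t v * E (\<lambda>z. ctr w z * G z) + real n * t w * E (\<lambda>z. ctr v z * G z)
     + E (\<lambda>z. ctr v z * ctr w z * G z)"
proof -
  have "E (\<lambda>z. T z v * (T z w * G z)) = real n * t v * E (\<lambda>z. T z w * G z) + E (\<lambda>z. ctr v z * (T z w * G z))"
    using G by (intro E_T tempered_mult) auto
  moreover have "E (\<lambda>z. ctr v z * (T z w * G z)) = E (\<lambda>z. T z w * (ctr v z * G z))"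
    by (simp add: mult_ac)
  moreover have "\<dots> = real n * t w * E (\<lambda>z. ctr v z * G z) + E (\<lambda>z. ctr w z * (ctr v z * G z))"
    using G by (intro E_T tempered_mult) auto
  moreover have "E (\<lambda>z. ctr w z * (ctr v z * G z)) = E (\<lambda>z. ctr v z * ctr w z * G z)"
    by (simp add: mult_ac)
  ultimately show ?thesis
    using E_T[OF G, of w] by (simp add: mult.assoc algebra_simps power2_eq_square)
qed

text \<open>The loop equation with \<open>G = 1\<close>.\<close>

lemma t_Cons: "t (a # as) = p a * t as + (\<Sum>s<length as. t (flip a as s) / real n
    + t (loop a as s) * t (drop (Suc s) as) + E (\<lambda>z. ctr (loop a as s) z * ctr (drop (Suc s) as) z) / (real n)\<^sup>2)"
proof -
  have 1: "E (\<lambda>z. T z v * T z w) = (real n)\<^sup>2 * t v * t w + E (\<lambda>z. ctr v z * ctr w z)" for v w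
    using E_T_T[OF tempered_const, of v w 1] by (simp add: E_const E_ctr)
  have 2: "E (\<lambda>z. T z v) = real n * t v" for v using n_pos by (simp add: t_def)
  have "real n * E (\<lambda>z. T z (a # as)) = trQ a * E (\<lambda>z. T z as)
    + (\<Sum>s<length as. E (\<lambda>z. T z (flip a as s)) + E (\<lambda>z. T z (loop a as s) * T z (drop (Suc s) as)))"
    using loop_equation[OF has_grad_const[of Ix 1], of a as] by (simp add: E_const)
  then have "(real n)\<^sup>2 * t (a # as) = (real n)\<^sup>2 * p a * t as
    + (\<Sum>s<length as. real n * t (flip a as s) + ((real n)\<^sup>2 * t (loop a as s) * t (drop (Suc s) as)
       + E (\<lambda>z. ctr (loop a as s) z * ctr (drop (Suc s) as) z)))"
    using n_pos by (simp add: 1 2 p_eq power2_eq_square mult_ac)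
  also have "\<dots> = (real n)\<^sup>2 * (p a * t as + (\<Sum>s<length as. t (flip a as s) / real n
    + t (loop a as s) * t (drop (Suc s) as) + E (\<lambda>z. ctr (loop a as s) z * ctr (drop (Suc s) as) z) / (real n)\<^sup>2))"
    using n_pos by (simp add: distrib_left sum_distrib_left power2_eq_square mult_ac add_ac)
  finally show ?thesis using n_pos by simp
qed

text \<open>Subtract the loop equation for the means, multiplied by \<open>E G\<close>, from the loop equation with
  \<open>G\<close>. The products of means cancel.\<close>

lemma E_ctr_Cons:
  assumes G: "has_grad Ix G G'"
  shows "E (\<lambda>z. ctr (a # as) z * G z) = p a * E (\<lambda>z. ctr as z * G z)
    + (\<Sum>s<length as. E (\<lambda>z. ctr (flip a as s) z * G z) / real n
        + t (loop a as s) * E (\<lambda>z. ctr (drop (Suc s) as) z * G z)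
        + t (drop (Suc s) as) * E (\<lambda>z. ctr (loop a as s) z * G z)
        + (E (\<lambda>z. ctr (loop a as s) z * ctr (drop (Suc s) as) z * G z)
           - E (\<lambda>z. ctr (loop a as s) z * ctr (drop (Suc s) as) z) * E G) / real n)
    + E (\<lambda>z. \<Sum>i<d. \<Sum>j<n. V z a as i j * G' (i, j) z) / real n"
    (is "_ = _ + (\<Sum>s<_. ?f s) + ?M / _")
proof -
  note tG = has_gradD(1)[OF G]
  let ?c = "\<lambda>w. E (\<lambda>z. ctr w z * G z)"
  have "real n * (real n * t (a # as) * E G + ?c (a # as)) = trQ a * (real n * t as * E G + ?c as)
    + (\<Sum>s<length as. (real n * t (flip a as s) * E G + ?c (flip a as s))
       + ((real n)\<^sup>2 * t (loop a as s) * t (drop (Suc s) as) * E G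
     + real n * t (loop a as s) * ?c (drop (Suc s) as) + real n * t (drop (Suc s) as) * ?c (loop a as s)
     + E (\<lambda>z. ctr (loop a as s) z * ctr (drop (Suc s) as) z * G z))) + ?M"
    using loop_equation[OF G, of a as] by (simp add: E_T[OF tG] E_T_T[OF tG])
  also have "trQ a = real n * p a" using n_pos by (simp add: p_eq)
  also have "(\<Sum>s<length as. (real n * t (flip a as s) * E G + ?c (flip a as s))
       + ((real n)\<^sup>2 * t (loop a as s) * t (drop (Suc s) as) * E G
     + real n * t (loop a as s) * ?c (drop (Suc s) as) + real n * t (drop (Suc s) as) * ?c (loop a as s)
     + E (\<lambda>z. ctr (loop a as s) z * ctr (drop (Suc s) as) z * G z)))
    = (\<Sum>s<length as. (real n)\<^sup>2 * E G * (t (flip a as s) / real n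
       + t (loop a as s) * t (drop (Suc s) as) + E (\<lambda>z. ctr (loop a as s) z * ctr (drop (Suc s) as) z) / (real n)\<^sup>2)
       + real n * ?f s)"
    using n_pos by (intro sum.cong refl) (simp add: field_simps power2_eq_square)
  also have "\<dots> = (real n)\<^sup>2 * E G * (t (a # as) - p a * t as) + real n * (\<Sum>s<length as. ?f s)"
    unfolding t_Cons[of a as] by (simp only: sum.distrib sum_distrib_left[symmetric]) simp
  finally have "real n * ?c (a # as) = real n * (p a * ?c as + (\<Sum>s<length as. ?f s) + ?M / real n)"
    using n_pos by (simp add: algebra_simps power2_eq_square)
  then show ?thesis using n_pos by simp
qed

text \<open>Joint moments of fluctuations are indexed by lists of words; \<open>wt\<close> is their expected size.\<close>

definition X :: "nat list list \<Rightarrow> (nat \<times> nat \<Rightarrow> real) \<Rightarrow> real" where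
  "X ws z = prod_list (map (\<lambda>w. ctr w z) ws)"

definition wt :: "nat list list \<Rightarrow> real" where
  "wt ws = prod_list (map (\<lambda>w. q * K ^ (length w - 1)) ws)"

lemma X_simps [simp]: "X [] z = 1" "X (w # ws) z = ctr w z * X ws z" "X (us @ vs) z = X us z * X vs z"
  by (simp_all add: X_def)

lemma X_Cons: "X (w # ws) = (\<lambda>z. ctr w z * X ws z)"
  by (rule ext) simp

lemma wt_simps [simp]: "wt [] = 1" "wt (w # ws) = q * K ^ (length w - 1) * wt ws" "wt (us @ vs) = wt us * wt vs"
  by (simp_all add: wt_def)

lemma wt_nonneg: "wt ws \<ge> 0"
  using q_pos K1 by (induction ws) auto

lemma tempered_X [intro]: "tempered Ix (X ws)"
proof (induction ws)
  case Nil then show ?case by (simp add: X_def[abs_def] tempered_const)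
next
  case (Cons w ws)
  then have "tempered Ix (\<lambda>z. ctr w z * X ws z)" by (intro tempered_mult tempered_ctr)
  then show ?case by (simp add: X_def[abs_def])
qed

lemma has_grad_X:
  "has_grad Ix (X ws) (\<lambda>e z. \<Sum>i<length ws. gradT (ws ! i) e z * X (take i ws @ drop (Suc i) ws) z)"
proof (induction ws)
  case Nil
  then show ?case using has_grad_const[of Ix 1] by (simp add: X_def[abs_def])
next
  case (Cons w ws)
  have "has_grad Ix (\<lambda>z. ctr w z * X ws z) (\<lambda>e z. gradT w e z * X ws z + ctr w z * (\<Sum>i<length ws. gradT (ws ! i) e z * X (take i ws @ drop (Suc i) ws) z))"
    by (intro has_grad_mult has_grad_ctr Cons)
  then have "has_grad Ix (\<lambda>z. ctr w z * X ws z) (\<lambda>e z. \<Sum>i<length (w # ws). gradT ((w # ws) ! i) e z * X (take i (w # ws) @ drop (Suc i) (w # ws)) z)"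
    by (rule has_grad_cong) (simp add: sum.lessThan_Suc_shift sum_distrib_left mult_ac del: sum.lessThan_Suc)
  then show ?case by (simp add: X_def[abs_def] del: sum.lessThan_Suc)
qed

lemma E_V_gradT:
  assumes h: "tempered Ix h"
  shows "E (\<lambda>z. \<Sum>i<d. \<Sum>j<n. V z a as i j * (gradT u (i, j) z * h z)) / real n
    = (\<Sum>s<length u. (t (merge1 a as u s) + t (merge2 a as u s)) * E h
        + (E (\<lambda>z. ctr (merge1 a as u s) z * h z) + E (\<lambda>z. ctr (merge2 a as u s) z * h z)) / real n)"
proof -
  have "(\<Sum>i<d. \<Sum>j<n. V z a as i j * (gradT u (i, j) z * h z))
     = (\<Sum>s<length u. T z (merge1 a as u s) * h z + T z (merge2 a as u s) * h z)" for z
  proof -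
    have "(\<Sum>i<d. \<Sum>j<n. V z a as i j * (gradT u (i, j) z * h z)) = (\<Sum>i<d. \<Sum>j<n. V z a as i j * gradT u (i, j) z) * h z"
      by (simp add: sum_distrib_right sum_distrib_left mult_ac)
    then show ?thesis by (simp add: V_gradT sum_distrib_right distrib_right)
  qed
  then have "E (\<lambda>z. \<Sum>i<d. \<Sum>j<n. V z a as i j * (gradT u (i, j) z * h z))
    = E (\<lambda>z. \<Sum>s<length u. T z (merge1 a as u s) * h z + T z (merge2 a as u s) * h z)" by simp
  also have "\<dots> = (\<Sum>s<length u. E (\<lambda>z. T z (merge1 a as u s) * h z + T z (merge2 a as u s) * h z))"
    using h by (intro E_sum tempered_add tempered_mult tempered_T)
  also have "\<dots> = (\<Sum>s<length u. E (\<lambda>z. T z (merge1 a as u s) * h z) + E (\<lambda>z. T z (merge2 a as u s) * h z))"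
    using h by (intro sum.cong refl E_add tempered_add tempered_mult tempered_T)
  also have "\<dots> = (\<Sum>s<length u. real n * (t (merge1 a as u s) + t (merge2 a as u s)) * E h
        + (E (\<lambda>z. ctr (merge1 a as u s) z * h z) + E (\<lambda>z. ctr (merge2 a as u s) z * h z)))"
    by (simp only: E_T[OF h]) (simp add: algebra_simps)
  finally show ?thesis
    using n_pos by (simp add: sum_divide_distrib add_divide_distrib)
qed

lemma E_V_gradX:
  "E (\<lambda>z. \<Sum>i<d. \<Sum>j<n. V z a as i j * (\<Sum>k<length ws. gradT (ws ! k) (i, j) z * X (take k ws @ drop (Suc k) ws) z)) / real n
   = (\<Sum>k<length ws. \<Sum>s<length (ws ! k). (t (merge1 a as (ws ! k) s) + t (merge2 a as (ws ! k) s)) * E (X (take k ws @ drop (Suc k) ws))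
        + (E (X (merge1 a as (ws ! k) s # take k ws @ drop (Suc k) ws))
           + E (X (merge2 a as (ws ! k) s # take k ws @ drop (Suc k) ws))) / real n)"
proof -
  let ?R = "\<lambda>k. X (take k ws @ drop (Suc k) ws)"
  have tm: "tempered Ix (\<lambda>z. \<Sum>i<d. \<Sum>j<n. V z a as i j * (gradT (ws ! k) (i, j) z * ?R k z))" for k
    using has_gradD(2)[OF has_grad_T] by (intro tempered_sum tempered_mult tempered_V tempered_X) auto
  have sw: "(\<Sum>i<d. \<Sum>j<n. V z a as i j * (\<Sum>k<length ws. gradT (ws ! k) (i, j) z * ?R k z))
     = (\<Sum>k<length ws. \<Sum>i<d. \<Sum>j<n. V z a as i j * (gradT (ws ! k) (i, j) z * ?R k z))" for z
  proof -
    have "(\<Sum>i<d. \<Sum>j<n. V z a as i j * (\<Sum>k<length ws. gradT (ws ! k) (i, j) z * ?R k z))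
       = (\<Sum>i<d. \<Sum>k<length ws. \<Sum>j<n. V z a as i j * (gradT (ws ! k) (i, j) z * ?R k z))"
      unfolding sum_distrib_left by (intro sum.cong refl sum.swap)
    also have "\<dots> = (\<Sum>k<length ws. \<Sum>i<d. \<Sum>j<n. V z a as i j * (gradT (ws ! k) (i, j) z * ?R k z))"
      by (rule sum.swap)
    finally show ?thesis .
  qed
  have "E (\<lambda>z. \<Sum>i<d. \<Sum>j<n. V z a as i j * (\<Sum>k<length ws. gradT (ws ! k) (i, j) z * ?R k z))
     = (\<Sum>k<length ws. E (\<lambda>z. \<Sum>i<d. \<Sum>j<n. V z a as i j * (gradT (ws ! k) (i, j) z * ?R k z)))"
    unfolding sw using tm by (intro E_sum)
  then show ?thesis
    by (simp only: sum_divide_distrib E_V_gradT[OF tempered_X] X_Cons)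
qed

text \<open>The two bounds that are proved simultaneously by induction on the total length \<open>N\<close>, since
  the recursion for means contains covariances and vice versa. The additional estimate for
  words with a letter that is at least \<open>2\<close> carries the gain \<open>q\<^sup>2\<close>.\<close>

definition t_bounded :: "real \<Rightarrow> nat \<Rightarrow> bool" where
  "t_bounded C N \<longleftrightarrow> (\<forall>w. length w \<le> N \<longrightarrow> pos_word w \<longrightarrow> \<bar>t w\<bar> \<le> C * K ^ length w
     \<and> (has_square w \<longrightarrow> \<bar>t w\<bar> \<le> C * q\<^sup>2 * K ^ (length w - 1)))"

definition X_bounded :: "real \<Rightarrow> nat \<Rightarrow> bool" where
  "X_bounded C N \<longleftrightarrow> (\<forall>ws. sum_list (map length ws) \<le> N \<longrightarrow> (\<forall>w\<in>set ws. pos_word w) \<longrightarrow> \<bar>E (X ws)\<bar> \<le> C * wt ws)"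

lemma t_bound: "t_bounded C N \<Longrightarrow> length w \<le> m \<Longrightarrow> length w \<le> N \<Longrightarrow> pos_word w \<Longrightarrow> C \<ge> 0 \<Longrightarrow> \<bar>t w\<bar> \<le> C * K ^ m"
  unfolding t_bounded_def by (meson K_pow_mono mult_left_mono order_trans)

lemma t_bound_square:
  "t_bounded C N \<Longrightarrow> length w \<le> Suc m \<Longrightarrow> length w \<le> N \<Longrightarrow> pos_word w \<Longrightarrow> has_square w \<Longrightarrow> C \<ge> 0 \<Longrightarrow> \<bar>t w\<bar> \<le> C * q\<^sup>2 * K ^ m"
proof -
  assume a: "t_bounded C N" "length w \<le> Suc m" "length w \<le> N" "pos_word w" "has_square w" "C \<ge> 0"
  then have "\<bar>t w\<bar> \<le> C * q\<^sup>2 * K ^ (length w - 1)" unfolding t_bounded_def by blast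
  also have "\<dots> \<le> C * q\<^sup>2 * K ^ m" using a by (intro mult_left_mono K_pow_mono) auto
  finally show ?thesis .
qed

lemma X_bound_Cons:
  assumes X: "X_bounded C N" and "length w \<le> Suc m" and "length w + sum_list (map length ws) \<le> N"
    and "pos_word w" "\<forall>w\<in>set ws. pos_word w" "C \<ge> 0"
  shows "\<bar>E (X (w # ws))\<bar> \<le> C * (q * K ^ m * wt ws)"
proof -
  have "\<bar>E (X (w # ws))\<bar> \<le> C * wt (w # ws)"
    using assms by (intro X[unfolded X_bounded_def, rule_format]) auto
  also have "\<dots> \<le> C * (q * K ^ m * wt ws)"
    using assms q_pos K1 by (auto intro!: mult_left_mono mult_right_mono K_pow_mono wt_nonneg)
  finally show ?thesis .
qed

lemma E_X_Nil: "E (X ([] # ws)) = 0" "E (X (w # [] # ws)) = 0"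
  by (simp_all add: X_def[abs_def] ctr_Nil E_const)

lemma E_X_pair_bound:
  assumes X: "X_bounded C N" and s: "s < length as" and l: "length as + sum_list (map length ws) \<le> N"
    and "pos_word as" "a \<ge> 1" "\<forall>w\<in>set ws. pos_word w" "C \<ge> 0"
  shows "\<bar>E (X (loop a as s # drop (Suc s) as # ws))\<bar> \<le> C * (q\<^sup>2 * K ^ (length as - 2) * wt ws)"
proof (cases "drop (Suc s) as = []")
  case True
  then show ?thesis using assms wt_nonneg[of ws] K1 by (simp add: E_X_Nil)
next
  case False
  then have l2: "length (drop (Suc s) as) \<le> Suc (length as - s - 2)" "s + 2 \<le> length as" using s by auto
  have "\<bar>E (X (loop a as s # drop (Suc s) as # ws))\<bar> \<le> C * (q * K ^ s * wt (drop (Suc s) as # ws))"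
    using assms by (intro X_bound_Cons[OF X]) (auto simp: pos_word_contract)
  also have "wt (drop (Suc s) as # ws) = q * K ^ (length as - s - 2) * wt ws"
    using l2 by simp
  also have "C * (q * K ^ s * (q * K ^ (length as - s - 2) * wt ws)) = C * (q\<^sup>2 * K ^ (s + (length as - s - 2)) * wt ws)"
    by (simp add: power2_eq_square power_add)
  also have "s + (length as - s - 2) = length as - 2" using l2 by simp
  finally show ?thesis .
qed

lemma q2_K_pow: "k \<ge> 1 \<Longrightarrow> q\<^sup>2 * K ^ (k - 1) \<le> K ^ k"
proof -
  assume "k \<ge> 1"
  then have "K ^ k = K * K ^ (k - 1)" by (cases k) auto
  then show ?thesis using qK K1 by (auto intro!: mult_right_mono)
qed

lemma t_step_summand:
  assumes tb: "t_bounded C N" and X: "X_bounded C N" and C: "C \<ge> 1"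
    and s: "s < length as" and l: "length as \<le> N" and pw: "pos_word as" "a \<ge> 1"
  shows "\<bar>t (flip a as s) / real n + t (loop a as s) * t (drop (Suc s) as)
    + E (\<lambda>z. ctr (loop a as s) z * ctr (drop (Suc s) as) z) / (real n)\<^sup>2\<bar> \<le> 3 * C\<^sup>2 * q\<^sup>2 * K ^ (length as - 1)"
proof -
  let ?k = "length as" let ?B = "C\<^sup>2 * q\<^sup>2 * K ^ (?k - 1)"
  have CC: "C \<le> C\<^sup>2" using C by (simp add: self_le_power)
  then have B: "C * q\<^sup>2 * K ^ (?k - 1) \<le> ?B" using K1 by (intro mult_right_mono) auto
  have n2: "1 / (real n)\<^sup>2 \<le> 1" using n_pos by simp
  have "\<bar>t (flip a as s)\<bar> \<le> C * q\<^sup>2 * K ^ (?k - 1)"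
    using s l pw C by (intro t_bound_square[OF tb]) (auto simp: pos_word_contract has_square_contract)
  then have 1: "\<bar>t (flip a as s) / real n\<bar> \<le> ?B"
    using B abs_mult_le[of "t (flip a as s)" _ "1 / real n" 1] n1 by fastforce
  have "\<bar>t (loop a as s) * t (drop (Suc s) as)\<bar> \<le> (C * q\<^sup>2 * K ^ s) * (C * K ^ (?k - Suc s))"
    using s l pw C
    by (intro abs_mult_le t_bound_square[OF tb] t_bound[OF tb]) (auto simp: pos_word_contract has_square_contract)
  also have "\<dots> = C\<^sup>2 * q\<^sup>2 * (K ^ s * K ^ (?k - Suc s))" by (simp add: power2_eq_square)
  also have "K ^ s * K ^ (?k - Suc s) = K ^ (?k - 1)" using s by (simp add: power_add[symmetric])
  finally have 2: "\<bar>t (loop a as s) * t (drop (Suc s) as)\<bar> \<le> ?B" .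
  have "\<bar>E (X [loop a as s, drop (Suc s) as])\<bar> \<le> C * (q\<^sup>2 * K ^ (?k - 2) * wt [])"
    using s l pw C by (intro E_X_pair_bound[OF X]) auto
  also have "\<dots> \<le> C * q\<^sup>2 * K ^ (?k - 1)"
    using C by (auto intro!: mult_left_mono K_pow_mono)
  finally have 3: "\<bar>E (\<lambda>z. ctr (loop a as s) z * ctr (drop (Suc s) as) z) / (real n)\<^sup>2\<bar> \<le> ?B"
    using B abs_mult_le[of "E (X [loop a as s, drop (Suc s) as])" _ "1 / (real n)\<^sup>2" 1] n2
    by (fastforce simp: X_def[abs_def])
  show ?thesis using 1 2 3 by linarith
qed

text \<open>The constant \<open>9\<close> comes from \<open>X_step\<close>, since means and fluctuations share one sequence of
  constants; the sum in the recursion for the means contributes \<open>3 N C\<^sup>2\<close>.\<close>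

lemma t_step:
  assumes tb: "t_bounded C N" and X: "X_bounded C N" and C: "C \<ge> 1"
  shows "t_bounded (C + real N * 9 * C\<^sup>2) (Suc N)"
  unfolding t_bounded_def
proof (intro allI impI)
  fix w assume l: "length w \<le> Suc N" and pw: "pos_word w"
  let ?C = "C + real N * 9 * C\<^sup>2"
  have C_le: "C \<le> ?C" by simp
  show "\<bar>t w\<bar> \<le> ?C * K ^ length w \<and> (has_square w \<longrightarrow> \<bar>t w\<bar> \<le> ?C * q\<^sup>2 * K ^ (length w - 1))"
  proof (cases w)
    case Nil
    then show ?thesis using C by (simp add: t_Nil has_square_def add_increasing2)
  next
    case (Cons a as)
    let ?k = "length as"
    have k: "?k \<le> N" and pw': "a \<ge> 1" "pos_word as" using l pw Cons by auto
    let ?S = "\<Sum>s<?k. t (flip a as s) / real n + t (loop a as s) * t (drop (Suc s) as)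
      + E (\<lambda>z. ctr (loop a as s) z * ctr (drop (Suc s) as) z) / (real n)\<^sup>2"
    have tw: "t w = p a * t as + ?S" unfolding Cons by (rule t_Cons)
    have "\<bar>?S\<bar> \<le> real ?k * (3 * C\<^sup>2 * q\<^sup>2 * K ^ (?k - 1))"
      by (intro abs_sum_lessThan_le t_step_summand[OF tb X C _ k pw'(2,1)])
    also have "\<dots> \<le> real N * 9 * C\<^sup>2 * (if ?k = 0 then 0 else q\<^sup>2 * K ^ (?k - 1))"
    proof (cases "?k = 0")
      case False
      have "(real ?k * 3) * (C\<^sup>2 * (q\<^sup>2 * K ^ (?k - 1))) \<le> (real N * 9) * (C\<^sup>2 * (q\<^sup>2 * K ^ (?k - 1)))"
        using k K1 by (intro mult_right_mono) auto
      then show ?thesis using False by (simp add: mult.assoc)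
    qed simp
    finally have S: "\<bar>?S\<bar> \<le> real N * 9 * C\<^sup>2 * (if ?k = 0 then 0 else q\<^sup>2 * K ^ (?k - 1))" .
    have t_as: "\<bar>t as\<bar> \<le> C * K ^ ?k" using k pw' C by (intro t_bound[OF tb]) auto
    have 1: "\<bar>t w\<bar> \<le> ?C * K ^ length w"
    proof -
      have "\<bar>p a * t as\<bar> \<le> K * (C * K ^ ?k)" by (intro abs_mult_le p_le_K pw' t_as)
      also have "\<dots> = C * K ^ Suc ?k" by simp
      finally have "\<bar>p a * t as\<bar> \<le> C * K ^ Suc ?k" .
      moreover have "(if ?k = 0 then 0 else q\<^sup>2 * K ^ (?k - 1)) \<le> K ^ ?k"
        using q2_K_pow[of ?k] by (auto simp: Suc_le_eq)
      then have "(if ?k = 0 then 0 else q\<^sup>2 * K ^ (?k - 1)) \<le> K ^ Suc ?k"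
        using K_pow_mono[of ?k "Suc ?k"] by linarith
      then have "real N * 9 * C\<^sup>2 * (if ?k = 0 then 0 else q\<^sup>2 * K ^ (?k - 1)) \<le> real N * 9 * C\<^sup>2 * K ^ Suc ?k"
        by (intro mult_left_mono) auto
      ultimately have "\<bar>t w\<bar> \<le> C * K ^ Suc ?k + real N * 9 * C\<^sup>2 * K ^ Suc ?k" using S tw by linarith
      also have "\<dots> = ?C * K ^ length w" by (simp add: Cons distrib_right)
      finally show ?thesis .
    qed
    have 2: "\<bar>t w\<bar> \<le> ?C * q\<^sup>2 * K ^ (length w - 1)" if sq: "has_square w"
    proof -
      have "\<bar>p a * t as\<bar> \<le> C * q\<^sup>2 * K ^ ?k"
      proof (cases "a \<ge> 2")
        case True
        then have "\<bar>p a * t as\<bar> \<le> q\<^sup>2 * (C * K ^ ?k)" by (intro abs_mult_le p2 t_as)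
        then show ?thesis by (simp add: mult_ac)
      next
        case False
        then have sq': "has_square as" using sq Cons by (auto simp: has_square_def)
        then have k0: "?k \<ge> 1" by (cases as) (auto simp: has_square_def)
        have "\<bar>p a * t as\<bar> \<le> K * (C * q\<^sup>2 * K ^ (?k - 1))"
          using k pw' C sq' k0 by (intro abs_mult_le p_le_K t_bound_square[OF tb]) auto
        then show ?thesis using k0 by (cases as) (auto simp: mult_ac)
      qed
      moreover have "real N * 9 * C\<^sup>2 * (if ?k = 0 then 0 else q\<^sup>2 * K ^ (?k - 1)) \<le> real N * 9 * C\<^sup>2 * (q\<^sup>2 * K ^ ?k)"
        using K1 by (intro mult_left_mono) (auto intro!: mult_left_mono K_pow_mono)
      ultimately have "\<bar>t w\<bar> \<le> C * q\<^sup>2 * K ^ ?k + real N * 9 * C\<^sup>2 * (q\<^sup>2 * K ^ ?k)" using S tw by linarith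
      also have "\<dots> = ?C * q\<^sup>2 * K ^ (length w - 1)" by (simp add: Cons algebra_simps)
      finally show ?thesis .
    qed
    show ?thesis using 1 2 by blast
  qed
qed

text \<open>Each of the five products is at most \<open>C\<^sup>2\<close> times the weight. The pairs of centred traces
  have an additional \<open>q \<le> K\<close>, and an empty remainder \<open>drop (Suc s) as\<close> has to be treated
  separately because the truncated exponent in the weight of an empty word is off by one.\<close>

lemma E_ctr_Cons_summand:
  assumes tb: "t_bounded C N" and X: "X_bounded C N" and C: "C \<ge> 1"
    and s: "s < length as" and l: "length as + sum_list (map length ws) \<le> N"
    and pw: "pos_word as" "a \<ge> 1" "\<forall>w\<in>set ws. pos_word w"
  shows "\<bar>E (\<lambda>z. ctr (flip a as s) z * X ws z) / real n
        + t (loop a as s) * E (\<lambda>z. ctr (drop (Suc s) as) z * X ws z)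
        + t (drop (Suc s) as) * E (\<lambda>z. ctr (loop a as s) z * X ws z)
        + (E (\<lambda>z. ctr (loop a as s) z * ctr (drop (Suc s) as) z * X ws z)
           - E (\<lambda>z. ctr (loop a as s) z * ctr (drop (Suc s) as) z) * E (X ws)) / real n\<bar>
     \<le> 5 * C\<^sup>2 * (q * K ^ length as * wt ws)"
proof -
  let ?k = "length as" let ?W = "q * K ^ length as * wt ws"
  have k0: "?k \<ge> 1" using s by simp
  have C0: "C \<ge> 0" using C by simp
  have CC: "C \<le> C\<^sup>2" using C by (simp add: self_le_power)
  have W0: "?W \<ge> 0" using q_pos K1 wt_nonneg by simp
  have CW: "C * ?W \<le> C\<^sup>2 * ?W" using CC W0 by (rule mult_right_mono)
  have qq: "q\<^sup>2 * K ^ (?k - 2) \<le> q * K ^ ?k"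
  proof -
    have "q\<^sup>2 * K ^ (?k - 2) \<le> q * (K * K ^ (?k - 1))"
      unfolding power2_eq_square mult.assoc using q_pos q_le_K K1
      by (intro mult_left_mono mult_mono K_pow_mono) auto
    then show ?thesis using k0 by (cases as) auto
  qed
  have n1': "\<bar>1 / real n\<bar> \<le> 1" using n1 by simp
  have "\<bar>E (X (flip a as s # ws))\<bar> \<le> C * (q * K ^ ?k * wt ws)"
    using s l pw C by (intro X_bound_Cons[OF X]) (auto simp: pos_word_contract)
  from abs_mult_le[OF this n1'] CW
  have 1: "\<bar>E (\<lambda>z. ctr (flip a as s) z * X ws z) / real n\<bar> \<le> C\<^sup>2 * ?W" by (simp add: X_Cons)
  have 2: "\<bar>t (loop a as s) * E (\<lambda>z. ctr (drop (Suc s) as) z * X ws z)\<bar> \<le> C\<^sup>2 * ?W"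
  proof (cases "drop (Suc s) as = []")
    case True
    then have "E (\<lambda>z. ctr (drop (Suc s) as) z * X ws z) = 0" by (simp add: ctr_Nil E_const)
    then show ?thesis using W0 by simp
  next
    case False
    then have s2: "s + 2 \<le> ?k" by auto
    have "\<bar>t (loop a as s) * E (X (drop (Suc s) as # ws))\<bar> \<le> (C * q\<^sup>2 * K ^ s) * (C * (q * K ^ (?k - s - 2) * wt ws))"
      using s s2 l pw C
      by (intro abs_mult_le t_bound_square[OF tb] X_bound_Cons[OF X]) (auto simp: pos_word_contract has_square_contract)
    also have "\<dots> = C\<^sup>2 * (q * (q\<^sup>2 * (K ^ s * K ^ (?k - s - 2))) * wt ws)" by (simp add: power2_eq_square)
    also have "K ^ s * K ^ (?k - s - 2) = K ^ (?k - 2)" using s2 by (simp add: power_add[symmetric])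
    also have "q\<^sup>2 * K ^ (?k - 2) \<le> q\<^sup>2 * K ^ (?k - 1)" by (intro mult_left_mono K_pow_mono) auto
    also have "\<dots> \<le> K ^ ?k" by (rule q2_K_pow[OF k0])
    finally show ?thesis using C0 q_pos wt_nonneg by (simp add: X_Cons mult_left_mono mult_right_mono)
  qed
  have "\<bar>t (drop (Suc s) as) * E (X (loop a as s # ws))\<bar> \<le> (C * K ^ (?k - Suc s)) * (C * (q * K ^ s * wt ws))"
    using s l pw C
    by (intro abs_mult_le t_bound[OF tb] X_bound_Cons[OF X]) (auto simp: pos_word_contract)
  also have "\<dots> = C\<^sup>2 * (q * (K ^ (?k - Suc s) * K ^ s) * wt ws)" by (simp add: power2_eq_square)
  also have "K ^ (?k - Suc s) * K ^ s = K ^ (?k - 1)" using s by (simp add: power_add[symmetric])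
  also have "\<dots> \<le> K ^ ?k" by (rule K_pow_mono) simp
  finally have 3: "\<bar>t (drop (Suc s) as) * E (\<lambda>z. ctr (loop a as s) z * X ws z)\<bar> \<le> C\<^sup>2 * ?W"
    using C0 q_pos wt_nonneg by (simp add: X_Cons mult_left_mono mult_right_mono)
  have "\<bar>E (X (loop a as s # drop (Suc s) as # ws))\<bar> \<le> C * (q\<^sup>2 * K ^ (?k - 2) * wt ws)"
    using s l pw C by (intro E_X_pair_bound[OF X]) auto
  also have "\<dots> \<le> C * ?W" using qq C wt_nonneg by (intro mult_left_mono mult_right_mono) auto
  finally have 4: "\<bar>E (\<lambda>z. ctr (loop a as s) z * ctr (drop (Suc s) as) z * X ws z)\<bar> \<le> C\<^sup>2 * ?W"
    using CW by (simp add: X_Cons mult.assoc)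
  have "\<bar>E (X [loop a as s, drop (Suc s) as]) * E (X ws)\<bar> \<le> (C * (q\<^sup>2 * K ^ (?k - 2) * wt [])) * (C * wt ws)"
    using s l pw C by (intro abs_mult_le E_X_pair_bound[OF X] X[unfolded X_bounded_def, rule_format]) auto
  also have "\<dots> = C\<^sup>2 * ((q\<^sup>2 * K ^ (?k - 2)) * wt ws)" by (simp add: power2_eq_square)
  also have "\<dots> \<le> C\<^sup>2 * ?W" using qq C wt_nonneg by (intro mult_left_mono mult_right_mono) auto
  finally have 5: "\<bar>E (\<lambda>z. ctr (loop a as s) z * ctr (drop (Suc s) as) z) * E (X ws)\<bar> \<le> C\<^sup>2 * ?W"
    by (simp add: X_def[abs_def])
  let ?d = "E (\<lambda>z. ctr (loop a as s) z * ctr (drop (Suc s) as) z * X ws z)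
           - E (\<lambda>z. ctr (loop a as s) z * ctr (drop (Suc s) as) z) * E (X ws)"
  have "\<bar>?d\<bar> \<le> 2 * (C\<^sup>2 * ?W)" using 4 5 by linarith
  from abs_mult_le[OF this n1'] have 6: "\<bar>?d / real n\<bar> \<le> 2 * (C\<^sup>2 * ?W)" by simp
  show ?thesis using 1 2 3 6 by linarith
qed

text \<open>Apply the recursion to the first word, with the product of the other fluctuations as test
  function. A letter of the own word costs \<open>5 C\<^sup>2\<close> and a letter of another word \<open>4 C\<^sup>2\<close> times
  the weight, whence the constant \<open>9\<close>.\<close>

lemma X_step:
  assumes tb: "t_bounded C N" and X: "X_bounded C N" and C: "C \<ge> 1"
  shows "X_bounded (C + real N * 9 * C\<^sup>2) (Suc N)"
  unfolding X_bounded_def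
proof (intro allI impI)
  fix ws0 assume l: "sum_list (map length ws0) \<le> Suc N" and pw: "\<forall>w\<in>set ws0. pos_word w"
  let ?C = "C + real N * 9 * C\<^sup>2"
  have C0: "C \<ge> 0" using C by simp
  have CC: "C \<le> C\<^sup>2" using C by (simp add: self_le_power)
  show "\<bar>E (X ws0)\<bar> \<le> ?C * wt ws0"
  proof (cases ws0)
    case Nil
    then show ?thesis using C by (simp add: X_def[abs_def] E_const add_increasing2)
  next
    case (Cons w ws)
    show ?thesis
    proof (cases w)
      case Nil
      then show ?thesis using Cons C wt_nonneg[of ws0] by (simp add: E_X_Nil del: wt_simps)
    next
      case w: (Cons a as)
      let ?k = "length as" let ?L = "sum_list (map length ws)" let ?W = "q * K ^ ?k * wt ws"
      have kL: "?k + ?L \<le> N" using l Cons w by simp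
      have pa: "a \<ge> 1" "pos_word as" "\<forall>w\<in>set ws. pos_word w" using pw Cons w by auto
      have W0: "?W \<ge> 0" using q_pos K1 wt_nonneg by simp
      let ?R = "\<lambda>k. take k ws @ drop (Suc k) ws"
      let ?S = "\<Sum>s<?k. E (\<lambda>z. ctr (flip a as s) z * X ws z) / real n
        + t (loop a as s) * E (\<lambda>z. ctr (drop (Suc s) as) z * X ws z)
        + t (drop (Suc s) as) * E (\<lambda>z. ctr (loop a as s) z * X ws z)
        + (E (\<lambda>z. ctr (loop a as s) z * ctr (drop (Suc s) as) z * X ws z)
           - E (\<lambda>z. ctr (loop a as s) z * ctr (drop (Suc s) as) z) * E (X ws)) / real n"
      let ?m = "\<lambda>k s. (t (merge1 a as (ws ! k) s) + t (merge2 a as (ws ! k) s)) * E (X (?R k))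
        + (E (X (merge1 a as (ws ! k) s # ?R k)) + E (X (merge2 a as (ws ! k) s # ?R k))) / real n"
      let ?M = "\<Sum>k<length ws. \<Sum>s<length (ws ! k). ?m k s"
      have eq: "E (X ws0) = p a * E (X (as # ws)) + ?S + ?M"
        unfolding Cons w X_Cons[of "a # as"] X_Cons[of as]
        using E_ctr_Cons[OF has_grad_X, of a as ws, unfolded E_V_gradX] .
      have A: "\<bar>p a * E (X (as # ws))\<bar> \<le> C * ?W"
      proof (cases as)
        case Nil
        then show ?thesis using C0 W0 by (simp add: E_X_Nil)
      next
        case (Cons b bs)
        have "\<bar>p a * E (X (as # ws))\<bar> \<le> K * (C * (q * K ^ (?k - 1) * wt ws))"
          using kL pa C Cons by (intro abs_mult_le p_le_K X_bound_Cons[OF X]) auto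
        then show ?thesis using Cons by (simp add: mult_ac)
      qed
      have B: "\<bar>?S\<bar> \<le> real ?k * (5 * C\<^sup>2 * ?W)"
        by (intro abs_sum_lessThan_le E_ctr_Cons_summand[OF tb X C _ kL pa(2,1,3)])
      have m: "\<bar>?m k s\<bar> \<le> 4 * C\<^sup>2 * ?W" if k: "k < length ws" and s: "s < length (ws ! k)" for k s
      proof -
        let ?u = "ws ! k"
        have ws: "ws = take k ws @ ?u # drop (Suc k) ws" using k by (rule id_take_nth_drop)
        have L: "?L = length ?u + sum_list (map length (?R k))" by (subst ws) simp
        have wt: "wt ws = q * K ^ (length ?u - 1) * wt (?R k)" by (subst ws) (simp only: wt_simps mult_ac)
        have pu: "pos_word ?u" using pa(3) k by simp
        have pR: "\<forall>w\<in>set (?R k). pos_word w" using pa(3) by (auto dest: in_set_takeD in_set_dropD)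
        have u0: "length ?u \<ge> 1" using s by simp
        have Kp: "K ^ (?k + length ?u - 1) = K ^ ?k * K ^ (length ?u - 1)"
          using u0 by (simp add: power_add[symmetric])
        \<comment> \<open>the mean of the merged word: the two centred traces that disappear have weight
          \<open>q\<^sup>2\<close>, which the new letter provides\<close>
        have t_m: "\<bar>t w * E (X (?R k))\<bar> \<le> C\<^sup>2 * ?W" if w: "w = merge1 a as ?u s \<or> w = merge2 a as ?u s" for w
        proof -
          have "\<bar>t w * E (X (?R k))\<bar> \<le> (C * q\<^sup>2 * K ^ (?k + length ?u - 1)) * (C * wt (?R k))"
            using w s kL L pa pu pR C u0
            by (intro abs_mult_le t_bound_square[OF tb] X[unfolded X_bounded_def, rule_format])
              (auto simp: pos_word_contract has_square_merge)
          then show ?thesis unfolding Kp wt by (simp add: power2_eq_square mult_ac)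
        qed
        \<comment> \<open>the fluctuation of the merged word: one factor \<open>q\<close> is lost and recovered from
          \<open>1/n \<le> q\<close>\<close>
        have x_m: "\<bar>E (X (w # ?R k)) / real n\<bar> \<le> C\<^sup>2 * ?W" if w: "w = merge1 a as ?u s \<or> w = merge2 a as ?u s" for w
        proof -
          have "\<bar>E (X (w # ?R k))\<bar> \<le> C * (q * K ^ (?k + length ?u - 1) * wt (?R k))"
            using w s kL L pa pu pR C u0
            by (intro X_bound_Cons[OF X]) (auto simp: pos_word_contract)
          moreover have "\<bar>1 / real n\<bar> \<le> q" using q_n n1 by simp
          ultimately have "\<bar>E (X (w # ?R k)) * (1 / real n)\<bar> \<le> C * (q * K ^ (?k + length ?u - 1) * wt (?R k)) * q"
            by (rule abs_mult_le)
          then have "\<bar>E (X (w # ?R k)) / real n\<bar> \<le> C * ?W" unfolding Kp wt by (simp add: mult_ac)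
          also have "\<dots> \<le> C\<^sup>2 * ?W" using CC W0 by (rule mult_right_mono)
          finally show ?thesis .
        qed
        show ?thesis
          using t_m[OF disjI1[OF refl]] t_m[OF disjI2[OF refl]] x_m[OF disjI1[OF refl]] x_m[OF disjI2[OF refl]]
          by (simp only: distrib_right add_divide_distrib)
      qed
      have M: "\<bar>?M\<bar> \<le> real ?L * (4 * C\<^sup>2 * ?W)"
      proof -
        have "\<bar>?M\<bar> \<le> (\<Sum>k<length ws. \<bar>\<Sum>s<length (ws ! k). ?m k s\<bar>)" by (rule sum_abs)
        also have "\<dots> \<le> (\<Sum>k<length ws. real (length (ws ! k)) * (4 * C\<^sup>2 * ?W))"
          by (intro sum_mono abs_sum_lessThan_le m) auto
        also have "\<dots> = real (\<Sum>k<length ws. length (ws ! k)) * (4 * C\<^sup>2 * ?W)"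
          by (simp add: sum_distrib_right)
        also have "(\<Sum>k<length ws. length (ws ! k)) = ?L"
          by (simp add: sum_list_sum_nth atLeast0LessThan)
        finally show ?thesis .
      qed
      have "real ?k * (5 * C\<^sup>2 * ?W) \<le> real ?k * (9 * C\<^sup>2 * ?W)" "real ?L * (4 * C\<^sup>2 * ?W) \<le> real ?L * (9 * C\<^sup>2 * ?W)"
        using W0 by (intro mult_left_mono mult_right_mono; simp)+
      then have "\<bar>E (X ws0)\<bar> \<le> C * ?W + (real ?k * (9 * C\<^sup>2 * ?W) + real ?L * (9 * C\<^sup>2 * ?W))"
        using A B M unfolding eq by linarith
      also have "\<dots> = C * ?W + real (?k + ?L) * (9 * C\<^sup>2 * ?W)" by (simp only: of_nat_add distrib_right)
      also have "\<dots> \<le> C * ?W + real N * (9 * C\<^sup>2 * ?W)"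
        using kL W0 by (intro add_left_mono mult_right_mono) auto
      also have "\<dots> = ?C * wt ws0" unfolding Cons w by (simp add: algebra_simps)
      finally show ?thesis .
    qed
  qed
qed

lemma bounded_mono: "t_bounded C N \<Longrightarrow> C \<le> C' \<Longrightarrow> t_bounded C' N" "X_bounded C N \<Longrightarrow> C \<le> C' \<Longrightarrow> X_bounded C' N"
proof -
  assume t: "t_bounded C N" and C: "C \<le> C'"
  have "C * K ^ m \<le> C' * K ^ m" "C * q\<^sup>2 * K ^ m \<le> C' * q\<^sup>2 * K ^ m" for m
    using C K1 by (auto intro!: mult_right_mono)
  then show "t_bounded C' N" using t unfolding t_bounded_def by (meson order_trans)
next
  assume X: "X_bounded C N" and C: "C \<le> C'"
  then have "C * wt ws \<le> C' * wt ws" for ws using wt_nonneg by (auto intro!: mult_right_mono)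
  then show "X_bounded C' N" using X unfolding X_bounded_def by (meson order_trans)
qed

theorem moment_bounds: "t_bounded (moment_const N) N" "X_bounded (moment_const N) N"
proof (induction N)
  case 0
  show "t_bounded (moment_const 0) 0" by (auto simp: t_bounded_def t_Nil has_square_def)
  have "\<bar>E (X ws)\<bar> \<le> wt ws" if "sum_list (map length ws) = 0" for ws
  proof (cases ws)
    case Nil
    then show ?thesis by (simp add: X_def[abs_def] E_const)
  next
    case (Cons w ws')
    then show ?thesis using that wt_nonneg[of ws] by (simp add: E_X_Nil del: wt_simps)
  qed
  then show "X_bounded (moment_const 0) 0" by (auto simp: X_bounded_def)
next
  case (Suc N)
  show "t_bounded (moment_const (Suc N)) (Suc N)"
    by (rule bounded_mono(1)[OF t_step[OF Suc moment_const_ge_1] moment_const_Suc])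
  show "X_bounded (moment_const (Suc N)) (Suc N)"
    by (rule bounded_mono(2)[OF X_step[OF Suc moment_const_ge_1] moment_const_Suc])
qed

end

lemma tau_nonneg:
  "(\<And>a. a \<ge> 1 \<Longrightarrow> p a \<ge> 0) \<Longrightarrow> pos_word w \<Longrightarrow> tau p w \<ge> 0"
proof (induction p w rule: tau.induct)
  case (2 p a as)
  then have "p a \<ge> 0" by simp
  then show ?case using 2
    by (auto intro!: add_nonneg_nonneg sum_nonneg mult_nonneg_nonneg simp: pos_word_contract)
qed simp

context wishart_bounds begin

lemma tau_bound: "length w \<le> N \<Longrightarrow> pos_word w \<Longrightarrow> \<bar>tau p w\<bar> \<le> moment_const N * K ^ length w"
proof (induction N arbitrary: w)
  case 0
  then show ?case by simp
next
  case (Suc N)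
  show ?case
  proof (cases w)
    case Nil
    then show ?thesis using moment_const_ge_1[of "Suc N"] by simp
  next
    case (Cons a as)
    let ?k = "length as" let ?C = "moment_const N"
    have C0: "?C \<ge> 0" using moment_const_ge_1[of N] by simp
    have k: "?k \<le> N" "a \<ge> 1" "pos_word as" using Suc.prems Cons by auto
    have "\<bar>\<Sum>s<?k. tau p (loop a as s) * tau p (drop (Suc s) as)\<bar> \<le> real ?k * (?C\<^sup>2 * K ^ ?k)"
    proof (rule abs_sum_lessThan_le)
      fix s assume s: "s < ?k"
      have "\<bar>tau p (loop a as s) * tau p (drop (Suc s) as)\<bar>
        \<le> (?C * K ^ length (loop a as s)) * (?C * K ^ length (drop (Suc s) as))"
        using s k by (intro abs_mult_le Suc.IH) (auto simp: pos_word_contract)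
      also have "\<dots> = ?C\<^sup>2 * (K ^ Suc s * K ^ (?k - Suc s))" using s by (simp add: power2_eq_square)
      also have "K ^ Suc s * K ^ (?k - Suc s) = K ^ ?k"
        using s by (metis power_add Suc_leI le_add_diff_inverse)
      finally show "\<bar>tau p (loop a as s) * tau p (drop (Suc s) as)\<bar> \<le> ?C\<^sup>2 * K ^ ?k" .
    qed
    also have "\<dots> \<le> (real N * 9) * (?C\<^sup>2 * K ^ Suc ?k)"
      using k K1 by (intro mult_mono mult_left_mono K_pow_mono) auto
    finally have 1: "\<bar>\<Sum>s<?k. tau p (loop a as s) * tau p (drop (Suc s) as)\<bar> \<le> real N * 9 * ?C\<^sup>2 * K ^ Suc ?k"
      by (simp add: mult.assoc)
    have "\<bar>p a * tau p as\<bar> \<le> K * (?C * K ^ ?k)"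
      using k by (intro abs_mult_le p_le_K Suc.IH)
    then have "\<bar>tau p w\<bar> \<le> (?C + real N * 9 * ?C\<^sup>2) * K ^ Suc ?k"
      using 1 unfolding Cons by (simp add: algebra_simps)
    also have "\<dots> \<le> moment_const (Suc N) * K ^ Suc ?k"
      using K1 by (intro mult_right_mono moment_const_Suc) auto
    finally show ?thesis by (simp add: Cons)
  qed
qed

lemma limit_const_ge_1: "limit_const N \<ge> 1"
proof (induction N)
  case (Suc N)
  have "0 \<le> real (Suc N) * (2 * moment_const (Suc N) + 2 * moment_const (Suc N) * limit_const N)"
    using moment_const_ge_1[of "Suc N"] Suc by (intro mult_nonneg_nonneg add_nonneg_nonneg) auto
  then show ?case using Suc by (simp add: limit_const.simps(2))
qed simp

declare limit_const.simps(2) [simp del]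

text \<open>Compare the two recursions term by term; differences of products are telescoped.\<close>

lemma t_tau: "length w \<le> N \<Longrightarrow> pos_word w \<Longrightarrow>
  \<bar>t w - tau p w\<bar> \<le> limit_const N / real n * (q\<^sup>2 * K ^ (length w - 1))"
proof (induction N arbitrary: w)
  case 0
  then show ?case by (simp add: t_Nil)
next
  case (Suc N)
  show ?case
  proof (cases w)
    case Nil
    then show ?thesis using limit_const_ge_1[of "Suc N"] by (simp add: t_Nil)
  next
    case (Cons a as)
    let ?k = "length as" let ?C = "moment_const (Suc N)" and ?D = "limit_const N" let ?m = "1 / real n"
    let ?B = "?m * (q\<^sup>2 * K ^ (?k - 1))"
    have C1: "?C \<ge> 1" by (rule moment_const_ge_1)
    have D1: "?D \<ge> 1" by (rule limit_const_ge_1)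
    have k: "?k \<le> N" "a \<ge> 1" "pos_word as" using Suc.prems Cons by auto
    have tb: "t_bounded ?C (Suc N)" and X: "X_bounded ?C (Suc N)" by (rule moment_bounds)+
    have B0: "?B \<ge> 0" using K1 by simp
    let ?f = "\<lambda>s. t (flip a as s) / real n + t (loop a as s) * t (drop (Suc s) as)
      + E (\<lambda>z. ctr (loop a as s) z * ctr (drop (Suc s) as) z) / (real n)\<^sup>2"
    have f: "\<bar>?f s - tau p (loop a as s) * tau p (drop (Suc s) as)\<bar> \<le> (2 * ?C + 2 * ?C * ?D) * ?B" if s: "s < ?k" for s
    proof -
      have "\<bar>?m * t (flip a as s)\<bar> \<le> ?m * (?C * q\<^sup>2 * K ^ (?k - 1))"
        using s k C1 n1 by (intro abs_mult_le t_bound_square[OF tb]) (auto simp: pos_word_contract has_square_contract)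
      then have 1: "\<bar>t (flip a as s) / real n\<bar> \<le> ?C * ?B" by (simp add: mult_ac)
      have 2: "\<bar>(t (loop a as s) - tau p (loop a as s)) * t (drop (Suc s) as)\<bar> \<le> ?C * ?D * ?B"
      proof -
        have "\<bar>(t (loop a as s) - tau p (loop a as s)) * t (drop (Suc s) as)\<bar>
          \<le> (?D / real n * (q\<^sup>2 * K ^ (length (loop a as s) - 1))) * (?C * K ^ (?k - Suc s))"
          using s k C1 by (intro abs_mult_le Suc.IH t_bound[OF tb]) (auto simp: pos_word_contract)
        also have "\<dots> = ?C * ?D * (?m * (q\<^sup>2 * (K ^ s * K ^ (?k - Suc s))))" using s by simp
        also have "K ^ s * K ^ (?k - Suc s) = K ^ (?k - 1)" using s by (simp add: power_add[symmetric])
        finally show ?thesis .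
      qed
      have 3: "\<bar>tau p (loop a as s) * (t (drop (Suc s) as) - tau p (drop (Suc s) as))\<bar> \<le> ?C * ?D * ?B"
      proof (cases "drop (Suc s) as = []")
        case True
        then show ?thesis using mult_nonneg_nonneg[OF mult_nonneg_nonneg[of ?C ?D] B0] C1 D1 by (simp add: t_Nil)
      next
        case False
        then have s2: "s + 2 \<le> ?k" by auto
        have "\<bar>tau p (loop a as s) * (t (drop (Suc s) as) - tau p (drop (Suc s) as))\<bar>
          \<le> (?C * K ^ length (loop a as s)) * (?D / real n * (q\<^sup>2 * K ^ (length (drop (Suc s) as) - 1)))"
          using s k C1 by (intro abs_mult_le Suc.IH tau_bound) (auto simp: pos_word_contract)
        also have "\<dots> = ?C * ?D * (?m * (q\<^sup>2 * (K ^ Suc s * K ^ (?k - s - 2))))" using s s2 by (simp del: power_Suc)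
        also have "K ^ Suc s * K ^ (?k - s - 2) = K ^ (?k - 1)"
        proof -
          have "Suc s + (?k - s - 2) = ?k - 1" using s2 by simp
          then show ?thesis by (simp only: power_add[symmetric])
        qed
        finally show ?thesis .
      qed
      have "\<bar>E (X [loop a as s, drop (Suc s) as])\<bar> \<le> ?C * (q\<^sup>2 * K ^ (?k - 2) * wt [])"
        using s k C1 by (intro E_X_pair_bound[OF X]) auto
      also have "\<dots> \<le> ?C * (q\<^sup>2 * K ^ (?k - 1))"
        using C1 by (auto intro!: mult_left_mono K_pow_mono)
      finally have "\<bar>E (X [loop a as s, drop (Suc s) as])\<bar> \<le> ?C * (q\<^sup>2 * K ^ (?k - 1))" .
      moreover have "1 / (real n)\<^sup>2 \<le> ?m" using n_pos by (simp add: field_simps power2_eq_square)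
      then have "\<bar>1 / (real n)\<^sup>2\<bar> \<le> ?m" by simp
      ultimately have "\<bar>E (X [loop a as s, drop (Suc s) as]) * (1 / (real n)\<^sup>2)\<bar> \<le> ?C * (q\<^sup>2 * K ^ (?k - 1)) * ?m"
        by (rule abs_mult_le)
      then have 4: "\<bar>E (\<lambda>z. ctr (loop a as s) z * ctr (drop (Suc s) as) z) / (real n)\<^sup>2\<bar> \<le> ?C * ?B"
        by (simp add: X_def[abs_def] mult_ac)
      have e: "?f s - tau p (loop a as s) * tau p (drop (Suc s) as)
        = t (flip a as s) / real n + (t (loop a as s) - tau p (loop a as s)) * t (drop (Suc s) as)
          + tau p (loop a as s) * (t (drop (Suc s) as) - tau p (drop (Suc s) as))
          + E (\<lambda>z. ctr (loop a as s) z * ctr (drop (Suc s) as) z) / (real n)\<^sup>2"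
        by (simp add: algebra_simps)
      show ?thesis using 1 2 3 4 unfolding e distrib_right[of "2 * ?C"] by linarith
    qed
    have "\<bar>\<Sum>s<?k. (?f s - tau p (loop a as s) * tau p (drop (Suc s) as))\<bar> \<le> real ?k * ((2 * ?C + 2 * ?C * ?D) * ?B)"
      by (intro abs_sum_lessThan_le f)
    also have "\<dots> \<le> real (Suc N) * ((2 * ?C + 2 * ?C * ?D) * (?m * (q\<^sup>2 * K ^ ?k)))"
      using k B0 C1 D1 K1 by (intro mult_mono mult_left_mono K_pow_mono) auto
    finally have S: "\<bar>\<Sum>s<?k. (?f s - tau p (loop a as s) * tau p (drop (Suc s) as))\<bar>
       \<le> real (Suc N) * (2 * ?C + 2 * ?C * ?D) * (?m * (q\<^sup>2 * K ^ ?k))" by (simp add: mult.assoc)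
    have A: "\<bar>p a * (t as - tau p as)\<bar> \<le> ?D * (?m * (q\<^sup>2 * K ^ ?k))"
    proof (cases as)
      case Nil
      then show ?thesis using D1 by (simp add: t_Nil)
    next
      case (Cons b bs)
      have "\<bar>p a * (t as - tau p as)\<bar> \<le> K * (?D / real n * (q\<^sup>2 * K ^ (?k - 1)))"
        using k by (intro abs_mult_le p_le_K Suc.IH)
      then show ?thesis using Cons by (simp add: mult_ac)
    qed
    have "t w - tau p w = p a * (t as - tau p as) + (\<Sum>s<?k. (?f s - tau p (loop a as s) * tau p (drop (Suc s) as)))"
      unfolding Cons t_Cons by (simp add: sum_subtractf right_diff_distrib)
    then have "\<bar>t w - tau p w\<bar> \<le> (?D + real (Suc N) * (2 * ?C + 2 * ?C * ?D)) * (?m * (q\<^sup>2 * K ^ ?k))"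
      using A S unfolding distrib_right[of ?D] by linarith
    then show ?thesis by (simp add: Cons limit_const.simps(2))
  qed
qed

lemma cov_const_nonneg: "cov_const L N \<ge> 0"
proof (induction N)
  case (Suc N)
  then show ?case using limit_const_ge_1[of "N + L"] moment_const_ge_1[of "N + L"] by simp
qed simp

text \<open>The recursions for \<open>E (ctr w * G)\<close> and for \<open>limit_cov p w u * E h\<close> are compared term by
  term. The hypotheses on \<open>G\<close> are a priori bounds of the expected size for its correlations
  with one and with two centred traces; those on \<open>h\<close> serve for the merged words, which have
  length up to \<open>M + length u\<close>. The test functions are kept general because the estimate is
  used for \<open>G = ctr u\<close> and for bounded functions of \<open>ctr u\<close>.\<close>

lemma ctr_covariance:
  fixes G h :: "(nat \<times> nat \<Rightarrow> real) \<Rightarrow> real"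
  assumes G: "has_grad Ix G (\<lambda>e z. gradT u e z * h z)" and th: "tempered Ix h"
    and u: "pos_word u" "length u \<ge> 1"
    and \<Gamma>: "\<Gamma> \<ge> 0" "H \<ge> 0"
    and H1: "\<And>w. pos_word w \<Longrightarrow> length w \<le> M \<Longrightarrow> \<bar>E (\<lambda>z. ctr w z * G z)\<bar> \<le> \<Gamma> * (q * K ^ (length w - 1))"
    and H2: "\<And>v w. pos_word v \<Longrightarrow> pos_word w \<Longrightarrow> length v + length w \<le> M \<Longrightarrow>
      \<bar>E (\<lambda>z. ctr v z * ctr w z * G z) - E (\<lambda>z. ctr v z * ctr w z) * E G\<bar> \<le> \<Gamma> * (q\<^sup>2 * K ^ (length v - 1 + (length w - 1)))"
    and H3: "\<And>w. pos_word w \<Longrightarrow> length w \<le> M + length u \<Longrightarrow> \<bar>E (\<lambda>z. ctr w z * h z)\<bar> \<le> H * (q * K ^ (length w - 1))"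
    and H4: "\<bar>E h\<bar> \<le> H"
  shows "N \<le> M \<Longrightarrow> length w \<le> N \<Longrightarrow> pos_word w \<Longrightarrow> \<bar>E (\<lambda>z. ctr w z * G z) - limit_cov p w u * E h\<bar>
    \<le> cov_const (length u) N / real n * (\<Gamma> * (q * K ^ (length w - 1)) + H * ((q + q\<^sup>2) * K ^ (length w + length u - 2)))"
proof (induction N arbitrary: w)
  case 0
  then show ?case by (simp add: ctr_Nil E_const)
next
  case (Suc N)
  let ?L = "length u"
  have err0: "0 \<le> cov_const ?L N' / real n * (\<Gamma> * (q * K ^ i) + H * ((q + q\<^sup>2) * K ^ j))" for N' i j
    using cov_const_nonneg[of ?L N'] \<Gamma> q_pos K1 by simp
  show ?case
  proof (cases w)
    case Nil
    then show ?thesis using err0[of "Suc N" 0 "?L - 2"] by (simp add: ctr_Nil E_const del: cov_const.simps)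
  next
    case (Cons a as)
    let ?k = "length as" let ?C = "moment_const (N + ?L)" and ?D = "limit_const (N + ?L)" and ?F = "cov_const ?L N"
    let ?m = "1 / real n"
    let ?g = "\<Gamma> * (q * K ^ ?k)" and ?h = "H * ((q + q\<^sup>2) * K ^ (?k + ?L - 1))"
    let ?c = "\<lambda>w. E (\<lambda>z. ctr w z * G z)" and ?cv = "\<lambda>w. limit_cov p w u"
    \<comment> \<open>\<open>?e\<close> is the error to be bounded; \<open>?g\<close> and \<open>?h\<close> are the target sizes of its two parts\<close>
    let ?e = "\<lambda>w. ?c w - ?cv w * E h"
    have C1: "?C \<ge> 1" by (rule moment_const_ge_1)
    have D1: "?D \<ge> 1" by (rule limit_const_ge_1)
    have F0: "?F \<ge> 0" by (rule cov_const_nonneg)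
    have k: "?k \<le> N" "N \<le> M" "Suc ?k \<le> M" "a \<ge> 1" "pos_word as" using Suc.prems Cons by auto
    have m: "?m \<ge> 0" "?m \<le> 1" using n1 by auto
    have g0: "?g \<ge> 0" "?h \<ge> 0" using \<Gamma> q_pos K1 by simp_all
    have mg: "0 \<le> ?m * ?g" "0 \<le> ?m * ?h" using mult_nonneg_nonneg[OF m(1) g0(1)] mult_nonneg_nonneg[OF m(1) g0(2)] by simp_all
    have nil: "?c [] = 0" by (simp add: ctr_Nil E_const)
    have ctrm: "\<bar>?c v\<bar> \<le> \<Gamma> * (q * K ^ i)" if "pos_word v" "length v \<le> Suc i" "length v \<le> M" for v i
    proof -
      have "\<bar>?c v\<bar> \<le> \<Gamma> * (q * K ^ (length v - 1))" using that by (intro H1)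
      also have "\<dots> \<le> \<Gamma> * (q * K ^ i)" using that \<Gamma> q_pos by (intro mult_left_mono K_pow_mono) auto
      finally show ?thesis .
    qed
    have IH: "\<bar>?e v\<bar> \<le> ?F / real n * (\<Gamma> * (q * K ^ i) + H * ((q + q\<^sup>2) * K ^ (i + ?L - 1)))"
      if "pos_word v" "length v \<le> Suc i" "length v \<le> N" "v \<noteq> []" for v i
    proof -
      have "\<bar>?e v\<bar> \<le> ?F / real n * (\<Gamma> * (q * K ^ (length v - 1)) + H * ((q + q\<^sup>2) * K ^ (length v + length u - 2)))"
        using that k by (intro Suc.IH) auto
      also have "\<dots> \<le> ?F / real n * (\<Gamma> * (q * K ^ i) + H * ((q + q\<^sup>2) * K ^ (i + ?L - 1)))"
        using that F0 m \<Gamma> q_pos by (intro mult_left_mono add_mono K_pow_mono) auto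
      finally show ?thesis .
    qed
    have fin: "(A * K ^ j) * (?F / real n * (\<Gamma> * (q * K ^ i) + H * ((q + q\<^sup>2) * K ^ (i + ?L - 1)))) \<le> A * ?F * (?m * (?g + ?h))"
      if "A \<ge> 0" "j + i \<le> ?k" for A i j
    proof -
      have "j + (i + ?L - 1) \<le> ?k + ?L - 1" using that u by simp
      then have "K ^ j * K ^ (i + ?L - 1) \<le> K ^ (?k + ?L - 1)" "K ^ j * K ^ i \<le> K ^ ?k"
        unfolding power_add[symmetric] using that by (auto intro!: K_pow_mono)
      then have "\<Gamma> * (q * (K ^ j * K ^ i)) + H * ((q + q\<^sup>2) * (K ^ j * K ^ (i + ?L - 1))) \<le> ?g + ?h"
        using \<Gamma> q_pos by (intro add_mono mult_left_mono) auto
      then have "A * ?F * (?m * (\<Gamma> * (q * (K ^ j * K ^ i)) + H * ((q + q\<^sup>2) * (K ^ j * K ^ (i + ?L - 1))))) \<le> A * ?F * (?m * (?g + ?h))"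
        using that F0 m by (intro mult_left_mono) auto
      then show ?thesis by (simp add: algebra_simps)
    qed
    let ?f = "\<lambda>s. ?c (flip a as s) / real n
        + t (loop a as s) * ?c (drop (Suc s) as)
        + t (drop (Suc s) as) * ?c (loop a as s)
        + (E (\<lambda>z. ctr (loop a as s) z * ctr (drop (Suc s) as) z * G z)
           - E (\<lambda>z. ctr (loop a as s) z * ctr (drop (Suc s) as) z) * E G) / real n"
    let ?f' = "\<lambda>s. (tau p (loop a as s) * ?cv (drop (Suc s) as) + tau p (drop (Suc s) as) * ?cv (loop a as s)) * E h"
    have f: "\<bar>?f s - ?f' s\<bar> \<le> (2 + 2 * ?D + 2 * ?C * ?F) * (?m * (?g + ?h))" if s: "s < ?k" for s
    proof -
      let ?l = "loop a as s" let ?d = "drop (Suc s) as"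
      have pl: "pos_word ?l" "pos_word ?d" "pos_word (flip a as s)" using k by (auto simp: pos_word_contract)
      have ld: "length ?l = Suc s" "length ?d = ?k - Suc s" using s by auto
      have "\<bar>?m * ?c (flip a as s)\<bar> \<le> ?m * ?g"
        using s k m pl by (intro abs_mult_le ctrm) auto
      then have 1: "\<bar>?c (flip a as s) / real n\<bar> \<le> ?m * ?g" by simp
      have Dm: "?D * (?m * \<Gamma> * (q * (q\<^sup>2 * K ^ (?k - 2)))) \<le> ?D * (?m * ?g)" if "?k \<ge> 2"
      proof -
        have "q\<^sup>2 * K ^ (?k - 2) \<le> K ^ ?k"
        proof -
          have "q\<^sup>2 * K ^ (?k - 1 - 1) \<le> K ^ (?k - 1)" using that by (intro q2_K_pow) simp
          also have "\<dots> \<le> K ^ ?k" by (rule K_pow_mono) simp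
          finally show ?thesis by (metis diff_diff_left one_add_one)
        qed
        then have "?m * \<Gamma> * (q * (q\<^sup>2 * K ^ (?k - 2))) \<le> ?m * \<Gamma> * (q * K ^ ?k)"
          using m \<Gamma> q_pos by (intro mult_left_mono) auto
        then show ?thesis using D1 by (intro mult_left_mono) (auto simp: mult_ac)
      qed
      have 2: "\<bar>(t ?l - tau p ?l) * ?c ?d\<bar> \<le> ?D * (?m * ?g)"
      proof (cases "?d = []")
        case True
        then show ?thesis using mult_nonneg_nonneg[of ?D, OF _ mg(1)] D1 by (simp add: nil)
      next
        case False
        then have s2: "s + 2 \<le> ?k" by auto
        have "\<bar>(t ?l - tau p ?l) * ?c ?d\<bar> \<le> (?D / real n * (q\<^sup>2 * K ^ (length ?l - 1))) * (\<Gamma> * (q * K ^ (?k - s - 2)))"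
          using s s2 k pl by (intro abs_mult_le t_tau ctrm) auto
        also have "\<dots> = ?D * (?m * \<Gamma> * (q * (q\<^sup>2 * (K ^ s * K ^ (?k - s - 2)))))" using s by simp
        also have "K ^ s * K ^ (?k - s - 2) = K ^ (?k - 2)"
          using s2 by (simp add: power_add[symmetric])
        also have "?D * (?m * \<Gamma> * (q * (q\<^sup>2 * K ^ (?k - 2)))) \<le> ?D * (?m * ?g)" using s2 by (intro Dm) simp
        finally show ?thesis .
      qed
      have 3: "\<bar>(t ?d - tau p ?d) * ?c ?l\<bar> \<le> ?D * (?m * ?g)"
      proof (cases "?d = []")
        case True
        then show ?thesis using mult_nonneg_nonneg[of ?D, OF _ mg(1)] D1 by (simp add: t_Nil)
      next
        case False
        then have s2: "s + 2 \<le> ?k" by auto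
        have "\<bar>(t ?d - tau p ?d) * ?c ?l\<bar> \<le> (?D / real n * (q\<^sup>2 * K ^ (length ?d - 1))) * (\<Gamma> * (q * K ^ s))"
          using s s2 k pl by (intro abs_mult_le t_tau ctrm) auto
        also have "\<dots> = ?D * (?m * \<Gamma> * (q * (q\<^sup>2 * (K ^ (?k - s - 2) * K ^ s))))" using s by simp
        also have "K ^ (?k - s - 2) * K ^ s = K ^ (?k - 2)"
          using s2 by (simp add: power_add[symmetric])
        also have "?D * (?m * \<Gamma> * (q * (q\<^sup>2 * K ^ (?k - 2)))) \<le> ?D * (?m * ?g)" using s2 by (intro Dm) simp
        finally show ?thesis .
      qed
      have 4: "\<bar>tau p ?l * ?e ?d\<bar> \<le> ?C * ?F * (?m * (?g + ?h))"
      proof (cases "?d = []")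
        case True
        have "0 \<le> ?m * (?g + ?h)" using mg by (simp add: distrib_left)
        then have "0 \<le> ?C * ?F * (?m * (?g + ?h))" using C1 F0 by (intro mult_nonneg_nonneg[of "?C * ?F"] mult_nonneg_nonneg[of ?C]) auto
        then show ?thesis using True by (simp add: nil)
      next
        case False
        then have s2: "s + 2 \<le> ?k" by auto
        have "\<bar>tau p ?l * ?e ?d\<bar> \<le> (?C * K ^ length ?l) * (?F / real n * (\<Gamma> * (q * K ^ (?k - s - 2)) + H * ((q + q\<^sup>2) * K ^ (?k - s - 2 + ?L - 1))))"
          using s s2 k pl False by (intro abs_mult_le tau_bound IH) auto
        also have "\<dots> \<le> ?C * ?F * (?m * (?g + ?h))" using C1 s2 ld by (intro fin) auto
        finally show ?thesis .
      qed
      have 5: "\<bar>tau p ?d * ?e ?l\<bar> \<le> ?C * ?F * (?m * (?g + ?h))"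
      proof -
        have "\<bar>tau p ?d * ?e ?l\<bar> \<le> (?C * K ^ length ?d) * (?F / real n * (\<Gamma> * (q * K ^ s) + H * ((q + q\<^sup>2) * K ^ (s + ?L - 1))))"
          using s k pl ld by (intro abs_mult_le tau_bound IH) (auto simp: loop_def)
        also have "\<dots> \<le> ?C * ?F * (?m * (?g + ?h))" using C1 s ld by (intro fin) auto
        finally show ?thesis .
      qed
      let ?x = "E (\<lambda>z. ctr ?l z * ctr ?d z * G z) - E (\<lambda>z. ctr ?l z * ctr ?d z) * E G"
      have 6: "\<bar>?x / real n\<bar> \<le> ?m * ?g"
      proof (cases "?d = []")
        case True
        then have "?x = 0" by (simp add: ctr_Nil E_const)
        then show ?thesis using mg by simp
      next
        case False
        then have s2: "s + 2 \<le> ?k" by auto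
        have "\<bar>?x\<bar> \<le> \<Gamma> * (q\<^sup>2 * K ^ (length ?l - 1 + (length ?d - 1)))"
          using s k pl ld by (intro H2) auto
        also have "length ?l - 1 + (length ?d - 1) = ?k - 2" using s2 ld by simp
        also have "\<Gamma> * (q\<^sup>2 * K ^ (?k - 2)) \<le> ?g"
        proof -
          have "q\<^sup>2 * K ^ (?k - 2) \<le> q * (K * K ^ (?k - 1))"
            unfolding power2_eq_square mult.assoc using q_pos q_le_K K1
            by (intro mult_left_mono mult_mono K_pow_mono) auto
          also have "K * K ^ (?k - 1) = K ^ ?k" using s2 by (cases as) auto
          finally show ?thesis using \<Gamma> by (intro mult_left_mono)
        qed
        finally have "\<bar>?m * ?x\<bar> \<le> ?m * ?g" using m by (intro abs_mult_le) auto
        then show ?thesis by simp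
      qed
      have e: "?f s - ?f' s = ?c (flip a as s) / real n + (t ?l - tau p ?l) * ?c ?d + (t ?d - tau p ?d) * ?c ?l
         + tau p ?l * ?e ?d + tau p ?d * ?e ?l + ?x / real n"
        by (simp add: algebra_simps)
      have "\<bar>?f s - ?f' s\<bar> \<le> 2 * (?m * ?g) + 2 * (?D * (?m * ?g)) + 2 * (?C * ?F * (?m * (?g + ?h)))"
        unfolding e by (rule abs_sum6_le[OF 1 2 3 4 5 6])
      also have "\<dots> \<le> 2 * (?m * (?g + ?h)) + 2 * (?D * (?m * (?g + ?h))) + 2 * (?C * ?F * (?m * (?g + ?h)))"
        using g0 m D1 by (intro add_mono mult_left_mono order_refl) auto
      also have "\<dots> = (2 + 2 * ?D + 2 * ?C * ?F) * (?m * (?g + ?h))" by (simp add: algebra_simps)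
      finally show ?thesis .
    qed
    have S: "\<bar>\<Sum>s<?k. (?f s - ?f' s)\<bar> \<le> real N * (2 + 2 * ?D + 2 * ?C * ?F) * (?m * (?g + ?h))"
    proof -
      have "\<bar>\<Sum>s<?k. (?f s - ?f' s)\<bar> \<le> real ?k * ((2 + 2 * ?D + 2 * ?C * ?F) * (?m * (?g + ?h)))"
        by (intro abs_sum_lessThan_le f)
      also have "\<dots> \<le> real N * ((2 + 2 * ?D + 2 * ?C * ?F) * (?m * (?g + ?h)))"
      proof (rule mult_right_mono)
        have "0 \<le> 2 + 2 * ?D + 2 * ?C * ?F" using C1 D1 F0 by simp
        moreover have "0 \<le> ?m * (?g + ?h)" using mg by (simp add: distrib_left)
        ultimately show "0 \<le> (2 + 2 * ?D + 2 * ?C * ?F) * (?m * (?g + ?h))" by (rule mult_nonneg_nonneg)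
      qed (use k in simp)
      finally show ?thesis by (simp add: mult.assoc)
    qed
    \<comment> \<open>the source terms, in which \<open>a\<close> is contracted with a letter of \<open>u\<close>\<close>
    let ?r = "\<lambda>s. (t (merge1 a as u s) + t (merge2 a as u s)) * E h
        + (E (\<lambda>z. ctr (merge1 a as u s) z * h z) + E (\<lambda>z. ctr (merge2 a as u s) z * h z)) / real n"
    let ?r' = "\<lambda>s. (tau p (merge1 a as u s) + tau p (merge2 a as u s)) * E h"
    have r: "\<bar>?r s - ?r' s\<bar> \<le> 2 * ((?D + 1) * (?m * (?g + ?h)))" if s: "s < ?L" for s
    proof -
      have w: "\<bar>(t w - tau p w) * E h\<bar> \<le> ?D * (?m * ?h)" "\<bar>E (\<lambda>z. ctr w z * h z) / real n\<bar> \<le> ?m * ?h"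
        if w: "w = merge1 a as u s \<or> w = merge2 a as u s" for w
      proof -
        have lw: "length w = ?k + ?L" "pos_word w" using w s k u by (auto simp: pos_word_contract)
        have "\<bar>(t w - tau p w) * E h\<bar> \<le> (?D / real n * (q\<^sup>2 * K ^ (length w - 1))) * H"
          using lw k by (intro abs_mult_le t_tau H4) auto
        also have "\<dots> = ?D * (?m * (H * (q\<^sup>2 * K ^ (?k + ?L - 1))))" using lw by simp
        also have "\<dots> \<le> ?D * (?m * ?h)"
          using D1 m \<Gamma> q_pos K1 by (intro mult_left_mono mult_right_mono) auto
        finally show "\<bar>(t w - tau p w) * E h\<bar> \<le> ?D * (?m * ?h)" .
        have "\<bar>?m * E (\<lambda>z. ctr w z * h z)\<bar> \<le> ?m * (H * (q * K ^ (length w - 1)))"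
          using lw k m by (intro abs_mult_le H3) auto
        also have "\<dots> \<le> ?m * ?h" using m \<Gamma> q_pos K1 lw by (intro mult_left_mono mult_mono) auto
        finally show "\<bar>E (\<lambda>z. ctr w z * h z) / real n\<bar> \<le> ?m * ?h" by simp
      qed
      have e: "?r s - ?r' s = (t (merge1 a as u s) - tau p (merge1 a as u s)) * E h
         + (t (merge2 a as u s) - tau p (merge2 a as u s)) * E h
         + E (\<lambda>z. ctr (merge1 a as u s) z * h z) / real n + E (\<lambda>z. ctr (merge2 a as u s) z * h z) / real n"
        by (simp add: algebra_simps add_divide_distrib)
      have "\<bar>?r s - ?r' s\<bar> \<le> 2 * (?D * (?m * ?h)) + 2 * (?m * ?h)"
        unfolding e by (intro abs_sum4_le w[OF disjI1[OF refl]] w[OF disjI2[OF refl]])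
      also have "\<dots> \<le> 2 * (?D * (?m * (?g + ?h))) + 2 * (?m * (?g + ?h))"
        using g0 m D1 by (intro add_mono mult_left_mono order_refl) auto
      also have "\<dots> = 2 * ((?D + 1) * (?m * (?g + ?h)))"
      proof -
        have "2 * (A * B) + 2 * B = 2 * ((A + 1) * B)" for A B :: real by (simp add: algebra_simps)
        then show ?thesis .
      qed
      finally show ?thesis .
    qed
    have R: "\<bar>\<Sum>s<?L. (?r s - ?r' s)\<bar> \<le> 2 * real ?L * (?D + 1) * (?m * (?g + ?h))"
    proof -
      have "\<bar>\<Sum>s<?L. (?r s - ?r' s)\<bar> \<le> real ?L * (2 * ((?D + 1) * (?m * (?g + ?h))))"
        by (intro abs_sum_lessThan_le r)
      also have "\<dots> = 2 * real ?L * (?D + 1) * (?m * (?g + ?h))" by (simp only: mult_ac)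
      finally show ?thesis .
    qed
    have A: "\<bar>p a * ?e as\<bar> \<le> ?F * (?m * (?g + ?h))"
    proof (cases as)
      case Nil
      have "0 \<le> ?m * (?g + ?h)" using mg by (simp add: distrib_left)
      then have "0 \<le> ?F * (?m * (?g + ?h))" by (rule mult_nonneg_nonneg[OF F0])
      then show ?thesis using Nil by (simp add: nil)
    next
      case (Cons b bs)
      then have k0: "?k \<ge> 1" by simp
      have "\<bar>p a * ?e as\<bar> \<le> K * (?F / real n * (\<Gamma> * (q * K ^ (?k - 1)) + H * ((q + q\<^sup>2) * K ^ (?k - 1 + ?L - 1))))"
        using k Cons by (intro abs_mult_le p_le_K IH) auto
      also have "\<dots> \<le> 1 * ?F * (?m * (?g + ?h))" using fin[of 1 1 "?k - 1"] k0 by simp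
      finally show ?thesis by simp
    qed
    have "?c w = p a * ?c as + (\<Sum>s<?k. ?f s) + (\<Sum>s<?L. ?r s)"
      unfolding Cons E_ctr_Cons[OF G, of a as] E_V_gradT[OF th] ..
    moreover have "?cv w * E h = p a * ?cv as * E h + (\<Sum>s<?k. ?f' s) + (\<Sum>s<?L. ?r' s)"
      unfolding Cons limit_cov.simps(2) distrib_right sum_distrib_right ..
    ultimately have "?e w = p a * ?e as + (\<Sum>s<?k. (?f s - ?f' s)) + (\<Sum>s<?L. (?r s - ?r' s))"
      unfolding sum_subtractf by (simp only: right_diff_distrib mult.assoc)
    then have "\<bar>?e w\<bar> \<le> ?F * (?m * (?g + ?h)) + real N * (2 + 2 * ?D + 2 * ?C * ?F) * (?m * (?g + ?h))
        + 2 * real ?L * (?D + 1) * (?m * (?g + ?h))"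
      using abs_sum3_le[OF A S R] by (simp only:)
    also have "\<dots> = (?F + real N * (2 + 2 * ?D + 2 * ?C * ?F) + 2 * real ?L * (?D + 1)) * (?m * (?g + ?h))"
      by (simp only: distrib_right)
    also have "?F + real N * (2 + 2 * ?D + 2 * ?C * ?F) + 2 * real ?L * (?D + 1) = cov_const ?L (Suc N)" by simp
    also have "cov_const ?L (Suc N) * (?m * (?g + ?h)) = cov_const ?L (Suc N) / real n * (\<Gamma> * (q * K ^ (length w - 1)) + H * ((q + q\<^sup>2) * K ^ (length w + ?L - 2)))"
      by (simp add: Cons del: cov_const.simps)
    finally show ?thesis .
  qed
qed

end

section \<open>Wick's formula\<close>

text \<open>Pairings of \<open>S\<close>, encoded as permutations so that they can be composed with the sign change.\<close>

definition fpf_involutions :: "'a set \<Rightarrow> ('a \<Rightarrow> 'a) set" where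
  "fpf_involutions S = {\<tau>. \<tau> permutes S \<and> (\<forall>x\<in>S. \<tau> (\<tau> x) = x \<and> \<tau> x \<noteq> x)}"

lemma finite_fpf_involutions: "finite S \<Longrightarrow> finite (fpf_involutions S)"
  by (rule finite_subset[OF _ finite_permutations[of S]]) (auto simp: fpf_involutions_def)

text \<open>Removing the pair \<open>{a, y}\<close> is composition with the transposition of \<open>a\<close> and \<open>y\<close>.\<close>

lemma fpf_involutions_split:
  assumes a: "a \<in> S" and y: "y \<in> S" "y \<noteq> a" and e: "e y = e a"
  shows "bij_betw (\<lambda>\<tau>. \<tau> \<circ> Transposition.transpose a y)
     {\<tau> \<in> fpf_involutions (S - {a, y}). \<forall>x\<in>S - {a, y}. e (\<tau> x) = e x}
     {\<tau> \<in> fpf_involutions S. (\<forall>x\<in>S. e (\<tau> x) = e x) \<and> \<tau> a = y}"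
proof (rule bij_betw_byWitness[where f'="\<lambda>\<tau>. \<tau> \<circ> Transposition.transpose a y"])
  let ?t = "Transposition.transpose a y"
  show "\<forall>\<tau>\<in>{\<tau> \<in> fpf_involutions (S - {a, y}). \<forall>x\<in>S - {a, y}. e (\<tau> x) = e x}. \<tau> \<circ> ?t \<circ> ?t = \<tau>"
    "\<forall>\<tau>\<in>{\<tau> \<in> fpf_involutions S. (\<forall>x\<in>S. e (\<tau> x) = e x) \<and> \<tau> a = y}. \<tau> \<circ> ?t \<circ> ?t = \<tau>"
    by (auto simp: comp_assoc)
  show "(\<lambda>\<tau>. \<tau> \<circ> ?t) ` {\<tau> \<in> fpf_involutions (S - {a, y}). \<forall>x\<in>S - {a, y}. e (\<tau> x) = e x}
    \<subseteq> {\<tau> \<in> fpf_involutions S. (\<forall>x\<in>S. e (\<tau> x) = e x) \<and> \<tau> a = y}"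
  proof (rule image_subsetI)
    fix \<tau> assume "\<tau> \<in> {\<tau> \<in> fpf_involutions (S - {a, y}). \<forall>x\<in>S - {a, y}. e (\<tau> x) = e x}"
    then have p: "\<tau> permutes S - {a, y}" and i: "\<And>x. x \<in> S - {a, y} \<Longrightarrow> \<tau> (\<tau> x) = x \<and> \<tau> x \<noteq> x"
      and ee: "\<And>x. x \<in> S - {a, y} \<Longrightarrow> e (\<tau> x) = e x" by (auto simp: fpf_involutions_def)
    have fix_ay: "\<tau> a = a" "\<tau> y = y" using p by (auto simp: permutes_def)
    have in_S: "\<tau> x \<in> S - {a, y}" if "x \<in> S - {a, y}" for x using permutes_in_image[OF p] that by blast
    have P: "\<tau> \<circ> ?t permutes S"
      by (rule permutes_compose[OF permutes_swap_id[OF a y(1)] permutes_subset[OF p]]) auto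
    have "(\<tau> \<circ> ?t) ((\<tau> \<circ> ?t) x) = x \<and> (\<tau> \<circ> ?t) x \<noteq> x \<and> e ((\<tau> \<circ> ?t) x) = e x" if "x \<in> S" for x
    proof (cases "x \<in> {a, y}")
      case True
      then show ?thesis using fix_ay y e by auto
    next
      case False
      then have x: "x \<in> S - {a, y}" using that by simp
      show ?thesis using i[OF x] in_S[OF x] ee[OF x] False by (auto simp: transpose_def)
    qed
    moreover have "(\<tau> \<circ> ?t) a = y" using fix_ay by simp
    ultimately show "\<tau> \<circ> ?t \<in> {\<tau> \<in> fpf_involutions S. (\<forall>x\<in>S. e (\<tau> x) = e x) \<and> \<tau> a = y}"
      using P by (auto simp: fpf_involutions_def)
  qed
  show "(\<lambda>\<tau>. \<tau> \<circ> ?t) ` {\<tau> \<in> fpf_involutions S. (\<forall>x\<in>S. e (\<tau> x) = e x) \<and> \<tau> a = y}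
    \<subseteq> {\<tau> \<in> fpf_involutions (S - {a, y}). \<forall>x\<in>S - {a, y}. e (\<tau> x) = e x}"
  proof (rule image_subsetI)
    fix \<tau> assume "\<tau> \<in> {\<tau> \<in> fpf_involutions S. (\<forall>x\<in>S. e (\<tau> x) = e x) \<and> \<tau> a = y}"
    then have p: "\<tau> permutes S" and i: "\<And>x. x \<in> S \<Longrightarrow> \<tau> (\<tau> x) = x \<and> \<tau> x \<noteq> x"
      and ee: "\<And>x. x \<in> S \<Longrightarrow> e (\<tau> x) = e x" and ay: "\<tau> a = y" by (auto simp: fpf_involutions_def)
    have ya: "\<tau> y = a" using i[OF a] ay by simp
    have P: "\<tau> \<circ> ?t permutes S" by (rule permutes_compose[OF permutes_swap_id[OF a y(1)] p])
    have P': "\<tau> \<circ> ?t permutes S - {a, y}"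
      by (rule permutes_superset[OF P]) (auto simp: ay ya)
    have "(\<tau> \<circ> ?t) ((\<tau> \<circ> ?t) x) = x \<and> (\<tau> \<circ> ?t) x \<noteq> x \<and> e ((\<tau> \<circ> ?t) x) = e x" if x: "x \<in> S - {a, y}" for x
    proof -
      have "\<tau> x \<noteq> a" "\<tau> x \<noteq> y" using i x ay ya by (metis DiffE insertCI)+
      then show ?thesis using x i ee by (auto simp: transpose_def)
    qed
    then show "\<tau> \<circ> ?t \<in> {\<tau> \<in> fpf_involutions (S - {a, y}). \<forall>x\<in>S - {a, y}. e (\<tau> x) = e x}"
      using P' by (auto simp: fpf_involutions_def)
  qed
qed

lemma has_grad_prod_coord:
  fixes e :: "'b \<Rightarrow> 'i"
  assumes I: "finite I" and "finite A" "\<And>x. x \<in> A \<Longrightarrow> e x \<in> I"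
  shows "has_grad I (\<lambda>z. \<Prod>x\<in>A. z (e x)) (\<lambda>i z. \<Sum>y\<in>A. (if i = e y then 1 else 0) * (\<Prod>x\<in>A - {y}. z (e x)))"
  using assms(2,3)
proof (induction A)
  case empty
  then show ?case using has_grad_const[of I 1] by simp
next
  case (insert a A)
  have "has_grad I (\<lambda>z. z (e a) * (\<Prod>x\<in>A. z (e x))) (\<lambda>i z. (if i = e a then 1 else 0) * (\<Prod>x\<in>A. z (e x))
      + z (e a) * (\<Sum>y\<in>A. (if i = e y then 1 else 0) * (\<Prod>x\<in>A - {y}. z (e x))))"
    using insert I by (intro has_grad_mult has_grad_coord insert.IH) auto
  then have "has_grad I (\<lambda>z. \<Prod>x\<in>insert a A. z (e x)) (\<lambda>i z. (if i = e a then 1 else 0) * (\<Prod>x\<in>A. z (e x))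
      + z (e a) * (\<Sum>y\<in>A. (if i = e y then 1 else 0) * (\<Prod>x\<in>A - {y}. z (e x))))"
    using insert by simp
  then show ?case
  proof (rule has_grad_cong)
    fix i and z :: "'i \<Rightarrow> real"
    have "(\<Prod>x\<in>insert a A - {y}. z (e x)) = z (e a) * (\<Prod>x\<in>A - {y}. z (e x))" if "y \<in> A" for y
    proof -
      have "insert a A - {y} = insert a (A - {y})" using that insert by auto
      then show ?thesis using insert by simp
    qed
    then have 1: "(\<Sum>y\<in>A. (if i = e y then 1 else 0) * (\<Prod>x\<in>insert a A - {y}. z (e x)))
       = z (e a) * (\<Sum>y\<in>A. (if i = e y then 1 else 0) * (\<Prod>x\<in>A - {y}. z (e x)))"
      by (simp add: sum_distrib_left mult_ac)
    have 2: "insert a A - {a} = A" using insert by auto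
    show "(if i = e a then 1 else 0) * (\<Prod>x\<in>A. z (e x))
      + z (e a) * (\<Sum>y\<in>A. (if i = e y then 1 else 0) * (\<Prod>x\<in>A - {y}. z (e x)))
      = (\<Sum>y\<in>insert a A. (if i = e y then 1 else 0) * (\<Prod>x\<in>insert a A - {y}. z (e x)))"
      using insert 1 2 by simp
  qed
qed

text \<open>Integration by parts in the coordinate of one factor \<open>a\<close> pairs it with every other factor
  \<open>y\<close> that belongs to the same coordinate. Coordinates are independent, so the pairings that
  count are those along which \<open>e\<close> is constant.\<close>

theorem wick:
  fixes e :: "'b \<Rightarrow> 'i"
  assumes I: "finite I" and s: "s > 0" and "finite S" "\<And>x. x \<in> S \<Longrightarrow> e x \<in> I"
  shows "(\<integral>z. (\<Prod>x\<in>S. z (e x)) \<partial>gauss_prod I s)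
    = s ^ card S * real (card {\<tau> \<in> fpf_involutions S. \<forall>x\<in>S. e (\<tau> x) = e x})"
  using assms(3,4)
proof (induction "card S" arbitrary: S rule: less_induct)
  case less
  interpret prob_space "gauss_prod I s" by (rule prob_space_gauss_prod[OF s])
  show ?case
  proof (cases "S = {}")
    case True
    have "fpf_involutions S = {id}" unfolding True fpf_involutions_def by auto
    then show ?thesis by (simp add: True prob_space)
  next
    case False
    then obtain a where a: "a \<in> S" by blast
    let ?A = "S - {a}"
    let ?F = "\<lambda>T. {\<tau> \<in> fpf_involutions T. \<forall>x\<in>T. e (\<tau> x) = e x}"
    have fA: "finite ?A" using less by simp
    have g: "has_grad I (\<lambda>z. \<Prod>x\<in>?A. z (e x)) (\<lambda>i z. \<Sum>y\<in>?A. (if i = e y then 1 else 0) * (\<Prod>x\<in>?A - {y}. z (e x)))"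
      using less by (intro has_grad_prod_coord I fA) auto
    have t: "tempered I (\<lambda>z. \<Prod>x\<in>?A - {y}. z (e x))" for y
      using less I by (intro tempered_prod tempered_coord) auto
    have sub: "?A - {y} = S - {a, y}" for y by auto
    have c1: "card (S - {a, y}) + 2 = card S" if "y \<in> ?A" for y
    proof -
      have "card {a, y} = 2" "card {a, y} \<le> card S" using that a less by (auto intro: card_mono)
      then show ?thesis using a that less by (simp add: card_Diff_subset)
    qed
    have IH: "(\<integral>z. (\<Prod>x\<in>?A - {y}. z (e x)) \<partial>gauss_prod I s) = s ^ card (S - {a, y}) * real (card (?F (S - {a, y})))"
      if y: "y \<in> ?A" for y
      unfolding sub using c1[OF y] less.prems by (intro less.hyps) auto
    have card_split: "card (?F S) = (\<Sum>y\<in>?A. if e a = e y then card (?F (S - {a, y})) else 0)"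
    proof -
      let ?G = "\<lambda>y. {\<tau> \<in> fpf_involutions S. (\<forall>x\<in>S. e (\<tau> x) = e x) \<and> \<tau> a = y}"
      have un: "?F S = (\<Union>y\<in>{y \<in> ?A. e a = e y}. ?G y)"
      proof (intro equalityI subsetI)
        fix \<tau> assume t: "\<tau> \<in> ?F S"
        then have "\<tau> a \<in> S" "\<tau> a \<noteq> a" "e a = e (\<tau> a)"
          using a by (auto simp: fpf_involutions_def permutes_in_image)
        then show "\<tau> \<in> (\<Union>y\<in>{y \<in> ?A. e a = e y}. ?G y)" using t by auto
      qed auto
      have "card (?F S) = (\<Sum>y\<in>{y \<in> ?A. e a = e y}. card (?G y))"
        unfolding un using fA finite_fpf_involutions[of S] less.prems
        by (intro card_UN_disjoint) auto
      also have "\<dots> = (\<Sum>y\<in>{y \<in> ?A. e a = e y}. card (?F (S - {a, y})))"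
        using a by (intro sum.cong refl bij_betw_same_card[symmetric, OF fpf_involutions_split]) auto
      also have "\<dots> = (\<Sum>y\<in>?A. if e a = e y then card (?F (S - {a, y})) else 0)"
        using fA by (intro sum.inter_filter)
      finally show ?thesis .
    qed
    have "(\<integral>z. (\<Prod>x\<in>S. z (e x)) \<partial>gauss_prod I s) = (\<integral>z. z (e a) * (\<Prod>x\<in>?A. z (e x)) \<partial>gauss_prod I s)"
      using a less by (intro Bochner_Integration.integral_cong refl) (simp add: prod.remove)
    also have "\<dots> = s\<^sup>2 * (\<integral>z. (\<Sum>y\<in>?A. (if e a = e y then 1 else 0) * (\<Prod>x\<in>?A - {y}. z (e x))) \<partial>gauss_prod I s)"
      using gauss_prod_integration_by_parts[OF I s g, of "e a"] a less by simp
    also have "(\<integral>z. (\<Sum>y\<in>?A. (if e a = e y then 1 else 0) * (\<Prod>x\<in>?A - {y}. z (e x))) \<partial>gauss_prod I s)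
      = (\<Sum>y\<in>?A. (if e a = e y then 1 else 0) * (\<integral>z. (\<Prod>x\<in>?A - {y}. z (e x)) \<partial>gauss_prod I s))"
      using t by (subst Bochner_Integration.integral_sum)
        (auto intro!: integrable_tempered[OF I s] tempered_mult tempered_const)
    also have "s\<^sup>2 * \<dots> = (\<Sum>y\<in>?A. s ^ card S * (if e a = e y then real (card (?F (S - {a, y}))) else 0))"
      unfolding sum_distrib_left
    proof (rule sum.cong[OF refl])
      fix y assume y: "y \<in> ?A"
      have "s ^ card S = s\<^sup>2 * s ^ card (S - {a, y})" unfolding c1[OF y, symmetric] by (simp add: power_add power2_eq_square)
      then show "s\<^sup>2 * ((if e a = e y then 1 else 0) * (\<integral>z. (\<Prod>x\<in>?A - {y}. z (e x)) \<partial>gauss_prod I s))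
         = s ^ card S * (if e a = e y then real (card (?F (S - {a, y}))) else 0)"
        by (simp add: IH[OF y])
    qed
    also have "\<dots> = s ^ card S * real (card (?F S))"
      unfolding card_split by (simp add: sum_distrib_left if_distrib cong: if_cong)
    finally show ?thesis .
  qed
qed

section \<open>Traces of matrix powers as sums over indices\<close>

lemma sum_PiE_insert:
  assumes "x \<notin> S"
  shows "(\<Sum>f\<in>PiE (insert x S) (\<lambda>_. B). F f) = (\<Sum>y\<in>B. \<Sum>g\<in>PiE S (\<lambda>_. B). F (g(x := y)))"
proof -
  have "(\<Sum>f\<in>PiE (insert x S) (\<lambda>_. B). F f) = (\<Sum>(y, g)\<in>B \<times> PiE S (\<lambda>_. B). F (g(x := y)))"
    unfolding PiE_insert_eq using inj_combinator[OF assms, of "\<lambda>_. B"]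
    by (subst sum.reindex) (auto simp: case_prod_unfold)
  then show ?thesis by (simp add: sum.cartesian_product)
qed

lemma sum_PiE_Un:
  assumes "A \<inter> C = {}"
  shows "(\<Sum>f\<in>PiE (A \<union> C) (\<lambda>_. B). F f)
    = (\<Sum>g\<in>PiE A (\<lambda>_. B). \<Sum>h\<in>PiE C (\<lambda>_. B). F (\<lambda>x. if x \<in> A then g x else h x))"
proof -
  have "(\<Sum>f\<in>PiE (A \<union> C) (\<lambda>_. B). F f)
    = (\<Sum>(g, h)\<in>PiE A (\<lambda>_. B) \<times> PiE C (\<lambda>_. B). F (\<lambda>x. if x \<in> A then g x else h x))"
  proof (rule sum.reindex_bij_witness[where i="\<lambda>(g, h) x. if x \<in> A then g x else h x"
      and j="\<lambda>f. (restrict f A, restrict f C)"])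
    fix f assume f: "f \<in> PiE (A \<union> C) (\<lambda>_. B)"
    show eq: "(case (restrict f A, restrict f C) of (g, h) \<Rightarrow> \<lambda>x. if x \<in> A then g x else h x) = f"
      using f by (auto simp: fun_eq_iff PiE_def extensional_def)
    show "(restrict f A, restrict f C) \<in> PiE A (\<lambda>_. B) \<times> PiE C (\<lambda>_. B)" using f by auto
    show "(case (restrict f A, restrict f C) of (g, h) \<Rightarrow> F (\<lambda>x. if x \<in> A then g x else h x)) = F f"
      using eq by simp
  next
    fix gh assume "gh \<in> PiE A (\<lambda>_. B) \<times> PiE C (\<lambda>_. B)"
    then show "(\<lambda>f. (restrict f A, restrict f C)) (case gh of (g, h) \<Rightarrow> \<lambda>x. if x \<in> A then g x else h x) = gh"
      "(case gh of (g, h) \<Rightarrow> \<lambda>x. if x \<in> A then g x else h x) \<in> PiE (A \<union> C) (\<lambda>_. B)"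
      using assms by (auto simp: fun_eq_iff PiE_def extensional_def restrict_def split: if_splits)
  qed
  then show ?thesis by (simp add: sum.cartesian_product)
qed

lemma sum_PiE_UN:
  fixes g :: "'k \<Rightarrow> ('a \<Rightarrow> 'b) \<Rightarrow> 'c :: comm_semiring_1"
  assumes "finite Ks" and disj: "\<And>k l. k \<in> Ks \<Longrightarrow> l \<in> Ks \<Longrightarrow> k \<noteq> l \<Longrightarrow> c k \<inter> c l = {}"
    and dep: "\<And>k f f'. k \<in> Ks \<Longrightarrow> (\<And>x. x \<in> c k \<Longrightarrow> f x = f' x) \<Longrightarrow> g k f = g k f'"
  shows "(\<Sum>f\<in>PiE (\<Union>k\<in>Ks. c k) (\<lambda>_. B). \<Prod>k\<in>Ks. g k f) = (\<Prod>k\<in>Ks. \<Sum>f\<in>PiE (c k) (\<lambda>_. B). g k f)"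
  using assms
proof (induction Ks)
  case (insert l Ks)
  let ?U = "\<Union>k\<in>Ks. c k"
  have d: "c l \<inter> ?U = {}" using insert.prems(1)[of l] insert.hyps by auto
  have "(\<Sum>f\<in>PiE (\<Union>k\<in>insert l Ks. c k) (\<lambda>_. B). \<Prod>k\<in>insert l Ks. g k f)
    = (\<Sum>f\<in>PiE (c l) (\<lambda>_. B). \<Sum>h\<in>PiE ?U (\<lambda>_. B). g l (\<lambda>x. if x \<in> c l then f x else h x)
       * (\<Prod>k\<in>Ks. g k (\<lambda>x. if x \<in> c l then f x else h x)))"
    using sum_PiE_Un[OF d, where B=B and F="\<lambda>f. g l f * (\<Prod>k\<in>Ks. g k f)"] insert.hyps by simp
  also have "\<dots> = (\<Sum>f\<in>PiE (c l) (\<lambda>_. B). \<Sum>h\<in>PiE ?U (\<lambda>_. B). g l f * (\<Prod>k\<in>Ks. g k h))"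
  proof (intro sum.cong refl arg_cong2[where f="(*)"] prod.cong)
    fix f h :: "'a \<Rightarrow> 'b"
    show "g l (\<lambda>x. if x \<in> c l then f x else h x) = g l f" by (rule insert.prems(2)) auto
    show "g k (\<lambda>x. if x \<in> c l then f x else h x) = g k h" if "k \<in> Ks" for k
      using that d by (intro insert.prems(2)) auto
  qed
  also have "\<dots> = (\<Sum>f\<in>PiE (c l) (\<lambda>_. B). g l f) * (\<Sum>h\<in>PiE ?U (\<lambda>_. B). \<Prod>k\<in>Ks. g k h)"
    by (simp only: sum_product)
  also have "(\<Sum>h\<in>PiE ?U (\<lambda>_. B). \<Prod>k\<in>Ks. g k h) = (\<Prod>k\<in>Ks. \<Sum>f\<in>PiE (c k) (\<lambda>_. B). g k f)"
  proof (rule insert.IH)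
    show "c k \<inter> c k' = {}" if "k \<in> Ks" "k' \<in> Ks" "k \<noteq> k'" for k k'
      using that by (intro insert.prems(1)) auto
    show "g k f = g k f'" if "k \<in> Ks" "\<And>x. x \<in> c k \<Longrightarrow> f x = f' x" for k f f'
      using that(1) by (intro insert.prems(2) that(2)) auto
  qed
  finally show ?case using insert.hyps by simp
qed simp

lemma pow_mat_Suc_left: "A \<in> carrier_mat N N \<Longrightarrow> A ^\<^sub>m Suc m = A * A ^\<^sub>m m"
proof (induction m)
  case (Suc m)
  then have "A ^\<^sub>m Suc (Suc m) = (A * A ^\<^sub>m m) * A" by simp
  also have "\<dots> = A * (A ^\<^sub>m m * A)" using Suc.prems by (intro assoc_mult_mat) auto
  finally show ?case by simp
qed auto

lemma index_mult_mat_sum: "A \<in> carrier_mat n k \<Longrightarrow> B \<in> carrier_mat k m \<Longrightarrow> i < n \<Longrightarrow> j < m \<Longrightarrow>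
  (A * B) $$ (i, j) = (\<Sum>l<k. A $$ (i, l) * B $$ (l, j))"
  by (simp add: scalar_prod_def atLeast0LessThan)

text \<open>Paths run from \<open>j\<close> to \<open>i\<close>, against the order of the indices, in order to match the factors
  \<open>A (i (\<sigma> y), i y)\<close> below.\<close>

lemma pow_mat_paths:
  assumes A: "A \<in> carrier_mat N N"
  shows "i < N \<Longrightarrow> j < N \<Longrightarrow> (A ^\<^sub>m m) $$ (i, j)
    = (\<Sum>f\<in>PiE {..m} (\<lambda>_. {..<N}). (if f 0 = j \<and> f m = i then \<Prod>k<m. A $$ (f (Suc k), f k) else 0))"
proof (induction m arbitrary: i)
  case 0
  have e: "(\<Sum>f\<in>PiE {..0::nat} (\<lambda>_. {..<N}). F f) = (\<Sum>y<N. F ((\<lambda>_. undefined)(0 := y)))"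
    for F :: "(nat \<Rightarrow> nat) \<Rightarrow> 'a"
  proof -
    have "(\<Sum>f\<in>PiE (insert 0 {}) (\<lambda>_. {..<N}). F f) = (\<Sum>y<N. \<Sum>g\<in>PiE {} (\<lambda>_. {..<N}). F (g(0 := y)))"
      by (rule sum_PiE_insert) simp
    then show ?thesis unfolding atMost_0 PiE_empty_domain by (simp add: fun_upd_def)
  qed
  have "(\<Sum>f\<in>PiE {..0} (\<lambda>_. {..<N}). (if f 0 = j \<and> f 0 = i then \<Prod>k<0. A $$ (f (Suc k), f k) else 0))
    = (\<Sum>y<N. if y = j \<and> y = i then 1 else 0)"
    unfolding e by (simp cong: if_cong)
  also have "\<dots> = (\<Sum>y<N. if y = j then (if y = i then 1 else 0) else 0)" by (intro sum.cong) auto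
  also have "\<dots> = (if j = i then 1 else 0)" using 0 by (simp add: sum.delta)
  finally show ?case using A 0 by auto
next
  case (Suc m)
  let ?p = "\<lambda>f. \<Prod>k<m. A $$ (f (Suc k), f k)"
  have ins: "{..Suc m} = insert (Suc m) {..m}" by auto
  have "(A ^\<^sub>m Suc m) $$ (i, j) = (\<Sum>l<N. A $$ (i, l) * (A ^\<^sub>m m) $$ (l, j))"
    unfolding pow_mat_Suc_left[OF A]
    by (rule index_mult_mat_sum[OF A pow_carrier_mat[OF A] Suc.prems])
  also have "\<dots> = (\<Sum>l<N. \<Sum>f\<in>PiE {..m} (\<lambda>_. {..<N}). A $$ (i, l) * (if f 0 = j \<and> f m = l then ?p f else 0))"
    using Suc by (simp add: sum_distrib_left)
  also have "\<dots> = (\<Sum>f\<in>PiE {..m} (\<lambda>_. {..<N}). \<Sum>l<N. A $$ (i, l) * (if f 0 = j \<and> f m = l then ?p f else 0))"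
    by (rule sum.swap)
  also have "\<dots> = (\<Sum>f\<in>PiE {..m} (\<lambda>_. {..<N}). if f 0 = j then A $$ (i, f m) * ?p f else 0)"
  proof (rule sum.cong[OF refl])
    fix f assume f: "f \<in> PiE {..m} (\<lambda>_. {..<N})"
    then have "f m < N" by auto
    moreover have "(\<Sum>l<N. A $$ (i, l) * (if f 0 = j \<and> f m = l then ?p f else 0))
      = (\<Sum>l<N. if f m = l then (if f 0 = j then A $$ (i, l) * ?p f else 0) else 0)"
      by (intro sum.cong) auto
    ultimately show "(\<Sum>l<N. A $$ (i, l) * (if f 0 = j \<and> f m = l then ?p f else 0)) = (if f 0 = j then A $$ (i, f m) * ?p f else 0)"
      by (simp add: sum.delta)
  qed
  also have "\<dots> = (\<Sum>y<N. \<Sum>f\<in>PiE {..m} (\<lambda>_. {..<N}). if y = i then (if f 0 = j then A $$ (y, f m) * ?p f else 0) else 0)"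
    using Suc.prems by (subst sum.swap) (simp add: sum.delta)
  also have "\<dots> = (\<Sum>f\<in>PiE {..Suc m} (\<lambda>_. {..<N}). (if f 0 = j \<and> f (Suc m) = i then \<Prod>k<Suc m. A $$ (f (Suc k), f k) else 0))"
    unfolding ins
    by (subst sum_PiE_insert, simp, intro sum.cong refl) (auto simp: mult_ac intro!: arg_cong2[where f="(*)"] prod.cong)
  finally show ?case .
qed

lemma mat_Tr_pow_cycle:
  assumes A: "A \<in> carrier_mat N N" and m: "m \<ge> 1"
  shows "mat_Tr (A ^\<^sub>m m) = (\<Sum>f\<in>PiE {..<m} (\<lambda>_. {..<N}). \<Prod>k<m. A $$ (f (Suc k mod m), f k))"
proof -
  obtain r where r: "m = Suc r" using m by (cases m) auto
  let ?p = "\<lambda>f. \<Prod>k<r. A $$ (f (Suc k), f k)"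
  have "mat_Tr (A ^\<^sub>m m) = (\<Sum>i<N. (A ^\<^sub>m Suc r) $$ (i, i))"
    using A by (simp add: mat_Tr_def r)
  also have "\<dots> = (\<Sum>i<N. \<Sum>l<N. A $$ (i, l) * (A ^\<^sub>m r) $$ (l, i))"
    unfolding pow_mat_Suc_left[OF A]
    by (intro sum.cong refl index_mult_mat_sum[OF A pow_carrier_mat[OF A]]) auto
  also have "\<dots> = (\<Sum>i<N. \<Sum>l<N. \<Sum>f\<in>PiE {..r} (\<lambda>_. {..<N}). A $$ (i, l) * (if f 0 = i \<and> f r = l then ?p f else 0))"
    by (simp add: pow_mat_paths[OF A] sum_distrib_left)
  also have "\<dots> = (\<Sum>i<N. \<Sum>f\<in>PiE {..r} (\<lambda>_. {..<N}). \<Sum>l<N. A $$ (i, l) * (if f 0 = i \<and> f r = l then ?p f else 0))"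
    by (intro sum.cong refl sum.swap)
  also have "\<dots> = (\<Sum>f\<in>PiE {..r} (\<lambda>_. {..<N}). \<Sum>i<N. \<Sum>l<N. A $$ (i, l) * (if f 0 = i \<and> f r = l then ?p f else 0))"
    by (rule sum.swap)
  also have "\<dots> = (\<Sum>f\<in>PiE {..r} (\<lambda>_. {..<N}). A $$ (f 0, f r) * ?p f)"
  proof (rule sum.cong[OF refl])
    fix f assume f: "f \<in> PiE {..r} (\<lambda>_. {..<N})"
    then have f: "f r < N" "f 0 < N" by auto
    have "(\<Sum>i<N. \<Sum>l<N. A $$ (i, l) * (if f 0 = i \<and> f r = l then ?p f else 0))
      = (\<Sum>i<N. \<Sum>l<N. if f r = l then (if f 0 = i then A $$ (i, l) * ?p f else 0) else 0)"
      by (intro sum.cong refl) simp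
    also have "\<dots> = (\<Sum>i<N. if f 0 = i then A $$ (i, f r) * ?p f else 0)"
      using f by (simp only: sum.delta' finite_lessThan lessThan_iff if_True)
    also have "\<dots> = A $$ (f 0, f r) * ?p f"
      using f by (simp only: sum.delta' finite_lessThan lessThan_iff if_True)
    finally show "(\<Sum>i<N. \<Sum>l<N. A $$ (i, l) * (if f 0 = i \<and> f r = l then ?p f else 0)) = A $$ (f 0, f r) * ?p f" .
  qed
  also have "\<dots> = (\<Sum>f\<in>PiE {..<m} (\<lambda>_. {..<N}). \<Prod>k<m. A $$ (f (Suc k mod m), f k))"
    unfolding r lessThan_Suc_atMost[symmetric]
  proof (rule sum.cong[OF refl])
    fix f :: "nat \<Rightarrow> nat"
    have "(\<Prod>k<r. A $$ (f (Suc k mod Suc r), f k)) = ?p f" by (intro prod.cong) auto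
    then show "A $$ (f 0, f r) * ?p f = (\<Prod>k<Suc r. A $$ (f (Suc k mod Suc r), f k))" by (simp add: mult_ac)
  qed
  finally show ?thesis .
qed

lemma orbit_enum:
  fixes x :: 'a
  assumes p: "permutation \<sigma>"
  defines "m \<equiv> card (orbit \<sigma> x)"
  shows "m \<ge> 1" "bij_betw (\<lambda>k. (\<sigma> ^^ k) x) {..<m} (orbit \<sigma> x)"
    "\<And>k. k < m \<Longrightarrow> \<sigma> ((\<sigma> ^^ k) x) = (\<sigma> ^^ (Suc k mod m)) x"
proof -
  have x: "x \<in> orbit \<sigma> x" by (rule permutation_self_in_orbit[OF p])
  let ?d = "funpow_dist1 \<sigma> x x"
  have inj: "inj_on (\<lambda>n. (\<sigma> ^^ n) x) {0..<?d}" by (rule inj_on_funpow_dist1[OF x])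
  have im: "orbit \<sigma> x = (\<lambda>n. (\<sigma> ^^ n) x) ` {0..<?d}" by (rule orbit_conv_funpow_dist1[OF x])
  have md: "m = ?d" unfolding m_def by (subst im) (simp only: card_image[OF inj] card_atLeastLessThan diff_zero)
  show "m \<ge> 1" unfolding md by simp
  show "bij_betw (\<lambda>k. (\<sigma> ^^ k) x) {..<m} (orbit \<sigma> x)"
    unfolding md bij_betw_def using inj im by (simp only: atLeast0LessThan simp_thms)
  fix k assume k: "k < m"
  show "\<sigma> ((\<sigma> ^^ k) x) = (\<sigma> ^^ (Suc k mod m)) x"
  proof (cases "Suc k = m")
    case True
    have "(\<sigma> ^^ Suc k) x = x" using funpow_dist1_prop[OF x] unfolding True md .
    then have "\<sigma> ((\<sigma> ^^ k) x) = x" by simp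
    then show ?thesis using True by simp
  next
    case False
    then show ?thesis using k by simp
  qed
qed

text \<open>A cycle of \<open>\<sigma>\<close> is enumerated by the iterates of \<open>\<sigma>\<close>, which turns a closed path of length \<open>m\<close>
  into an index function on the cycle.\<close>

lemma trace_of_orbit:
  assumes A: "A \<in> carrier_mat N N" and p: "permutation \<sigma>"
  shows "(\<Sum>i\<in>PiE (orbit \<sigma> x) (\<lambda>_. {..<N}). \<Prod>y\<in>orbit \<sigma> x. A $$ (i (\<sigma> y), i y))
    = mat_Tr (A ^\<^sub>m card (orbit \<sigma> x))"
proof -
  let ?c = "orbit \<sigma> x" let ?m = "card ?c" let ?\<beta> = "\<lambda>k. (\<sigma> ^^ k) x"
  note e = orbit_enum[OF p, where x=x]
  have \<beta>: "\<And>k. k < ?m \<Longrightarrow> ?\<beta> k \<in> ?c" using e(2) by (auto simp: bij_betw_def)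
  have mod: "\<And>k. k < ?m \<Longrightarrow> Suc k mod ?m < ?m" using e(1) by simp
  have "mat_Tr (A ^\<^sub>m ?m) = (\<Sum>f\<in>PiE {..<?m} (\<lambda>_. {..<N}). \<Prod>k<?m. A $$ (f (Suc k mod ?m), f k))"
    by (rule mat_Tr_pow_cycle[OF A e(1)])
  also have "\<dots> = (\<Sum>i\<in>PiE ?c (\<lambda>_. {..<N}). \<Prod>y\<in>?c. A $$ (i (\<sigma> y), i y))"
  proof (rule sum.reindex_bij_witness[where i="\<lambda>i. restrict (\<lambda>k. i (?\<beta> k)) {..<?m}"
        and j="\<lambda>f. restrict (\<lambda>y. f (the_inv_into {..<?m} ?\<beta> y)) ?c"])
    have inj: "inj_on ?\<beta> {..<?m}" using e(2) by (auto simp: bij_betw_def)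
    have ti: "the_inv_into {..<?m} ?\<beta> (?\<beta> k) = k" if "k < ?m" for k
      using inj that by (intro the_inv_into_f_f) auto
    have it: "?\<beta> (the_inv_into {..<?m} ?\<beta> y) = y" "the_inv_into {..<?m} ?\<beta> y < ?m" if "y \<in> ?c" for y
      using f_the_inv_into_f_bij_betw[OF e(2) that]
        bij_betwE[OF bij_betw_the_inv_into[OF e(2)]] that by auto
    {
      fix f assume f: "f \<in> PiE {..<?m} (\<lambda>_. {..<N})"
      let ?i = "restrict (\<lambda>y. f (the_inv_into {..<?m} ?\<beta> y)) ?c"
      show "restrict (\<lambda>k. ?i (?\<beta> k)) {..<?m} = f"
        using f \<beta> ti by (intro ext) (auto simp: PiE_def extensional_def restrict_def)
      show "?i \<in> PiE ?c (\<lambda>_. {..<N})" using f it by auto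
      have "(\<Prod>y\<in>?c. A $$ (?i (\<sigma> y), ?i y)) = (\<Prod>k<?m. A $$ (?i (\<sigma> (?\<beta> k)), ?i (?\<beta> k)))"
        by (rule prod.reindex_bij_betw[OF e(2), symmetric])
      also have "\<dots> = (\<Prod>k<?m. A $$ (f (Suc k mod ?m), f k))"
        using e(3) \<beta> ti mod by (intro prod.cong refl) (simp del: funpow.simps)
      finally show "(\<Prod>y\<in>?c. A $$ (?i (\<sigma> y), ?i y)) = (\<Prod>k<?m. A $$ (f (Suc k mod ?m), f k))" .
    next
      fix i assume i: "i \<in> PiE ?c (\<lambda>_. {..<N})"
      show "restrict (\<lambda>y. restrict (\<lambda>k. i (?\<beta> k)) {..<?m} (the_inv_into {..<?m} ?\<beta> y)) ?c = i"
        using i it by (intro ext) (auto simp: PiE_def extensional_def restrict_def)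
      show "restrict (\<lambda>k. i (?\<beta> k)) {..<?m} \<in> PiE {..<?m} (\<lambda>_. {..<N})" using i \<beta> by auto
    }
  qed
  finally show ?thesis ..
qed

lemma orbit_eq_of_mem:
  assumes "permutation \<sigma>" "y \<in> orbit \<sigma> x"
  shows "orbit \<sigma> y = orbit \<sigma> x"
proof
  show "orbit \<sigma> y \<subseteq> orbit \<sigma> x" by (rule subsetI, rule orbit_trans[OF _ assms(2)])
  have x: "x \<in> orbit \<sigma> y"
    by (rule orbit_swap[OF permutation_self_in_orbit[OF assms(1)] assms(2)])
  show "orbit \<sigma> x \<subseteq> orbit \<sigma> y" by (rule subsetI, rule orbit_trans[OF _ x])
qed

lemma orbits_disjoint:
  assumes "permutation \<sigma>" "orbit \<sigma> x \<inter> orbit \<sigma> y \<noteq> {}"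
  shows "orbit \<sigma> x = orbit \<sigma> y"
proof -
  obtain z where "z \<in> orbit \<sigma> x" "z \<in> orbit \<sigma> y" using assms(2) by blast
  then show ?thesis using orbit_eq_of_mem[OF assms(1), of z x] orbit_eq_of_mem[OF assms(1), of z y] by simp
qed

lemma trace_of_permutation:
  fixes S :: "int set"
  assumes A: "A \<in> carrier_mat N N" and fin: "finite S" and \<sigma>: "\<sigma> permutes S"
  shows "(\<Sum>i\<in>PiE S (\<lambda>_. {..<N}). \<Prod>y\<in>S. A $$ (i (\<sigma> y), i y))
    = (\<Prod>c\<in>cycles_on S \<sigma>. mat_Tr (A ^\<^sub>m card c))"
proof -
  have p: "permutation \<sigma>" by (rule permutes_imp_permutation[OF fin \<sigma>])
  let ?C = "cycles_on S \<sigma>"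
  have fC: "finite ?C" using fin by (simp add: cycles_on_def)
  have U: "(\<Union>c\<in>?C. c) = S"
    using permutation_self_in_orbit[OF p] permutes_orbit_subset[OF \<sigma>] by (auto simp: cycles_on_def)
  have disj: "c \<inter> c' = {}" if "c \<in> ?C" "c' \<in> ?C" "c \<noteq> c'" for c c'
    using that orbits_disjoint[OF p] by (auto simp: cycles_on_def)
  have fc: "finite c" if "c \<in> ?C" for c
    by (rule finite_subset[OF _ fin]) (use that U in blast)
  have "(\<Sum>i\<in>PiE S (\<lambda>_. {..<N}). \<Prod>y\<in>S. A $$ (i (\<sigma> y), i y))
    = (\<Sum>i\<in>PiE (\<Union>c\<in>?C. c) (\<lambda>_. {..<N}). \<Prod>c\<in>?C. \<Prod>y\<in>c. A $$ (i (\<sigma> y), i y))"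
  proof -
    have "(\<Prod>y\<in>(\<Union>c\<in>?C. c). A $$ (i (\<sigma> y), i y)) = (\<Prod>c\<in>?C. \<Prod>y\<in>c. A $$ (i (\<sigma> y), i y))" for i
      using fC fc disj by (intro prod.UNION_disjoint) auto
    then show ?thesis unfolding U by simp
  qed
  also have "\<dots> = (\<Prod>c\<in>?C. \<Sum>i\<in>PiE c (\<lambda>_. {..<N}). \<Prod>y\<in>c. A $$ (i (\<sigma> y), i y))"
  proof (rule sum_PiE_UN[OF fC disj])
    fix c and f f' :: "int \<Rightarrow> nat" assume c: "c \<in> ?C" and eq: "\<And>x. x \<in> c \<Longrightarrow> f x = f' x"
    show "(\<Prod>y\<in>c. A $$ (f (\<sigma> y), f y)) = (\<Prod>y\<in>c. A $$ (f' (\<sigma> y), f' y))"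
    proof (rule prod.cong[OF refl])
      fix y assume y: "y \<in> c"
      then have "\<sigma> y \<in> c" using c by (auto simp: cycles_on_def intro: orbit.step)
      then show "A $$ (f (\<sigma> y), f y) = A $$ (f' (\<sigma> y), f' y)" using eq y by simp
    qed
  qed
  also have "\<dots> = (\<Prod>c\<in>?C. mat_Tr (A ^\<^sub>m card c))"
    using trace_of_orbit[OF A p] by (intro prod.cong refl) (auto simp: cycles_on_def)
  finally show ?thesis .
qed

section \<open>Premaps\<close>

definition neg_on :: "nat \<Rightarrow> int \<Rightarrow> int" where
  "neg_on m k = (if k \<in> pm_set m then - k else k)"

lemma pm_set_iff: "k \<in> pm_set m \<longleftrightarrow> k \<noteq> 0 \<and> \<bar>k\<bar> \<le> int m"
proof -
  have "k \<in> uminus ` {1..int m} \<longleftrightarrow> - k \<in> {1..int m}" by (metis add.inverse_inverse image_iff)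
  then show ?thesis by (auto simp: pm_set_def)
qed

lemma finite_pm_set [simp]: "finite (pm_set m)" by (simp add: pm_set_def)

lemma neg_in_pm_set [simp]: "- k \<in> pm_set m \<longleftrightarrow> k \<in> pm_set m" by (simp add: pm_set_iff)

lemma neg_on_neg_on [simp]: "neg_on m (neg_on m k) = k" by (simp add: neg_on_def)

lemma neg_on_permutes: "neg_on m permutes pm_set m"
  unfolding permutes_def by (auto simp: neg_on_def) (metis neg_on_def neg_on_neg_on)+

lemma premap_neg_eq:
  assumes "\<pi> permutes pm_set m"
  shows "(\<forall>k \<in> pm_set m. \<pi> k = - Hilbert_Choice.inv \<pi> (- k)) \<longleftrightarrow> (\<forall>k \<in> pm_set m. \<pi> (- \<pi> k) = - k)"
proof -
  have "\<pi> k = - Hilbert_Choice.inv \<pi> (- k) \<longleftrightarrow> \<pi> (- \<pi> k) = - k" for k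
    using permutes_inv_eq[OF assms, of "- k" "- \<pi> k"] by (metis add.inverse_inverse)
  then show ?thesis by simp
qed

text \<open>If \<open>k\<close> and \<open>- k\<close> lay on one cycle, moving both one step towards each other would shorten
  their distance along the cycle by two, until \<open>\<pi> k = - k\<close> or \<open>k = - k\<close>.\<close>

lemma no_self_opposite:
  assumes \<pi>: "\<pi> permutes pm_set m" and r: "\<And>k. k \<in> pm_set m \<Longrightarrow> \<pi> (- \<pi> k) = - k"
    and f: "\<And>k. k \<in> pm_set m \<Longrightarrow> \<pi> k \<noteq> - k"
  shows "k \<in> pm_set m \<Longrightarrow> (\<pi> ^^ j) k \<noteq> - k"
proof (induction j arbitrary: k rule: less_induct)
  case (less j)
  have S: "\<pi> k \<in> pm_set m" using permutes_in_image[OF \<pi>] less.prems by blast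
  consider "j = 0" | "j = 1" | i where "j = Suc (Suc i)" by (metis One_nat_def not0_implies_Suc)
  then show ?case
  proof cases
    case 1
    then show ?thesis using less.prems by (simp add: pm_set_iff)
  next
    case 2
    then show ?thesis using f[OF less.prems] by simp
  next
    case 3
    show ?thesis
    proof
      assume "(\<pi> ^^ j) k = - k"
      then have "\<pi> ((\<pi> ^^ Suc i) k) = \<pi> (- \<pi> k)" using 3 r[OF less.prems] by simp
      then have "(\<pi> ^^ Suc i) k = - \<pi> k" using permutes_inj[OF \<pi>] by (simp add: inj_eq)
      then have "(\<pi> ^^ i) (\<pi> k) = - \<pi> k" by (simp add: funpow_swap1)
      then show False using less.IH[OF _ S, of i] 3 by simp
    qed
  qed
qed

text \<open>The equation \<open>\<pi> (- \<pi> k) = - k\<close> says that \<open>\<tau> = \<pi> \<circ> neg\<close> is an involution. Given this, the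
  condition on cycles holds as soon as \<open>\<tau>\<close> has no fixed point, by \<open>no_self_opposite\<close>.\<close>

lemma premaps_iff: "\<pi> \<in> premaps m \<longleftrightarrow> \<pi> \<circ> neg_on m \<in> fpf_involutions (pm_set m)"
proof
  let ?S = "pm_set m"
  assume "\<pi> \<in> premaps m"
  then have p: "\<pi> permutes ?S" and r: "\<And>k. k \<in> ?S \<Longrightarrow> \<pi> (- \<pi> k) = - k"
    and c: "\<And>x k. x \<in> ?S \<Longrightarrow> k \<in> orbit \<pi> x \<Longrightarrow> - k \<notin> orbit \<pi> x"
    using premap_neg_eq[of \<pi> m] by (auto simp: premaps_def cycles_on_def)
  have perm: "permutation \<pi>" by (rule permutes_imp_permutation[OF finite_pm_set p])
  have P: "\<pi> \<circ> neg_on m permutes ?S" by (rule permutes_compose[OF neg_on_permutes p])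
  have "(\<pi> \<circ> neg_on m) ((\<pi> \<circ> neg_on m) x) = x \<and> (\<pi> \<circ> neg_on m) x \<noteq> x" if x: "x \<in> ?S" for x
  proof
    have m: "- x \<in> ?S" using x by simp
    then have "\<pi> (- x) \<in> ?S" using permutes_in_image[OF p] by blast
    then show "(\<pi> \<circ> neg_on m) ((\<pi> \<circ> neg_on m) x) = x" using x r[OF m] by (simp add: neg_on_def)
    have "\<pi> (- x) \<noteq> x"
    proof
      assume "\<pi> (- x) = x"
      then have "x \<in> orbit \<pi> (- x)" by (metis orbit.base)
      then show False using c[OF m permutation_self_in_orbit[OF perm]] by simp
    qed
    then show "(\<pi> \<circ> neg_on m) x \<noteq> x" using x by (simp add: neg_on_def)
  qed
  then show "\<pi> \<circ> neg_on m \<in> fpf_involutions ?S" using P by (simp add: fpf_involutions_def)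
next
  let ?S = "pm_set m" let ?t = "\<pi> \<circ> neg_on m"
  assume "?t \<in> fpf_involutions ?S"
  then have P: "?t permutes ?S" and i: "\<And>x. x \<in> ?S \<Longrightarrow> ?t (?t x) = x" "\<And>x. x \<in> ?S \<Longrightarrow> ?t x \<noteq> x"
    by (auto simp: fpf_involutions_def)
  have eq: "\<pi> = ?t \<circ> neg_on m" by (simp add: fun_eq_iff)
  have p: "\<pi> permutes ?S" by (subst eq) (rule permutes_compose[OF neg_on_permutes P])
  have perm: "permutation \<pi>" by (rule permutes_imp_permutation[OF finite_pm_set p])
  have r: "\<pi> (- \<pi> k) = - k" if k: "k \<in> ?S" for k
  proof -
    have "\<pi> k \<in> ?S" using permutes_in_image[OF p] k by blast
    then show ?thesis using i(1)[of "- k"] k by (simp add: neg_on_def)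
  qed
  have f: "\<pi> k \<noteq> - k" if k: "k \<in> ?S" for k
    using i(2)[of "- k"] k by (simp add: neg_on_def)
  have "\<not> (k \<in> orbit \<pi> x \<and> - k \<in> orbit \<pi> x)" if x: "x \<in> ?S" for x k
  proof
    assume a: "k \<in> orbit \<pi> x \<and> - k \<in> orbit \<pi> x"
    then have k: "k \<in> ?S" using permutes_orbit_subset[OF p x] by blast
    have "- k \<in> orbit \<pi> k" using a orbit_eq_of_mem[OF perm, of k x] by simp
    then obtain j where "(\<pi> ^^ j) k = - k" by (auto simp: orbit_altdef)
    then show False using no_self_opposite[OF p r f k] by blast
  qed
  then show "\<pi> \<in> premaps m"
    using p premap_neg_eq[OF p] r by (auto simp: premaps_def cycles_on_def)
qed

lemma bij_betw_premaps: "bij_betw (\<lambda>\<tau>. \<tau> \<circ> neg_on m) (fpf_involutions (pm_set m)) (premaps m)"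
proof (rule bij_betw_byWitness[where f'="\<lambda>\<pi>. \<pi> \<circ> neg_on m"])
  have [simp]: "\<tau> \<circ> neg_on m \<circ> neg_on m = \<tau>" for \<tau> by (simp add: fun_eq_iff)
  show "\<forall>\<tau>\<in>fpf_involutions (pm_set m). \<tau> \<circ> neg_on m \<circ> neg_on m = \<tau>"
    "\<forall>\<pi>\<in>premaps m. \<pi> \<circ> neg_on m \<circ> neg_on m = \<pi>" by simp_all
  show "(\<lambda>\<tau>. \<tau> \<circ> neg_on m) ` fpf_involutions (pm_set m) \<subseteq> premaps m"
    "(\<lambda>\<pi>. \<pi> \<circ> neg_on m) ` premaps m \<subseteq> fpf_involutions (pm_set m)"
    by (auto simp: premaps_iff)
qed

lemma finite_premaps: "finite (premaps m)"
  using bij_betw_finite[OF bij_betw_premaps] finite_fpf_involutions[of "pm_set m"] by simp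

locale premap =
  fixes m :: nat and \<pi> :: "int \<Rightarrow> int"
  assumes premap: "\<pi> \<in> premaps m"
begin

lemma permutes: "\<pi> permutes pm_set m" using premap by (simp add: premaps_def)

lemma permutation: "permutation \<pi>" by (rule permutes_imp_permutation[OF finite_pm_set permutes])

lemma pi_in: "k \<in> pm_set m \<Longrightarrow> \<pi> k \<in> pm_set m" using permutes_in_image[OF permutes] by blast

lemma pi_neg: "k \<in> pm_set m \<Longrightarrow> \<pi> (- \<pi> k) = - k"
  using premap premap_neg_eq[OF permutes] by (simp add: premaps_def)

lemma no_opposite: "x \<in> pm_set m \<Longrightarrow> k \<in> orbit \<pi> x \<Longrightarrow> - k \<notin> orbit \<pi> x"
  using premap by (auto simp: premaps_def cycles_on_def)

lemma orbit_in: "x \<in> pm_set m \<Longrightarrow> y \<in> orbit \<pi> x \<Longrightarrow> y \<in> pm_set m"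
  using permutes_orbit_subset[OF permutes] by blast

lemma neg_pi_in_orbit: "k \<in> pm_set m \<Longrightarrow> - \<pi> k \<in> orbit \<pi> (- k)"
proof -
  assume k: "k \<in> pm_set m"
  have "- k \<in> orbit \<pi> (- \<pi> k)" using pi_neg[OF k] orbit.base[of \<pi> "- \<pi> k"] by simp
  then show ?thesis by (rule orbit_swap[OF permutation_self_in_orbit[OF permutation]])
qed

lemma neg_in_orbit: "x \<in> pm_set m \<Longrightarrow> y \<in> orbit \<pi> x \<Longrightarrow> - y \<in> orbit \<pi> (- x)"
proof (erule orbit.induct)
  assume x: "x \<in> pm_set m"
  show "- \<pi> x \<in> orbit \<pi> (- x)" by (rule neg_pi_in_orbit[OF x])
  fix y assume y: "y \<in> orbit \<pi> x" "- y \<in> orbit \<pi> (- x)"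
  have "- \<pi> y \<in> orbit \<pi> (- y)" by (rule neg_pi_in_orbit[OF orbit_in[OF x y(1)]])
  then show "- \<pi> y \<in> orbit \<pi> (- x)" by (rule orbit_trans[OF _ y(2)])
qed

lemma orbit_neg: "x \<in> pm_set m \<Longrightarrow> y \<in> orbit \<pi> (- x) \<longleftrightarrow> - y \<in> orbit \<pi> x"
  using neg_in_orbit[of x "- y"] neg_in_orbit[of "- x" y] by auto

lemma half_iff: "x \<in> half_set m \<pi> \<longleftrightarrow> x \<in> pm_set m \<and> particular (orbit \<pi> x)"
proof
  assume "x \<in> half_set m \<pi>"
  then obtain y where y: "y \<in> pm_set m" "particular (orbit \<pi> y)" "x \<in> orbit \<pi> y"
    by (auto simp: half_set_def cycles_on_def)
  then show "x \<in> pm_set m \<and> particular (orbit \<pi> x)"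
    using orbit_in orbit_eq_of_mem[OF permutation y(3)] by auto
next
  assume "x \<in> pm_set m \<and> particular (orbit \<pi> x)"
  then show "x \<in> half_set m \<pi>"
    using permutation_self_in_orbit[OF permutation, of x] by (auto simp: half_set_def cycles_on_def)
qed

lemma half_subset: "half_set m \<pi> \<subseteq> pm_set m" using half_iff by blast

text \<open>The cycles of \<open>k\<close> and \<open>- k\<close> are different and opposite to each other; the element of
  smallest absolute value of one is the negative of that of the other, so exactly one is
  particular.\<close>

lemma half_neg: "x \<in> pm_set m \<Longrightarrow> - x \<in> half_set m \<pi> \<longleftrightarrow> x \<notin> half_set m \<pi>"
proof -
  assume x: "x \<in> pm_set m"
  let ?c = "orbit \<pi> x"
  obtain k where k: "k \<in> ?c" "\<And>j. j \<in> ?c \<Longrightarrow> \<bar>k\<bar> \<le> \<bar>j\<bar>"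
    using ex_has_least_nat[of "\<lambda>k. k \<in> ?c" x "\<lambda>k. nat \<bar>k\<bar>"] permutation_self_in_orbit[OF permutation, of x]
    by (metis abs_ge_zero nat_le_eq_zle)
  have nk: "- k \<notin> ?c" by (rule no_opposite[OF x k(1)])
  have k0: "k \<noteq> 0" using orbit_in[OF x k(1)] by (simp add: pm_set_iff)
  have 1: "particular ?c \<longleftrightarrow> k > 0"
  proof
    assume "particular ?c"
    then obtain k' where k': "k' \<in> ?c" "k' > 0" "\<forall>j\<in>?c. \<bar>k'\<bar> \<le> \<bar>j\<bar>" by (auto simp: particular_def)
    then have "\<bar>k'\<bar> = \<bar>k\<bar>" using k(2)[OF k'(1)] k'(3)[rule_format, OF k(1)] by linarith
    then have "k' = k \<or> k' = - k" by linarith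
    then show "k > 0" using k' nk by auto
  qed (use k in \<open>auto simp: particular_def\<close>)
  have 2: "particular (orbit \<pi> (- x)) \<longleftrightarrow> k < 0"
  proof
    assume "particular (orbit \<pi> (- x))"
    then obtain k' where k': "k' \<in> orbit \<pi> (- x)" "k' > 0" "\<forall>j\<in>orbit \<pi> (- x). \<bar>k'\<bar> \<le> \<bar>j\<bar>"
      by (auto simp: particular_def)
    have mk: "- k \<in> orbit \<pi> (- x)" "- k' \<in> ?c" using k k' orbit_neg[OF x] by auto
    have "\<bar>k'\<bar> \<le> \<bar>k\<bar>" "\<bar>k\<bar> \<le> \<bar>k'\<bar>" using k'(3)[rule_format, OF mk(1)] k(2)[OF mk(2)] by auto
    then have "k' = k \<or> k' = - k" by linarith
    then show "k < 0" using k' nk mk by auto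
  next
    assume "k < 0"
    moreover have "- k \<in> orbit \<pi> (- x)" using k orbit_neg[OF x] by simp
    moreover have "\<bar>- k\<bar> \<le> \<bar>j\<bar>" if "j \<in> orbit \<pi> (- x)" for j using k(2)[of "- j"] that orbit_neg[OF x] by simp
    ultimately show "particular (orbit \<pi> (- x))" unfolding particular_def by (intro bexI[of _ "- k"]) auto
  qed
  show ?thesis using 1 2 k0 x by (auto simp: half_iff)
qed

lemma half_pi: "x \<in> half_set m \<pi> \<Longrightarrow> \<pi> x \<in> half_set m \<pi>"
  using half_iff pi_in permutation_orbit_step[OF permutation] by simp

lemma half_apply: "x \<in> half_set m \<pi> \<Longrightarrow> half m \<pi> x = \<pi> x"
  by (simp add: half_def perm_restrict_def)

lemma half_permutes: "half m \<pi> permutes half_set m \<pi>"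
proof -
  have fin: "finite (half_set m \<pi>)" by (rule finite_subset[OF half_subset finite_pm_set])
  have "inj_on \<pi> (half_set m \<pi>)" using permutes_inj[OF permutes] by (rule inj_on_subset) simp
  moreover have "\<pi> ` half_set m \<pi> \<subseteq> half_set m \<pi>" using half_pi by blast
  ultimately have b: "bij_betw \<pi> (half_set m \<pi>) (half_set m \<pi>)"
    using fin by (simp add: bij_betw_def endo_inj_surj)
  then have "bij_betw (half m \<pi>) (half_set m \<pi>) (half_set m \<pi>)"
    by (subst bij_betw_cong[of _ _ \<pi>]) (auto simp: half_apply)
  then show ?thesis by (rule bij_imp_permutes) (simp add: half_def perm_restrict_def)
qed

lemma finite_half: "finite (half_set m \<pi>)" by (rule finite_subset[OF half_subset finite_pm_set])

lemma abs_half: "bij_betw abs (half_set m \<pi>) {1..int m}"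
  unfolding bij_betw_def
proof
  show "inj_on abs (half_set m \<pi>)"
  proof (rule inj_onI)
    fix x y assume xy: "x \<in> half_set m \<pi>" "y \<in> half_set m \<pi>" "\<bar>x\<bar> = \<bar>y\<bar>"
    then have "x = y \<or> x = - y" by linarith
    then show "x = y" using xy half_neg[of y] half_subset by auto
  qed
  show "abs ` half_set m \<pi> = {1..int m}"
  proof (intro equalityI subsetI)
    fix k assume "k \<in> abs ` half_set m \<pi>"
    then show "k \<in> {1..int m}" using half_subset by (force simp: pm_set_iff)
  next
    fix k assume k: "k \<in> {1..int m}"
    then have "k \<in> pm_set m" by (simp add: pm_set_iff)
    then have "k \<in> half_set m \<pi> \<or> - k \<in> half_set m \<pi>" using half_neg by blast
    then show "k \<in> abs ` half_set m \<pi>" using k by (force intro: rev_image_eqI)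
  qed
qed

text \<open>An index function that is invariant under the pairing is determined by its restriction to
  the particular cycles, since \<open>i (- y) = i (\<pi> y)\<close>, and this restriction is arbitrary. The
  factor of \<open>k\<close> then reads \<open>A (i (\<pi> y), i y)\<close> with \<open>y = \<plusminus>k\<close> particular, which the symmetry of
  \<open>A\<close> makes independent of the sign. The product over a cycle is a closed path.\<close>

lemma sum_invariant_indices:
  assumes A: "A \<in> carrier_mat N N" and sym: "\<And>i j. i < N \<Longrightarrow> j < N \<Longrightarrow> A $$ (i, j) = A $$ (j, i)"
  shows "(\<Sum>i\<in>{i \<in> PiE (pm_set m) (\<lambda>_. {..<N}). \<forall>x\<in>pm_set m. i ((\<pi> \<circ> neg_on m) x) = i x}.
      \<Prod>k\<in>{1..int m}. A $$ (i k, i (- k)))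
    = (\<Prod>c\<in>cycles_on (half_set m \<pi>) (half m \<pi>). mat_Tr (A ^\<^sub>m card c))"
proof -
  let ?S = "pm_set m" let ?H = "half_set m \<pi>"
  let ?ext = "\<lambda>f x. if x \<in> ?H then f x else if x \<in> ?S then f (\<pi> (- x)) else undefined"
  have t: "(\<pi> \<circ> neg_on m) x = \<pi> (- x)" if "x \<in> ?S" for x using that by (simp add: neg_on_def)
  have ext_neg: "?ext f (- y) = f (\<pi> y)" if "y \<in> ?H" for f :: "int \<Rightarrow> nat" and y
    using that half_neg[of y] half_subset by auto
  have "(\<Sum>i\<in>{i \<in> PiE ?S (\<lambda>_. {..<N}). \<forall>x\<in>?S. i ((\<pi> \<circ> neg_on m) x) = i x}. \<Prod>k\<in>{1..int m}. A $$ (i k, i (- k)))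
    = (\<Sum>f\<in>PiE ?H (\<lambda>_. {..<N}). \<Prod>y\<in>?H. A $$ (f (half m \<pi> y), f y))"
  proof (rule sum.reindex_bij_witness[where i="?ext" and j="\<lambda>i. restrict i ?H"])
    fix f assume f: "f \<in> PiE ?H (\<lambda>_. {..<N})"
    show "restrict (?ext f) ?H = f" using f by (auto simp: fun_eq_iff PiE_def extensional_def)
    have "?ext f \<in> PiE ?S (\<lambda>_. {..<N})"
    proof (rule PiE_I)
      fix x assume x: "x \<in> ?S"
      show "?ext f x \<in> {..<N}"
      proof (cases "x \<in> ?H")
        case False
        then have "- x \<in> ?H" using half_neg x by simp
        then have "\<pi> (- x) \<in> ?H" by (rule half_pi)
        then show ?thesis using f False x by auto
      qed (use f in auto)
    qed (use half_subset in auto)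
    moreover have "?ext f ((\<pi> \<circ> neg_on m) x) = ?ext f x" if x: "x \<in> ?S" for x
    proof (cases "x \<in> ?H")
      case False
      then have "- x \<in> ?H" using half_neg x by simp
      then have "\<pi> (- x) \<in> ?H" by (rule half_pi)
      then show ?thesis unfolding t[OF x] using False x by simp
    next
      case True
      have "\<pi> (- x) \<in> ?S" using x pi_in by simp
      have "- \<pi> (- x) \<in> ?H"
      proof -
        have "\<pi> (- \<pi> (- x)) = x" using pi_neg[of "- x"] x by simp
        then have "orbit \<pi> (- \<pi> (- x)) = orbit \<pi> x"
          using permutation_orbit_step[OF permutation, of "- \<pi> (- x)"] by simp
        then show ?thesis using True x pi_in[of "- x"] by (simp add: half_iff)
      qed
      moreover have "\<pi> (- x) \<in> ?S" using x pi_in by simp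
      ultimately have "\<pi> (- x) \<notin> ?H" "\<pi> (- x) \<in> ?S" using half_neg by blast+
      then show ?thesis unfolding t[OF x] using True x pi_neg[of "- x"] by simp
    qed
    ultimately show "?ext f \<in> {i \<in> PiE ?S (\<lambda>_. {..<N}). \<forall>x\<in>?S. i ((\<pi> \<circ> neg_on m) x) = i x}"
      by (intro CollectI conjI ballI)
  next
    fix i assume i: "i \<in> {i \<in> PiE ?S (\<lambda>_. {..<N}). \<forall>x\<in>?S. i ((\<pi> \<circ> neg_on m) x) = i x}"
    then have iS: "\<And>x. x \<in> ?S \<Longrightarrow> i x < N" and it: "\<And>x. x \<in> ?S \<Longrightarrow> i (\<pi> (- x)) = i x"
      and iu: "\<And>x. x \<notin> ?S \<Longrightarrow> i x = undefined" using t by (auto simp: PiE_def extensional_def)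
    show "?ext (restrict i ?H) = i"
    proof
      fix x
      consider "x \<in> ?H" | "x \<notin> ?H" "x \<in> ?S" | "x \<notin> ?H" "x \<notin> ?S" by blast
      then show "?ext (restrict i ?H) x = i x"
      proof cases
        case 2
        then have "\<pi> (- x) \<in> ?H" using half_neg[of x] half_pi[of "- x"] by simp
        then show ?thesis using 2 it by simp
      qed (use iu in auto)
    qed
    show "restrict i ?H \<in> PiE ?H (\<lambda>_. {..<N})" using iS half_subset by auto
    have "(\<Prod>k\<in>{1..int m}. A $$ (i k, i (- k))) = (\<Prod>y\<in>?H. A $$ (i \<bar>y\<bar>, i (- \<bar>y\<bar>)))"
      by (rule prod.reindex_bij_betw[OF abs_half, symmetric])
    also have "\<dots> = (\<Prod>y\<in>?H. A $$ (restrict i ?H (half m \<pi> y), restrict i ?H y))"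
    proof (rule prod.cong[OF refl])
      fix y assume y: "y \<in> ?H"
      then have yS: "y \<in> ?S" "- y \<in> ?S" using half_subset by auto
      have "A $$ (i \<bar>y\<bar>, i (- \<bar>y\<bar>)) = A $$ (i (- y), i y)"
        using sym[OF iS[OF yS(1)] iS[OF yS(2)]] by (cases "y \<ge> 0") auto
      also have "i (- y) = i (\<pi> y)" using it[OF yS(2)] by simp
      finally show "A $$ (i \<bar>y\<bar>, i (- \<bar>y\<bar>)) = A $$ (restrict i ?H (half m \<pi> y), restrict i ?H y)"
        using y half_pi by (simp add: half_apply)
    qed
    finally show "(\<Prod>y\<in>?H. A $$ (restrict i ?H (half m \<pi> y), restrict i ?H y)) = (\<Prod>k\<in>{1..int m}. A $$ (i k, i (- k)))" ..
  qed
  also have "\<dots> = (\<Prod>c\<in>cycles_on ?H (half m \<pi>). mat_Tr (A ^\<^sub>m card c))"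
    by (rule trace_of_permutation[OF A finite_half half_permutes])
  finally show ?thesis .
qed

end

section \<open>The genus expansion\<close>

lemma long_cycle_apply:
  assumes "k \<in> {1..int l}"
  shows "(long_cycle l ^^ j) 1 = 1 + int (j mod l)"
proof -
  let ?cs = "[1..int l]"
  have l: "l \<ge> 1" using assms by auto
  have "map (long_cycle l ^^ j) ?cs = rotate j ?cs" unfolding long_cycle_def by (rule cyclic_rotation) simp
  moreover have "map (long_cycle l ^^ j) ?cs ! 0 = (long_cycle l ^^ j) (?cs ! 0)"
    using l by (intro nth_map) simp
  moreover have "?cs ! 0 = 1" using l by (subst nth_upto) auto
  moreover have "rotate j ?cs ! 0 = 1 + int (j mod l)"
  proof -
    have "j mod l < l" using l by simp
    then have "[1..int l] ! (j mod l) = 1 + int (j mod l)" by (subst nth_upto) auto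
    then show ?thesis using l by (simp add: nth_rotate)
  qed
  ultimately show ?thesis by simp
qed

lemma long_cycle_permutes: "long_cycle l permutes {1..int l}"
  using cycle_permutes[of "[1..int l]"] by (simp add: long_cycle_def)

lemma orbit_long_cycle:
  assumes "k \<in> {1..int l}"
  shows "orbit (long_cycle l) k = {1..int l}"
proof -
  let ?g = "long_cycle l"
  have l: "l \<ge> 1" using assms by auto
  have perm: "permutation ?g" by (rule permutes_imp_permutation[OF _ long_cycle_permutes]) simp
  have "i \<in> orbit ?g 1" if i: "i \<in> {1..int l}" for i
  proof -
    have "(?g ^^ nat (i - 1)) 1 = 1 + int (nat (i - 1) mod l)" by (rule long_cycle_apply[OF i])
    also have "nat (i - 1) mod l = nat (i - 1)" using i by (intro mod_less) auto
    also have "1 + int (nat (i - 1)) = i" using i by simp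
    finally have "(?g ^^ nat (i - 1)) 1 = i" .
    then show ?thesis using orbit_altdef_permutation[OF perm, of 1] by (metis (mono_tags, lifting) mem_Collect_eq)
  qed
  moreover have "orbit ?g 1 \<subseteq> {1..int l}"
    using l by (intro permutes_orbit_subset[OF long_cycle_permutes]) simp
  ultimately have "orbit ?g 1 = {1..int l}" by blast
  then show ?thesis using orbit_eq_of_mem[OF perm, of k 1] assms by simp
qed

lemma cycles_on_long_cycle: "l \<ge> 1 \<Longrightarrow> cycles_on {1..int l} (long_cycle l) = {{1..int l}}"
  using orbit_long_cycle by (auto simp: cycles_on_def intro!: image_eqI[of _ _ 1])

lemma trace_power_expand:
  assumes A: "A \<in> carrier_mat N N" and l: "l \<ge> 1"
  shows "mat_Tr (A ^\<^sub>m l) = (\<Sum>j\<in>PiE {1..int l} (\<lambda>_. {..<N}). \<Prod>k\<in>{1..int l}. A $$ (j (long_cycle l k), j k))"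
  using trace_of_permutation[OF A _ long_cycle_permutes, of l] l
  by (simp add: cycles_on_long_cycle)

abbreviation gam_plus :: "nat \<Rightarrow> int \<Rightarrow> int" where "gam_plus l \<equiv> perm_plus (long_cycle l)"
abbreviation gam_minus :: "nat \<Rightarrow> int \<Rightarrow> int" where "gam_minus l \<equiv> perm_minus (long_cycle l)"

lemma long_cycle_in: "k \<in> {1..int l} \<Longrightarrow> long_cycle l k \<in> {1..int l}"
  using permutes_in_image[OF long_cycle_permutes] by blast

lemma long_cycle_outside: "k \<notin> {1..int l} \<Longrightarrow> long_cycle l k = k"
  using long_cycle_permutes by (simp add: permutes_def)

lemma long_cycle_pos: "long_cycle l k > 0 \<longleftrightarrow> k > 0"
  using long_cycle_in[of k l] long_cycle_outside[of k l] by (cases "k \<in> {1..int l}") auto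

lemma permutes_involutive_conj:
  assumes f: "f permutes S" and n: "\<And>k. n (n k) = k" and img: "\<And>k. k \<in> S' \<longleftrightarrow> n k \<in> S"
  shows "(\<lambda>k. n (f (n k))) permutes S'"
  unfolding permutes_def
proof (intro conjI allI impI)
  show "n (f (n x)) = x" if "x \<notin> S'" for x using f that img n by (simp add: permutes_def)
  fix y
  show "\<exists>!x. n (f (n x)) = y"
  proof (rule ex1I[of _ "n (Hilbert_Choice.inv f (n y))"])
    show "n (f (n (n (Hilbert_Choice.inv f (n y))))) = y" using permutes_inverses(1)[OF f] n by simp
    fix x assume "n (f (n x)) = y"
    then have "f (n x) = n y" using n by metis
    then have "Hilbert_Choice.inv f (n y) = n x" using permutes_inverses(2)[OF f] by metis
    then show "x = n (Hilbert_Choice.inv f (n y))" using n by simp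
  qed
qed

lemma gam_minus_permutes: "gam_minus l permutes pm_set l"
proof -
  have "(\<lambda>k. - long_cycle l (- k)) permutes uminus ` {1..int l}"
  proof (rule permutes_involutive_conj[OF long_cycle_permutes])
    show "k \<in> uminus ` {1..int l} \<longleftrightarrow> - k \<in> {1..int l}" for k by (metis add.inverse_inverse image_iff)
  qed simp
  moreover have "gam_minus l = (\<lambda>k. - long_cycle l (- k))"
    using long_cycle_outside[of _ l] by (auto simp: fun_eq_iff perm_minus_def)
  ultimately show ?thesis by (metis permutes_subset pm_set_def sup_ge2)
qed

lemma gam_plus_permutes: "gam_plus l permutes pm_set l"
proof -
  have "gam_plus l = long_cycle l"
    using long_cycle_outside[of _ l] by (auto simp: fun_eq_iff perm_plus_def)
  then show ?thesis using permutes_subset[OF long_cycle_permutes, of l "pm_set l"] by (simp add: pm_set_def)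
qed

lemma gam_conj: "k \<in> pm_set l \<Longrightarrow> gam_plus l (- k) = - gam_minus l k"
  by (auto simp: perm_plus_def perm_minus_def pm_set_iff)

text \<open>Its particular cycles count the column indices of \<open>Z\<close> that a pairing leaves free. It is a
  premap, because in terms of pairings it is a conjugate of \<open>\<pi>\<close> (\<open>face_perm_neg\<close>).\<close>

definition face_perm :: "nat \<Rightarrow> (int \<Rightarrow> int) \<Rightarrow> int \<Rightarrow> int" where
  "face_perm l \<pi> = Hilbert_Choice.inv (gam_minus l) \<circ> \<pi> \<circ> gam_plus l"

lemma face_perm_neg:
  "face_perm l \<pi> \<circ> neg_on l = Hilbert_Choice.inv (gam_minus l) \<circ> (\<pi> \<circ> neg_on l) \<circ> gam_minus l"
proof
  fix k
  show "(face_perm l \<pi> \<circ> neg_on l) k = (Hilbert_Choice.inv (gam_minus l) \<circ> (\<pi> \<circ> neg_on l) \<circ> gam_minus l) k"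
  proof (cases "k \<in> pm_set l")
    case True
    then have "gam_minus l k \<in> pm_set l" using permutes_in_image[OF gam_minus_permutes] by blast
    then show ?thesis using True gam_conj[OF True] by (simp add: face_perm_def neg_on_def)
  next
    case False
    then have "gam_minus l k = k" "gam_plus l k = k"
      using gam_minus_permutes gam_plus_permutes by (simp_all add: permutes_def)
    then show ?thesis using False by (simp add: face_perm_def neg_on_def)
  qed
qed

lemma conj_fpf_involution:
  assumes \<tau>: "\<tau> \<in> fpf_involutions S" and g: "g permutes S"
  shows "Hilbert_Choice.inv g \<circ> \<tau> \<circ> g \<in> fpf_involutions S"
proof -
  have p: "\<tau> permutes S" and i: "\<And>x. x \<in> S \<Longrightarrow> \<tau> (\<tau> x) = x" "\<And>x. x \<in> S \<Longrightarrow> \<tau> x \<noteq> x"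
    using \<tau> by (auto simp: fpf_involutions_def)
  have "Hilbert_Choice.inv g \<circ> \<tau> \<circ> g permutes S"
    using permutes_compose[OF g permutes_compose[OF p permutes_inv[OF g]]] by (simp add: comp_assoc)
  moreover have "(Hilbert_Choice.inv g \<circ> \<tau> \<circ> g) ((Hilbert_Choice.inv g \<circ> \<tau> \<circ> g) x) = x
      \<and> (Hilbert_Choice.inv g \<circ> \<tau> \<circ> g) x \<noteq> x" if x: "x \<in> S" for x
  proof -
    have gx: "g x \<in> S" using permutes_in_image[OF g] x by blast
    have "Hilbert_Choice.inv g (\<tau> (g x)) \<noteq> x" using i(2)[OF gx] permutes_inverses(1)[OF g] by metis
    then show ?thesis using i(1)[OF gx] permutes_inverses[OF g] by simp
  qed
  ultimately show ?thesis by (simp add: fpf_involutions_def)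
qed

lemma face_perm_premap: "\<pi> \<in> premaps l \<Longrightarrow> face_perm l \<pi> \<in> premaps l"
  unfolding premaps_iff face_perm_neg by (rule conj_fpf_involution[OF _ gam_minus_permutes])

lemma orbit_half: "premap m \<pi> \<Longrightarrow> c \<in> cycles_on (half_set m \<pi>) (half m \<pi>) \<Longrightarrow> finite c \<and> c \<noteq> {} \<and> c \<subseteq> half_set m \<pi>"
proof -
  assume p: "premap m \<pi>" and c: "c \<in> cycles_on (half_set m \<pi>) (half m \<pi>)"
  interpret premap m \<pi> by (rule p)
  obtain x where "x \<in> half_set m \<pi>" "c = orbit (half m \<pi>) x" using c by (auto simp: cycles_on_def)
  then have "c \<subseteq> half_set m \<pi>" "c \<noteq> {}"
    using permutes_orbit_subset[OF half_permutes] orbit_nonempty[of "half m \<pi>" x] by auto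
  then show ?thesis using finite_subset[OF _ finite_half] by blast
qed

text \<open>The permutation acts as the long cycle on the positive numbers and maps negative numbers to
  negative ones, so its only particular cycle is \<open>{1..l}\<close>.\<close>

lemma num_half_euler_long_cycle:
  assumes l: "l \<ge> 1"
  shows "num_half l (gam_plus l \<circ> Hilbert_Choice.inv (gam_minus l)) = 1"
proof -
  let ?s = "gam_plus l \<circ> Hilbert_Choice.inv (gam_minus l)"
  have pos: "?s k = long_cycle l k" if "k > 0" for k
  proof -
    have "Hilbert_Choice.inv (gam_minus l) k = k"
      using that permutes_inv_eq[OF gam_minus_permutes, of l k k] by (simp add: perm_minus_def)
    then show ?thesis using that by (simp add: perm_plus_def)
  qed
  have neg: "?s k < 0" if "k < 0" for k
  proof -
    have "Hilbert_Choice.inv (gam_minus l) k = - Hilbert_Choice.inv (long_cycle l) (- k)" (is "_ = ?x")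
    proof -
      have L: "long_cycle l (- ?x) = - k" using permutes_inverses(1)[OF long_cycle_permutes] by simp
      then have "?x < 0" using long_cycle_pos[of l "- ?x"] that by simp
      then have "gam_minus l ?x = k" using L by (simp add: perm_minus_def)
      then show ?thesis using permutes_inv_eq[OF gam_minus_permutes] by simp
    qed
    moreover have "- Hilbert_Choice.inv (long_cycle l) (- k) < 0"
      using that permutes_inverses(1)[OF long_cycle_permutes, of l "- k"] long_cycle_pos[of l "Hilbert_Choice.inv (long_cycle l) (- k)"] by simp
    ultimately show ?thesis by (simp add: perm_plus_def)
  qed
  have posin: "k > 0" if "k \<in> {1..int l}" for k using that by simp
  have orb_pos: "orbit ?s k = {1..int l}" if k: "k \<in> {1..int l}" for k
  proof -
    have "orbit (long_cycle l) k = orbit ?s k"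
      using k long_cycle_in pos by (intro orbit_cong0[of k "{1..int l}"]) auto
    then show ?thesis using orbit_long_cycle[OF k] by simp
  qed
  have orb_neg: "j < 0" if "k < 0" "j \<in> orbit ?s k" for j k
    using that(2) by induct (use neg that(1) in auto)
  have part: "particular {1..int l}" unfolding particular_def using l by (intro bexI[of _ 1]) auto
  have npart: "\<not> particular (orbit ?s k)" if "k < 0" for k
    using orb_neg[OF that] by (force simp: particular_def)
  have "{c \<in> cycles_on (pm_set l) ?s. particular c} = {{1..int l}}"
  proof (intro equalityI subsetI)
    fix c assume "c \<in> {c \<in> cycles_on (pm_set l) ?s. particular c}"
    then obtain k where k: "k \<in> pm_set l" "c = orbit ?s k" "particular c" by (auto simp: cycles_on_def)
    then have "k > 0" using npart[of k] by (cases "k < 0") (auto simp: pm_set_iff)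
    then have "k \<in> {1..int l}" using k by (simp add: pm_set_iff)
    then show "c \<in> {{1..int l}}" using orb_pos k by simp
  next
    fix c assume "c \<in> {{1..int l}}"
    then have "c = orbit ?s 1" "1 \<in> pm_set l" using orb_pos[of 1] l by (auto simp: pm_set_iff)
    then show "c \<in> {c \<in> cycles_on (pm_set l) ?s. particular c}" using part \<open>c \<in> _\<close> by (auto simp: cycles_on_def)
  qed
  then have H: "half_set l ?s = {1..int l}" by (simp add: half_set_def)
  have "orbit (half l ?s) k = {1..int l}" if k: "k \<in> {1..int l}" for k
  proof -
    have "orbit (long_cycle l) k = orbit (half l ?s) k"
      using k long_cycle_in pos by (intro orbit_cong0[of k "{1..int l}"]) (auto simp: half_def H perm_restrict_def)
    then show ?thesis using orbit_long_cycle[OF k] by simp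
  qed
  then have "cycles_on {1..int l} (half l ?s) = {{1..int l}}"
    using l by (auto simp: cycles_on_def intro!: image_eqI[of _ _ 1])
  then show ?thesis by (simp add: num_half_def num_cycles_def H)
qed

lemma pm_set_UN: "pm_set l = (\<Union>k\<in>{1..int l}. {k, - k})"
proof (intro equalityI subsetI)
  fix x assume "x \<in> pm_set l"
  then have "\<bar>x\<bar> \<in> {1..int l}" "x \<in> {\<bar>x\<bar>, - \<bar>x\<bar>}" by (auto simp: pm_set_iff)
  then show "x \<in> (\<Union>k\<in>{1..int l}. {k, - k})" by blast
qed (auto simp: pm_set_iff)

lemma prod_pm_set:
  fixes h :: "int \<Rightarrow> 'a :: comm_monoid_mult"
  shows "(\<Prod>x\<in>pm_set l. h x) = (\<Prod>k\<in>{1..int l}. h k * h (- k))"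
proof -
  have "(\<Prod>x\<in>pm_set l. h x) = (\<Prod>k\<in>{1..int l}. \<Prod>x\<in>{k, - k}. h x)"
    unfolding pm_set_UN by (rule prod.UNION_disjoint) auto
  also have "\<dots> = (\<Prod>k\<in>{1..int l}. h k * h (- k))" by (intro prod.cong refl) auto
  finally show ?thesis .
qed

lemma card_pm_set: "card (pm_set l) = 2 * l"
proof -
  have "pm_set l = {1..int l} \<union> uminus ` {1..int l}" by (simp add: pm_set_def)
  moreover have "card (uminus ` {1..int l}) = l" by (subst card_image) auto
  ultimately show ?thesis by (simp add: card_Un_disjoint disjoint_iff image_iff)
qed

lemma prod_double_sum:
  fixes g :: "int \<Rightarrow> nat \<Rightarrow> nat \<Rightarrow> 'a :: comm_semiring_1"
  shows "(\<Prod>k\<in>{1..int l}. \<Sum>a<N. \<Sum>b<N. g k a b) = (\<Sum>i\<in>PiE (pm_set l) (\<lambda>_. {..<N}). \<Prod>k\<in>{1..int l}. g k (i k) (i (- k)))"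
proof -
  have "(\<Sum>i\<in>PiE (pm_set l) (\<lambda>_. {..<N}). \<Prod>k\<in>{1..int l}. g k (i k) (i (- k)))
    = (\<Prod>k\<in>{1..int l}. \<Sum>i\<in>PiE {k, - k} (\<lambda>_. {..<N}). g k (i k) (i (- k)))"
    unfolding pm_set_UN by (rule sum_PiE_UN) auto
  also have "\<dots> = (\<Prod>k\<in>{1..int l}. \<Sum>a<N. \<Sum>b<N. g k a b)"
  proof (rule prod.cong[OF refl])
    fix k assume k: "k \<in> {1..int l}"
    have "(\<Sum>i\<in>PiE {k, - k} (\<lambda>_. {..<N}). g k (i k) (i (- k)))
      = (\<Sum>a<N. \<Sum>i\<in>PiE {- k} (\<lambda>_. {..<N}). g k ((i(k := a)) k) ((i(k := a)) (- k)))"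
      using k by (intro sum_PiE_insert) auto
    also have "\<dots> = (\<Sum>a<N. \<Sum>i\<in>PiE {- k} (\<lambda>_. {..<N}). g k a (i (- k)))"
      using k by (intro sum.cong refl) auto
    also have "\<dots> = (\<Sum>a<N. \<Sum>b<N. \<Sum>i\<in>PiE {} (\<lambda>_. {..<N}). g k a ((i(- k := b)) (- k)))"
      by (intro sum.cong refl sum_PiE_insert) auto
    finally show "(\<Sum>i\<in>PiE {k, - k} (\<lambda>_. {..<N}). g k (i k) (i (- k))) = (\<Sum>a<N. \<Sum>b<N. g k a b)"
      unfolding PiE_empty_domain by simp
  qed
  finally show ?thesis ..
qed

text \<open>In \<open>W (j (\<gamma> k), j k) = \<Sum>a b. Z (a, j (\<gamma> k)) * D (a, b) * Z (b, j k)\<close> the left factor \<open>Z\<close> is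
  labelled \<open>k\<close> and the right one \<open>- k\<close>; this is the column index of the factor with label \<open>x\<close>.\<close>

definition face_index :: "nat \<Rightarrow> (int \<Rightarrow> nat) \<Rightarrow> int \<Rightarrow> nat" where
  "face_index l j x = (if x > 0 then j (long_cycle l x) else j (- x))"

lemma face_index_eq:
  assumes "y \<in> pm_set l"
  shows "face_index l j y = restrict (\<lambda>x. j (long_cycle l \<bar>x\<bar>)) (pm_set l) (Hilbert_Choice.inv (gam_minus l) y)"
proof -
  let ?x = "Hilbert_Choice.inv (gam_minus l) y"
  have x: "?x \<in> pm_set l" "gam_minus l ?x = y"
    using assms permutes_in_image[OF permutes_inv[OF gam_minus_permutes]] permutes_inverses(1)[OF gam_minus_permutes] by blast+
  show ?thesis
  proof (cases "?x < 0")
    case True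
    then have y: "y = - long_cycle l (- ?x)" using x(2) by (simp add: perm_minus_def)
    then have "y < 0" using True long_cycle_pos[of l "- ?x"] by simp
    then have "face_index l j y = j (- y)" by (simp add: face_index_def)
    also have "- y = long_cycle l \<bar>?x\<bar>" using y True by simp
    finally show ?thesis using x(1) by simp
  next
    case False
    then have "?x = y" using x(2) by (simp add: perm_minus_def)
    then show ?thesis using x(1) False by (auto simp: face_index_def pm_set_iff)
  qed
qed

text \<open>After a relabelling by \<open>\<gamma>\<^sub>-\<close> a column index is an index function on \<open>\<plusminus>[l]\<close> with
  \<open>i k = i (- k)\<close>, and the pairing becomes that of \<open>face_perm\<close>. The constraint \<open>i k = i (- k)\<close>
  is the entry of an identity matrix, so the number of solutions is a case of
  \<open>sum_invariant_indices\<close>, with every cycle contributing \<open>Tr 1 = n\<close>.\<close>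

lemma card_face_indices:
  assumes \<pi>: "\<pi> \<in> premaps l"
  shows "card {j \<in> PiE {1..int l} (\<lambda>_. {..<n}). \<forall>x\<in>pm_set l. face_index l j ((\<pi> \<circ> neg_on l) x) = face_index l j x}
    = n ^ num_half l (face_perm l \<pi>)"
proof -
  let ?S = "pm_set l" let ?\<psi> = "face_perm l \<pi>" let ?B = "{..<n}" let ?\<tau> = "\<pi> \<circ> neg_on l" let ?g = "gam_minus l"
  have ps: "premap l ?\<psi>" by unfold_locales (rule face_perm_premap[OF \<pi>])
  let ?G = "{i \<in> PiE ?S (\<lambda>_. ?B). \<forall>x\<in>?S. i ((?\<psi> \<circ> neg_on l) x) = i x}"
  let ?J = "{j \<in> PiE {1..int l} (\<lambda>_. ?B). \<forall>x\<in>?S. face_index l j (?\<tau> x) = face_index l j x}"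
  have fG: "finite ?G" by (rule finite_subset[of _ "PiE ?S (\<lambda>_. ?B)"]) (auto intro!: finite_PiE)
  have "(\<Sum>i\<in>?G. \<Prod>k\<in>{1..int l}. (1\<^sub>m n :: real mat) $$ (i k, i (- k)))
    = (\<Prod>c\<in>cycles_on (half_set l ?\<psi>) (half l ?\<psi>). mat_Tr (1\<^sub>m n ^\<^sub>m card c))"
    by (rule premap.sum_invariant_indices[OF ps]) auto
  also have "\<dots> = real n ^ num_half l ?\<psi>"
  proof -
    have "(1\<^sub>m n :: real mat) ^\<^sub>m k = 1\<^sub>m n" for k by (induction k) auto
    then show ?thesis by (simp add: mat_Tr_def num_half_def num_cycles_def)
  qed
  also have "(\<Sum>i\<in>?G. \<Prod>k\<in>{1..int l}. (1\<^sub>m n :: real mat) $$ (i k, i (- k)))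
    = (\<Sum>i\<in>?G. if \<forall>k\<in>{1..int l}. i k = i (- k) then 1 else 0)"
  proof (rule sum.cong[OF refl])
    fix i assume i: "i \<in> ?G"
    have "i k < n" "i (- k) < n" if "k \<in> {1..int l}" for k
    proof -
      have "k \<in> ?S" "- k \<in> ?S" using that by (auto simp: pm_set_iff)
      then show "i k < n" "i (- k) < n" using i PiE_mem[of i ?S "\<lambda>_. ?B"] by auto
    qed
    then have "(\<Prod>k\<in>{1..int l}. (1\<^sub>m n :: real mat) $$ (i k, i (- k))) = (\<Prod>k\<in>{1..int l}. if i k = i (- k) then 1 else 0)"
      by (intro prod.cong refl) auto
    also have "\<dots> = (if \<forall>k\<in>{1..int l}. i k = i (- k) then 1 else 0)"
      by (auto intro!: prod.neutral)
    finally show "(\<Prod>k\<in>{1..int l}. (1\<^sub>m n :: real mat) $$ (i k, i (- k))) = (if \<forall>k\<in>{1..int l}. i k = i (- k) then 1 else 0)" .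
  qed
  also have "\<dots> = real (card {i \<in> ?G. \<forall>k\<in>{1..int l}. i k = i (- k)})"
    using fG by (simp add: sum.If_cases Int_def)
  also have "card {i \<in> ?G. \<forall>k\<in>{1..int l}. i k = i (- k)} = card ?J"
  proof (rule bij_betw_same_card[of "\<lambda>i. restrict (\<lambda>k. i (Hilbert_Choice.inv (long_cycle l) k)) {1..int l}"],
      rule bij_betw_byWitness[where f'="\<lambda>j. restrict (\<lambda>x. j (long_cycle l \<bar>x\<bar>)) ?S"])
    let ?c = "long_cycle l" let ?ci = "Hilbert_Choice.inv (long_cycle l)"
    have ci: "?ci k \<in> {1..int l}" if "k \<in> {1..int l}" for k
      using permutes_in_image[OF permutes_inv[OF long_cycle_permutes]] that by blast
    have cci: "?c (?ci k) = k" "?ci (?c k) = k" for k using permutes_inverses[OF long_cycle_permutes] by auto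
    have absS: "\<bar>x\<bar> \<in> {1..int l}" if "x \<in> ?S" for x using that by (auto simp: pm_set_iff)
    have S: "k \<in> ?S" if "k \<in> {1..int l}" for k using that by (auto simp: pm_set_iff)
    let ?to = "\<lambda>i. restrict (\<lambda>k. i (?ci k)) {1..int l}" let ?from = "\<lambda>j. restrict (\<lambda>x. j (?c \<bar>x\<bar>)) ?S"
    have 1: "?from (?to i) = i" if i: "i \<in> {i \<in> ?G. \<forall>k\<in>{1..int l}. i k = i (- k)}" for i
    proof
      fix x
      show "?from (?to i) x = i x"
      proof (cases "x \<in> ?S")
        case True
        then have "?c \<bar>x\<bar> \<in> {1..int l}" using absS long_cycle_in by blast
        then have "?from (?to i) x = i \<bar>x\<bar>" using True cci by simp
        also have "\<dots> = i x" using i absS[OF True] by (cases "x \<ge> 0") auto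
        finally show ?thesis .
      next
        case False
        then show ?thesis using i by (auto simp: PiE_def extensional_def)
      qed
    qed
    then show "\<forall>i\<in>{i \<in> ?G. \<forall>k\<in>{1..int l}. i k = i (- k)}. ?from (?to i) = i" by blast
    have 2: "?to (?from j) = j" if j: "j \<in> PiE {1..int l} (\<lambda>_. ?B)" for j
    proof
      fix k show "?to (?from j) k = j k"
      proof (cases "k \<in> {1..int l}")
        case True
        then have "?ci k \<in> ?S" "\<bar>?ci k\<bar> = ?ci k" using ci[OF True] S by auto
        then show ?thesis using True cci by simp
      next
        case False
        then show ?thesis using j by (auto simp: PiE_def extensional_def)
      qed
    qed
    then show "\<forall>j\<in>?J. ?to (?from j) = j" by blast
    have inv: "(\<forall>x\<in>?S. ?from j ((?\<psi> \<circ> neg_on l) x) = ?from j x) \<longleftrightarrow> (\<forall>x\<in>?S. face_index l j (?\<tau> x) = face_index l j x)" for j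
    proof -
      have gS: "?g x \<in> ?S \<longleftrightarrow> x \<in> ?S" for x by (rule permutes_in_image[OF gam_minus_permutes])
      have tS: "?\<tau> x \<in> ?S" if "x \<in> ?S" for x
        using that \<pi> permutes_in_image[of ?\<tau> ?S] by (auto simp: premaps_iff fpf_involutions_def)
      have "(\<forall>x\<in>?S. face_index l j (?\<tau> x) = face_index l j x)
        \<longleftrightarrow> (\<forall>x\<in>?S. face_index l j (?\<tau> (?g x)) = face_index l j (?g x))"
        using gS permutes_inverses(1)[OF gam_minus_permutes] by metis
      also have "\<dots> \<longleftrightarrow> (\<forall>x\<in>?S. ?from j ((?\<psi> \<circ> neg_on l) x) = ?from j x)"
      proof (rule ball_cong[OF refl])
        fix x assume x: "x \<in> ?S"
        then have "face_index l j (?\<tau> (?g x)) = ?from j (Hilbert_Choice.inv ?g (?\<tau> (?g x)))"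
          using tS gS by (intro face_index_eq) blast
        also have "Hilbert_Choice.inv ?g (?\<tau> (?g x)) = (?\<psi> \<circ> neg_on l) x" unfolding face_perm_neg by simp
        finally have a: "face_index l j (?\<tau> (?g x)) = ?from j ((?\<psi> \<circ> neg_on l) x)" .
        have "face_index l j (?g x) = ?from j (Hilbert_Choice.inv ?g (?g x))"
          using x gS by (intro face_index_eq) blast
        also have "Hilbert_Choice.inv ?g (?g x) = x" using permutes_inverses(2)[OF gam_minus_permutes] by simp
        finally show "face_index l j (?\<tau> (?g x)) = face_index l j (?g x) \<longleftrightarrow> ?from j ((?\<psi> \<circ> neg_on l) x) = ?from j x"
          unfolding a by simp
      qed
      finally show ?thesis ..
    qed
    show "?to ` {i \<in> ?G. \<forall>k\<in>{1..int l}. i k = i (- k)} \<subseteq> ?J"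
    proof (rule image_subsetI)
      fix i assume i: "i \<in> {i \<in> ?G. \<forall>k\<in>{1..int l}. i k = i (- k)}"
      have "?to i \<in> PiE {1..int l} (\<lambda>_. ?B)"
      proof (rule PiE_I)
        fix k assume k: "k \<in> {1..int l}"
        then show "?to i k \<in> ?B" using i S[OF ci[OF k]] by (auto dest!: PiE_mem)
      qed auto
      moreover have "\<forall>x\<in>?S. face_index l (?to i) (?\<tau> x) = face_index l (?to i) x"
        unfolding inv[symmetric] 1[OF i] using i by blast
      ultimately show "?to i \<in> ?J" by (intro CollectI conjI)
    qed
    show "?from ` ?J \<subseteq> {i \<in> ?G. \<forall>k\<in>{1..int l}. i k = i (- k)}"
    proof (rule image_subsetI)
      fix j assume j: "j \<in> ?J"
      then have "\<forall>x\<in>?S. ?from j ((?\<psi> \<circ> neg_on l) x) = ?from j x" unfolding inv by blast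
      moreover have "?from j \<in> PiE ?S (\<lambda>_. ?B)"
      proof (rule PiE_I)
        fix x assume x: "x \<in> ?S"
        then show "?from j x \<in> ?B" using j long_cycle_in[OF absS[OF x]] by (auto dest!: PiE_mem)
      qed auto
      moreover have "\<forall>k\<in>{1..int l}. ?from j k = ?from j (- k)" using S by simp
      ultimately show "?from j \<in> {i \<in> ?G. \<forall>k\<in>{1..int l}. i k = i (- k)}" by (intro CollectI conjI)
    qed
  qed
  finally have "real (card ?J) = real (n ^ num_half l ?\<psi>)" by simp
  then show ?thesis by (simp only: of_nat_eq_iff)
qed

lemma ThetaE:
  assumes "\<theta> \<in> Theta n"
  obtains d D where "\<theta> = (real d / real n, D)" "1 \<le> n" "n \<le> d" "D \<in> carrier_mat d d" "transpose_mat D = D" "pos_def_mat D"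
  using assms unfolding Theta_def by blast

lemma cw_space_eq:
  assumes "\<theta> \<in> Theta n"
  shows "cw_space \<theta> = gauss_prod ({..<par_d \<theta>} \<times> {..<n}) (1 / sqrt (real n))"
  unfolding cw_space_def gauss_prod_def gauss_def par_n_eq[OF assms] ..

lemma wishart_index:
  assumes "\<theta> \<in> Theta n" "x < n" "y < n"
  shows "wishart \<theta> z $$ (x, y) = (\<Sum>a<par_d \<theta>. \<Sum>b<par_d \<theta>. z (a, x) * par_D \<theta> $$ (a, b) * z (b, y))"
proof -
  obtain d D where \<theta>: "\<theta> = (real d / real n, D)" "D \<in> carrier_mat d d" using assms(1) by (rule ThetaE)
  have pd: "par_d \<theta> = d" "par_D \<theta> = D" "par_n \<theta> = n" using \<theta> par_n_eq[OF assms(1)] by (auto simp: par_d_def par_D_def)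
  let ?Z = "Z_mat \<theta> z"
  have Z: "?Z \<in> carrier_mat d n" "transpose_mat ?Z \<in> carrier_mat n d" by (auto simp: Z_mat_def pd)
  have "wishart \<theta> z $$ (x, y) = (\<Sum>b<d. (transpose_mat ?Z * D) $$ (x, b) * ?Z $$ (b, y))"
    unfolding wishart_def pd by (rule index_mult_mat_sum[OF mult_carrier_mat[OF Z(2) \<theta>(2)] Z(1) assms(2,3)])
  also have "\<dots> = (\<Sum>b<d. (\<Sum>a<d. z (a, x) * D $$ (a, b)) * z (b, y))"
  proof (rule sum.cong[OF refl])
    fix b assume b: "b \<in> {..<d}"
    then have "(transpose_mat ?Z * D) $$ (x, b) = (\<Sum>a<d. transpose_mat ?Z $$ (x, a) * D $$ (a, b))"
      by (intro index_mult_mat_sum[OF Z(2) \<theta>(2) assms(2)]) simp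
    also have "\<dots> = (\<Sum>a<d. z (a, x) * D $$ (a, b))" using assms by (intro sum.cong refl) (simp add: Z_mat_def pd)
    finally show "(transpose_mat ?Z * D) $$ (x, b) * ?Z $$ (b, y) = (\<Sum>a<d. z (a, x) * D $$ (a, b)) * z (b, y)"
      using b assms by (simp add: Z_mat_def pd)
  qed
  also have "\<dots> = (\<Sum>a<d. \<Sum>b<d. z (a, x) * D $$ (a, b) * z (b, y))"
    by (subst sum.swap) (simp add: sum_distrib_right)
  finally show ?thesis unfolding pd .
qed

lemma wishart_carrier: "\<theta> \<in> Theta n \<Longrightarrow> wishart \<theta> z \<in> carrier_mat n n"
  by (auto simp: wishart_def Z_mat_def par_n_eq)

lemma sum_factor:
  fixes c :: "'a :: comm_semiring_1"
  shows "(\<Sum>j\<in>J. \<Sum>i\<in>I. \<Sum>\<tau>\<in>F. c * (f j \<tau> * g i \<tau>)) = (\<Sum>\<tau>\<in>F. c * ((\<Sum>j\<in>J. f j \<tau>) * (\<Sum>i\<in>I. g i \<tau>)))"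
proof -
  have "(\<Sum>j\<in>J. \<Sum>i\<in>I. \<Sum>\<tau>\<in>F. c * (f j \<tau> * g i \<tau>)) = (\<Sum>j\<in>J. \<Sum>\<tau>\<in>F. \<Sum>i\<in>I. c * (f j \<tau> * g i \<tau>))"
    by (intro sum.cong refl sum.swap)
  also have "\<dots> = (\<Sum>\<tau>\<in>F. \<Sum>j\<in>J. \<Sum>i\<in>I. c * (f j \<tau> * g i \<tau>))" by (rule sum.swap)
  also have "\<dots> = (\<Sum>\<tau>\<in>F. c * ((\<Sum>j\<in>J. f j \<tau>) * (\<Sum>i\<in>I. g i \<tau>)))"
    by (rule sum.cong[OF refl], subst sum_product, simp only: sum_distrib_left)
  finally show ?thesis .
qed

text \<open>Expand the trace, apply Wick's formula to the \<open>2l\<close> Gaussian factors labelled by \<open>\<plusminus>[l]\<close>, and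
  exchange the sums: for a fixed pairing the row indices give \<open>\<Prod>Tr (D^|c|)\<close> and the column
  indices a power of \<open>n\<close>. The normalisation contributes \<open>n^(- l)\<close>, and the exponents add up to
  \<open>\<chi> - 1\<close>, as the remaining summand of the Euler characteristic is \<open>1\<close>.\<close>

theorem genus_expansion:
  assumes \<theta>: "\<theta> \<in> Theta n" and l: "l \<ge> 1"
  shows "(\<integral>z. trace_power l \<theta> z \<partial>cw_space \<theta>)
    = (\<Sum>\<pi>\<in>premaps l. real n powi (euler_char l (long_cycle l) \<pi> - 1) * (par_lambda \<theta> ^ num_half l \<pi> * tr_half l \<pi> (par_D \<theta>)))"
proof -
  obtain d D where \<theta>d: "\<theta> = (real d / real n, D)" "1 \<le> n" "n \<le> d" "D \<in> carrier_mat d d" "transpose_mat D = D"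
    using \<theta> by (rule ThetaE)
  have pd: "par_d \<theta> = d" "par_D \<theta> = D" "par_lambda \<theta> = real d / real n"
    using \<theta>d by (auto simp: par_d_def par_D_def par_lambda_def)
  have sym: "D $$ (i, j) = D $$ (j, i)" if "i < d" "j < d" for i j
    using \<theta>d(4,5) that by (metis carrier_matD index_transpose_mat(1))
  let ?s = "1 / sqrt (real n)" let ?I = "{..<d} \<times> {..<n}" let ?L = "{1..int l}" let ?S = "pm_set l"
  let ?i = "PiE ?S (\<lambda>_. {..<d})" let ?j = "PiE ?L (\<lambda>_. {..<n})"
  let ?F = "fpf_involutions ?S"
  have s: "?s > 0" using \<theta>d by simp
  have n0: "n > 0" using \<theta>d by simp
  let ?e = "\<lambda>i j x. (i x, face_index l j x)"
  have e_in: "?e i j x \<in> ?I" if "i \<in> ?i" "j \<in> ?j" "x \<in> ?S" for i j x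
  proof -
    have "long_cycle l x \<in> ?L" if "x > 0" using that \<open>x \<in> ?S\<close> by (intro long_cycle_in) (auto simp: pm_set_iff)
    moreover have "- x \<in> ?L" if "\<not> x > 0" using that \<open>x \<in> ?S\<close> by (auto simp: pm_set_iff)
    ultimately have "face_index l j x < n"
      using PiE_mem[OF \<open>j \<in> ?j\<close>, of "long_cycle l x"] PiE_mem[OF \<open>j \<in> ?j\<close>, of "- x"] by (auto simp: face_index_def)
    then show ?thesis using PiE_mem[OF that(1,3)] by simp
  qed
  let ?D = "\<lambda>i. \<Prod>k\<in>?L. D $$ (i k, i (- k))"
  have expand: "trace_power l \<theta> z = (\<Sum>j\<in>?j. \<Sum>i\<in>?i. ?D i * (\<Prod>x\<in>?S. z (?e i j x)))" for z
  proof -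
    have "trace_power l \<theta> z = (\<Sum>j\<in>?j. \<Prod>k\<in>?L. wishart \<theta> z $$ (j (long_cycle l k), j k))"
      unfolding trace_power_def by (rule trace_power_expand[OF wishart_carrier[OF \<theta>] l])
    also have "\<dots> = (\<Sum>j\<in>?j. \<Prod>k\<in>?L. \<Sum>a<d. \<Sum>b<d. z (a, j (long_cycle l k)) * D $$ (a, b) * z (b, j k))"
    proof (intro sum.cong prod.cong refl)
      fix j k assume j: "j \<in> ?j" and k: "k \<in> ?L"
      have "j (long_cycle l k) < n" "j k < n" using PiE_mem[OF j long_cycle_in[OF k]] PiE_mem[OF j k] by auto
      from wishart_index[OF \<theta> this]
      show "wishart \<theta> z $$ (j (long_cycle l k), j k) = (\<Sum>a<d. \<Sum>b<d. z (a, j (long_cycle l k)) * D $$ (a, b) * z (b, j k))"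
        by (simp add: pd)
    qed
    also have "\<dots> = (\<Sum>j\<in>?j. \<Sum>i\<in>?i. \<Prod>k\<in>?L. z (i k, j (long_cycle l k)) * D $$ (i k, i (- k)) * z (i (- k), j k))"
      by (simp only: prod_double_sum)
    also have "\<dots> = (\<Sum>j\<in>?j. \<Sum>i\<in>?i. ?D i * (\<Prod>x\<in>?S. z (?e i j x)))"
    proof (intro sum.cong refl)
      fix j i
      have "(\<Prod>x\<in>?S. z (?e i j x)) = (\<Prod>k\<in>?L. z (i k, j (long_cycle l k)) * z (i (- k), j k))"
        unfolding prod_pm_set by (intro prod.cong refl) (auto simp: face_index_def)
      then show "(\<Prod>k\<in>?L. z (i k, j (long_cycle l k)) * D $$ (i k, i (- k)) * z (i (- k), j k))
        = ?D i * (\<Prod>x\<in>?S. z (?e i j x))"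
        by (simp add: prod.distrib mult_ac)
    qed
    finally show ?thesis .
  qed
  have tmp: "tempered ?I (\<lambda>z. \<Prod>x\<in>?S. z (?e i j x))" if "i \<in> ?i" "j \<in> ?j" for i j
    using e_in[OF that] by (intro tempered_prod tempered_coord) auto
  have "(\<integral>z. trace_power l \<theta> z \<partial>cw_space \<theta>)
    = (\<Sum>j\<in>?j. \<Sum>i\<in>?i. ?D i * (\<integral>z. (\<Prod>x\<in>?S. z (?e i j x)) \<partial>gauss_prod ?I ?s))"
  proof -
    have int: "integrable (gauss_prod ?I ?s) (\<lambda>z. ?D i * (\<Prod>x\<in>?S. z (?e i j x)))" if "i \<in> ?i" "j \<in> ?j" for i j
      using tmp[OF that] by (intro integrable_tempered s tempered_mult tempered_const) auto
    have "(\<integral>z. trace_power l \<theta> z \<partial>cw_space \<theta>) = (\<integral>z. (\<Sum>j\<in>?j. \<Sum>i\<in>?i. ?D i * (\<Prod>x\<in>?S. z (?e i j x))) \<partial>gauss_prod ?I ?s)"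
      unfolding cw_space_eq[OF \<theta>] pd expand ..
    also have "\<dots> = (\<Sum>j\<in>?j. (\<integral>z. (\<Sum>i\<in>?i. ?D i * (\<Prod>x\<in>?S. z (?e i j x))) \<partial>gauss_prod ?I ?s))"
      using int by (intro Bochner_Integration.integral_sum Bochner_Integration.integrable_sum)
    also have "\<dots> = (\<Sum>j\<in>?j. \<Sum>i\<in>?i. (\<integral>z. ?D i * (\<Prod>x\<in>?S. z (?e i j x)) \<partial>gauss_prod ?I ?s))"
      using int by (intro sum.cong refl Bochner_Integration.integral_sum)
    finally show ?thesis by simp
  qed
  also have "\<dots> = (\<Sum>j\<in>?j. \<Sum>i\<in>?i. ?D i * (?s ^ (2 * l) * (\<Sum>\<tau>\<in>?F. if (\<forall>x\<in>?S. i (\<tau> x) = i x) \<and> (\<forall>x\<in>?S. face_index l j (\<tau> x) = face_index l j x) then 1 else 0)))"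
  proof (intro sum.cong refl arg_cong2[where f="(*)"])
    fix i j assume ij: "j \<in> ?j" "i \<in> ?i"
    have fF: "finite ?F" by (rule finite_fpf_involutions) simp
    have "(\<integral>z. (\<Prod>x\<in>?S. z (?e i j x)) \<partial>gauss_prod ?I ?s) = ?s ^ (2 * l) * real (card {\<tau> \<in> ?F. \<forall>x\<in>?S. ?e i j (\<tau> x) = ?e i j x})"
      using wick[of ?I ?s ?S "?e i j"] s e_in[OF ij(2,1)] by (simp add: card_pm_set)
    also have "real (card {\<tau> \<in> ?F. \<forall>x\<in>?S. ?e i j (\<tau> x) = ?e i j x})
      = (\<Sum>\<tau>\<in>?F. if \<forall>x\<in>?S. ?e i j (\<tau> x) = ?e i j x then 1 else 0)"
      using fF by (simp add: sum.If_cases Int_def)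
    also have "\<dots> = (\<Sum>\<tau>\<in>?F. if (\<forall>x\<in>?S. i (\<tau> x) = i x) \<and> (\<forall>x\<in>?S. face_index l j (\<tau> x) = face_index l j x) then 1 else 0)"
      by (intro sum.cong refl if_cong) auto
    finally show "(\<integral>z. (\<Prod>x\<in>?S. z (?e i j x)) \<partial>gauss_prod ?I ?s)
      = ?s ^ (2 * l) * (\<Sum>\<tau>\<in>?F. if (\<forall>x\<in>?S. i (\<tau> x) = i x) \<and> (\<forall>x\<in>?S. face_index l j (\<tau> x) = face_index l j x) then 1 else 0)" .
  qed
  also have "\<dots> = (\<Sum>j\<in>?j. \<Sum>i\<in>?i. \<Sum>\<tau>\<in>?F. ?s ^ (2 * l) * ((if \<forall>x\<in>?S. face_index l j (\<tau> x) = face_index l j x then 1 else 0)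
      * (if \<forall>x\<in>?S. i (\<tau> x) = i x then ?D i else 0)))"
    unfolding sum_distrib_left by (intro sum.cong refl) auto
  also have "\<dots> = (\<Sum>\<tau>\<in>?F. ?s ^ (2 * l) * ((\<Sum>j\<in>?j. if \<forall>x\<in>?S. face_index l j (\<tau> x) = face_index l j x then 1 else 0)
      * (\<Sum>i\<in>?i. if \<forall>x\<in>?S. i (\<tau> x) = i x then ?D i else 0)))"
    by (rule sum_factor)
  also have "\<dots> = (\<Sum>\<pi>\<in>premaps l. ?s ^ (2 * l) * ((\<Sum>j\<in>?j. if \<forall>x\<in>?S. face_index l j ((\<pi> \<circ> neg_on l) x) = face_index l j x then 1 else 0)
      * (\<Sum>i\<in>?i. if \<forall>x\<in>?S. i ((\<pi> \<circ> neg_on l) x) = i x then ?D i else 0)))"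
    (is "_ = (\<Sum>\<pi>\<in>_. ?T (\<pi> \<circ> neg_on l))")
  proof -
    have "\<tau> \<circ> neg_on l \<circ> neg_on l = \<tau>" for \<tau> :: "int \<Rightarrow> int" by (simp add: fun_eq_iff)
    then have "(\<Sum>\<tau>\<in>?F. ?T \<tau>) = (\<Sum>\<tau>\<in>?F. ?T ((\<tau> \<circ> neg_on l) \<circ> neg_on l))" by simp
    also have "\<dots> = (\<Sum>\<pi>\<in>premaps l. ?T (\<pi> \<circ> neg_on l))"
      by (rule sum.reindex_bij_betw[OF bij_betw_premaps])
    finally show ?thesis .
  qed
  also have "\<dots> = (\<Sum>\<pi>\<in>premaps l. real n powi (euler_char l (long_cycle l) \<pi> - 1) * (par_lambda \<theta> ^ num_half l \<pi> * tr_half l \<pi> (par_D \<theta>)))"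
  proof (rule sum.cong[OF refl])
    fix \<pi> assume \<pi>: "\<pi> \<in> premaps l"
    interpret pr: premap l \<pi> by unfold_locales (rule \<pi>)
    let ?V = "num_half l \<pi>" let ?f = "num_half l (face_perm l \<pi>)"
    have A: "(\<Sum>j\<in>?j. if \<forall>x\<in>?S. face_index l j ((\<pi> \<circ> neg_on l) x) = face_index l j x then 1 else 0) = real n ^ ?f"
    proof -
      have "finite ?j" by (intro finite_PiE) auto
      then show ?thesis using card_face_indices[OF \<pi>, of n]
        by (simp add: sum.If_cases Int_def)
    qed
    have "(\<Sum>i\<in>?i. if \<forall>x\<in>?S. i ((\<pi> \<circ> neg_on l) x) = i x then ?D i else 0)
      = (\<Sum>i\<in>{i \<in> ?i. \<forall>x\<in>?S. i ((\<pi> \<circ> neg_on l) x) = i x}. ?D i)"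
      by (rule sum.inter_filter[symmetric]) (auto intro!: finite_PiE)
    also have "\<dots> = (\<Prod>c\<in>cycles_on (half_set l \<pi>) (half l \<pi>). mat_Tr (D ^\<^sub>m card c))"
      by (rule pr.sum_invariant_indices[OF \<theta>d(4) sym])
    also have "\<dots> = (\<Prod>c\<in>cycles_on (half_set l \<pi>) (half l \<pi>). real d * moment (card c) D)"
      using \<theta>d by (intro prod.cong refl) (simp add: moment_def mat_tr_def)
    also have "\<dots> = real d ^ ?V * tr_half l \<pi> D"
      by (simp add: prod.distrib num_half_def num_cycles_def tr_half_def tr_perm_def)
    finally have B: "(\<Sum>i\<in>?i. if \<forall>x\<in>?S. i ((\<pi> \<circ> neg_on l) x) = i x then ?D i else 0) = real d ^ ?V * tr_half l \<pi> D" .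
    have chi: "euler_char l (long_cycle l) \<pi> - 1 = int ?V + int ?f - int l"
      unfolding euler_char_def using num_half_euler_long_cycle[OF l] by (simp add: face_perm_def)
    have "real n powi (euler_char l (long_cycle l) \<pi> - 1) = real n ^ ?V * real n ^ ?f / real n ^ l"
      unfolding chi using n0 by (simp add: power_int_diff power_int_add power_int_of_nat)
    moreover have "?s ^ (2 * l) = 1 / real n ^ l"
      by (simp add: power_mult power_divide)
    ultimately show "?T (\<pi> \<circ> neg_on l) = real n powi (euler_char l (long_cycle l) \<pi> - 1) * (par_lambda \<theta> ^ num_half l \<pi> * tr_half l \<pi> (par_D \<theta>))"
      unfolding A B pd using n0 by (simp add: power_divide)
  qed
  finally show ?thesis .
qed

section \<open>Lower bound for the limiting variance\<close>

declare tau.simps(2) [simp del] limit_cov.simps(2) [simp del]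

lemma tau_single: "tau p [a] = p a"
  by (simp add: tau.simps(2))

text \<open>All terms of the recursion are nonnegative, so any one of them is a lower bound.\<close>

lemma tau_ge_peel:
  assumes p: "\<And>a. a \<ge> 1 \<Longrightarrow> p a \<ge> 0" and w: "a \<ge> 1" "pos_word as"
  shows "tau p (a # as) \<ge> p a * tau p as"
    "s < length as \<Longrightarrow> tau p (a # as) \<ge> tau p (loop a as s) * tau p (drop (Suc s) as)"
proof -
  have nn: "0 \<le> tau p (loop a as s) * tau p (drop (Suc s) as)" for s
    by (intro mult_nonneg_nonneg tau_nonneg p) (use w in \<open>simp_all add: pos_word_contract\<close>)
  have pp: "0 \<le> p a * tau p as" by (intro mult_nonneg_nonneg tau_nonneg p w)
  show "tau p (a # as) \<ge> p a * tau p as" using nn by (simp add: tau.simps(2) sum_nonneg)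
  assume "s < length as"
  then have "tau p (loop a as s) * tau p (drop (Suc s) as)
    \<le> (\<Sum>s<length as. tau p (loop a as s) * tau p (drop (Suc s) as))"
    using nn by (intro member_le_sum) auto
  then show "tau p (a # as) \<ge> tau p (loop a as s) * tau p (drop (Suc s) as)" using pp by (simp add: tau.simps(2))
qed

lemma pos_word_replicate [simp]: "a \<ge> 1 \<Longrightarrow> pos_word (replicate r a)"
  by (auto simp: pos_word_def)

lemma tau_ones_ge_p1:
  assumes p: "\<And>a. a \<ge> 1 \<Longrightarrow> p a \<ge> 0"
  shows "pos_word w \<Longrightarrow> p 1 ^ r * tau p w \<le> tau p (replicate r 1 @ w)"
proof (induction r)
  case (Suc r)
  have "p 1 ^ Suc r * tau p w = p 1 * (p 1 ^ r * tau p w)" by simp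
  also have "\<dots> \<le> p 1 * tau p (replicate r 1 @ w)" by (intro mult_left_mono Suc p) simp
  also have "\<dots> \<le> tau p (replicate (Suc r) 1 @ w)"
    using tau_ge_peel(1)[of p 1 "replicate r 1 @ w", OF p] Suc.prems by simp
  finally show ?case .
qed simp

lemma tau_pair_ge_p2:
  assumes p: "\<And>a. a \<ge> 1 \<Longrightarrow> p a \<ge> 0" and w: "pos_word w"
  shows "p 2 * tau p w \<le> tau p (1 # 1 # w)"
proof -
  have "tau p (loop 1 (1 # w) 0) = p 2" by (simp add: loop_def tau_single numeral_2_eq_2)
  then show ?thesis using tau_ge_peel(2)[of p 1 "1 # w" 0, OF p] w by simp
qed

lemma tau_even_ones_ge_p2:
  assumes p: "\<And>a. a \<ge> 1 \<Longrightarrow> p a \<ge> 0"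
  shows "pos_word w \<Longrightarrow> p 2 ^ r * tau p w \<le> tau p (replicate (2 * r) 1 @ w)"
proof (induction r)
  case (Suc r)
  have "p 2 ^ Suc r * tau p w = p 2 * (p 2 ^ r * tau p w)" by simp
  also have "\<dots> \<le> p 2 * tau p (replicate (2 * r) 1 @ w)" by (intro mult_left_mono Suc p) simp
  also have "\<dots> \<le> tau p (1 # 1 # (replicate (2 * r) 1 @ w))"
    using Suc.prems by (intro tau_pair_ge_p2 p) simp_all
  also have "1 # 1 # (replicate (2 * r) 1 @ w) = replicate (2 * Suc r) 1 @ w" by simp
  finally show ?case .
qed simp

text \<open>There are two ways of discarding terms. Removing the letters \<open>1\<close> one at a time gives a
  factor \<open>p 1\<close> each; contracting neighbouring letters \<open>1\<close> in pairs gives a factor \<open>p 2\<close> per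
  pair. For odd \<open>r\<close> one letter on each side of the \<open>2\<close> has no partner, and these two are
  contracted with each other.\<close>

lemma tau_middle_square_ge:
  assumes p: "\<And>a. a \<ge> 1 \<Longrightarrow> p a \<ge> 0"
  shows "tau p (replicate r 1 @ 2 # replicate r 1) \<ge> p 2 * (p 1 ^ 2) ^ r"
    "tau p (replicate r 1 @ 2 # replicate r 1) \<ge> p 2 * p 2 ^ r"
proof -
  have p12: "p 1 \<ge> 0" "p 2 \<ge> 0" by (rule p, simp)+
  have one: "tau p (2 # replicate r 1) \<ge> p 2 * p 1 ^ r"
  proof -
    have "p 1 ^ r * tau p [] \<le> tau p (replicate r 1 @ [])" by (intro tau_ones_ge_p1 p) simp_all
    then have "p 2 * p 1 ^ r \<le> p 2 * tau p (replicate r 1)" using p12 by (intro mult_left_mono) auto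
    also have "\<dots> \<le> tau p (2 # replicate r 1)" by (intro tau_ge_peel p) simp_all
    finally show ?thesis .
  qed
  have "p 2 * (p 1 ^ 2) ^ r = p 1 ^ r * (p 2 * p 1 ^ r)"
    by (simp add: power_mult[symmetric] mult_2 power_add)
  also have "\<dots> \<le> p 1 ^ r * tau p (2 # replicate r 1)" using one p12 by (intro mult_left_mono) auto
  also have "\<dots> \<le> tau p (replicate r 1 @ 2 # replicate r 1)" by (intro tau_ones_ge_p1 p) simp_all
  finally show "tau p (replicate r 1 @ 2 # replicate r 1) \<ge> p 2 * (p 1 ^ 2) ^ r" .
  have ev: "p 2 ^ i \<le> tau p (replicate (2 * i) 1)" for i
    using tau_even_ones_ge_p2[of p "[]" i, OF p] by simp
  show "tau p (replicate r 1 @ 2 # replicate r 1) \<ge> p 2 * p 2 ^ r"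
  proof (cases "even r")
    case True
    then obtain i where r: "r = 2 * i" by (elim evenE)
    have "p 2 * p 2 ^ r = p 2 ^ i * (p 2 * p 2 ^ i)" by (simp add: r mult_2 power_add)
    also have "\<dots> \<le> p 2 ^ i * (p 2 * tau p (replicate r 1))"
      using ev[of i] p12 r by (intro mult_left_mono) auto
    also have "\<dots> \<le> p 2 ^ i * tau p (2 # replicate r 1)"
      using p12 by (intro mult_left_mono tau_ge_peel p) simp_all
    also have "\<dots> \<le> tau p (replicate (2 * i) 1 @ 2 # replicate r 1)" by (intro tau_even_ones_ge_p2 p) simp_all
    finally show ?thesis by (simp add: r)
  next
    case False
    then obtain i where r: "r = 2 * i + 1" by (elim oddE)
    let ?as = "2 # replicate r 1"
    have l: "loop 1 ?as 1 = [2, 2]" "drop (Suc 1) ?as = replicate (2 * i) 1"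
      using r by (auto simp: loop_def numeral_2_eq_2)
    have "p 2 * p 2 \<le> p 2 * tau p [2]" by (simp add: tau_single)
    also have "\<dots> \<le> tau p [2, 2]" by (intro tau_ge_peel p) simp_all
    finally have "p 2 * p 2 * p 2 ^ i \<le> tau p [2, 2] * tau p (replicate (2 * i) 1)"
      using ev[of i] p12 tau_nonneg[of p "[2, 2]", OF p] by (intro mult_mono) simp_all
    also have "\<dots> \<le> tau p (1 # ?as)" using tau_ge_peel(2)[of p 1 ?as 1, OF p] r l by simp
    finally have a: "p 2 * p 2 * p 2 ^ i \<le> tau p (1 # ?as)" .
    have "p 2 * p 2 ^ r = p 2 ^ i * (p 2 * p 2 * p 2 ^ i)" by (simp add: r mult_2 power_add)
    also have "\<dots> \<le> p 2 ^ i * tau p (1 # ?as)" using a p12 by (intro mult_left_mono) auto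
    also have "\<dots> \<le> tau p (replicate (2 * i) 1 @ 1 # ?as)" by (intro tau_even_ones_ge_p2 p) simp_all
    also have "replicate (2 * i) 1 @ 1 # ?as = replicate r 1 @ 2 # replicate r 1"
      unfolding r by (simp only: replicate_app_Cons_same[symmetric] Suc_eq_plus1[symmetric] replicate_Suc append_Cons)
    finally show ?thesis .
  qed
qed

lemma limit_cov_nonneg:
  assumes p: "\<And>a. a \<ge> 1 \<Longrightarrow> p a \<ge> 0" and u: "pos_word u"
  shows "pos_word w \<Longrightarrow> limit_cov p w u \<ge> 0"
proof (induction "length w" arbitrary: w rule: less_induct)
  case less
  show ?case
  proof (cases w)
    case (Cons a as)
    have pw: "a \<ge> 1" "pos_word as" using less.prems Cons by auto
    have "0 \<le> tau p (loop a as s) * limit_cov p (drop (Suc s) as) u + tau p (drop (Suc s) as) * limit_cov p (loop a as s) u"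
      if "s < length as" for s
      using that pw Cons
      by (intro add_nonneg_nonneg mult_nonneg_nonneg tau_nonneg less.hyps p) (simp_all add: pos_word_contract)
    moreover have "0 \<le> tau p (merge1 a as u s) + tau p (merge2 a as u s)" for s
      using pw u by (intro add_nonneg_nonneg tau_nonneg p) (simp_all add: pos_word_contract)
    moreover have "0 \<le> p a * limit_cov p as u"
      using pw Cons by (intro mult_nonneg_nonneg less.hyps p) simp_all
    ultimately show ?thesis unfolding Cons limit_cov.simps(2)
      by (intro add_nonneg_nonneg[OF add_nonneg_nonneg[OF _ sum_nonneg] sum_nonneg]) simp_all
  qed simp
qed

lemma limit_cov_ge_merge:
  assumes p: "\<And>a. a \<ge> 1 \<Longrightarrow> p a \<ge> 0" and u: "pos_word u" and w: "a \<ge> 1" "pos_word as" and s: "s < length u"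
  shows "limit_cov p (a # as) u \<ge> tau p (merge1 a as u s)"
proof -
  have "0 \<le> (\<Sum>s<length as. tau p (loop a as s) * limit_cov p (drop (Suc s) as) u + tau p (drop (Suc s) as) * limit_cov p (loop a as s) u)"
    using w u by (intro sum_nonneg add_nonneg_nonneg mult_nonneg_nonneg tau_nonneg limit_cov_nonneg p) (simp_all add: pos_word_contract)
  moreover have "0 \<le> p a * limit_cov p as u"
    by (intro mult_nonneg_nonneg limit_cov_nonneg p w u)
  moreover have t: "0 \<le> tau p (merge1 a as u s)" "0 \<le> tau p (merge2 a as u s)" for s
  proof -
    have "pos_word (merge1 a as u s)" "pos_word (merge2 a as u s)" for s
      using w u by (simp_all add: pos_word_contract)
    then show "0 \<le> tau p (merge1 a as u s)" "0 \<le> tau p (merge2 a as u s)" for s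
      using tau_nonneg[of p, OF p] by simp_all
  qed
  then have "tau p (merge1 a as u s) + tau p (merge2 a as u s) \<le> (\<Sum>s<length u. tau p (merge1 a as u s) + tau p (merge2 a as u s))"
    using s by (intro member_le_sum[of s]) (auto intro: add_nonneg_nonneg)
  ultimately show ?thesis unfolding limit_cov.simps(2) using t(2)[of s]
    by linarith
qed

text \<open>Keep only the term in which the first letters of the two words merge into a \<open>2\<close>. The maximum
  serves the two cases of \<open>K = max 1 (p 1)\<close>.\<close>

lemma limit_var_lower_bound:
  assumes p: "\<And>a. a \<ge> 1 \<Longrightarrow> p a \<ge> 0" and l: "l \<ge> 1"
  defines "u \<equiv> replicate l (1::nat)"
  shows "limit_cov p u u \<ge> p 2 * (max ((p 1)\<^sup>2) (p 2)) ^ (l - 1)"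
proof -
  obtain r where r: "l = Suc r" using l by (cases l) auto
  have "merge1 1 (replicate r 1) u 0 = replicate r 1 @ 2 # replicate r 1"
    by (simp add: merge1_def u_def r numeral_2_eq_2)
  then have "tau p (replicate r 1 @ 2 # replicate r 1) \<le> limit_cov p (1 # replicate r 1) u"
    using limit_cov_ge_merge[of p u 1 "replicate r 1" 0, OF p] by (simp add: u_def r)
  then have "tau p (replicate r 1 @ 2 # replicate r 1) \<le> limit_cov p u u" by (simp add: u_def r)
  moreover have "p 2 * (max ((p 1)\<^sup>2) (p 2)) ^ r \<le> tau p (replicate r 1 @ 2 # replicate r 1)"
    using tau_middle_square_ge[of p r, OF p] by (simp add: max_def)
  ultimately show ?thesis by (simp add: r)
qed

section \<open>Traces of powers of a positive definite matrix\<close>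

text \<open>The discriminant argument: \<open>b (x f + y g) (x f + y g) \<ge> 0\<close> for a suitable combination.\<close>

lemma quad_Cauchy_Schwarz:
  fixes B :: "nat \<Rightarrow> nat \<Rightarrow> real" and f g :: "nat \<Rightarrow> real"
  assumes sym: "\<And>i j. i < d \<Longrightarrow> j < d \<Longrightarrow> B i j = B j i"
    and psd: "\<And>f. (\<Sum>i<d. \<Sum>j<d. f i * B i j * f j) \<ge> 0"
  defines "b \<equiv> \<lambda>f g. \<Sum>i<d. \<Sum>j<d. f i * B i j * g j"
  shows "(b f g)\<^sup>2 \<le> b f f * b g g"
proof -
  have bs: "b g f = b f g"
  proof -
    have "b g f = (\<Sum>j<d. \<Sum>i<d. g i * B i j * f j)" unfolding b_def by (rule sum.swap)
    also have "\<dots> = b f g" unfolding b_def by (intro sum.cong refl) (auto simp: sym mult_ac)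
    finally show ?thesis .
  qed
  have q: "0 \<le> s\<^sup>2 * b f f + 2 * s * t * b f g + t\<^sup>2 * b g g" for s t
  proof -
    have "0 \<le> (\<Sum>i<d. \<Sum>j<d. (s * f i + t * g i) * B i j * (s * f j + t * g j))"
      using psd[of "\<lambda>i. s * f i + t * g i"] .
    also have "\<dots> = (\<Sum>i<d. \<Sum>j<d. s\<^sup>2 * (f i * B i j * f j) + s * t * (f i * B i j * g j) + s * t * (g i * B i j * f j) + t\<^sup>2 * (g i * B i j * g j))"
      by (intro sum.cong refl) (simp add: algebra_simps power2_eq_square)
    also have "\<dots> = s\<^sup>2 * b f f + s * t * b f g + s * t * b g f + t\<^sup>2 * b g g"
      unfolding b_def by (simp add: sum.distrib sum_distrib_left)
    finally show ?thesis by (simp add: bs mult_ac)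
  qed
  have nn: "b f f \<ge> 0" "b g g \<ge> 0" unfolding b_def by (rule psd)+
  show ?thesis
  proof (cases "b g g = 0")
    case True
    have "b f g = 0"
    proof (rule ccontr)
      assume ne: "b f g \<noteq> 0"
      have "0 \<le> b f f + 2 * (- (b f f + 1) / (2 * b f g)) * b f g"
        using q[of 1 "- (b f f + 1) / (2 * b f g)"] True by simp
      then show False using ne by (simp add: field_simps)
    qed
    then show ?thesis using nn by simp
  next
    case False
    then have pos: "b g g > 0" using nn by simp
    have "0 \<le> (b g g)\<^sup>2 * b f f + 2 * b g g * (- b f g) * b f g + (- b f g)\<^sup>2 * b g g"
      by (rule q)
    also have "\<dots> = b g g * (b f f * b g g - (b f g)\<^sup>2)" by (simp add: algebra_simps power2_eq_square)
    finally show ?thesis using pos by (simp add: zero_le_mult_iff)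
  qed
qed

locale sym_powers =
  fixes d :: nat and D :: "real mat" and S :: real
  assumes D: "D \<in> carrier_mat d d" and sym: "\<And>i j. i < d \<Longrightarrow> j < d \<Longrightarrow> D $$ (i, j) = D $$ (j, i)"
    and S: "S > 0"
begin

lemma pow_add: "i < d \<Longrightarrow> j < d \<Longrightarrow> (\<Sum>k<d. (D ^\<^sub>m a) $$ (i, k) * (D ^\<^sub>m b) $$ (k, j)) = (D ^\<^sub>m (a + b)) $$ (i, j)"
proof (induction b arbitrary: j)
  case 0
  then show ?case using D by (simp add: if_distrib[of "\<lambda>x. _ * x"] sum.delta cong: if_cong)
next
  case (Suc b)
  have pc: "D ^\<^sub>m a \<in> carrier_mat d d" for a by (rule pow_carrier_mat[OF D])
  have "(\<Sum>k<d. (D ^\<^sub>m a) $$ (i, k) * (D ^\<^sub>m Suc b) $$ (k, j))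
    = (\<Sum>k<d. \<Sum>l<d. (D ^\<^sub>m a) $$ (i, k) * (D ^\<^sub>m b) $$ (k, l) * D $$ (l, j))"
    using Suc.prems index_mult_mat_sum[OF pc D] by (simp add: sum_distrib_left mult.assoc del: index_mult_mat)
  also have "\<dots> = (\<Sum>l<d. \<Sum>k<d. (D ^\<^sub>m a) $$ (i, k) * (D ^\<^sub>m b) $$ (k, l) * D $$ (l, j))" by (rule sum.swap)
  also have "\<dots> = (\<Sum>l<d. (D ^\<^sub>m (a + b)) $$ (i, l) * D $$ (l, j))"
    using Suc by (intro sum.cong refl) (simp add: sum_distrib_right[symmetric])
  also have "\<dots> = (D ^\<^sub>m (a + b) * D) $$ (i, j)" using Suc.prems by (intro index_mult_mat_sum[OF pc D, symmetric])
  finally show ?case by simp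
qed

lemma pow_sym: "i < d \<Longrightarrow> j < d \<Longrightarrow> (D ^\<^sub>m a) $$ (i, j) = (D ^\<^sub>m a) $$ (j, i)"
proof (induction a arbitrary: i j)
  case 0 then show ?case using D by auto
next
  case (Suc a)
  have one: "(D ^\<^sub>m 1) $$ (k, l) = D $$ (k, l)" for k l using D by simp
  have "(D ^\<^sub>m Suc a) $$ (i, j) = (\<Sum>k<d. (D ^\<^sub>m a) $$ (i, k) * D $$ (k, j))"
    using pow_add[OF Suc.prems, of a 1] unfolding one by simp
  also have "\<dots> = (\<Sum>k<d. D $$ (j, k) * (D ^\<^sub>m a) $$ (k, i))"
    using Suc sym by (intro sum.cong refl) (auto simp: mult_ac)
  also have "\<dots> = (D ^\<^sub>m Suc a) $$ (j, i)" using pow_add[OF Suc.prems(2,1), of 1 a] unfolding one by simp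
  finally show ?case .
qed

lemma wishart_words_powers: "n > 0 \<Longrightarrow> wishart_words d n (\<lambda>a i j. (D ^\<^sub>m a) $$ (i, j) / S ^ a)"
proof
  fix i j a b assume ij: "i < d" "j < d"
  show "(D ^\<^sub>m a) $$ (i, j) / S ^ a = (D ^\<^sub>m a) $$ (j, i) / S ^ a" using pow_sym[OF ij] by simp
  have "(\<Sum>k<d. (D ^\<^sub>m a) $$ (i, k) / S ^ a * ((D ^\<^sub>m b) $$ (k, j) / S ^ b))
    = (\<Sum>k<d. (D ^\<^sub>m a) $$ (i, k) * (D ^\<^sub>m b) $$ (k, j)) / S ^ (a + b)"
    by (simp add: sum_divide_distrib power_add)
  then show "(\<Sum>k<d. (D ^\<^sub>m a) $$ (i, k) / S ^ a * ((D ^\<^sub>m b) $$ (k, j) / S ^ b)) = (D ^\<^sub>m (a + b)) $$ (i, j) / S ^ (a + b)"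
    by (simp add: pow_add[OF ij])
qed

text \<open>For the word \<open>1 \<dots> 1\<close> the trace is that of a power of the Wishart matrix itself.\<close>

lemma T_replicate:
  assumes n: "n > 0" and W: "W \<in> carrier_mat n n"
    and We: "\<And>x y. x < n \<Longrightarrow> y < n \<Longrightarrow> W $$ (x, y) = (\<Sum>a<d. \<Sum>b<d. z (a, x) * D $$ (a, b) * z (b, y))"
  shows "wishart_words.T d n (\<lambda>a i j. (D ^\<^sub>m a) $$ (i, j) / S ^ a) z (replicate l 1) = mat_Tr (W ^\<^sub>m l) / S ^ l"
proof -
  interpret wishart_words d n "\<lambda>a i j. (D ^\<^sub>m a) $$ (i, j) / S ^ a" by (rule wishart_words_powers[OF n])
  have P1: "P z [1] x y = W $$ (x, y) / S" if "x < n" "y < n" for x y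
    using that D by (simp add: P_single U_def We sum_distrib_left sum_divide_distrib mult_ac)
  have P: "P z (replicate l 1) x y = (W ^\<^sub>m l) $$ (x, y) / S ^ l" if "x < n" "y < n" for x y l
    using that
  proof (induction l arbitrary: x)
    case 0
    then show ?case using W by auto
  next
    case (Suc l)
    have "P z (replicate (Suc l) 1) x y = (\<Sum>k<n. P z [1] x k * P z (replicate l 1) k y)"
      using P_append[of x z "[1]" "replicate l 1" y] Suc.prems by simp
    also have "\<dots> = (\<Sum>k<n. W $$ (x, k) * (W ^\<^sub>m l) $$ (k, y)) / S ^ Suc l"
      unfolding sum_divide_distrib using Suc P1 by (intro sum.cong refl) simp
    also have "(\<Sum>k<n. W $$ (x, k) * (W ^\<^sub>m l) $$ (k, y)) = (W * W ^\<^sub>m l) $$ (x, y)"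
      by (rule index_mult_mat_sum[OF W pow_carrier_mat[OF W] Suc.prems, symmetric])
    finally show ?case unfolding pow_mat_Suc_left[OF W] .
  qed
  have "dim_row (W ^\<^sub>m l) = n" using pow_carrier_mat[OF W] by blast
  then show ?thesis unfolding T_def mat_Tr_def using P by (simp add: sum_divide_distrib)
qed

end

text \<open>The two properties of a positive semidefinite matrix with operator norm at most \<open>S\<close> from
  which \<open>Tr (D^(k+1)) \<le> S Tr (D^k)\<close> follows without a diagonalisation.\<close>

locale psd_powers = sym_powers +
  assumes psd: "\<And>f. (\<Sum>i<d. \<Sum>j<d. f i * D $$ (i, j) * f j) \<ge> 0"
    and bound: "\<And>f. (\<Sum>i<d. (\<Sum>j<d. D $$ (i, j) * f j)\<^sup>2) \<le> S\<^sup>2 * (\<Sum>i<d. (f i)\<^sup>2)"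
begin

definition quad :: "(nat \<Rightarrow> real) \<Rightarrow> real" where "quad f = (\<Sum>i<d. \<Sum>j<d. f i * D $$ (i, j) * f j)"

lemma quad_le: "quad f \<le> S * (\<Sum>i<d. (f i)\<^sup>2)"
proof -
  let ?g = "\<lambda>i. \<Sum>j<d. D $$ (i, j) * f j"
  have "quad f = (\<Sum>i<d. f i * ?g i)" unfolding quad_def by (simp add: sum_distrib_left mult.assoc)
  then have "(quad f)\<^sup>2 \<le> (\<Sum>i<d. (f i)\<^sup>2) * (\<Sum>i<d. (?g i)\<^sup>2)"
    by (simp add: Cauchy_Schwarz_ineq_sum)
  also have "\<dots> \<le> (\<Sum>i<d. (f i)\<^sup>2) * (S\<^sup>2 * (\<Sum>i<d. (f i)\<^sup>2))"
    by (intro mult_left_mono bound sum_nonneg) auto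
  also have "\<dots> = (S * (\<Sum>i<d. (f i)\<^sup>2))\<^sup>2" by (simp add: power2_eq_square)
  finally show ?thesis using S by (intro power2_le_imp_le[of "quad f"]) (auto intro!: mult_nonneg_nonneg sum_nonneg)
qed

text \<open>Cauchy-Schwarz for the form of \<open>D\<close> gives
  \<open>|D f|^4 \<le> quad (D f) * quad f \<le> S |D f|\<^sup>2 * quad f\<close>.\<close>

lemma norm_apply_le: "(\<Sum>i<d. (\<Sum>j<d. D $$ (i, j) * f j)\<^sup>2) \<le> S * quad f"
proof -
  let ?g = "\<lambda>i. \<Sum>j<d. D $$ (i, j) * f j"
  let ?N = "\<Sum>i<d. (?g i)\<^sup>2"
  have N: "?N \<ge> 0" by (intro sum_nonneg) auto
  have "?N = (\<Sum>i<d. \<Sum>j<d. ?g i * D $$ (i, j) * f j)"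
    by (simp add: power2_eq_square sum_distrib_left mult.assoc)
  then have "?N\<^sup>2 \<le> quad ?g * quad f"
    unfolding quad_def using quad_Cauchy_Schwarz[where B="\<lambda>i j. D $$ (i, j)" and d=d, OF sym psd, of ?g f] by simp
  also have "\<dots> \<le> (S * ?N) * quad f"
    using psd[of f] unfolding quad_def[symmetric] by (intro mult_right_mono quad_le)
  finally have "?N * ?N \<le> ?N * (S * quad f)" by (simp add: power2_eq_square mult_ac)
  moreover have "0 \<le> S * quad f" using S psd[of f] by (simp add: quad_def)
  ultimately show ?thesis using N by (cases "?N = 0") auto
qed

lemma Tr_odd: "mat_Tr (D ^\<^sub>m (2 * m + 1)) = (\<Sum>k<d. quad (\<lambda>i. (D ^\<^sub>m m) $$ (i, k)))"
proof -
  have one: "(D ^\<^sub>m 1) $$ (k, l) = D $$ (k, l)" for k l using D by simp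
  have e: "(D ^\<^sub>m (2 * m + 1)) $$ (k, k) = quad (\<lambda>i. (D ^\<^sub>m m) $$ (i, k))" if k: "k < d" for k
  proof -
    have "(D ^\<^sub>m (m + (1 + m))) $$ (k, k) = (\<Sum>i<d. (D ^\<^sub>m m) $$ (k, i) * (D ^\<^sub>m (1 + m)) $$ (i, k))"
      by (rule pow_add[OF k k, symmetric])
    also have "\<dots> = (\<Sum>i<d. (D ^\<^sub>m m) $$ (i, k) * (\<Sum>j<d. D $$ (i, j) * (D ^\<^sub>m m) $$ (j, k)))"
    proof (rule sum.cong[OF refl])
      fix i assume "i \<in> {..<d}"
      then have i: "i < d" by simp
      show "(D ^\<^sub>m m) $$ (k, i) * (D ^\<^sub>m (1 + m)) $$ (i, k) = (D ^\<^sub>m m) $$ (i, k) * (\<Sum>j<d. D $$ (i, j) * (D ^\<^sub>m m) $$ (j, k))"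
        using pow_add[OF i k, of 1 m] pow_sym[OF k i, of m] unfolding one by simp
    qed
    also have "\<dots> = quad (\<lambda>i. (D ^\<^sub>m m) $$ (i, k))" by (simp add: quad_def sum_distrib_left mult.assoc)
    finally show ?thesis by (simp add: mult_2)
  qed
  have "dim_row (D ^\<^sub>m (2 * m + 1)) = d" using pow_carrier_mat[OF D] by blast
  then show ?thesis unfolding mat_Tr_def using e by (intro sum.cong) auto
qed

lemma Tr_even: "mat_Tr (D ^\<^sub>m (2 * m)) = (\<Sum>k<d. \<Sum>i<d. ((D ^\<^sub>m m) $$ (i, k))\<^sup>2)"
proof -
  have e: "(D ^\<^sub>m (2 * m)) $$ (k, k) = (\<Sum>i<d. ((D ^\<^sub>m m) $$ (i, k))\<^sup>2)" if k: "k < d" for k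
  proof -
    have "(D ^\<^sub>m (m + m)) $$ (k, k) = (\<Sum>i<d. (D ^\<^sub>m m) $$ (k, i) * (D ^\<^sub>m m) $$ (i, k))"
      by (rule pow_add[OF k k, symmetric])
    also have "\<dots> = (\<Sum>i<d. ((D ^\<^sub>m m) $$ (i, k))\<^sup>2)"
      using pow_sym[OF k] by (intro sum.cong refl) (simp add: power2_eq_square)
    finally show ?thesis by (simp add: mult_2)
  qed
  have "dim_row (D ^\<^sub>m (2 * m)) = d" using pow_carrier_mat[OF D] by blast
  then show ?thesis unfolding mat_Tr_def using e by (intro sum.cong) auto
qed

lemma Tr_pow_nonneg: "mat_Tr (D ^\<^sub>m k) \<ge> 0"
proof (cases "even k")
  case True
  then show ?thesis by (elim evenE) (simp add: Tr_even sum_nonneg)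
next
  case False
  then obtain m where k: "k = 2 * m + 1" by (elim oddE)
  show ?thesis unfolding k Tr_odd quad_def by (rule sum_nonneg) (rule psd)
qed

text \<open>Write \<open>D^k\<close> as a product of two equal powers, with one factor \<open>D\<close> between them if \<open>k\<close> is
  odd, and estimate column by column.\<close>

lemma Tr_pow_Suc_le: "mat_Tr (D ^\<^sub>m Suc k) \<le> S * mat_Tr (D ^\<^sub>m k)"
proof (cases "even k")
  case True
  then obtain m where k: "k = 2 * m" by (elim evenE)
  have "mat_Tr (D ^\<^sub>m Suc k) = (\<Sum>i<d. quad (\<lambda>j. (D ^\<^sub>m m) $$ (j, i)))" using Tr_odd[of m] by (simp add: k)
  also have "\<dots> \<le> (\<Sum>i<d. S * (\<Sum>j<d. ((D ^\<^sub>m m) $$ (j, i))\<^sup>2))" by (intro sum_mono quad_le)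
  finally show ?thesis by (simp add: k Tr_even sum_distrib_left)
next
  case False
  then obtain m where k: "k = 2 * m + 1" by (elim oddE)
  have one: "(D ^\<^sub>m 1) $$ (k, l) = D $$ (k, l)" for k l using D by simp
  have "mat_Tr (D ^\<^sub>m Suc k) = (\<Sum>i<d. \<Sum>j<d. ((D ^\<^sub>m (1 + m)) $$ (j, i))\<^sup>2)" using Tr_even[of "1 + m"] by (simp add: k)
  also have "\<dots> = (\<Sum>i<d. \<Sum>j<d. (\<Sum>h<d. D $$ (j, h) * (D ^\<^sub>m m) $$ (h, i))\<^sup>2)"
  proof (intro sum.cong refl)
    fix i j assume "i \<in> {..<d}" "j \<in> {..<d}"
    then show "((D ^\<^sub>m (1 + m)) $$ (j, i))\<^sup>2 = (\<Sum>h<d. D $$ (j, h) * (D ^\<^sub>m m) $$ (h, i))\<^sup>2"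
      using pow_add[of j i 1 m] unfolding one by simp
  qed
  also have "\<dots> \<le> (\<Sum>i<d. S * quad (\<lambda>h. (D ^\<^sub>m m) $$ (h, i)))" by (intro sum_mono norm_apply_le)
  finally show ?thesis using Tr_odd[of m] by (simp add: k sum_distrib_left)
qed

end

lemma apply_vec_norm:
  assumes "D \<in> carrier_mat d d"
  shows "euclid_norm (D *\<^sub>v vec d f) = sqrt (\<Sum>i<d. (\<Sum>j<d. D $$ (i, j) * f j)\<^sup>2)"
    "euclid_norm (vec d f) = sqrt (\<Sum>i<d. (f i)\<^sup>2)"
    "scalar_prod (vec d f) (D *\<^sub>v vec d f) = (\<Sum>i<d. \<Sum>j<d. f i * D $$ (i, j) * f j)"
  using assms
  by (auto simp: euclid_norm_def scalar_prod_def atLeast0LessThan power2_eq_square sum_distrib_left mult.assoc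
      intro!: sum.cong)

text \<open>The set whose supremum is the spectral norm is bounded, by means of the absolute row sums,
  hence the supremum is an upper bound for all vectors after scaling. It is positive because
  \<open>D\<close> does not annihilate the first basis vector.\<close>

lemma psd_powers_pos_def:
  assumes D: "D \<in> carrier_mat d d" and tr: "transpose_mat D = D" and pd: "pos_def_mat D" and d: "d \<ge> 1"
  shows "psd_powers d D (spectral_norm D)"
proof -
  let ?S = "spectral_norm D" let ?B = "{v \<in> carrier_vec d. euclid_norm v \<le> 1}"
  let ?N = "\<lambda>f. \<Sum>i<d. (\<Sum>j<d. D $$ (i, j) * f j)\<^sup>2" let ?n = "\<lambda>f. \<Sum>i<d. (f i)\<^sup>2"
  have S_def: "?S = (SUP v\<in>?B. euclid_norm (D *\<^sub>v v))" using D by (simp add: spectral_norm_def)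
  have vec: "v = vec d (\<lambda>i. v $ i)" if "v \<in> carrier_vec d" for v :: "real vec" using that by auto
  have pos: "(\<Sum>i<d. \<Sum>j<d. f i * D $$ (i, j) * f j) > 0" if "i < d" "f i \<noteq> 0" for f i
  proof -
    have "vec d f \<noteq> 0\<^sub>v d" using that by (metis index_vec index_zero_vec(1))
    then have "scalar_prod (vec d f) (D *\<^sub>v vec d f) > 0" using pd D by (simp add: pos_def_mat_def)
    then show ?thesis unfolding apply_vec_norm(3)[OF D] .
  qed
  have psd: "(\<Sum>i<d. \<Sum>j<d. f i * D $$ (i, j) * f j) \<ge> 0" for f
  proof (cases "\<exists>i<d. f i \<noteq> 0")
    case True
    then show ?thesis using pos by (auto intro: less_imp_le)
  qed simp
  have bdd: "bdd_above ((\<lambda>v. euclid_norm (D *\<^sub>v v)) ` ?B)"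
  proof (rule bdd_aboveI2)
    fix v assume v: "v \<in> ?B"
    then have v': "v = vec d (\<lambda>i. v $ i)" using vec by blast
    have "sqrt (?n (\<lambda>i. v $ i)) \<le> 1" using v apply_vec_norm(2)[OF D, of "\<lambda>i. v $ i"] v' by simp
    then have n1: "?n (\<lambda>i. v $ i) \<le> 1" by simp
    have vi: "\<bar>v $ i\<bar> \<le> 1" if "i < d" for i
    proof -
      have "(v $ i)\<^sup>2 \<le> ?n (\<lambda>i. v $ i)" using that by (intro member_le_sum) auto
      then have "(v $ i)\<^sup>2 \<le> 1" using n1 by simp
      then show ?thesis by (simp add: abs_square_le_1)
    qed
    have "?N (\<lambda>i. v $ i) \<le> (\<Sum>i<d. (\<Sum>j<d. \<bar>D $$ (i, j)\<bar>)\<^sup>2)"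
    proof (rule sum_mono)
      fix i assume "i \<in> {..<d}"
      have "\<bar>\<Sum>j<d. D $$ (i, j) * v $ j\<bar> \<le> (\<Sum>j<d. \<bar>D $$ (i, j) * v $ j\<bar>)" by (rule sum_abs)
      also have "\<dots> \<le> (\<Sum>j<d. \<bar>D $$ (i, j)\<bar>)"
        using vi by (intro sum_mono) (simp add: abs_mult mult_left_le)
      finally have "\<bar>\<Sum>j<d. D $$ (i, j) * v $ j\<bar> \<le> (\<Sum>j<d. \<bar>D $$ (i, j)\<bar>)" .
      then show "(\<Sum>j<d. D $$ (i, j) * v $ j)\<^sup>2 \<le> (\<Sum>j<d. \<bar>D $$ (i, j)\<bar>)\<^sup>2"
        by (intro power2_le_iff_abs_le[THEN iffD2]) (auto intro: sum_nonneg)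
    qed
    then show "euclid_norm (D *\<^sub>v v) \<le> sqrt (\<Sum>i<d. (\<Sum>j<d. \<bar>D $$ (i, j)\<bar>)\<^sup>2)"
      by (subst v', subst apply_vec_norm(1)[OF D]) simp
  qed
  have le: "euclid_norm (D *\<^sub>v v) \<le> ?S" if "v \<in> ?B" for v
    unfolding S_def by (rule cSUP_upper[OF that bdd])
  have S: "?S > 0"
  proof -
    let ?e = "\<lambda>i::nat. if i = 0 then 1 else (0::real)"
    have n: "?n ?e = 1" using d by (simp add: if_distrib[of "\<lambda>x. x\<^sup>2"] sum.delta cong: if_cong)
    have "vec d ?e \<in> ?B" using n by (simp add: apply_vec_norm(2)[OF D])
    from le[OF this] have "sqrt (?N ?e) \<le> ?S" by (simp only: apply_vec_norm(1)[OF D])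
    moreover have "?N ?e > 0"
    proof (rule ccontr)
      assume "\<not> ?N ?e > 0"
      then have "?N ?e = 0" using sum_nonneg[of "{..<d}" "\<lambda>i. (\<Sum>j<d. D $$ (i, j) * ?e j)\<^sup>2"] by simp
      then have z: "\<And>i. i < d \<Longrightarrow> (\<Sum>j<d. D $$ (i, j) * ?e j) = 0" by (simp add: sum_nonneg_eq_0_iff)
      have "(\<Sum>i<d. \<Sum>j<d. ?e i * D $$ (i, j) * ?e j) = (\<Sum>i<d. ?e i * (\<Sum>j<d. D $$ (i, j) * ?e j))"
        by (simp only: sum_distrib_left mult.assoc)
      also have "\<dots> = 0" using z by (intro sum.neutral ballI) (simp only: lessThan_iff mult_zero_right)
      finally show False using pos[of 0 ?e] d by simp
    qed
    ultimately show ?thesis by (meson less_le_trans real_sqrt_gt_zero)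
  qed
  have bound: "?N f \<le> ?S\<^sup>2 * ?n f" for f
  proof (cases "\<exists>i<d. f i \<noteq> 0")
    case False
    then show ?thesis by simp
  next
    case True
    then obtain i where "i < d" "f i \<noteq> 0" by blast
    then have npos: "?n f > 0" by (intro sum_pos2[of _ i]) auto
    let ?c = "sqrt (?n f)" let ?g = "\<lambda>i. f i / ?c"
    have c: "?c > 0" "?c\<^sup>2 = ?n f" using npos by auto
    have "?n ?g = 1" using npos by (simp add: power_divide c sum_divide_distrib[symmetric])
    then have "vec d ?g \<in> ?B" by (simp add: apply_vec_norm(2)[OF D])
    from le[OF this] have "sqrt (?N ?g) \<le> ?S" by (simp only: apply_vec_norm(1)[OF D])
    then have "?N ?g \<le> ?S\<^sup>2" using S by (simp add: real_sqrt_le_iff' sqrt_le_D)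
    moreover have "?N ?g = ?N f / ?n f"
      using c by (simp add: sum_divide_distrib[symmetric] power_divide)
    ultimately have "?N f / ?n f \<le> ?S\<^sup>2" by (simp only:)
    then show ?thesis using npos by (simp only: pos_divide_le_eq)
  qed
  show ?thesis
  proof
    show "D $$ (i, j) = D $$ (j, i)" if "i < d" "j < d" for i j
      using D tr that by (metis carrier_matD index_transpose_mat(1))
  qed (use D S psd bound in auto)
qed

section \<open>Amplification\<close>

text \<open>An index of a Kronecker product is a pair of indices, encoded as \<open>k = i * a + r\<close>.\<close>

lemma sum_div_mod:
  fixes F :: "nat \<Rightarrow> nat \<Rightarrow> 'a :: comm_monoid_add"
  shows "(\<Sum>k<d * a. F (k div a) (k mod a)) = (\<Sum>i<d. \<Sum>r<a. F i r)"
proof -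
  have "(\<Sum>k<d * a. F (k div a) (k mod a)) = (\<Sum>(i, r)\<in>{..<d} \<times> {..<a}. F i r)"
  proof (rule sum.reindex_bij_witness[where i="\<lambda>(i, r). i * a + r" and j="\<lambda>k. (k div a, k mod a)"])
    fix k assume k: "k \<in> {..<d * a}"
    then have "a > 0" by (cases a) auto
    then show "(k div a, k mod a) \<in> {..<d} \<times> {..<a}" using k by (simp add: less_mult_imp_div_less)
  next
    fix ir assume "ir \<in> {..<d} \<times> {..<a}"
    then obtain i r where ir: "ir = (i, r)" "i < d" "r < a" by auto
    have "i * a + r < Suc i * a" using ir by simp
    also have "\<dots> \<le> d * a" using ir by (intro mult_right_mono) auto
    finally show "(case ir of (i, r) \<Rightarrow> i * a + r) \<in> {..<d * a}" using ir by simp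
    show "((case ir of (i, r) \<Rightarrow> i * a + r) div a, (case ir of (i, r) \<Rightarrow> i * a + r) mod a) = ir"
      using ir by simp
  qed auto
  then show ?thesis by (simp add: sum.cartesian_product)
qed

lemma kronecker_one_carrier: "D \<in> carrier_mat d d \<Longrightarrow> kronecker D (1\<^sub>m a) \<in> carrier_mat (d * a) (d * a)"
  by (simp add: kronecker_def)

lemma div_mod_lt: "(k::nat) < d * a \<Longrightarrow> k div a < d \<and> k mod a < a"
  by (cases "a = 0") (auto simp: less_mult_imp_div_less)

lemma kronecker_one_index: "D \<in> carrier_mat d d \<Longrightarrow> i < d * a \<Longrightarrow> j < d * a \<Longrightarrow>
  kronecker D (1\<^sub>m a) $$ (i, j) = (if i mod a = j mod a then D $$ (i div a, j div a) else 0)"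
  using div_mod_lt[of i d a] div_mod_lt[of j d a] by (simp add: kronecker_def)

lemma kronecker_one_mult:
  assumes A: "A \<in> carrier_mat d d" and B: "B \<in> carrier_mat d d"
  shows "kronecker A (1\<^sub>m a) * kronecker B (1\<^sub>m a) = kronecker (A * B) (1\<^sub>m a)"
proof (rule eq_matI)
  note cA = kronecker_one_carrier[OF A, of a] and cB = kronecker_one_carrier[OF B, of a]
    and cAB = kronecker_one_carrier[OF mult_carrier_mat[OF A B], of a]
  show "dim_row (kronecker A (1\<^sub>m a) * kronecker B (1\<^sub>m a)) = dim_row (kronecker (A * B) (1\<^sub>m a))"
    "dim_col (kronecker A (1\<^sub>m a) * kronecker B (1\<^sub>m a)) = dim_col (kronecker (A * B) (1\<^sub>m a))"
    using cA cB cAB by auto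
  fix i j assume "i < dim_row (kronecker (A * B) (1\<^sub>m a))" "j < dim_col (kronecker (A * B) (1\<^sub>m a))"
  then have ij: "i < d * a" "j < d * a" using cAB by auto
  note lt = div_mod_lt[OF ij(1)] div_mod_lt[OF ij(2)]
  have "(kronecker A (1\<^sub>m a) * kronecker B (1\<^sub>m a)) $$ (i, j)
    = (\<Sum>k<d * a. kronecker A (1\<^sub>m a) $$ (i, k) * kronecker B (1\<^sub>m a) $$ (k, j))"
    by (rule index_mult_mat_sum[OF cA cB ij])
  also have "\<dots> = (\<Sum>k<d * a. if i mod a = k mod a then (if k mod a = j mod a then A $$ (i div a, k div a) * B $$ (k div a, j div a) else 0) else 0)"
    using ij by (intro sum.cong refl) (simp add: kronecker_one_index[OF A] kronecker_one_index[OF B])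
  also have "\<dots> = (\<Sum>k<d. \<Sum>r<a. if i mod a = r then (if r = j mod a then A $$ (i div a, k) * B $$ (k, j div a) else 0) else 0)"
    by (rule sum_div_mod[where F="\<lambda>k r. if i mod a = r then (if r = j mod a then A $$ (i div a, k) * B $$ (k, j div a) else 0) else 0"])
  also have "\<dots> = (\<Sum>k<d. if i mod a = j mod a then A $$ (i div a, k) * B $$ (k, j div a) else 0)"
    using lt by (intro sum.cong refl) (simp only: sum.delta' finite_lessThan lessThan_iff if_True)
  also have "\<dots> = kronecker (A * B) (1\<^sub>m a) $$ (i, j)"
    unfolding kronecker_one_index[OF mult_carrier_mat[OF A B] ij]
    using lt by (simp only: index_mult_mat_sum[OF A B]) (simp split: if_splits)
  finally show "(kronecker A (1\<^sub>m a) * kronecker B (1\<^sub>m a)) $$ (i, j) = kronecker (A * B) (1\<^sub>m a) $$ (i, j)" .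
qed

lemma kronecker_one_pow:
  assumes A: "A \<in> carrier_mat d d"
  shows "kronecker A (1\<^sub>m a) ^\<^sub>m k = kronecker (A ^\<^sub>m k) (1\<^sub>m a)"
proof (induction k)
  case 0
  have "kronecker (1\<^sub>m d) (1\<^sub>m a) = (1\<^sub>m (d * a) :: real mat)"
  proof (rule eq_matI)
    fix i j assume "i < dim_row (1\<^sub>m (d * a) :: real mat)" "j < dim_col (1\<^sub>m (d * a) :: real mat)"
    then have ij: "i < d * a" "j < d * a" by auto
    have "i mod a = j mod a \<and> i div a = j div a \<longleftrightarrow> i = j" by (metis div_mod_decomp)
    then show "kronecker (1\<^sub>m d) (1\<^sub>m a) $$ (i, j) = (1\<^sub>m (d * a) :: real mat) $$ (i, j)"
      using ij div_mod_lt[OF ij(1)] div_mod_lt[OF ij(2)] by (auto simp: kronecker_one_index[of _ d])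
  qed (auto simp: kronecker_def)
  then show ?case using A by (simp add: kronecker_def)
next
  case (Suc k)
  then show ?case using kronecker_one_mult[OF pow_carrier_mat[OF A] A] by simp
qed

lemma kronecker_one_Tr: "A \<in> carrier_mat d d \<Longrightarrow> mat_Tr (kronecker A (1\<^sub>m a)) = real a * mat_Tr A"
proof -
  assume A: "A \<in> carrier_mat d d"
  have "mat_Tr (kronecker A (1\<^sub>m a)) = (\<Sum>k<d * a. A $$ (k div a, k div a))"
    using kronecker_one_carrier[OF A, of a] by (simp add: mat_Tr_def kronecker_one_index[OF A])
  also have "\<dots> = (\<Sum>i<d. \<Sum>r<a. A $$ (i, i))" by (rule sum_div_mod[where F="\<lambda>i r. A $$ (i, i)"])
  finally show ?thesis using A by (simp add: mat_Tr_def sum_distrib_left)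
qed

lemma pos_def_iff:
  assumes D: "D \<in> carrier_mat d d"
  shows "pos_def_mat D \<longleftrightarrow> (\<forall>f. (\<exists>i<d. f i \<noteq> 0) \<longrightarrow> (\<Sum>i<d. \<Sum>j<d. f i * D $$ (i, j) * f j) > 0)"
proof
  assume pd: "pos_def_mat D"
  show "\<forall>f. (\<exists>i<d. f i \<noteq> 0) \<longrightarrow> (\<Sum>i<d. \<Sum>j<d. f i * D $$ (i, j) * f j) > 0"
  proof (intro allI impI)
    fix f :: "nat \<Rightarrow> real" assume "\<exists>i<d. f i \<noteq> 0"
    then have "vec d f \<noteq> 0\<^sub>v d" by (metis index_vec index_zero_vec(1))
    then have "scalar_prod (vec d f) (D *\<^sub>v vec d f) > 0" using pd D by (simp add: pos_def_mat_def)
    then show "(\<Sum>i<d. \<Sum>j<d. f i * D $$ (i, j) * f j) > 0" unfolding apply_vec_norm(3)[OF D] .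
  qed
next
  assume a: "\<forall>f. (\<exists>i<d. f i \<noteq> 0) \<longrightarrow> (\<Sum>i<d. \<Sum>j<d. f i * D $$ (i, j) * f j) > 0"
  show "pos_def_mat D" unfolding pos_def_mat_def
  proof (intro ballI impI)
    fix v :: "real vec" assume v: "v \<in> carrier_vec (dim_row D)" "v \<noteq> 0\<^sub>v (dim_row D)"
    then have v': "v = vec d (\<lambda>i. v $ i)" using D by auto
    have "\<exists>i<d. v $ i \<noteq> 0"
    proof (rule ccontr)
      assume "\<not> ?thesis"
      then have "v = 0\<^sub>v (dim_row D)" using v D by (intro eq_vecI) auto
      then show False using v by simp
    qed
    then have "scalar_prod (vec d (\<lambda>i. v $ i)) (D *\<^sub>v vec d (\<lambda>i. v $ i)) > 0"
      unfolding apply_vec_norm(3)[OF D] using a by blast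
    then show "scalar_prod v (D *\<^sub>v v) > 0" using v' by simp
  qed
qed

text \<open>The quadratic form is the sum of the forms of \<open>D\<close> on the \<open>a\<close> residue classes.\<close>

lemma kronecker_one_pos_def:
  assumes D: "D \<in> carrier_mat d d" and pd: "pos_def_mat D"
  shows "pos_def_mat (kronecker D (1\<^sub>m a))"
  unfolding pos_def_iff[OF kronecker_one_carrier[OF D]]
proof (intro allI impI)
  fix f :: "nat \<Rightarrow> real" assume "\<exists>i<d * a. f i \<noteq> 0"
  then obtain k where k: "k < d * a" "f k \<noteq> 0" by blast
  let ?Q = "\<lambda>g. \<Sum>i<d. \<Sum>j<d. g i * D $$ (i, j) * g j"
  have Qpos: "?Q g > 0" if "i < d" "g i \<noteq> 0" for g i using pd that unfolding pos_def_iff[OF D] by blast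
  have Qnn: "?Q g \<ge> 0" for g
    by (cases "\<exists>i<d. g i \<noteq> 0") (auto intro: less_imp_le Qpos)
  have "(\<Sum>i<d * a. \<Sum>j<d * a. f i * kronecker D (1\<^sub>m a) $$ (i, j) * f j)
    = (\<Sum>i<d * a. \<Sum>j<d * a. if i mod a = j mod a then f ((i div a) * a + i mod a) * D $$ (i div a, j div a) * f ((j div a) * a + j mod a) else 0)"
    unfolding div_mult_mod_eq by (intro sum.cong refl) (simp add: kronecker_one_index[OF D])
  also have "\<dots> = (\<Sum>i<d * a. \<Sum>j<d. \<Sum>r<a. if i mod a = r then f ((i div a) * a + i mod a) * D $$ (i div a, j) * f (j * a + r) else 0)"
    by (intro sum.cong refl
      sum_div_mod[where F="\<lambda>j r. if _ mod a = r then f ((_ div a) * a + _ mod a) * D $$ (_ div a, j) * f (j * a + r) else 0"])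
  also have "\<dots> = (\<Sum>i<d * a. \<Sum>j<d. f ((i div a) * a + i mod a) * D $$ (i div a, j) * f (j * a + i mod a))"
    using div_mod_lt[of _ d a] by (intro sum.cong refl) (simp only: sum.delta' finite_lessThan lessThan_iff if_True)
  also have "\<dots> = (\<Sum>i<d. \<Sum>r<a. \<Sum>j<d. f (i * a + r) * D $$ (i, j) * f (j * a + r))"
    by (rule sum_div_mod[where F="\<lambda>i r. \<Sum>j<d. f (i * a + r) * D $$ (i, j) * f (j * a + r)"])
  also have "\<dots> = (\<Sum>r<a. ?Q (\<lambda>i. f (i * a + r)))" by (rule sum.swap)
  also have "\<dots> > 0"
  proof (rule sum_pos2[of _ "k mod a"])
    show "0 < ?Q (\<lambda>i. f (i * a + k mod a))" using div_mod_lt[OF k(1)] k(2) by (intro Qpos[of "k div a"]) auto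
  qed (use div_mod_lt[OF k(1)] Qnn in auto)
  finally show "(\<Sum>i<d * a. \<Sum>j<d * a. f i * kronecker D (1\<^sub>m a) $$ (i, j) * f j) > 0" .
qed

text \<open>The two integers hidden in a parameter are both multiplied by \<open>a\<close>.\<close>

lemma amplify_Theta:
  assumes \<theta>: "\<theta> \<in> Theta n" and a: "a \<ge> 1"
  shows "amplify a \<theta> \<in> Theta (a * n)"
proof -
  obtain d D where t: "\<theta> = (real d / real n, D)" "1 \<le> n" "n \<le> d" "D \<in> carrier_mat d d" "transpose_mat D = D" "pos_def_mat D"
    using \<theta> by (rule ThetaE)
  let ?E = "kronecker D (1\<^sub>m a)"
  note c = kronecker_one_carrier[OF t(4), of a]
  have sym: "D $$ (i, j) = D $$ (j, i)" if "i < d" "j < d" for i j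
    using t(4,5) that by (metis carrier_matD index_transpose_mat(1))
  have "transpose_mat ?E = ?E"
  proof (rule eq_matI)
    fix i j assume "i < dim_row ?E" "j < dim_col ?E"
    then have ij: "i < d * a" "j < d * a" using c by auto
    then show "transpose_mat ?E $$ (i, j) = ?E $$ (i, j)"
      using c div_mod_lt[OF ij(1)] div_mod_lt[OF ij(2)] sym by (simp add: kronecker_one_index[OF t(4)])
  qed (use c in auto)
  moreover have "real d / real n = real (d * a) / real (a * n)" using a t by simp
  ultimately show ?thesis
    using t a c kronecker_one_pos_def[OF t(4,6), of a]
    unfolding Theta_def amplify_def par_lambda_def par_D_def by (auto intro!: exI[of _ "d * a"])
qed

section \<open>The variance of the free deterministic equivalent\<close>

text \<open>Invariant under amplification, and therefore so are the limits \<open>tau\<close> and \<open>limit_cov\<close>.\<close>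

definition trace_param :: "cw_param \<Rightarrow> nat \<Rightarrow> real" where
  "trace_param \<theta> a = mat_Tr (par_D \<theta> ^\<^sub>m a) / (real (par_n \<theta>) * spectral_norm (par_D \<theta>) ^ a)"

lemma wishart_bounds_of_trace_param:
  assumes sp: "sym_powers d D S" and n: "n > 0"
    and p: "\<And>a. p a = mat_Tr (D ^\<^sub>m a) / (real n * S ^ a)"
    and nn: "\<And>a. p a \<ge> 0" and dec: "\<And>a. p (Suc a) \<le> p a" and q: "1 / real n \<le> sqrt (p 2)"
  shows "wishart_bounds d n (\<lambda>a i j. (D ^\<^sub>m a) $$ (i, j) / S ^ a) p (max 1 (p 1)) (sqrt (p 2))"
proof -
  interpret sym_powers d D S by (rule sp)
  interpret wishart_words d n "\<lambda>a i j. (D ^\<^sub>m a) $$ (i, j) / S ^ a" by (rule wishart_words_powers[OF n])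
  have le: "p b \<le> p a" if "a \<le> b" for a b using dec that by (rule lift_Suc_antimono_le)
  show ?thesis
  proof
    fix a
    have "dim_row (D ^\<^sub>m a) = d" using pow_carrier_mat[OF D] by blast
    then have "trQ a = mat_Tr (D ^\<^sub>m a) / S ^ a" by (simp add: trQ_def mat_Tr_def sum_divide_distrib)
    then show "p a = trQ a / real n" by (simp add: p)
    show "\<bar>p 1\<bar> \<le> max 1 (p 1)" using nn by simp
    show "\<bar>p a\<bar> \<le> (sqrt (p 2))\<^sup>2" if "2 \<le> a" using nn le[OF that] by simp
    show "(sqrt (p 2))\<^sup>2 \<le> max 1 (p 1)" using nn le[of 1 2] by simp
    show "1 / real n \<le> sqrt (p 2)" by (rule q)
  qed simp
qed

locale cw_parameter =
  fixes \<theta> :: cw_param and n :: nat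
  assumes \<theta>: "\<theta> \<in> Theta n"
begin

abbreviation "d \<equiv> par_d \<theta>"
abbreviation "D \<equiv> par_D \<theta>"
abbreviation "S \<equiv> spectral_norm (par_D \<theta>)"
abbreviation "p \<equiv> trace_param \<theta>"

lemma basic: "1 \<le> n" "n \<le> d" "D \<in> carrier_mat d d" "transpose_mat D = D" "pos_def_mat D" "par_lambda \<theta> = real d / real n" "par_n \<theta> = n"
proof -
  obtain d' D' where t: "\<theta> = (real d' / real n, D')" "1 \<le> n" "n \<le> d'" "D' \<in> carrier_mat d' d'" "transpose_mat D' = D'" "pos_def_mat D'"
    using \<theta> by (rule ThetaE)
  have e: "D = D'" "d = d'" "par_lambda \<theta> = real d' / real n" using t(1,4) by (auto simp: par_d_def par_D_def par_lambda_def)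
  show "1 \<le> n" "n \<le> d" "D \<in> carrier_mat d d" "transpose_mat D = D" "pos_def_mat D" "par_lambda \<theta> = real d / real n" "par_n \<theta> = n"
    unfolding e using t par_n_eq[OF \<theta>] by auto
qed

lemma dim_row_D: "dim_row D = d" by (simp add: par_d_def)

lemma n_pos: "n > 0" using basic by simp

sublocale psd_powers d D S
  using basic by (intro psd_powers_pos_def) auto

lemma p_def: "p a = mat_Tr (D ^\<^sub>m a) / (real n * S ^ a)" by (simp add: trace_param_def basic)

lemma p_nonneg: "p a \<ge> 0" using Tr_pow_nonneg[of a] S by (simp add: p_def)

lemma p_Suc_le: "p (Suc a) \<le> p a"
proof -
  have "p (Suc a) \<le> (S * mat_Tr (D ^\<^sub>m a)) / (real n * S ^ Suc a)"
    unfolding p_def using S n_pos Tr_pow_Suc_le[of a] by (intro divide_right_mono) auto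
  also have "\<dots> = p a" using S by (simp add: p_def)
  finally show ?thesis .
qed

lemma p_antimono: "a \<le> b \<Longrightarrow> p b \<le> p a" using p_Suc_le by (rule lift_Suc_antimono_le)

lemma p2_eq: "p 2 = par_lambda \<theta> / (R_ratio D)\<^sup>2"
proof -
  have m: "mat_tr (D ^\<^sub>m 2) \<ge> 0" using Tr_pow_nonneg[of 2] by (simp add: mat_tr_def)
  have dr: "dim_row (D ^\<^sub>m 2) = d" using pow_carrier_mat[OF basic(3)] by blast
  show ?thesis using m S n_pos basic(2)
    by (simp add: p_def R_ratio_def power_divide basic(6) mat_tr_def dim_row_D)
qed

lemma Tr2_pos: "mat_Tr (D ^\<^sub>m 2) > 0"
proof (rule ccontr)
  assume "\<not> ?thesis"
  then have T0: "mat_Tr (D ^\<^sub>m 2) = 0" using Tr_pow_nonneg[of 2] by linarith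
  have one: "D ^\<^sub>m 1 = D" using basic(3) by simp
  have "(\<Sum>k<d. \<Sum>i<d. (D $$ (i, k))\<^sup>2) = 0" using Tr_even[of 1] T0 unfolding one mult_1_right by (simp only:)
  then have "\<forall>k\<in>{..<d}. (\<Sum>i<d. (D $$ (i, k))\<^sup>2) = 0"
    by (subst (asm) sum_nonneg_eq_0_iff) (auto intro: sum_nonneg)
  then have z: "D $$ (i, k) = 0" if "k < d" "i < d" for i k
    using that by (auto simp: sum_nonneg_eq_0_iff)
  have "(\<Sum>i<d. \<Sum>j<d. (1::real) * D $$ (i, j) * 1) > 0"
  proof -
    have ex: "\<exists>i<d. (1::real) \<noteq> 0" using basic(1,2) by (intro exI[of _ 0]) auto
    have "\<forall>f. (\<exists>i<d. f i \<noteq> 0) \<longrightarrow> (\<Sum>i<d. \<Sum>j<d. f i * D $$ (i, j) * f j) > 0"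
      using basic(5) pos_def_iff[OF basic(3)] by (simp only:)
    from this[rule_format, of "\<lambda>_. 1", OF ex] show ?thesis .
  qed
  then show False using z by simp
qed

lemma R_pos: "R_ratio D > 0"
  using S Tr2_pos basic pow_carrier_mat[OF basic(3), of 2]
  by (auto simp: R_ratio_def mat_tr_def intro!: divide_pos_pos)

lemma p2_pos: "p 2 > 0" using Tr2_pos S n_pos by (simp add: p_def)

text \<open>This is where \<open>d \<ge> n\<close> enters.\<close>

lemma p2_ge: "p 2 \<ge> 1 / (R_ratio D)\<^sup>2"
  unfolding p2_eq using basic n_pos R_pos by (intro divide_right_mono) auto

lemma integral_cw: "(\<integral>z. F z \<partial>cw_space \<theta>) = wishart_words.E d n F"
proof -
  interpret w: wishart_words d n "\<lambda>a i j. (D ^\<^sub>m a) $$ (i, j) / S ^ a" by (rule wishart_words_powers[OF n_pos])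
  show ?thesis unfolding w.E_def cw_space_eq[OF \<theta>] ..
qed

end

text \<open>The covariance estimate with \<open>G = ctr u\<close> and \<open>h = 1\<close>; the moment bounds supply its
  hypotheses.\<close>

lemma (in wishart_bounds) second_moment_estimate:
  assumes u: "pos_word u" "length u = L" "L \<ge> 1"
  shows "\<bar>E (\<lambda>z. ctr u z * ctr u z) - limit_cov p u u\<bar>
    \<le> cov_const L L / real n * (moment_const (3 * L) * (q * K ^ (L - 1)) * (q * K ^ (L - 1)) + (q + q\<^sup>2) * K ^ (2 * L - 2))"
proof -
  let ?C = "moment_const (3 * L)" let ?w = "q * K ^ (L - 1)" let ?\<Gamma> = "?C * ?w"
  have C: "?C \<ge> 1" by (rule moment_const_ge_1)
  have w: "?w \<ge> 0" using q_pos K1 by simp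
  have Xb: "X_bounded ?C (3 * L)" by (rule moment_bounds)
  have "\<bar>E (\<lambda>z. ctr u z * ctr u z) - limit_cov p u u * E (\<lambda>_. 1)\<bar>
    \<le> cov_const (length u) L / real n * (?\<Gamma> * (q * K ^ (length u - 1)) + 1 * ((q + q\<^sup>2) * K ^ (length u + length u - 2)))"
  proof (rule ctr_covariance[where M=L])
    show "has_grad Ix (ctr u) (\<lambda>e z. gradT u e z * 1)" using has_grad_ctr by simp
    show "tempered Ix (\<lambda>_. 1)" by (rule tempered_const)
    show "0 \<le> ?\<Gamma>" using C by (intro mult_nonneg_nonneg[OF _ w]) simp
    show "\<bar>E (\<lambda>z. ctr w z * ctr u z)\<bar> \<le> ?\<Gamma> * (q * K ^ (length w - 1))" if "pos_word w" "length w \<le> L" for w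
    proof -
      have "\<bar>E (X [w, u])\<bar> \<le> ?C * wt [w, u]"
        using that u by (intro Xb[unfolded X_bounded_def, rule_format]) auto
      moreover have "?C * wt [w, u] = ?\<Gamma> * (q * K ^ (length w - 1))"
        using u by (simp only: wt_simps mult_ac mult_1_right)
      moreover have "E (X [w, u]) = E (\<lambda>z. ctr w z * ctr u z)" by (simp add: X_def[abs_def])
      ultimately show ?thesis by (simp only:)
    qed
    show "\<bar>E (\<lambda>z. ctr v z * ctr w z * ctr u z) - E (\<lambda>z. ctr v z * ctr w z) * E (ctr u)\<bar>
      \<le> ?\<Gamma> * (q\<^sup>2 * K ^ (length v - 1 + (length w - 1)))"
      if "pos_word v" "pos_word w" "length v + length w \<le> L" for v w
    proof -
      have "\<bar>E (X [v, w, u])\<bar> \<le> ?C * wt [v, w, u]"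
        using that u by (intro Xb[unfolded X_bounded_def, rule_format]) auto
      moreover have "?C * wt [v, w, u] = ?\<Gamma> * (q\<^sup>2 * K ^ (length v - 1 + (length w - 1)))"
        using u by (simp only: wt_simps power2_eq_square power_add mult_ac mult_1_right)
      moreover have "E (X [v, w, u]) = E (\<lambda>z. ctr v z * ctr w z * ctr u z)" by (simp add: X_def[abs_def] mult.assoc)
      ultimately show ?thesis by (simp only: E_ctr mult_zero_right diff_zero)
    qed
    show "\<bar>E (\<lambda>z. ctr w z * 1)\<bar> \<le> 1 * (q * K ^ (length w - 1))" for w using q_pos K1 by (simp add: E_ctr)
    show "\<bar>E (\<lambda>_. 1)\<bar> \<le> 1" by (simp add: E_const)
  qed (use u in auto)
  then show ?thesis using u by (simp add: E_const mult_2)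
qed

context cw_parameter begin

lemma square_of_scaled_difference:
  fixes s x y :: real
  shows "(s ^ k * x - s ^ k * y)\<^sup>2 = s ^ (2 * k) * ((x - y) * (x - y))"
proof -
  have "(s ^ k * x - s ^ k * y)\<^sup>2 = (s ^ k * (x - y))\<^sup>2" by (simp only: right_diff_distrib)
  also have "\<dots> = s ^ (2 * k) * ((x - y) * (x - y))"
    by (simp add: power_mult_distrib power_mult[symmetric] mult.commute[of k] power2_eq_square[of "x - y"])
  finally show ?thesis .
qed

text \<open>Along the amplification \<open>S\<close> and \<open>p\<close> are constant and \<open>n\<close> is replaced by \<open>a * n\<close>, so the
  second moment estimate applies to all sufficiently large \<open>a\<close> with an error \<open>O(1/a)\<close>.\<close>

theorem fde_var_eq:
  assumes l: "l \<ge> 1"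
  shows "fde_var l \<theta> = S ^ (2 * l) * limit_cov p (replicate l 1) (replicate l 1)"
proof -
  let ?u = "replicate l (1::nat)" let ?K = "max 1 (p 1)" let ?q = "sqrt (p 2)"
  let ?v = "limit_cov p ?u ?u"
  let ?A = "cov_const l l * (moment_const (3 * l) * (?q * ?K ^ (l - 1)) * (?q * ?K ^ (l - 1)) + (?q + ?q\<^sup>2) * ?K ^ (2 * l - 2))"
  let ?V = "\<lambda>a. prob_space.variance (cw_space (amplify a \<theta>)) (trace_power l (amplify a \<theta>))"
  have q0: "?q > 0" using p2_pos by simp
  have est: "\<bar>?V a - S ^ (2 * l) * ?v\<bar> \<le> S ^ (2 * l) * (?A / real n) / real a" if a: "a \<ge> 1" "1 / ?q \<le> real a" for a
  proof -
    interpret a: cw_parameter "amplify a \<theta>" "a * n" by (rule cw_parameter.intro, rule amplify_Theta[OF \<theta> a(1)])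
    have Da: "par_D (amplify a \<theta>) = kronecker D (1\<^sub>m a)" by (simp add: amplify_def par_D_def)
    have da: "par_d (amplify a \<theta>) = d * a"
      using kronecker_one_carrier[OF basic(3), of a] unfolding par_d_def Da by blast
    have an: "a * n > 0" using a(1) n_pos by (rule_tac mult_pos_pos) auto
    have sp: "sym_powers (d * a) (kronecker D (1\<^sub>m a)) S"
      using a.D a.sym S unfolding Da da by (intro sym_powers.intro)
    interpret sp: sym_powers "d * a" "kronecker D (1\<^sub>m a)" S by (rule sp)
    let ?Q = "\<lambda>k i j. (kronecker D (1\<^sub>m a) ^\<^sub>m k) $$ (i, j) / S ^ k"
    have pa: "p k = mat_Tr (kronecker D (1\<^sub>m a) ^\<^sub>m k) / (real (a * n) * S ^ k)" for k
      using a by (simp add: p_def kronecker_one_pow[OF basic(3)] kronecker_one_Tr[OF pow_carrier_mat[OF basic(3)]])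
    interpret w: wishart_bounds "d * a" "a * n" ?Q p ?K ?q
    proof (rule wishart_bounds_of_trace_param[OF sp an pa p_nonneg p_Suc_le])
      have "1 / real (a * n) \<le> 1 / real a" using a n_pos by (intro divide_left_mono) auto
      also have "\<dots> \<le> ?q" using a q0 by (simp add: field_simps)
      finally show "1 / real (a * n) \<le> ?q" .
    qed
    have T: "trace_power l (amplify a \<theta>) z = S ^ l * w.T z ?u" for z
    proof -
      have "w.T z ?u = mat_Tr (wishart (amplify a \<theta>) z ^\<^sub>m l) / S ^ l"
        by (rule sp.T_replicate[OF an wishart_carrier[OF a.\<theta>]])
          (simp add: wishart_index[OF a.\<theta>] da Da)
      then show ?thesis using S by (simp add: trace_power_def)
    qed
    have int: "(\<integral>z. F z \<partial>cw_space (amplify a \<theta>)) = w.E F" for F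
      unfolding w.E_def cw_space_eq[OF a.\<theta>] da ..
    have ex: "w.E (\<lambda>z. S ^ l * w.T z ?u) = S ^ l * (real (a * n) * w.t ?u)"
      using an by (simp add: w.E_cmult w.t_def)
    have "?V a = w.E (\<lambda>z. S ^ (2 * l) * (w.ctr ?u z * w.ctr ?u z))"
      unfolding int T ex square_of_scaled_difference w.ctr_def ..
    also have "\<dots> = S ^ (2 * l) * w.E (\<lambda>z. w.ctr ?u z * w.ctr ?u z)" by (rule w.E_cmult)
    finally have V: "?V a = S ^ (2 * l) * w.E (\<lambda>z. w.ctr ?u z * w.ctr ?u z)" .
    have "\<bar>w.E (\<lambda>z. w.ctr ?u z * w.ctr ?u z) - ?v\<bar> \<le> ?A / real (a * n)"
      using w.second_moment_estimate[of ?u l] l by simp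
    then have "S ^ (2 * l) * \<bar>w.E (\<lambda>z. w.ctr ?u z * w.ctr ?u z) - ?v\<bar> \<le> S ^ (2 * l) * (?A / real (a * n))"
      using S by (intro mult_left_mono) auto
    moreover have "\<bar>S ^ (2 * l) * w.E (\<lambda>z. w.ctr ?u z * w.ctr ?u z) - S ^ (2 * l) * ?v\<bar>
      = S ^ (2 * l) * \<bar>w.E (\<lambda>z. w.ctr ?u z * w.ctr ?u z) - ?v\<bar>"
      using S by (simp only: right_diff_distrib[symmetric] abs_mult abs_power2 power_mult zero_le_power2 abs_of_nonneg zero_le_power)
    moreover have "s * (A / real (a * n)) = s * (A / real n) / real a" for s A by simp
    ultimately show ?thesis unfolding V by (simp only:)
  qed
  have "?V \<longlonglongrightarrow> S ^ (2 * l) * ?v"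
  proof (rule LIM_zero_cancel, rule Lim_null_comparison)
    show "(\<lambda>a. S ^ (2 * l) * (?A / real n) / real a) \<longlonglongrightarrow> 0"
      by (rule lim_const_over_n)
    obtain a0 where "1 / ?q \<le> real a0" using real_arch_simple by blast
    then have "norm (?V a - S ^ (2 * l) * ?v) \<le> S ^ (2 * l) * (?A / real n) / real a" if "a \<ge> max 1 a0" for a
      using est[of a] that by (auto simp: real_norm_def)
    then show "\<forall>\<^sub>F a in sequentially. norm (?V a - S ^ (2 * l) * ?v) \<le> S ^ (2 * l) * (?A / real n) / real a"
      using eventually_ge_at_top[of "max 1 a0"] by (auto elim: eventually_mono)
  qed
  then show ?thesis unfolding fde_var_def by (rule limI)
qed

end

section \<open>The mean of the free deterministic equivalent\<close>

lemma one_mat_Theta: "n \<ge> 1 \<Longrightarrow> (real n / real n, 1\<^sub>m n) \<in> Theta n"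
proof -
  assume n: "n \<ge> 1"
  have c: "(1\<^sub>m n :: real mat) \<in> carrier_mat n n" by simp
  have "pos_def_mat (1\<^sub>m n :: real mat)" unfolding pos_def_iff[OF c]
  proof (intro allI impI)
    fix f :: "nat \<Rightarrow> real" assume "\<exists>i<n. f i \<noteq> 0"
    then obtain i where i: "i < n" "f i \<noteq> 0" by blast
    have "(\<Sum>i<n. \<Sum>j<n. f i * 1\<^sub>m n $$ (i, j) * f j) = (\<Sum>i<n. \<Sum>j<n. if i = j then f i * f j else 0)"
      by (intro sum.cong refl) auto
    also have "\<dots> = (\<Sum>i<n. f i * f i)"
      by (intro sum.cong refl) (simp only: sum.delta' finite_lessThan lessThan_iff if_True)
    also have "\<dots> > 0"
    proof -
      have "0 < f i * f i" using i by (metis not_real_square_gt_zero)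
      then show ?thesis using i by (intro sum_pos2[of _ i]) auto
    qed
    finally show "(\<Sum>i<n. \<Sum>j<n. f i * 1\<^sub>m n $$ (i, j) * f j) > 0" .
  qed
  then show ?thesis using n unfolding Theta_def by (auto intro!: exI[of _ n])
qed

lemma pow_one_mat: "(1\<^sub>m n :: real mat) ^\<^sub>m k = 1\<^sub>m n"
  by (induction k) auto

text \<open>A probabilistic proof of a topological fact. For \<open>D = 1\<close> and \<open>d = n\<close> all weights in the
  genus expansion are \<open>1\<close>, so each single term \<open>n^(\<chi> - 1)\<close> is at most \<open>E (Tr (W^l))\<close>, which is
  at most a constant times \<open>n\<close> by the moment bounds.\<close>

theorem euler_char_le_2:
  assumes \<pi>: "\<pi> \<in> premaps l" and l: "l \<ge> 1"
  shows "euler_char l (long_cycle l) \<pi> \<le> 2"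
proof (rule ccontr)
  assume "\<not> ?thesis"
  then have chi: "2 \<le> euler_char l (long_cycle l) \<pi> - 1" by simp
  obtain n0 where n0: "moment_const l < real n0" using reals_Archimedean2 by blast
  define n where "n = max 1 n0"
  have n: "n \<ge> 1" "moment_const l < real n" using n0 by (auto simp: n_def)
  let ?\<theta> = "(real n / real n, 1\<^sub>m n :: real mat)"
  have \<theta>: "?\<theta> \<in> Theta n" using n by (intro one_mat_Theta)
  have pd: "par_d ?\<theta> = n" "par_D ?\<theta> = 1\<^sub>m n" "par_lambda ?\<theta> = 1"
    using n by (auto simp: par_d_def par_D_def par_lambda_def)
  have sp: "sym_powers n (1\<^sub>m n) 1" by (rule sym_powers.intro) auto
  let ?Q = "\<lambda>a i j. ((1\<^sub>m n :: real mat) ^\<^sub>m a) $$ (i, j) / 1 ^ a"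
  interpret w: wishart_bounds n n ?Q "\<lambda>_. 1" "max 1 1" "sqrt 1"
  proof (rule wishart_bounds_of_trace_param[OF sp])
    show "1 = mat_Tr (1\<^sub>m n ^\<^sub>m a) / (real n * 1 ^ a)" for a using n by (simp add: pow_one_mat mat_Tr_def)
  qed (use n in auto)
  let ?u = "replicate l (1::nat)"
  have "w.t_bounded (moment_const l) l" by (rule w.moment_bounds)
  then have tb: "\<bar>w.t ?u\<bar> \<le> moment_const l" using w.t_bound[of "moment_const l" l ?u l] moment_const_ge_1[of l] by simp
  have T: "w.T z ?u = trace_power l ?\<theta> z" for z
  proof -
    have "w.T z ?u = mat_Tr (wishart ?\<theta> z ^\<^sub>m l) / 1 ^ l"
    proof (rule sym_powers.T_replicate[OF sp _ wishart_carrier[OF \<theta>]])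
      show "wishart ?\<theta> z $$ (x, y) = (\<Sum>a<n. \<Sum>b<n. z (a, x) * 1\<^sub>m n $$ (a, b) * z (b, y))" if "x < n" "y < n" for x y
        using wishart_index[OF \<theta> that] unfolding pd .
    qed (use n in simp)
    then show ?thesis by (simp add: trace_power_def)
  qed
  have "(\<integral>z. trace_power l ?\<theta> z \<partial>cw_space ?\<theta>) = w.E (\<lambda>z. w.T z ?u)"
    unfolding T w.E_def cw_space_eq[OF \<theta>] pd ..
  also have "\<dots> = real n * w.t ?u"
  proof -
    have "real n \<noteq> 0" using n by simp
    then show ?thesis unfolding w.t_def by (simp only: times_divide_eq_right nonzero_mult_div_cancel_left not_False_eq_True)
  qed
  also have "\<dots> \<le> real n * moment_const l" using tb by (intro mult_left_mono) auto
  finally have up: "(\<integral>z. trace_power l ?\<theta> z \<partial>cw_space ?\<theta>) \<le> real n * moment_const l" .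
  have th: "tr_half l \<pi>' (1\<^sub>m n) = 1" for \<pi>'
    using n by (simp add: tr_half_def tr_perm_def moment_def mat_tr_def mat_Tr_def pow_one_mat)
  have "real n ^ 2 \<le> real n powi (euler_char l (long_cycle l) \<pi> - 1)"
    using chi n power_int_increasing[of 2 "euler_char l (long_cycle l) \<pi> - 1" "real n"] by simp
  also have "\<dots> \<le> (\<Sum>\<pi>'\<in>premaps l. real n powi (euler_char l (long_cycle l) \<pi>' - 1))"
    using \<pi> finite_premaps by (intro member_le_sum) auto
  also have "\<dots> = (\<integral>z. trace_power l ?\<theta> z \<partial>cw_space ?\<theta>)"
    unfolding genus_expansion[OF \<theta> l] pd th by simp
  finally have "real n * real n \<le> real n * moment_const l" using up by (simp add: power2_eq_square)
  then show False using n by (simp add: mult_le_cancel_left)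
qed

lemma cycles_partition:
  assumes fin: "finite S" and \<sigma>: "\<sigma> permutes S"
  shows "finite (cycles_on S \<sigma>)" "(\<Sum>c\<in>cycles_on S \<sigma>. card c) = card S"
proof -
  have p: "permutation \<sigma>" by (rule permutes_imp_permutation[OF fin \<sigma>])
  let ?C = "cycles_on S \<sigma>"
  show fC: "finite ?C" using fin by (simp add: cycles_on_def)
  have U: "\<Union>?C = S"
    using permutation_self_in_orbit[OF p] permutes_orbit_subset[OF \<sigma>] by (auto simp: cycles_on_def)
  have "card (\<Union>?C) = (\<Sum>c\<in>?C. card c)"
  proof (rule card_Union_disjoint)
    show "pairwise disjnt ?C"
    proof (rule pairwiseI)
      fix c c' assume c: "c \<in> ?C" "c' \<in> ?C" "c \<noteq> c'"
      then obtain x y where "c = orbit \<sigma> x" "c' = orbit \<sigma> y" by (auto simp: cycles_on_def)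
      then show "disjnt c c'" using c(3) orbits_disjoint[OF p, of x y] by (auto simp: disjnt_def)
    qed
    show "finite c" if "c \<in> ?C" for c by (rule finite_subset[OF _ fin]) (use that U in blast)
  qed
  then show "(\<Sum>c\<in>?C. card c) = card S" unfolding U by simp
qed

context premap begin

abbreviation "H \<equiv> half_set m \<pi>"
abbreviation "C \<equiv> cycles_on (half_set m \<pi>) (half m \<pi>)"

lemma card_H: "card H = m" using bij_betw_same_card[OF abs_half] by simp

lemma finite_C: "finite C" by (rule cycles_partition(1)[OF finite_half half_permutes])

lemma sum_card_C: "(\<Sum>c\<in>C. card c) = m"
  using cycles_partition(2)[OF finite_half half_permutes] card_H by simp

lemma card_cycle_ge_1: "c \<in> C \<Longrightarrow> card c \<ge> 1"
proof -
  assume "c \<in> C"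
  moreover have "premap m \<pi>" by (rule premap_axioms)
  ultimately have "finite c" "c \<noteq> {}" using orbit_half by blast+
  then show ?thesis by (simp add: Suc_le_eq card_gt_0_iff)
qed

lemma num_half_pos: "m \<ge> 1 \<Longrightarrow> num_half m \<pi> \<ge> 1"
proof -
  assume "m \<ge> 1"
  then have "C \<noteq> {}" using sum_card_C by auto
  then show ?thesis using finite_C by (simp add: num_half_def num_cycles_def Suc_le_eq card_gt_0_iff)
qed

end

text \<open>If all cycles of \<open>\<pi>/2\<close> were fixed points, there would be \<open>l\<close> of them, and together with the
  two other positive summands this gives \<open>\<chi> \<ge> 2\<close>.\<close>

lemma premap_with_long_cycle:
  assumes \<pi>: "\<pi> \<in> premaps l" and l: "l \<ge> 1" and chi: "euler_char l (long_cycle l) \<pi> \<le> 0"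
  shows "\<exists>c\<in>cycles_on (half_set l \<pi>) (half l \<pi>). card c \<ge> 2"
proof (rule ccontr)
  interpret premap l \<pi> by (rule premap.intro) (rule \<pi>)
  have f: "premap l (face_perm l \<pi>)" by (rule premap.intro) (rule face_perm_premap[OF \<pi>])
  assume "\<not> ?thesis"
  then have "card c = 1" if "c \<in> C" for c using card_cycle_ge_1[OF that] that by force
  then have "(\<Sum>c\<in>C. card c) = card C" by simp
  then have "num_half l \<pi> = l" using sum_card_C by (simp add: num_half_def num_cycles_def)
  moreover have "num_half l (face_perm l \<pi>) \<ge> 1" by (rule premap.num_half_pos[OF f l])
  ultimately show False using chi num_half_euler_long_cycle[OF l]
    unfolding euler_char_def face_perm_def by simp
qed

context cw_parameter begin

lemma weight_eq:
  assumes \<pi>: "\<pi> \<in> premaps l"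
  shows "par_lambda \<theta> ^ num_half l \<pi> * tr_half l \<pi> D = S ^ l * (\<Prod>c\<in>cycles_on (half_set l \<pi>) (half l \<pi>). p (card c))"
proof -
  interpret pr: premap l \<pi> by (rule premap.intro) (rule \<pi>)
  have m: "par_lambda \<theta> * moment k D = S ^ k * p k" for k
  proof -
    have "dim_row (D ^\<^sub>m k) = d" using pow_carrier_mat[OF basic(3)] by blast
    then show ?thesis using S n_pos basic(2) by (simp add: p_def basic(6) moment_def mat_tr_def)
  qed
  have "par_lambda \<theta> ^ num_half l \<pi> * tr_half l \<pi> D = (\<Prod>c\<in>pr.C. par_lambda \<theta> * moment (card c) D)"
    by (simp add: prod.distrib num_half_def num_cycles_def tr_half_def tr_perm_def)
  also have "\<dots> = (\<Prod>c\<in>pr.C. S ^ card c) * (\<Prod>c\<in>pr.C. p (card c))" by (simp add: m prod.distrib)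
  also have "(\<Prod>c\<in>pr.C. S ^ card c) = S ^ l" by (simp add: power_sum[symmetric] pr.sum_card_C)
  finally show ?thesis .
qed

text \<open>A cycle of length at least \<open>2\<close> provides \<open>p 2\<close>, and at most \<open>l - 2\<close> cycles remain. One factor
  \<open>sqrt (p 2)\<close> is traded for \<open>K\<close>, to obtain the weight of the fluctuations.\<close>

lemma weight_bound:
  assumes \<pi>: "\<pi> \<in> premaps l" and l: "l \<ge> 1" and chi: "euler_char l (long_cycle l) \<pi> \<le> 0"
  shows "(\<Prod>c\<in>cycles_on (half_set l \<pi>) (half l \<pi>). p (card c)) \<le> sqrt (p 2) * max 1 (p 1) ^ (l - 1)"
proof -
  interpret pr: premap l \<pi> by (rule premap.intro) (rule \<pi>)
  let ?K = "max 1 (p 1)"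
  obtain c0 where c0: "c0 \<in> pr.C" "card c0 \<ge> 2" using premap_with_long_cycle[OF assms] by blast
  have pK: "p (card c) \<le> ?K" if "c \<in> pr.C" for c
    using p_antimono[of 1 "card c"] pr.card_cycle_ge_1[OF that] by simp
  have "(\<Sum>c\<in>pr.C. card c) = card c0 + (\<Sum>c\<in>pr.C - {c0}. card c)"
    using pr.finite_C c0 by (simp add: sum.remove)
  moreover have "(\<Sum>c\<in>pr.C - {c0}. card c) \<ge> (\<Sum>c\<in>pr.C - {c0}. 1)"
    using pr.card_cycle_ge_1 by (intro sum_mono) auto
  ultimately have N: "card (pr.C - {c0}) + 2 \<le> l" using pr.sum_card_C c0 by simp
  have "(\<Prod>c\<in>pr.C. p (card c)) = p (card c0) * (\<Prod>c\<in>pr.C - {c0}. p (card c))"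
    using pr.finite_C c0 by (simp add: prod.remove)
  also have "\<dots> \<le> p 2 * (\<Prod>c\<in>pr.C - {c0}. ?K)"
    using p_nonneg pK p_antimono[OF c0(2)] by (intro mult_mono prod_mono prod_nonneg) auto
  also have "\<dots> = p 2 * ?K ^ card (pr.C - {c0})" by simp
  also have "\<dots> \<le> p 2 * ?K ^ (l - 2)" using N p_nonneg by (intro mult_left_mono power_increasing) auto
  also have "p 2 * ?K ^ (l - 2) \<le> sqrt (p 2) * (?K * ?K ^ (l - 2))"
  proof -
    have "p 2 \<le> p 1" by (rule p_antimono) simp
    also have "p 1 \<le> ?K\<^sup>2" using self_le_power[of ?K 2] by simp
    finally have "sqrt (p 2) \<le> ?K" by (intro real_le_lsqrt) auto
    then have "sqrt (p 2) * (sqrt (p 2) * ?K ^ (l - 2)) \<le> sqrt (p 2) * (?K * ?K ^ (l - 2))"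
      using p_nonneg by (intro mult_left_mono mult_right_mono) auto
    then show ?thesis using p_nonneg[of 2] by (simp add: mult.assoc[symmetric])
  qed
  finally have fin: "(\<Prod>c\<in>pr.C. p (card c)) \<le> sqrt (p 2) * (?K * ?K ^ (l - 2))" .
  obtain k where "l = 2 + k" using N le_Suc_ex[of 2 l] by auto
  then have "?K * ?K ^ (l - 2) = ?K ^ (l - 1)" by simp
  then show ?thesis using fin by (simp only:)
qed

text \<open>The terms of the genus expansion with \<open>\<chi> \<le> 0\<close> carry \<open>n^(\<chi> - 1) \<le> 1/n\<close>.\<close>

theorem fde_mean_error:
  assumes l: "l \<ge> 1"
  shows "\<bar>(\<integral>z. trace_power l \<theta> z \<partial>cw_space \<theta>) - fde_mean l \<theta>\<bar>
    \<le> real (card (premaps l)) / real n * (S ^ l * (sqrt (p 2) * max 1 (p 1) ^ (l - 1)))"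
proof -
  let ?\<chi> = "euler_char l (long_cycle l)" let ?B = "S ^ l * (sqrt (p 2) * max 1 (p 1) ^ (l - 1))"
  let ?w = "\<lambda>\<pi>. par_lambda \<theta> ^ num_half l \<pi> * tr_half l \<pi> D"
  let ?t = "\<lambda>\<pi>. real n powi (?\<chi> \<pi> - 1) * ?w \<pi>"
  let ?P = "\<lambda>x. {\<pi> \<in> premaps l. ?\<chi> \<pi> = x}" let ?L = "{\<pi> \<in> premaps l. ?\<chi> \<pi> \<le> 0}"
  have fin: "finite (?P x)" "finite ?L" for x using finite_premaps by auto
  have "premaps l = ?P 2 \<union> (?P 1 \<union> ?L)" using euler_char_le_2[OF _ l] by force
  then have "(\<Sum>\<pi>\<in>premaps l. ?t \<pi>) = (\<Sum>\<pi>\<in>?P 2 \<union> (?P 1 \<union> ?L). ?t \<pi>)" by simp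
  also have "\<dots> = (\<Sum>\<pi>\<in>?P 2. ?t \<pi>) + ((\<Sum>\<pi>\<in>?P 1. ?t \<pi>) + (\<Sum>\<pi>\<in>?L. ?t \<pi>))"
    using fin by (subst sum.union_disjoint, simp, simp, force, subst sum.union_disjoint) force+
  also have "(\<Sum>\<pi>\<in>?P 2. ?t \<pi>) = real n * fde_coeff 2 l \<theta>"
    by (simp add: fde_coeff_def sum_distrib_left)
  also have "(\<Sum>\<pi>\<in>?P 1. ?t \<pi>) = fde_coeff 1 l \<theta>" by (simp add: fde_coeff_def)
  finally have "(\<integral>z. trace_power l \<theta> z \<partial>cw_space \<theta>) - fde_mean l \<theta> = (\<Sum>\<pi>\<in>?L. ?t \<pi>)"
    unfolding genus_expansion[OF \<theta> l] fde_mean_def basic(7) by simp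
  then have "\<bar>(\<integral>z. trace_power l \<theta> z \<partial>cw_space \<theta>) - fde_mean l \<theta>\<bar> = \<bar>\<Sum>\<pi>\<in>?L. ?t \<pi>\<bar>" by (simp only:)
  also have "\<bar>\<Sum>\<pi>\<in>?L. ?t \<pi>\<bar> \<le> (\<Sum>\<pi>\<in>?L. \<bar>?t \<pi>\<bar>)" by (rule sum_abs)
  also have "\<dots> \<le> (\<Sum>\<pi>\<in>?L. 1 / real n * ?B)"
  proof (rule sum_mono)
    fix \<pi> assume \<pi>: "\<pi> \<in> ?L"
    have "0 \<le> (\<Prod>c\<in>cycles_on (half_set l \<pi>) (half l \<pi>). p (card c))" by (intro prod_nonneg) (simp add: p_nonneg)
    moreover have "(\<Prod>c\<in>cycles_on (half_set l \<pi>) (half l \<pi>). p (card c)) \<le> sqrt (p 2) * max 1 (p 1) ^ (l - 1)"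
      using \<pi> l by (intro weight_bound) auto
    ultimately have W: "\<bar>?w \<pi>\<bar> \<le> ?B" using \<pi> S by (simp add: weight_eq abs_mult mult_left_mono)
    have N: "\<bar>real n powi (?\<chi> \<pi> - 1)\<bar> \<le> 1 / real n"
    proof -
      have "real n powi (?\<chi> \<pi> - 1) \<le> real n powi (- 1)" using \<pi> n_pos by (intro power_int_increasing) auto
      then show ?thesis by (simp add: power_int_minus divide_inverse)
    qed
    show "\<bar>?t \<pi>\<bar> \<le> 1 / real n * ?B" by (rule abs_mult_le[OF N W])
  qed
  also have "\<dots> = real (card ?L) * (1 / real n * ?B)" by simp
  also have "\<dots> \<le> real (card (premaps l)) * (1 / real n * ?B)"
    using S p_nonneg finite_premaps
    by (intro mult_right_mono) (auto intro!: card_mono mult_nonneg_nonneg)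
  finally show ?thesis by simp
qed

end

section \<open>Gaussian fluctuations\<close>

lemma DERIV_of_quadratic_bound:
  fixes g :: "real \<Rightarrow> real"
  assumes "\<And>k. \<bar>g (t + k) - g t - k * D\<bar> \<le> k\<^sup>2 * A"
  shows "(g has_real_derivative D) (at t)"
  unfolding DERIV_def
proof (rule LIM_zero_cancel, rule Lim_null_comparison)
  show "((\<lambda>h. \<bar>h\<bar> * A) \<longlongrightarrow> 0) (at 0)"
    by (intro tendsto_mult_left_zero tendsto_rabs_zero tendsto_ident_at)
  have "norm ((g (t + h) - g t) / h - D) \<le> \<bar>h\<bar> * A" if "h \<noteq> 0" for h
  proof -
    have "h * ((g (t + h) - g t) / h - D) = g (t + h) - g t - h * D"
      using that unfolding right_diff_distrib[of h] by (metis nonzero_mult_div_cancel_left times_divide_eq_right)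
    then have "\<bar>h\<bar> * \<bar>(g (t + h) - g t) / h - D\<bar> = \<bar>g (t + h) - g t - h * D\<bar>"
      unfolding abs_mult[symmetric] by (simp only:)
    also have "\<dots> \<le> \<bar>h\<bar> * (\<bar>h\<bar> * A)" using assms[of h] by (simp add: power2_eq_square abs_mult_self_eq mult.assoc[symmetric])
    finally show ?thesis using that by simp
  qed
  then show "\<forall>\<^sub>F h in at 0. norm ((g (t + h) - g t) / h - D) \<le> \<bar>h\<bar> * A"
    by (auto simp: eventually_at_filter)
qed

lemma iexp_remainder: "cmod (iexp (x + k) - iexp x - \<i> * complex_of_real k * iexp x) \<le> k\<^sup>2 / 2"
proof -
  have "iexp (x + k) - iexp x - \<i> * complex_of_real k * iexp x = iexp x * (iexp k - (\<Sum>j\<le>1. (\<i> * complex_of_real k) ^ j / fact j))"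
    by (simp add: exp_add distrib_left algebra_simps)
  then have "cmod (iexp (x + k) - iexp x - \<i> * complex_of_real k * iexp x)
    = cmod (iexp k - (\<Sum>j\<le>1. (\<i> * complex_of_real k) ^ j / fact j))"
    by (simp add: norm_mult)
  also have "\<dots> \<le> \<bar>k\<bar> ^ Suc 1 / fact (Suc 1)" by (rule iexp_approx1)
  finally show ?thesis by (simp add: power2_eq_square)
qed

text \<open>Real and imaginary parts of the second order remainder of the complex exponential.\<close>

lemma cos_sin_remainder:
  "\<bar>cos (x + k) - cos x + k * sin x\<bar> \<le> k\<^sup>2 / 2" "\<bar>sin (x + k) - sin x - k * cos x\<bar> \<le> k\<^sup>2 / (2::real)"
proof -
  let ?z = "iexp (x + k) - iexp x - \<i> * complex_of_real k * iexp x"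
  have e: "iexp y = Complex (cos y) (sin y)" for y by (simp add: cis_conv_exp[symmetric] cis.ctr)
  have "Re ?z = cos (x + k) - cos x + k * sin x" "Im ?z = sin (x + k) - sin x - k * cos x"
    unfolding e by simp_all
  then show "\<bar>cos (x + k) - cos x + k * sin x\<bar> \<le> k\<^sup>2 / 2" "\<bar>sin (x + k) - sin x - k * cos x\<bar> \<le> k\<^sup>2 / 2"
    using iexp_remainder[of x k] abs_Re_le_cmod[of ?z] abs_Im_le_cmod[of ?z] by linarith+
qed

text \<open>The derivative of \<open>c t * exp (t\<^sup>2 / 2)\<close> is \<open>(c' t + t * c t) * exp (t\<^sup>2 / 2)\<close>, which is
  small.\<close>

lemma perturbed_gaussian_ode:
  fixes c c' :: "real \<Rightarrow> real"
  assumes der: "\<And>t. (c has_real_derivative c' t) (at t)"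
    and b: "\<And>t. \<bar>t\<bar> \<le> \<bar>\<tau>\<bar> \<Longrightarrow> \<bar>c' t + t * c t\<bar> \<le> \<epsilon>"
  shows "\<bar>c \<tau> - c 0 * exp (- \<tau>\<^sup>2 / 2)\<bar> \<le> \<bar>\<tau>\<bar> * \<epsilon>"
proof -
  let ?F = "\<lambda>t. c t * exp (t\<^sup>2 / 2)" let ?S = "{- \<bar>\<tau>\<bar>..\<bar>\<tau>\<bar>}"
  have e0: "\<epsilon> \<ge> 0" using b[of 0] by simp
  have "norm (?F \<tau> - ?F 0) \<le> (\<epsilon> * exp (\<tau>\<^sup>2 / 2)) * norm (\<tau> - 0)"
  proof (rule field_differentiable_bound[of ?S])
    fix t assume t: "t \<in> ?S"
    have "(?F has_real_derivative (c' t + t * c t) * exp (t\<^sup>2 / 2)) (at t)"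
      by (rule derivative_eq_intros der refl | simp)+ (simp add: algebra_simps)
    then show "(?F has_real_derivative (c' t + t * c t) * exp (t\<^sup>2 / 2)) (at t within ?S)"
      by (rule has_field_derivative_at_within)
    have "\<bar>t\<bar> \<le> \<bar>\<tau>\<bar>" using t by auto
    moreover then have "t\<^sup>2 \<le> \<tau>\<^sup>2" by (simp add: abs_le_square_iff)
    ultimately show "norm ((c' t + t * c t) * exp (t\<^sup>2 / 2)) \<le> \<epsilon> * exp (\<tau>\<^sup>2 / 2)"
      unfolding norm_mult using b[of t] e0 by (intro mult_mono) auto
  qed auto
  then have "\<bar>c \<tau> * exp (\<tau>\<^sup>2 / 2) - c 0\<bar> * exp (- \<tau>\<^sup>2 / 2) \<le> \<epsilon> * exp (\<tau>\<^sup>2 / 2) * \<bar>\<tau>\<bar> * exp (- \<tau>\<^sup>2 / 2)"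
    by (intro mult_right_mono) auto
  moreover have ee: "exp (\<tau>\<^sup>2 / 2) * exp (- \<tau>\<^sup>2 / 2) = 1" by (simp add: exp_add[symmetric])
  moreover have "\<bar>c \<tau> * exp (\<tau>\<^sup>2 / 2) - c 0\<bar> * exp (- \<tau>\<^sup>2 / 2) = \<bar>(c \<tau> * exp (\<tau>\<^sup>2 / 2) - c 0) * exp (- \<tau>\<^sup>2 / 2)\<bar>"
    by (simp add: abs_mult)
  moreover have "(c \<tau> * exp (\<tau>\<^sup>2 / 2) - c 0) * exp (- \<tau>\<^sup>2 / 2) = c \<tau> - c 0 * exp (- \<tau>\<^sup>2 / 2)"
    using ee by (simp add: left_diff_distrib mult.assoc)
  moreover have "\<epsilon> * exp (\<tau>\<^sup>2 / 2) * \<bar>\<tau>\<bar> * exp (- \<tau>\<^sup>2 / 2) = \<bar>\<tau>\<bar> * \<epsilon>"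
    using ee by (simp add: mult_ac)
  ultimately show ?thesis by (simp only:)
qed

context wishart_words begin

lemma abs_E_le:
  assumes "tempered Ix F" "tempered Ix G" "\<And>z. \<bar>F z\<bar> \<le> G z"
  shows "\<bar>E F\<bar> \<le> E G"
  unfolding E_def using assms integrable_E
  by (intro order_trans[OF integral_abs_bound] integral_mono) auto

lemma tempered_cmult: "tempered Ix F \<Longrightarrow> tempered Ix (\<lambda>z. c * F z)"
  by (intro tempered_mult tempered_const)

lemma tempered_trig:
  assumes "tempered Ix Y"
  shows "tempered Ix (\<lambda>z. cos (t * Y z))" "tempered Ix (\<lambda>z. sin (t * Y z))"
  using tempered_cmult[OF assms, of t]
  by (rule tempered_bounded_comp[where B=1]; auto intro: continuous_intros)+

text \<open>Differentiation under the integral, from a remainder that is quadratic in the increment and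
  therefore integrable.\<close>

lemma E_trig_derivative:
  assumes Y: "tempered Ix Y"
  shows "((\<lambda>t. E (\<lambda>z. cos (t * Y z))) has_real_derivative - E (\<lambda>z. Y z * sin (t * Y z))) (at t)"
    "((\<lambda>t. E (\<lambda>z. sin (t * Y z))) has_real_derivative E (\<lambda>z. Y z * cos (t * Y z))) (at t)"
proof -
  note tr = tempered_trig[OF Y]
  have Y2: "tempered Ix (\<lambda>z. Y z * Y z)" using Y by (intro tempered_mult)
  have s: "tempered Ix (\<lambda>z. Y z * sin (t * Y z))" "tempered Ix (\<lambda>z. Y z * cos (t * Y z))" for t
    by (intro tempered_mult Y tr)+
  have q: "tempered Ix (\<lambda>z. k\<^sup>2 / 2 * (Y z * Y z))" for k by (rule tempered_cmult[OF Y2])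
  have scale: "t * Y z + k * Y z = (t + k) * Y z" "k * Y z * w = k * (Y z * w)"
    "(k * Y z)\<^sup>2 / 2 = k\<^sup>2 / 2 * (Y z * Y z)" for k z w
    by (simp_all add: distrib_right power_mult_distrib power2_eq_square)
  show "((\<lambda>t. E (\<lambda>z. cos (t * Y z))) has_real_derivative - E (\<lambda>z. Y z * sin (t * Y z))) (at t)"
  proof (rule DERIV_of_quadratic_bound[where A="E (\<lambda>z. Y z * Y z) / 2"])
    fix k
    have "E (\<lambda>z. cos ((t + k) * Y z) - cos (t * Y z) + k * (Y z * sin (t * Y z)))
      = E (\<lambda>z. cos ((t + k) * Y z) - cos (t * Y z)) + k * E (\<lambda>z. Y z * sin (t * Y z))"
      using tempered_add[OF tr(1)[of "t + k"] tempered_cmult[OF tr(1)[of t], of "-1"]]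
      by (subst E_add) (auto simp: E_cmult intro!: tempered_cmult s)
    also have "E (\<lambda>z. cos ((t + k) * Y z) - cos (t * Y z)) = E (\<lambda>z. cos ((t + k) * Y z)) - E (\<lambda>z. cos (t * Y z))"
      by (intro E_diff tr)
    finally have "E (\<lambda>z. cos ((t + k) * Y z)) - E (\<lambda>z. cos (t * Y z)) - k * - E (\<lambda>z. Y z * sin (t * Y z))
      = E (\<lambda>z. cos ((t + k) * Y z) - cos (t * Y z) + k * (Y z * sin (t * Y z)))" by simp
    also have "\<bar>\<dots>\<bar> \<le> E (\<lambda>z. k\<^sup>2 / 2 * (Y z * Y z))"
    proof (rule abs_E_le[OF _ q])
      show "tempered Ix (\<lambda>z. cos ((t + k) * Y z) - cos (t * Y z) + k * (Y z * sin (t * Y z)))"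
        using tempered_add[OF tempered_add[OF tr(1)[of "t + k"] tempered_cmult[OF tr(1)[of t], of "-1"]] tempered_cmult[OF s(1)[of t], of k]]
        by simp
      show "\<bar>cos ((t + k) * Y z) - cos (t * Y z) + k * (Y z * sin (t * Y z))\<bar> \<le> k\<^sup>2 / 2 * (Y z * Y z)" for z
        using cos_sin_remainder(1)[of "t * Y z" "k * Y z"] unfolding scale .
    qed
    also have "E (\<lambda>z. k\<^sup>2 / 2 * (Y z * Y z)) = k\<^sup>2 * (E (\<lambda>z. Y z * Y z) / 2)" unfolding E_cmult by simp
    finally show "\<bar>E (\<lambda>z. cos ((t + k) * Y z)) - E (\<lambda>z. cos (t * Y z)) - k * - E (\<lambda>z. Y z * sin (t * Y z))\<bar>
      \<le> k\<^sup>2 * (E (\<lambda>z. Y z * Y z) / 2)" .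
  qed
  show "((\<lambda>t. E (\<lambda>z. sin (t * Y z))) has_real_derivative E (\<lambda>z. Y z * cos (t * Y z))) (at t)"
  proof (rule DERIV_of_quadratic_bound[where A="E (\<lambda>z. Y z * Y z) / 2"])
    fix k
    have "E (\<lambda>z. sin ((t + k) * Y z) - sin (t * Y z) - k * (Y z * cos (t * Y z)))
      = E (\<lambda>z. sin ((t + k) * Y z) - sin (t * Y z)) - k * E (\<lambda>z. Y z * cos (t * Y z))"
      using tempered_add[OF tr(2)[of "t + k"] tempered_cmult[OF tr(2)[of t], of "-1"]]
      by (subst E_diff) (auto simp: E_cmult intro!: tempered_cmult s)
    also have "E (\<lambda>z. sin ((t + k) * Y z) - sin (t * Y z)) = E (\<lambda>z. sin ((t + k) * Y z)) - E (\<lambda>z. sin (t * Y z))"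
      by (intro E_diff tr)
    finally have "E (\<lambda>z. sin ((t + k) * Y z)) - E (\<lambda>z. sin (t * Y z)) - k * E (\<lambda>z. Y z * cos (t * Y z))
      = E (\<lambda>z. sin ((t + k) * Y z) - sin (t * Y z) - k * (Y z * cos (t * Y z)))" by simp
    also have "\<bar>\<dots>\<bar> \<le> E (\<lambda>z. k\<^sup>2 / 2 * (Y z * Y z))"
    proof (rule abs_E_le[OF _ q])
      show "tempered Ix (\<lambda>z. sin ((t + k) * Y z) - sin (t * Y z) - k * (Y z * cos (t * Y z)))"
        using tempered_add[OF tempered_add[OF tr(2)[of "t + k"] tempered_cmult[OF tr(2)[of t], of "-1"]] tempered_cmult[OF s(2)[of t], of "-k"]]
        by simp
      show "\<bar>sin ((t + k) * Y z) - sin (t * Y z) - k * (Y z * cos (t * Y z))\<bar> \<le> k\<^sup>2 / 2 * (Y z * Y z)" for z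
        using cos_sin_remainder(2)[of "t * Y z" "k * Y z"] unfolding scale .
    qed
    also have "E (\<lambda>z. k\<^sup>2 / 2 * (Y z * Y z)) = k\<^sup>2 * (E (\<lambda>z. Y z * Y z) / 2)" unfolding E_cmult by simp
    finally show "\<bar>E (\<lambda>z. sin ((t + k) * Y z)) - E (\<lambda>z. sin (t * Y z)) - k * E (\<lambda>z. Y z * cos (t * Y z))\<bar>
      \<le> k\<^sup>2 * (E (\<lambda>z. Y z * Y z) / 2)" .
  qed
qed

end

context wishart_bounds begin

lemma E_ctr_square:
  assumes "pos_word w" "2 * length w \<le> N"
  shows "E (\<lambda>z. ctr w z * ctr w z) \<le> moment_const N * (q * K ^ (length w - 1))\<^sup>2"
proof -
  have "\<bar>E (X [w, w])\<bar> \<le> moment_const N * wt [w, w]"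
    using assms by (intro moment_bounds(2)[unfolded X_bounded_def, rule_format]) auto
  moreover have "X [w, w] = (\<lambda>z. ctr w z * ctr w z)" by (simp add: X_def[abs_def])
  moreover have "wt [w, w] = (q * K ^ (length w - 1))\<^sup>2" by (simp add: power2_eq_square)
  ultimately show ?thesis by (simp only: abs_le_iff)
qed

lemma scale_pos: "q * K ^ i > 0" using q_pos K1 by simp

text \<open>Cauchy-Schwarz, in the form of the inequality between arithmetic and geometric means with
  the scale \<open>q K^(|w| - 1)\<close> of the fluctuation as weight.\<close>

lemma E_ctr_times_bounded:
  assumes w: "pos_word w" "2 * length w \<le> N" and g: "tempered Ix g" "\<And>z. \<bar>g z\<bar> \<le> 1"
  shows "\<bar>E (\<lambda>z. ctr w z * g z)\<bar> \<le> moment_const N * (q * K ^ (length w - 1))"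
proof -
  let ?a = "q * K ^ (length w - 1)"
  have a: "?a > 0" by (rule scale_pos)
  have tc: "tempered Ix (\<lambda>z. ctr w z * ctr w z)" by (intro tempered_mult tempered_ctr)
  have "\<bar>E (\<lambda>z. ctr w z * g z)\<bar> \<le> E (\<lambda>z. 1 / (2 * ?a) * (ctr w z * ctr w z) + ?a / 2)"
  proof (rule abs_E_le)
    show "tempered Ix (\<lambda>z. ctr w z * g z)" by (intro tempered_mult tempered_ctr g)
    show "tempered Ix (\<lambda>z. 1 / (2 * ?a) * (ctr w z * ctr w z) + ?a / 2)"
      by (intro tempered_add tempered_cmult tc tempered_const)
    fix z
    have "\<bar>ctr w z * g z\<bar> \<le> \<bar>ctr w z\<bar> * 1" unfolding abs_mult using g(2) by (intro mult_left_mono) auto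
    also have "\<dots> \<le> 1 / (2 * ?a) * (ctr w z * ctr w z) + ?a / 2"
    proof -
      have gen: "\<bar>x\<bar> * 1 \<le> 1 / (2 * a) * (x * x) + a / 2" if "a > 0" for x a :: real
      proof -
        have "0 \<le> (\<bar>x\<bar> - a)\<^sup>2 / (2 * a)" using that by simp
        also have "\<dots> = 1 / (2 * a) * (x * x) + a / 2 - \<bar>x\<bar>"
          using that by (simp add: power2_eq_square field_simps)
        finally show ?thesis by simp
      qed
      show ?thesis by (rule gen[OF a])
    qed
    finally show "\<bar>ctr w z * g z\<bar> \<le> 1 / (2 * ?a) * (ctr w z * ctr w z) + ?a / 2" .
  qed
  also have "\<dots> = 1 / (2 * ?a) * E (\<lambda>z. ctr w z * ctr w z) + ?a / 2"
    unfolding E_add[OF tempered_cmult[OF tc] tempered_const] E_cmult E_const ..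
  also have "\<dots> \<le> 1 / (2 * ?a) * (moment_const N * ?a\<^sup>2) + ?a / 2"
    using a by (intro add_right_mono mult_left_mono E_ctr_square w) auto
  also have "1 / (2 * ?a) * (moment_const N * ?a\<^sup>2) = moment_const N * ?a / 2" using a by (simp add: power2_eq_square)
  also have "moment_const N * ?a / 2 + ?a / 2 \<le> moment_const N * ?a / 2 + moment_const N * ?a / 2"
    using mult_right_mono[OF moment_const_ge_1[of N] less_imp_le[OF a]] by (intro add_left_mono divide_right_mono) simp_all
  finally show ?thesis by (simp add: mult_ac)
qed

lemma E_ctr_ctr_times_bounded:
  assumes v: "pos_word v" "2 * length v \<le> N" and w: "pos_word w" "2 * length w \<le> N"
    and g: "tempered Ix g" "\<And>z. \<bar>g z\<bar> \<le> 1"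
  shows "\<bar>E (\<lambda>z. ctr v z * ctr w z * g z)\<bar> \<le> moment_const N * ((q * K ^ (length v - 1)) * (q * K ^ (length w - 1)))"
proof -
  let ?a = "q * K ^ (length v - 1)" and ?b = "q * K ^ (length w - 1)"
  have a: "?a > 0" "?b > 0" by (rule scale_pos)+
  have tc: "tempered Ix (\<lambda>z. ctr u z * ctr u z)" for u by (intro tempered_mult tempered_ctr)
  have "\<bar>E (\<lambda>z. ctr v z * ctr w z * g z)\<bar> \<le> E (\<lambda>z. ?b / (2 * ?a) * (ctr v z * ctr v z) + ?a / (2 * ?b) * (ctr w z * ctr w z))"
  proof (rule abs_E_le)
    show "tempered Ix (\<lambda>z. ctr v z * ctr w z * g z)" by (intro tempered_mult tempered_ctr g)
    show "tempered Ix (\<lambda>z. ?b / (2 * ?a) * (ctr v z * ctr v z) + ?a / (2 * ?b) * (ctr w z * ctr w z))"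
      by (intro tempered_add tempered_cmult tc)
    fix z
    have "\<bar>ctr v z * ctr w z * g z\<bar> \<le> \<bar>ctr v z * ctr w z\<bar> * 1"
      unfolding abs_mult[of _ "g z"] using g(2) by (intro mult_left_mono) auto
    also have "\<dots> \<le> ?b / (2 * ?a) * (ctr v z * ctr v z) + ?a / (2 * ?b) * (ctr w z * ctr w z)"
    proof -
      have gen: "x * y \<le> b / (2 * a) * (x * x) + a / (2 * b) * (y * y)" if "a > 0" "b > 0" for x y a b :: real
      proof -
        have "0 \<le> (b * x - a * y)\<^sup>2 / (2 * a * b)" using that by simp
        also have "\<dots> = b / (2 * a) * (x * x) + a / (2 * b) * (y * y) - x * y"
          using that by (simp add: power2_eq_square field_simps)
        finally show ?thesis by simp
      qed
      have "\<bar>ctr v z\<bar> * \<bar>ctr w z\<bar> \<le> ?b / (2 * ?a) * (\<bar>ctr v z\<bar> * \<bar>ctr v z\<bar>) + ?a / (2 * ?b) * (\<bar>ctr w z\<bar> * \<bar>ctr w z\<bar>)"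
        by (rule gen[OF a])
      then show ?thesis by (simp only: abs_mult_self_eq abs_mult mult_1_right)
    qed
    finally show "\<bar>ctr v z * ctr w z * g z\<bar> \<le> ?b / (2 * ?a) * (ctr v z * ctr v z) + ?a / (2 * ?b) * (ctr w z * ctr w z)" .
  qed
  also have "\<dots> = ?b / (2 * ?a) * E (\<lambda>z. ctr v z * ctr v z) + ?a / (2 * ?b) * E (\<lambda>z. ctr w z * ctr w z)"
    unfolding E_add[OF tempered_cmult[OF tc] tempered_cmult[OF tc]] E_cmult ..
  also have "\<dots> \<le> ?b / (2 * ?a) * (moment_const N * ?a\<^sup>2) + ?a / (2 * ?b) * (moment_const N * ?b\<^sup>2)"
  proof -
    have "0 \<le> x / (2 * y)" if "x > 0" "y > 0" for x y :: real using that by simp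
    then show ?thesis using a by (intro add_mono mult_left_mono E_ctr_square v w) blast+
  qed
  also have "\<dots> = moment_const N * (?a * ?b)"
  proof -
    have "b / (2 * a) * (B * a\<^sup>2) + a / (2 * b) * (B * b\<^sup>2) = B * (a * b)" if "a > 0" "b > 0" for a b B :: real
      using that by (simp add: power2_eq_square field_simps)
    then show ?thesis using a by blast
  qed
  finally show ?thesis .
qed

text \<open>The covariance estimate with \<open>G = f (s Y)\<close> and \<open>h = (s / sqrt v) f' (s Y)\<close>, divided by
  \<open>sqrt v\<close>. The ratio \<open>\<rho>\<close> compares the size that the moment bounds allow for the fluctuation
  with its limiting standard deviation.\<close>

theorem stein_estimate:
  fixes f f' :: "real \<Rightarrow> real"
  assumes u: "pos_word u" "length u = L" "L \<ge> 1" and v: "limit_cov p u u = v" "v > 0"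
    and f: "\<And>x. (f has_real_derivative f' x) (at x)" "\<And>x. \<bar>f x\<bar> \<le> 1" "\<And>x. \<bar>f' x\<bar> \<le> 1" "continuous_on UNIV f'"
  defines "Y \<equiv> \<lambda>z. ctr u z / sqrt v" and "\<rho> \<equiv> q * K ^ (L - 1) / sqrt v"
  shows "\<bar>E (\<lambda>z. Y z * f (s * Y z)) - s * E (\<lambda>z. f' (s * Y z))\<bar>
    \<le> cov_const L L * moment_const (4 * L) / real n * (2 * \<rho> + \<bar>s\<bar> * (\<rho>\<^sup>2 * (1 / q + 1)))"
proof -
  let ?B = "moment_const (4 * L)" let ?r = "sqrt v" let ?c = "s / ?r"
  have r: "?r > 0" "?r * ?r = v" using v by auto
  have B: "?B \<ge> 1" by (rule moment_const_ge_1)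
  have cf: "continuous_on UNIV f" using f(1) by (intro continuous_at_imp_continuous_on ballI) (auto intro: DERIV_isCont)
  let ?F = "\<lambda>z. ?c * ctr u z"
  have tF: "tempered Ix ?F" by (intro tempered_cmult tempered_ctr)
  have tf: "tempered Ix (\<lambda>z. f (?F z))" "tempered Ix (\<lambda>z. f' (?F z))"
    by (rule tempered_bounded_comp[OF tF cf f(2)], rule tempered_bounded_comp[OF tF f(4) f(3)])
  have gF: "has_grad Ix ?F (\<lambda>e z. ?c * gradT u e z)"
    using has_grad_mult[OF has_grad_const[of Ix ?c] has_grad_ctr[of u]] by simp
  have G: "has_grad Ix (\<lambda>z. f (?F z)) (\<lambda>e z. gradT u e z * (?c * f' (?F z)))"
    by (rule has_grad_cong[OF has_grad_comp[OF gF f(1) tf]]) simp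
  have th: "tempered Ix (\<lambda>z. ?c * f' (?F z))" by (intro tempered_cmult tf)
  have Eg: "\<bar>E (\<lambda>z. g (?F z))\<bar> \<le> 1" if "tempered Ix (\<lambda>z. g (?F z))" "\<And>x. \<bar>g x\<bar> \<le> 1" for g :: "real \<Rightarrow> real"
    using abs_E_le[OF that(1) tempered_const[of Ix 1]] that(2) by (simp add: E_const)
  have "\<bar>E (\<lambda>z. ctr u z * f (?F z)) - limit_cov p u u * E (\<lambda>z. ?c * f' (?F z))\<bar>
    \<le> cov_const (length u) L / real n * ((2 * ?B) * (q * K ^ (length u - 1)) + (\<bar>?c\<bar> * ?B) * ((q + q\<^sup>2) * K ^ (length u + length u - 2)))"
  proof (rule ctr_covariance[OF G th, where M=L])
    show "0 \<le> 2 * ?B" "0 \<le> \<bar>?c\<bar> * ?B" using B by auto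
    show "\<bar>E (\<lambda>z. ctr w z * f (?F z))\<bar> \<le> 2 * ?B * (q * K ^ (length w - 1))" if "pos_word w" "length w \<le> L" for w
    proof -
      have "\<bar>E (\<lambda>z. ctr w z * f (?F z))\<bar> \<le> ?B * (q * K ^ (length w - 1))"
        using that f(2) by (intro E_ctr_times_bounded tf) auto
      also have "\<dots> \<le> 2 * ?B * (q * K ^ (length w - 1))"
        using B scale_pos by (intro mult_right_mono) (auto intro: less_imp_le)
      finally show ?thesis .
    qed
    show "\<bar>E (\<lambda>z. ctr v z * ctr w z * f (?F z)) - E (\<lambda>z. ctr v z * ctr w z) * E (\<lambda>z. f (?F z))\<bar>
      \<le> 2 * ?B * (q\<^sup>2 * K ^ (length v - 1 + (length w - 1)))"
      if vw: "pos_word v" "pos_word w" "length v + length w \<le> L" for v w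
    proof -
      let ?W = "?B * ((q * K ^ (length v - 1)) * (q * K ^ (length w - 1)))"
      have 1: "\<bar>E (\<lambda>z. ctr v z * ctr w z * f (?F z))\<bar> \<le> ?W"
        using vw f(2) by (intro E_ctr_ctr_times_bounded tf) auto
      have "\<bar>E (\<lambda>z. ctr v z * ctr w z * 1)\<bar> \<le> ?W"
        using vw by (intro E_ctr_ctr_times_bounded tempered_const) auto
      then have "\<bar>E (\<lambda>z. ctr v z * ctr w z) * E (\<lambda>z. f (?F z))\<bar> \<le> ?W * 1"
        using Eg[OF tf(1) f(2)] by (intro abs_mult_le) auto
      with 1 have "\<bar>E (\<lambda>z. ctr v z * ctr w z * f (?F z)) - E (\<lambda>z. ctr v z * ctr w z) * E (\<lambda>z. f (?F z))\<bar> \<le> 2 * ?W"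
        by linarith
      also have "2 * ?W = 2 * ?B * (q\<^sup>2 * K ^ (length v - 1 + (length w - 1)))"
        by (simp only: power2_eq_square power_add mult_ac)
      finally show ?thesis .
    qed
    show "\<bar>E (\<lambda>z. ctr w z * (?c * f' (?F z)))\<bar> \<le> \<bar>?c\<bar> * ?B * (q * K ^ (length w - 1))"
      if w: "pos_word w" "length w \<le> L + length u" for w
    proof -
      have "\<bar>E (\<lambda>z. ctr w z * f' (?F z))\<bar> \<le> ?B * (q * K ^ (length w - 1))"
        using w u f(3) by (intro E_ctr_times_bounded tf) auto
      then have "\<bar>?c\<bar> * \<bar>E (\<lambda>z. ctr w z * f' (?F z))\<bar> \<le> \<bar>?c\<bar> * (?B * (q * K ^ (length w - 1)))"
        by (rule mult_left_mono) simp
      moreover have "E (\<lambda>z. ctr w z * (?c * f' (?F z))) = ?c * E (\<lambda>z. ctr w z * f' (?F z))"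
        unfolding E_cmult[symmetric] by (simp only: mult.left_commute)
      ultimately show ?thesis by (simp only: abs_mult mult.assoc)
    qed
    have "\<bar>E (\<lambda>z. ?c * f' (?F z))\<bar> \<le> \<bar>?c\<bar> * 1"
      unfolding E_cmult abs_mult using Eg[OF tf(2) f(3)] by (intro mult_left_mono) auto
    also have "\<dots> \<le> \<bar>?c\<bar> * ?B" using B by (intro mult_left_mono) auto
    finally show "\<bar>E (\<lambda>z. ?c * f' (?F z))\<bar> \<le> \<bar>?c\<bar> * ?B" .
  qed (use u in auto)
  then have main: "\<bar>E (\<lambda>z. ctr u z * f (?F z)) - v * (?c * E (\<lambda>z. f' (?F z)))\<bar>
    \<le> cov_const L L / real n * ((2 * ?B) * (q * K ^ (L - 1)) + (\<bar>?c\<bar> * ?B) * ((q + q\<^sup>2) * K ^ (L + L - 2)))"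
    unfolding u(2) v(1) E_cmult .
  have FY: "?F z = s * Y z" for z by (simp add: Y_def)
  have "E (\<lambda>z. Y z * f (s * Y z)) = 1 / ?r * E (\<lambda>z. ctr u z * f (?F z))"
    unfolding FY E_cmult[symmetric] by (simp add: Y_def)
  moreover have "s * E (\<lambda>z. f' (s * Y z)) = 1 / ?r * (v * (?c * E (\<lambda>z. f' (?F z))))"
    unfolding FY using r by (simp add: field_simps)
  ultimately have "\<bar>E (\<lambda>z. Y z * f (s * Y z)) - s * E (\<lambda>z. f' (s * Y z))\<bar>
    = 1 / ?r * \<bar>E (\<lambda>z. ctr u z * f (?F z)) - v * (?c * E (\<lambda>z. f' (?F z)))\<bar>"
    using r by (simp only: right_diff_distrib[symmetric] abs_mult) simp
  also have "\<dots> \<le> 1 / ?r * (cov_const L L / real n * ((2 * ?B) * (q * K ^ (L - 1)) + (\<bar>?c\<bar> * ?B) * ((q + q\<^sup>2) * K ^ (L + L - 2))))"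
    using main r by (intro mult_left_mono) auto
  also have "\<dots> = cov_const L L * ?B / real n * (2 * \<rho> + \<bar>s\<bar> * (\<rho>\<^sup>2 * (1 / q + 1)))"
  proof -
    have K2: "K ^ (L + L - 2) = K ^ (L - 1) * K ^ (L - 1)"
    proof -
      have "L + L - 2 = (L - 1) + (L - 1)" using u by simp
      then show ?thesis by (simp only: power_add)
    qed
    have gen: "1 / r * (C / m * ((2 * B) * (q * k) + (t / r * B) * ((q + q\<^sup>2) * (k * k))))
      = C * B / m * (2 * (q * k / r) + t * ((q * k / r)\<^sup>2 * (1 / q + 1)))"
      if "r > 0" "q > 0" for r C m B q k t :: real
    proof -
      have X: "(q * k / r)\<^sup>2 * (1 / q + 1) = ((q + q\<^sup>2) * (k * k)) / (r * r)"
        using that by (simp add: power2_eq_square field_simps)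
      have "1 / r * (C / m * ((2 * B) * (q * k) + (t / r * B) * Y)) = C * B / m * (2 * (q * k / r) + t * (Y / (r * r)))" for Y
        using that by (simp add: add_divide_distrib distrib_left mult_ac)
      then show ?thesis unfolding X .
    qed
    show ?thesis unfolding K2 \<rho>_def abs_divide using gen[OF r(1) q_pos] r by simp
  qed
  finally show ?thesis .
qed

end

lemma iexp_Complex: "iexp y = complex_of_real (cos y) + \<i> * complex_of_real (sin y)"
  by (simp add: cis_conv_exp[symmetric] cis.ctr complex_eq_iff)

lemma dist_iexp_1: "cmod (iexp y - 1) \<le> \<bar>y\<bar>"
  using iexp_approx1[of y 0] by simp

context wishart_bounds begin

text \<open>Stein's identity for \<open>sin\<close> and \<open>cos\<close> makes \<open>E (cos (t Y))\<close> and \<open>E (sin (t Y))\<close> approximate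
  solutions of \<open>c' t = - t c t\<close>, with initial values \<open>1\<close> and \<open>0\<close>. The shift \<open>b\<close> accounts for
  the error of the mean.\<close>

theorem char_normal_estimate:
  assumes u: "pos_word u" "length u = L" "L \<ge> 1" and v: "limit_cov p u u = v" "v > 0"
    and Z: "\<And>z. Z z = ctr u z / sqrt v + b"
  defines "\<rho> \<equiv> q * K ^ (L - 1) / sqrt v"
  shows "cmod (char (distr (gauss_prod Ix (1 / sqrt (real n))) borel Z) x - exp (- x\<^sup>2 / 2))
    \<le> 2 * \<bar>x\<bar> * (cov_const L L * moment_const (4 * L) / real n * (2 * \<rho> + \<bar>x\<bar> * (\<rho>\<^sup>2 * (1 / q + 1)))) + \<bar>x * b\<bar>"
proof -
  let ?M = "gauss_prod Ix (1 / sqrt (real n))"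
  let ?Y = "\<lambda>z. ctr u z / sqrt v"
  let ?C = "cov_const L L * moment_const (4 * L) / real n"
  let ?\<epsilon> = "?C * (2 * \<rho> + \<bar>x\<bar> * (\<rho>\<^sup>2 * (1 / q + 1)))"
  let ?c = "\<lambda>t. E (\<lambda>z. cos (t * ?Y z))" and ?s = "\<lambda>t. E (\<lambda>z. sin (t * ?Y z))"
  have C0: "?C \<ge> 0"
    using cov_const_nonneg[of L L] moment_const_ge_1[of "4 * L"] by (intro divide_nonneg_nonneg mult_nonneg_nonneg) auto
  have \<rho>0: "\<rho> \<ge> 0" using scale_pos[of "L - 1"] v unfolding \<rho>_def by simp
  have tY: "tempered Ix ?Y" using tempered_cmult[OF tempered_ctr[of u], of "1 / sqrt v"] by simp
  note tr = tempered_trig[OF tY]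
  have mono: "?C * (2 * \<rho> + \<bar>t\<bar> * (\<rho>\<^sup>2 * (1 / q + 1))) \<le> ?\<epsilon>" if "\<bar>t\<bar> \<le> \<bar>x\<bar>" for t
    using that C0 q_pos by (intro mult_left_mono add_left_mono mult_right_mono) auto
  have c: "\<bar>?c x - exp (- x\<^sup>2 / 2)\<bar> \<le> \<bar>x\<bar> * ?\<epsilon>"
  proof -
    have "\<bar>?c x - ?c 0 * exp (- x\<^sup>2 / 2)\<bar> \<le> \<bar>x\<bar> * ?\<epsilon>"
    proof (rule perturbed_gaussian_ode[OF E_trig_derivative(1)[OF tY]])
      fix t assume t: "\<bar>t\<bar> \<le> \<bar>x\<bar>"
      have "\<bar>E (\<lambda>z. ?Y z * sin (t * ?Y z)) - t * ?c t\<bar> \<le> ?C * (2 * \<rho> + \<bar>t\<bar> * (\<rho>\<^sup>2 * (1 / q + 1)))"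
        unfolding \<rho>_def by (rule stein_estimate[OF u v]) (auto intro!: derivative_eq_intros continuous_intros)
      then show "\<bar>- E (\<lambda>z. ?Y z * sin (t * ?Y z)) + t * ?c t\<bar> \<le> ?\<epsilon>" using mono[OF t] by linarith
    qed
    then show ?thesis by (simp add: E_const)
  qed
  have s: "\<bar>?s x\<bar> \<le> \<bar>x\<bar> * ?\<epsilon>"
  proof -
    have "\<bar>?s x - ?s 0 * exp (- x\<^sup>2 / 2)\<bar> \<le> \<bar>x\<bar> * ?\<epsilon>"
    proof (rule perturbed_gaussian_ode[OF E_trig_derivative(2)[OF tY]])
      fix t assume t: "\<bar>t\<bar> \<le> \<bar>x\<bar>"
      have "\<bar>E (\<lambda>z. ?Y z * cos (t * ?Y z)) - t * E (\<lambda>z. - sin (t * ?Y z))\<bar> \<le> ?C * (2 * \<rho> + \<bar>t\<bar> * (\<rho>\<^sup>2 * (1 / q + 1)))"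
        unfolding \<rho>_def by (rule stein_estimate[OF u v]) (auto intro!: derivative_eq_intros continuous_intros)
      moreover have "E (\<lambda>z. - sin (t * ?Y z)) = - ?s t" using E_cmult[of "-1" "\<lambda>z. sin (t * ?Y z)"] by simp
      ultimately show "\<bar>E (\<lambda>z. ?Y z * cos (t * ?Y z)) + t * ?s t\<bar> \<le> ?\<epsilon>" using mono[OF t] by simp
    qed
    then show ?thesis by (simp add: E_const)
  qed
  have int: "integrable ?M (\<lambda>z. cos (x * ?Y z))" "integrable ?M (\<lambda>z. sin (x * ?Y z))"
    using tr by (auto intro: integrable_E)
  have ch: "(CLINT z|?M. iexp (x * ?Y z)) = complex_of_real (?c x) + \<i> * complex_of_real (?s x)"
    unfolding iexp_Complex E_def using int by simp
  have mZ: "Z \<in> borel_measurable ?M"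
    using measurable_gauss_prod[OF tempered_add[OF tY tempered_const[of Ix b]]]
    unfolding Z[abs_def] .
  have "char (distr ?M borel Z) x = (CLINT z|?M. iexp (x * Z z))"
    unfolding char_def using mZ by (subst integral_distr) auto
  also have "\<dots> = (CLINT z|?M. iexp (x * b) * iexp (x * ?Y z))"
    unfolding Z by (intro Bochner_Integration.integral_cong refl) (simp add: exp_add[symmetric] algebra_simps add_divide_distrib)
  also have "\<dots> = iexp (x * b) * (complex_of_real (?c x) + \<i> * complex_of_real (?s x))"
    unfolding ch[symmetric] by simp
  finally have ch1: "char (distr ?M borel Z) x = iexp (x * b) * (complex_of_real (?c x) + \<i> * complex_of_real (?s x))" .
  have triangle: "cmod (a1 * (a2 + a3) + a4 * a5) \<le> cmod a1 * (cmod a2 + cmod a3) + cmod a4 * cmod a5" for a1 a2 a3 a4 a5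
  proof -
    have "cmod (a1 * (a2 + a3) + a4 * a5) \<le> cmod a1 * cmod (a2 + a3) + cmod a4 * cmod a5"
      using norm_triangle_ineq[of "a1 * (a2 + a3)" "a4 * a5"] by (simp only: norm_mult)
    also have "\<dots> \<le> cmod a1 * (cmod a2 + cmod a3) + cmod a4 * cmod a5"
      by (intro add_right_mono mult_left_mono norm_triangle_ineq norm_ge_zero)
    finally show ?thesis .
  qed
  from ch1 have e: "char (distr ?M borel Z) x - exp (- x\<^sup>2 / 2)
    = iexp (x * b) * (complex_of_real (?c x - exp (- x\<^sup>2 / 2)) + \<i> * complex_of_real (?s x))
      + complex_of_real (exp (- x\<^sup>2 / 2)) * (iexp (x * b) - 1)"
    by (simp add: algebra_simps)
  have "cmod (char (distr ?M borel Z) x - exp (- x\<^sup>2 / 2)) \<le> cmod (iexp (x * b)) * (cmod (complex_of_real (?c x - exp (- x\<^sup>2 / 2))) + cmod (\<i> * complex_of_real (?s x)))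
      + cmod (complex_of_real (exp (- x\<^sup>2 / 2))) * cmod (iexp (x * b) - 1)"
    unfolding e by (rule triangle)
  also have "\<dots> \<le> 1 * (\<bar>x\<bar> * ?\<epsilon> + \<bar>x\<bar> * ?\<epsilon>) + 1 * \<bar>x * b\<bar>"
    using c s dist_iexp_1[of "x * b"] by (intro add_mono mult_mono) (auto simp: norm_mult simp del: of_real_diff)
  finally show ?thesis by (simp only: mult_1_left mult.assoc mult_2 distrib_right)
qed

end

section \<open>Convergence of the Z-score\<close>

context cw_parameter begin

abbreviation "r \<equiv> max 1 (R_ratio D)"

lemma inverse_sqrt_p2_le: "1 / sqrt (p 2) \<le> r"
proof -
  have "sqrt (1 / (R_ratio D)\<^sup>2) \<le> sqrt (p 2)" using p2_ge by (rule real_sqrt_le_mono)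
  then have "1 / R_ratio D \<le> sqrt (p 2)" using R_pos by (simp add: real_sqrt_divide)
  then have "1 / sqrt (p 2) \<le> R_ratio D" using R_pos p2_pos by (simp add: field_simps)
  then show ?thesis by simp
qed

lemma limit_var_pos: "l \<ge> 1 \<Longrightarrow> limit_cov p (replicate l 1) (replicate l 1) > 0"
proof -
  assume l: "l \<ge> 1"
  have "0 < p 2 * (max ((p 1)\<^sup>2) (p 2)) ^ (l - 1)" using p2_pos by (intro mult_pos_pos zero_less_power) auto
  also have "\<dots> \<le> limit_cov p (replicate l 1) (replicate l 1)"
    using p_nonneg l by (intro limit_var_lower_bound) auto
  finally show ?thesis .
qed

text \<open>\<open>K\<close> is \<open>1\<close> or \<open>p 1\<close>, and \<open>1 \<le> r * sqrt (p 2)\<close>, so \<open>K \<le> r * sqrt (max ((p 1)\<^sup>2) (p 2))\<close>;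
  compare with the lower bound for \<open>v\<close>.\<close>

lemma standardised_scale_le:
  assumes l: "l \<ge> 1"
  shows "sqrt (p 2) * max 1 (p 1) ^ (l - 1) / sqrt (limit_cov p (replicate l 1) (replicate l 1)) \<le> r ^ (l - 1)"
proof -
  let ?v = "limit_cov p (replicate l 1) (replicate l 1)" let ?K = "max 1 (p 1)"
  let ?M = "max ((p 1)\<^sup>2) (p 2)"
  have r1: "1 \<le> r\<^sup>2" by simp
  have "1 \<le> r\<^sup>2 * p 2"
  proof -
    have "1 = (1 / sqrt (p 2))\<^sup>2 * p 2" using p2_pos by (simp add: power_divide)
    also have "\<dots> \<le> r\<^sup>2 * p 2" using inverse_sqrt_p2_le p2_pos by (intro mult_right_mono power_mono) auto
    finally show ?thesis .
  qed
  moreover have "r\<^sup>2 * p 2 \<le> r\<^sup>2 * ?M" "r\<^sup>2 * (p 1)\<^sup>2 \<le> r\<^sup>2 * ?M" by (intro mult_left_mono; simp)+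
  moreover have "1 * (p 1)\<^sup>2 \<le> r\<^sup>2 * (p 1)\<^sup>2" using r1 by (rule mult_right_mono) simp
  ultimately have "1 \<le> r\<^sup>2 * ?M" "(p 1)\<^sup>2 \<le> r\<^sup>2 * ?M" by linarith+
  moreover have "?K = 1 \<or> ?K = p 1" by linarith
  ultimately have "?K\<^sup>2 \<le> r\<^sup>2 * ?M" by (metis one_power2)
  then have "sqrt (?K\<^sup>2) \<le> sqrt (r\<^sup>2 * ?M)" by (rule real_sqrt_le_mono)
  then have K: "?K \<le> r * sqrt ?M" by (simp add: real_sqrt_mult)
  have "sqrt (p 2) * ?K ^ (l - 1) \<le> sqrt (p 2) * (r * sqrt ?M) ^ (l - 1)"
    using K p2_pos by (intro mult_left_mono power_mono) auto
  also have "\<dots> = r ^ (l - 1) * sqrt (p 2 * ?M ^ (l - 1))"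
    by (simp add: power_mult_distrib real_sqrt_mult real_sqrt_power)
  also have "\<dots> \<le> r ^ (l - 1) * sqrt ?v"
    using p_nonneg l by (intro mult_left_mono real_sqrt_le_mono limit_var_lower_bound) auto
  finally show ?thesis using limit_var_pos[OF l] by (simp add: pos_divide_le_eq)
qed

text \<open>With \<open>\<rho> \<le> r^(l - 1)\<close> and \<open>1/q \<le> r\<close> the error of \<open>char_normal_estimate\<close> is of order
  \<open>r^(2l - 1) / n\<close>, and that of the mean of order \<open>r^(l - 1) / n\<close>. The assumption on \<open>n\<close>
  ensures \<open>1/n \<le> q\<close>.\<close>

theorem char_Z_score_estimate:
  assumes l: "l \<ge> 1" and big: "r ^ (3 * l) \<le> real n"
  shows "cmod (char (distr (cw_space \<theta>) borel (fde_Z_score l \<theta> \<theta>)) x - exp (- x\<^sup>2 / 2))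
    \<le> (4 * \<bar>x\<bar> * (1 + \<bar>x\<bar>) * (cov_const l l * moment_const (4 * l)) + \<bar>x\<bar> * real (card (premaps l))) * (r ^ (3 * l) / real n)"
proof -
  let ?u = "replicate l (1::nat)" let ?v = "limit_cov p ?u ?u"
  let ?q = "sqrt (p 2)" let ?K = "max 1 (p 1)" let ?\<rho> = "?q * ?K ^ (l - 1) / sqrt ?v"
  let ?X = "r ^ (3 * l) / real n" let ?A = "cov_const l l * moment_const (4 * l)"
  have v: "?v > 0" by (rule limit_var_pos[OF l])
  have pw: "r ^ i \<le> r ^ (3 * l)" if "i \<le> 3 * l" for i using that by (intro power_increasing) auto
  have q_n: "1 / real n \<le> ?q"
  proof -
    have "1 / ?q \<le> r ^ 1" using inverse_sqrt_p2_le by simp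
    also have "\<dots> \<le> r ^ (3 * l)" using l by (intro pw) simp
    also have "\<dots> \<le> real n" by (rule big)
    finally show ?thesis using p2_pos n_pos by (simp add: field_simps)
  qed
  have sp: "sym_powers d D S" by (rule sym_powers_axioms)
  interpret w: wishart_bounds d n "\<lambda>a i j. (D ^\<^sub>m a) $$ (i, j) / S ^ a" p ?K ?q
    by (rule wishart_bounds_of_trace_param[OF sp n_pos p_def p_nonneg p_Suc_le q_n])
  have T: "trace_power l \<theta> z = S ^ l * w.T z ?u" for z
  proof -
    have "w.T z ?u = mat_Tr (wishart \<theta> z ^\<^sub>m l) / S ^ l"
      by (rule T_replicate[OF n_pos wishart_carrier[OF \<theta>] wishart_index[OF \<theta>]])
    then show ?thesis using S by (simp add: trace_power_def)
  qed
  have mean: "(\<integral>z. trace_power l \<theta> z \<partial>cw_space \<theta>) = S ^ l * (real n * w.t ?u)"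
    unfolding integral_cw T w.E_cmult using n_pos by (simp add: w.t_def)
  define b where "b = (S ^ l * (real n * w.t ?u) - fde_mean l \<theta>) / (S ^ l * sqrt ?v)"
  have sd: "sqrt (fde_var l \<theta>) = S ^ l * sqrt ?v"
  proof -
    have "sqrt (S ^ (2 * l)) = S ^ l" using S by (simp add: power_mult power2_eq_square power_mult_distrib real_sqrt_mult mult.commute[of 2])
    then show ?thesis unfolding fde_var_eq[OF l] real_sqrt_mult by simp
  qed
  have Z: "fde_Z_score l \<theta> \<theta> z = w.ctr ?u z / sqrt ?v + b" for z
    unfolding fde_Z_score_def sd T w.ctr_def b_def using S v by (simp add: field_simps)
  have \<rho>: "0 \<le> ?\<rho>" "?\<rho> \<le> r ^ (l - 1)"
    using standardised_scale_le[OF l] w.scale_pos[of "l - 1"] v by (auto intro!: divide_nonneg_nonneg mult_nonneg_nonneg)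
  have A0: "?A \<ge> 0" using w.cov_const_nonneg[of l l] moment_const_ge_1[of "4 * l"] by (intro mult_nonneg_nonneg) auto
  have \<rho>3: "?\<rho> \<le> r ^ (3 * l)" by (rule order_trans[OF \<rho>(2) pw]) simp
  have "?\<rho>\<^sup>2 * (1 / ?q + 1) \<le> (r ^ (l - 1))\<^sup>2 * (2 * r)"
  proof (rule mult_mono)
    show "?\<rho>\<^sup>2 \<le> (r ^ (l - 1))\<^sup>2" using \<rho> by (intro power_mono)
    show "1 / ?q + 1 \<le> 2 * r" using inverse_sqrt_p2_le by simp
  qed (use p_nonneg in auto)
  also have "\<dots> = 2 * r ^ (2 * (l - 1) + 1)" by (simp add: power_mult[symmetric] mult.commute[of 2])
  also have "\<dots> \<le> 2 * r ^ (3 * l)" using l pw[of "2 * (l - 1) + 1"] by simp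
  finally have \<rho>2: "?\<rho>\<^sup>2 * (1 / ?q + 1) \<le> 2 * r ^ (3 * l)" .
  have "2 * ?\<rho> + \<bar>x\<bar> * (?\<rho>\<^sup>2 * (1 / ?q + 1)) \<le> 2 * r ^ (3 * l) + \<bar>x\<bar> * (2 * r ^ (3 * l))"
    using \<rho>3 \<rho>2 by (intro add_mono mult_left_mono) auto
  also have "\<dots> = 2 * (1 + \<bar>x\<bar>) * r ^ (3 * l)" by (simp add: algebra_simps)
  finally have "?A / real n * (2 * ?\<rho> + \<bar>x\<bar> * (?\<rho>\<^sup>2 * (1 / ?q + 1))) \<le> ?A / real n * (2 * (1 + \<bar>x\<bar>) * r ^ (3 * l))"
    using A0 by (intro mult_left_mono) auto
  then have 1: "2 * \<bar>x\<bar> * (?A / real n * (2 * ?\<rho> + \<bar>x\<bar> * (?\<rho>\<^sup>2 * (1 / ?q + 1))))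
    \<le> 2 * \<bar>x\<bar> * (?A / real n * (2 * (1 + \<bar>x\<bar>) * r ^ (3 * l)))"
    by (rule mult_left_mono) simp
  have "\<bar>b\<bar> \<le> real (card (premaps l)) * ?X"
  proof -
    have pos: "S ^ l * sqrt ?v > 0" using S v by simp
    have "\<bar>b\<bar> = \<bar>S ^ l * (real n * w.t ?u) - fde_mean l \<theta>\<bar> / (S ^ l * sqrt ?v)"
      unfolding b_def abs_divide using pos by simp
    also have "\<dots> \<le> (real (card (premaps l)) / real n * (S ^ l * (?q * ?K ^ (l - 1)))) / (S ^ l * sqrt ?v)"
      using fde_mean_error[OF l] pos unfolding mean by (intro divide_right_mono) auto
    also have "\<dots> = real (card (premaps l)) / real n * ?\<rho>" using S by simp
    also have "\<dots> \<le> real (card (premaps l)) / real n * r ^ (3 * l)"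
      using \<rho>3 by (intro mult_left_mono) auto
    finally show ?thesis by simp
  qed
  then have 2: "\<bar>x * b\<bar> \<le> \<bar>x\<bar> * (real (card (premaps l)) * ?X)"
    unfolding abs_mult by (rule mult_left_mono) simp
  have "cmod (char (distr (cw_space \<theta>) borel (fde_Z_score l \<theta> \<theta>)) x - exp (- x\<^sup>2 / 2))
    \<le> 2 * \<bar>x\<bar> * (?A / real n * (2 * ?\<rho> + \<bar>x\<bar> * (?\<rho>\<^sup>2 * (1 / ?q + 1)))) + \<bar>x * b\<bar>"
    unfolding cw_space_eq[OF \<theta>] using l v by (intro w.char_normal_estimate[OF _ _ _ refl _ Z]) auto
  also have "\<dots> \<le> 2 * \<bar>x\<bar> * (?A / real n * (2 * (1 + \<bar>x\<bar>) * r ^ (3 * l))) + \<bar>x\<bar> * (real (card (premaps l)) * ?X)"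
    using 1 2 by (rule add_mono)
  also have "\<dots> = (4 * \<bar>x\<bar> * (1 + \<bar>x\<bar>) * ?A + \<bar>x\<bar> * real (card (premaps l))) * ?X"
  proof -
    have "2 * a * (A / N * (2 * (1 + a) * X)) + a * (c * (X / N)) = (4 * a * (1 + a) * A + a * c) * (X / N)"
      for a A N X c :: real
      by (simp add: algebra_simps add_divide_distrib)
    then show ?thesis .
  qed
  finally show ?thesis .
qed

lemma real_distribution_Z_score:
  assumes l: "l \<ge> 1"
  shows "real_distribution (distr (cw_space \<theta>) borel (fde_Z_score l \<theta> \<theta>))"
proof -
  interpret w: wishart_words d n "\<lambda>a i j. (D ^\<^sub>m a) $$ (i, j) / S ^ a" by (rule wishart_words_powers[OF n_pos])
  interpret prob_space "cw_space \<theta>"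
    unfolding cw_space_eq[OF \<theta>] by (rule prob_space_gauss_prod[OF w.sd_pos])
  have T: "trace_power l \<theta> z = S ^ l * w.T z (replicate l 1)" for z
  proof -
    have "w.T z (replicate l 1) = mat_Tr (wishart \<theta> z ^\<^sub>m l) / S ^ l"
      by (rule T_replicate[OF n_pos wishart_carrier[OF \<theta>] wishart_index[OF \<theta>]])
    then show ?thesis using S by (simp add: trace_power_def)
  qed
  have "trace_power l \<theta> \<in> borel_measurable (cw_space \<theta>)"
    unfolding cw_space_eq[OF \<theta>] T[abs_def] by (intro measurable_gauss_prod w.tempered_cmult w.tempered_T)
  then have "fde_Z_score l \<theta> \<theta> \<in> borel_measurable (cw_space \<theta>)"
    unfolding fde_Z_score_def[abs_def] by simp
  then show ?thesis
    by (intro real_distribution.intro prob_space_distr real_distribution_axioms.intro) auto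
qed

end

lemma smallo_powr_root:
  fixes R :: "nat \<Rightarrow> real"
  assumes R: "R \<in> o(\<lambda>n. real n powr (1 / real k))" and k: "k \<ge> 1"
  shows "(\<lambda>n. max 1 (R n) ^ k / real n) \<longlonglongrightarrow> 0"
proof -
  let ?a = "\<lambda>n. real n powr (1 / real k)"
  have "(\<lambda>n. \<bar>R n / ?a n\<bar>) \<longlonglongrightarrow> 0"
    using smalloD_tendsto[OF R] by (rule tendsto_rabs_zero)
  moreover have "(\<lambda>n. 1 / ?a n) \<longlonglongrightarrow> 0"
    using k by real_asymp
  ultimately have "(\<lambda>n. (1 / ?a n + \<bar>R n / ?a n\<bar>) ^ k) \<longlonglongrightarrow> (0 + 0) ^ k"
    by (intro tendsto_power tendsto_add)
  then have lim: "(\<lambda>n. (1 / ?a n + \<bar>R n / ?a n\<bar>) ^ k) \<longlonglongrightarrow> 0" using k by (simp add: power_0_left)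
  show ?thesis
  proof (rule Lim_null_comparison[OF eventually_mono[OF eventually_gt_at_top[of 0]] lim])
    fix n :: nat assume n: "0 < n"
    have a: "?a n > 0" using n by simp
    have ak: "?a n ^ k = real n" using n k by (simp add: powr_power)
    have "max 1 (R n) ^ k / real n = (max 1 (R n) / ?a n) ^ k" by (simp add: power_divide ak)
    also have "\<dots> \<le> (1 / ?a n + \<bar>R n / ?a n\<bar>) ^ k"
    proof (rule power_mono)
      have "max 1 (R n) / ?a n \<le> (1 + \<bar>R n\<bar>) / ?a n" using a by (intro divide_right_mono) auto
      then show "max 1 (R n) / ?a n \<le> 1 / ?a n + \<bar>R n / ?a n\<bar>" using a by (simp add: add_divide_distrib)
    qed (use a in simp)
    finally show "norm (max 1 (R n) ^ k / real n) \<le> (1 / ?a n + \<bar>R n / ?a n\<bar>) ^ k" by simp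
  qed
qed

theorem theorem1p3:
  fixes l :: nat and \<theta> :: "nat \<Rightarrow> cw_param"
  assumes "l \<ge> 1"
    and "\<And>n. n \<ge> 1 \<Longrightarrow> \<theta> n \<in> Theta n"
    and "(\<lambda>n. R_ratio (par_D (\<theta> n))) \<in> o(\<lambda>n. real n powr (1 / (3 * real l)))"
  shows "weak_conv_m
           (\<lambda>n. distr (cw_space (\<theta> n)) borel (fde_Z_score l (\<theta> n) (\<theta> n)))
           std_normal_distribution"
proof -
  let ?M = "\<lambda>n. distr (cw_space (\<theta> n)) borel (fde_Z_score l (\<theta> n) (\<theta> n))"
  let ?X = "\<lambda>n. max 1 (R_ratio (par_D (\<theta> n))) ^ (3 * l) / real n"
  have par: "cw_parameter (\<theta> n) n" if "n \<ge> 1" for n using assms(2)[OF that] by (rule cw_parameter.intro)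
  have X: "?X \<longlonglongrightarrow> 0" using assms(1,3) by (intro smallo_powr_root) auto
  \<comment> \<open>there is no parameter for \<open>n = 0\<close>, so the first member of the sequence is dropped\<close>
  have "weak_conv_m (\<lambda>n. ?M (Suc n)) std_normal_distribution"
  proof (rule levy_continuity)
    show "real_distribution (?M (Suc n))" for n
      by (rule cw_parameter.real_distribution_Z_score[OF par assms(1)]) simp
    show "real_distribution std_normal_distribution" by (rule real_dist_normal_dist)
    fix x
    let ?A = "4 * \<bar>x\<bar> * (1 + \<bar>x\<bar>) * (cov_const l l * moment_const (4 * l)) + \<bar>x\<bar> * real (card (premaps l))"
    have "(\<lambda>n. char (?M n) x - exp (- x\<^sup>2 / 2)) \<longlonglongrightarrow> 0"
    proof (rule Lim_null_comparison)
      show "(\<lambda>n. ?A * ?X n) \<longlonglongrightarrow> 0" using X by (rule tendsto_mult_right_zero)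
      have "\<forall>\<^sub>F n in sequentially. ?X n < 1" using X by (rule order_tendstoD) simp
      then show "\<forall>\<^sub>F n in sequentially. cmod (char (?M n) x - exp (- x\<^sup>2 / 2)) \<le> ?A * ?X n"
        using eventually_ge_at_top[of 1]
      proof eventually_elim
        case (elim n)
        then have "max 1 (R_ratio (par_D (\<theta> n))) ^ (3 * l) \<le> real n" by (simp add: field_simps)
        then show ?case by (rule cw_parameter.char_Z_score_estimate[OF par[OF elim(2)] assms(1)])
      qed
    qed
    then have "(\<lambda>n. char (?M n) x) \<longlonglongrightarrow> complex_of_real (exp (- x\<^sup>2 / 2))" by (rule LIM_zero_cancel)
    then show "(\<lambda>n. char (?M (Suc n)) x) \<longlonglongrightarrow> char std_normal_distribution x"
      unfolding char_std_normal_distribution by (rule LIMSEQ_Suc)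
  qed
  then show ?thesis unfolding weak_conv_m_def weak_conv_def by (blast intro: LIMSEQ_imp_Suc)
qed

end
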